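(* Let $(\mathbb{G},\circ)$ be a stratified Lie group of homogeneous dimension $Q$, let $\{X_1,\dots,X_{N_1}\}$ be left-invariant vector fields forming a basis of the first layer of its Lie algebra, and let $\mathcal{L}=\sum_{j=1}^{N_1}X_j^2$. Let $\alpha\in[0,Q]$ and let $u$ be a positive solution of the heat equation $\frac{\partial}{\partial t}u=\mathcal{L}u$ on $\mathbb{G}\times(0,\infty)$. Define $$S_\alpha(u)=\Big\{x\in\mathbb{G} : \limsup_{t\to0+}t^{\alpha/2}u(x,t)=+\infty\Big\},\qquad T_\alpha(u)=\Big\{x\in\mathbb{G} : \limsup_{t\to0+}t^{\alpha/2}u(x,t)>0\Big\}.$$ Then $$\mathcal{H}^{Q-\alpha}\big(S_\alpha(u)\big)=0\qquad\text{and}\qquad \dim_{\mathcal{H}}\big(T_\alpha(u)\big)\le Q-\alpha,$$ where $\mathcal{H}^{s}$ and $\dim_{\mathcal{H}}$ denote the $s$-dimensional Hausdorff outer measure and the Hausdorff dimension with respect to the Carnot-Carathéodory metric associated with $\{X_1,\dots,X_{N_1}\}$.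
   Context: A stratified Lie group (Carnot group) $(\mathbb{G},\circ)$ is a connected, simply connected nilpotent Lie group whose Lie algebra decomposes as a vector space $\mathfrak{g}=V_1\oplus\cdots\oplus V_l$ with $[V_1,V_j]=V_{j+1}$ for $1\le j<l$ and $[V_1,V_l]=0$, where $[V_1,V_j]=\mathrm{span}\{[X,Y]: X\in V_1,Y\in V_j\}$. The first layer is $V_1$. The homogeneous dimension is $Q=\sum_{j=1}^l j\dim V_j$. The Carnot-Carathéodory metric $d$ associated with $\{X_1,\dots,X_{N_1}\}$ is the left-invariant metric on $\mathbb{G}$ defined by: $d(x,y)$ is the infimum of all $T>0$ for which there is an absolutely continuous curve $\gamma:[0,T]\to\mathbb{G}$ with $\gamma(0)=x$, $\gamma(T)=y$, $\gamma'(s)=\sum_j a_j(s)X_j(\gamma(s))$ and $\sum_j a_j(s)^2\le1$ for a.e. $s$ (and $d(x,x)=0$). A positive solution of the heat equation is a function $u:\mathbb{G}\times(0,\infty)\to(0,\infty)$, smooth (solutions are smooth since $\partial_t-\mathcal{L}$ is hypoelliptic), with $\partial_t u=\mathcal{L}u$, where $\mathcal{L}$ acts in the $\mathbb{G}$ variable. For a metric space $(X,d)$, $E\subset X$, $s\ge0$, $\varepsilon>0$: $\mathcal{H}^s_\varepsilon(E)=\inf\sum_i(\mathrm{diam}\,U_i)^s$ over all countable (or finite) covers $\{U_i\}$ of $E$ with $0<\mathrm{diam}\,U_i\le\varepsilon$; $\mathcal{H}^s(E)=\lim_{\varepsilon\to0}\mathcal{H}^s_\varepsilon(E)$; and $\dim_{\mathcal{H}}E=\inf\{s\ge0:\mathcal{H}^s(E)=0\}$.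 The empty set has $\mathcal{H}^s$-measure $0$ for every $s\ge 0$. *)

theory Defs
  imports "HOL-Analysis.Analysis" "HOL-Library.Function_Algebras"
begin

section \<open>Smooth maps and manifolds\<close>

text \<open>Both notions below are meant for open sets \<open>S\<close>.\<close>

primrec Ck_on :: "nat \<Rightarrow> 'a::real_normed_vector set \<Rightarrow> ('a \<Rightarrow> 'b::real_normed_vector) \<Rightarrow> bool"
  where
    "Ck_on 0 S f \<longleftrightarrow> continuous_on S f"
  | "Ck_on (Suc k) S f \<longleftrightarrow>
       (\<forall>x\<in>S. f differentiable (at x)) \<and>
       (\<forall>v. Ck_on k S (\<lambda>x. frechet_derivative f (at x) v))"

definition smooth_on :: "'a::real_normed_vector set \<Rightarrow> ('a \<Rightarrow> 'b::real_normed_vector) \<Rightarrow> bool"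
  where "smooth_on S f \<longleftrightarrow> (\<forall>k. Ck_on k S f)"

text \<open>A chart is a domain together with a coordinate map; the values of the coordinate map outside
  the domain are irrelevant. Atlases need not be maximal.\<close>

type_synonym ('a, 'e) atlas = "('a set \<times> ('a \<Rightarrow> 'e)) set"

definition smooth_atlas :: "('a::topological_space, 'e::euclidean_space) atlas \<Rightarrow> bool"
  where "smooth_atlas A \<longleftrightarrow>
    (\<Union>(U, \<phi>)\<in>A. U) = UNIV \<and>
    (\<forall>(U, \<phi>)\<in>A. open U \<and> open (\<phi> ` U) \<and> homeomorphism U (\<phi> ` U) \<phi> (inv_into U \<phi>)) \<and>
    (\<forall>(U, \<phi>)\<in>A. \<forall>(V, \<psi>)\<in>A. smooth_on (\<phi> ` (U \<inter> V)) (\<psi> \<circ> inv_into U \<phi>))"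

definition euclidean_atlas :: "('e, 'e::euclidean_space) atlas"
  where "euclidean_atlas = {(UNIV, id)}"

definition prod_atlas ::
    "('a, 'e) atlas \<Rightarrow> ('b, 'f) atlas \<Rightarrow> ('a \<times> 'b, 'e \<times> 'f) atlas"
  where "prod_atlas A B = {(U \<times> V, map_prod \<phi> \<psi>) | U \<phi> V \<psi>. (U, \<phi>) \<in> A \<and> (V, \<psi>) \<in> B}"

text \<open>Smoothness, on an open subset \<open>S\<close>, of a map between manifolds with atlases \<open>A\<close> and \<open>B\<close>.\<close>

definition smooth_map_on ::
    "('a::topological_space, 'e::euclidean_space) atlas \<Rightarrow>
     ('b::topological_space, 'f::euclidean_space) atlas \<Rightarrow> 'a set \<Rightarrow> ('a \<Rightarrow> 'b) \<Rightarrow> bool"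
  where "smooth_map_on A B S f \<longleftrightarrow>
    continuous_on S f \<and>
    (\<forall>(U, \<phi>)\<in>A. \<forall>(V, \<psi>)\<in>B. smooth_on (\<phi> ` (S \<inter> U \<inter> f -` V)) (\<psi> \<circ> f \<circ> inv_into U \<phi>))"

definition smooth_funs :: "('a::topological_space, 'e::euclidean_space) atlas \<Rightarrow> ('a \<Rightarrow> real) set"
  where "smooth_funs A = {f. smooth_map_on A euclidean_atlas UNIV f}"


section \<open>Lie groups and their Lie algebras\<close>

text \<open>The group law is written additively, although it need not be commutative: this is the
  library's type class for groups.\<close>

definition lie_group ::
    "('a::{topological_group_add, t2_space, second_countable_topology}, 'e::euclidean_space) atlas
     \<Rightarrow> bool"
  where "lie_group A \<longleftrightarrow>
    smooth_atlas A \<and>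
    smooth_map_on (prod_atlas A A) A UNIV (\<lambda>(x, y). x + y) \<and>
    smooth_map_on A A UNIV uminus"

text \<open>Upper central series.\<close>

primrec upper_central :: "nat \<Rightarrow> 'a::group_add set"
  where
    "upper_central 0 = {0}"
  | "upper_central (Suc k) = {x. \<forall>y. - x - y + x + y \<in> upper_central k}"

definition nilpotent_group :: "'a::group_add itself \<Rightarrow> bool"
  where "nilpotent_group _ \<longleftrightarrow> (\<exists>k. upper_central k = (UNIV :: 'a set))"

text \<open>Vector fields are derivations of the algebra of smooth functions. As HOL functions are total,
  they are normalised to vanish on non-smooth arguments, so that two vector fields coincide iff they
  are equal as HOL functions.\<close>

type_synonym 'a vfield = "('a \<Rightarrow> real) \<Rightarrow> ('a \<Rightarrow> real)"

definition vector_field ::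
    "('a::topological_space, 'e::euclidean_space) atlas \<Rightarrow> 'a vfield \<Rightarrow> bool"
  where "vector_field A X \<longleftrightarrow>
    (\<forall>f. f \<notin> smooth_funs A \<longrightarrow> X f = (\<lambda>x. 0)) \<and>
    (\<forall>f\<in>smooth_funs A. X f \<in> smooth_funs A) \<and>
    (\<forall>f\<in>smooth_funs A. \<forall>g\<in>smooth_funs A. X (\<lambda>x. f x + g x) = (\<lambda>x. X f x + X g x)) \<and>
    (\<forall>c. \<forall>f\<in>smooth_funs A. X (\<lambda>x. c * f x) = (\<lambda>x. c * X f x)) \<and>
    (\<forall>f\<in>smooth_funs A. \<forall>g\<in>smooth_funs A.
       X (\<lambda>x. f x * g x) = (\<lambda>x. f x * X g x + X f x * g x))"

definition lie_algebra ::
    "('a::{topological_space, group_add}, 'e::euclidean_space) atlas \<Rightarrow> 'a vfield set"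
  where "lie_algebra A =
    {X. vector_field A X \<and> (\<forall>f\<in>smooth_funs A. \<forall>g. X (\<lambda>x. f (g + x)) = (\<lambda>x. X f (g + x)))}"

definition vf_scale :: "real \<Rightarrow> 'a vfield \<Rightarrow> 'a vfield"
  where "vf_scale c X = (\<lambda>f x. c * X f x)"

interpretation vf: vector_space vf_scale
  by unfold_locales (auto simp: vf_scale_def fun_eq_iff algebra_simps)

definition lie_bracket :: "'a vfield \<Rightarrow> 'a vfield \<Rightarrow> 'a vfield"
  where "lie_bracket X Y = (\<lambda>f x. X (Y f) x - Y (X f) x)"

definition bracket_span :: "'a vfield set \<Rightarrow> 'a vfield set \<Rightarrow> 'a vfield set"
  where "bracket_span V W = vf.span {lie_bracket X Y | X Y. X \<in> V \<and> Y \<in> W}"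


section \<open>Stratified Lie groups\<close>

text \<open>\<open>V 1, \<dots>, V l\<close> are the layers. That the Lie algebra is their direct sum is expressed by
  bijectivity of the addition map from their product. The trivial group does not occur, as
  \<open>DIM('e) \<ge> 1\<close>.\<close>

definition stratification ::
    "('a::{topological_space, group_add}, 'e::euclidean_space) atlas \<Rightarrow>
     nat \<Rightarrow> (nat \<Rightarrow> 'a vfield set) \<Rightarrow> bool"
  where "stratification A l V \<longleftrightarrow>
    1 \<le> l \<and>
    (\<forall>j\<in>{1..l}. vf.subspace (V j)) \<and>
    bij_betw (\<lambda>Y. \<Sum>j\<in>{1..l}. Y j) (Pi\<^sub>E {1..l} V) (lie_algebra A) \<and>
    (\<forall>j. 1 \<le> j \<and> j < l \<longrightarrow> bracket_span (V 1) (V j) = V (j + 1)) \<and>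
    bracket_span (V 1) (V l) = {0}"

definition stratified_lie_group ::
    "('a::{topological_group_add, t2_space, second_countable_topology}, 'e::euclidean_space) atlas
     \<Rightarrow> nat \<Rightarrow> (nat \<Rightarrow> 'a vfield set) \<Rightarrow> bool"
  where "stratified_lie_group A l V \<longleftrightarrow>
    lie_group A \<and> connected (UNIV :: 'a set) \<and> simply_connected (UNIV :: 'a set) \<and>
    nilpotent_group TYPE('a) \<and> stratification A l V"

definition homogeneous_dim :: "nat \<Rightarrow> (nat \<Rightarrow> 'a vfield set) \<Rightarrow> nat"
  where "homogeneous_dim l V = (\<Sum>j\<in>{1..l}. j * vf.dim (V j))"

definition is_basis :: "nat \<Rightarrow> (nat \<Rightarrow> 'a vfield) \<Rightarrow> 'a vfield set \<Rightarrow> bool"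
  where "is_basis N X W \<longleftrightarrow>
    inj_on X {1..N} \<and> vf.independent (X ` {1..N}) \<and> vf.span (X ` {1..N}) = W"

definition sub_laplacian :: "nat \<Rightarrow> (nat \<Rightarrow> 'a vfield) \<Rightarrow> ('a \<Rightarrow> real) \<Rightarrow> 'a \<Rightarrow> real"
  where "sub_laplacian N X f x = (\<Sum>j\<in>{1..N}. X j (X j f) x)"


section \<open>The Carnot-Caratheodory metric\<close>

definition abs_cont_on :: "real \<Rightarrow> real \<Rightarrow> (real \<Rightarrow> 'e::metric_space) \<Rightarrow> bool"
  where "abs_cont_on c d f \<longleftrightarrow>
    (\<forall>\<epsilon>>0. \<exists>\<delta>>0. \<forall>n. \<forall>a b :: nat \<Rightarrow> real.
      (\<forall>i<n. c \<le> a i \<and> a i \<le> b i \<and> b i \<le> d) \<and>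
      (\<forall>i<n. \<forall>j<n. i \<noteq> j \<longrightarrow> {a i<..<b i} \<inter> {a j<..<b j} = {}) \<and>
      (\<Sum>i<n. b i - a i) < \<delta> \<longrightarrow>
      (\<Sum>i<n. dist (f (a i)) (f (b i))) < \<epsilon>)"

definition abs_cont_curve ::
    "('a::topological_space, 'e::euclidean_space) atlas \<Rightarrow> real \<Rightarrow> (real \<Rightarrow> 'a) \<Rightarrow> bool"
  where "abs_cont_curve A T \<gamma> \<longleftrightarrow>
    continuous_on {0..T} \<gamma> \<and>
    (\<forall>(U, \<phi>)\<in>A. \<forall>c d. 0 \<le> c \<and> c \<le> d \<and> d \<le> T \<and> \<gamma> ` {c..d} \<subseteq> U \<longrightarrow> abs_cont_on c d (\<phi> \<circ> \<gamma>))"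

text \<open>The tangent vector \<open>\<gamma>'(s)\<close> is the derivation \<open>f \<mapsto> (f \<circ> \<gamma>)'(s)\<close>.\<close>

definition horizontal_curve ::
    "('a::topological_space, 'e::euclidean_space) atlas \<Rightarrow> nat \<Rightarrow> (nat \<Rightarrow> 'a vfield) \<Rightarrow>
     real \<Rightarrow> (real \<Rightarrow> 'a) \<Rightarrow> bool"
  where "horizontal_curve A N X T \<gamma> \<longleftrightarrow>
    abs_cont_curve A T \<gamma> \<and>
    (\<exists>a :: nat \<Rightarrow> real \<Rightarrow> real. AE s in lborel. 0 < s \<and> s < T \<longrightarrow>
       (\<forall>f\<in>smooth_funs A.
          ((\<lambda>r. f (\<gamma> r)) has_real_derivative (\<Sum>j\<in>{1..N}. a j s * X j f (\<gamma> s))) (at s)) \<and>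
       (\<Sum>j\<in>{1..N}. (a j s)\<^sup>2) \<le> 1)"

text \<open>On a stratified group the infimum is over a nonempty set, by the Chow-Rashevskii theorem.\<close>

definition cc_dist ::
    "('a::topological_space, 'e::euclidean_space) atlas \<Rightarrow> nat \<Rightarrow> (nat \<Rightarrow> 'a vfield) \<Rightarrow>
     'a \<Rightarrow> 'a \<Rightarrow> real"
  where "cc_dist A N X x y =
    (if x = y then 0
     else Inf {T. 0 < T \<and> (\<exists>\<gamma>. horizontal_curve A N X T \<gamma> \<and> \<gamma> 0 = x \<and> \<gamma> T = y)})"


section \<open>Hausdorff measure and dimension of a metric \<open>d\<close>\<close>

definition ediam :: "('a \<Rightarrow> 'a \<Rightarrow> real) \<Rightarrow> 'a set \<Rightarrow> ennreal"
  where "ediam d U = (SUP x\<in>U. SUP y\<in>U. ennreal (d x y))"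

definition hausdorff_pre :: "('a \<Rightarrow> 'a \<Rightarrow> real) \<Rightarrow> real \<Rightarrow> real \<Rightarrow> 'a set \<Rightarrow> ennreal"
  where "hausdorff_pre d s \<epsilon> E =
    Inf {(\<Sum>\<^sub>\<infinity>U\<in>\<U>. ennreal (enn2real (ediam d U) powr s)) | \<U>.
           countable \<U> \<and> E \<subseteq> \<Union>\<U> \<and> (\<forall>U\<in>\<U>. 0 < ediam d U \<and> ediam d U \<le> ennreal \<epsilon>)}"

definition hausdorff_measure :: "('a \<Rightarrow> 'a \<Rightarrow> real) \<Rightarrow> real \<Rightarrow> 'a set \<Rightarrow> ennreal"
  where "hausdorff_measure d s E = Lim (at_right 0) (\<lambda>\<epsilon>. hausdorff_pre d s \<epsilon> E)"

definition hausdorff_dim :: "('a \<Rightarrow> 'a \<Rightarrow> real) \<Rightarrow> 'a set \<Rightarrow> ereal"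
  where "hausdorff_dim d E = Inf {ereal s | s. 0 \<le> s \<and> hausdorff_measure d s E = 0}"

lemma hausdorff_pre_antimono:
  assumes "\<delta> \<le> \<epsilon>"
  shows "hausdorff_pre d s \<epsilon> E \<le> hausdorff_pre d s \<delta> E"
proof -
  have "\<And>U. ediam d U \<le> ennreal \<delta> \<Longrightarrow> ediam d U \<le> ennreal \<epsilon>"
    using ennreal_leI[OF assms] by (rule order_trans[rotated])
  then show ?thesis
    unfolding hausdorff_pre_def by (intro Inf_superset_mono) fast
qed

lemma hausdorff_pre_tendsto_SUP:
  "((\<lambda>\<epsilon>. hausdorff_pre d s \<epsilon> E) \<longlongrightarrow> (SUP \<epsilon>\<in>{0<..}. hausdorff_pre d s \<epsilon> E)) (at_right 0)"
proof (rule order_tendstoI)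
  fix a assume "a < (SUP \<epsilon>\<in>{0<..}. hausdorff_pre d s \<epsilon> E)"
  then obtain \<epsilon> where "\<epsilon> > 0" "a < hausdorff_pre d s \<epsilon> E"
    by (auto simp: less_SUP_iff)
  then show "\<forall>\<^sub>F \<delta> in at_right 0. a < hausdorff_pre d s \<delta> E"
    unfolding eventually_at_right_field
    by (intro exI[of _ \<epsilon>]) (auto intro: less_le_trans[OF _ hausdorff_pre_antimono])
next
  fix a assume a: "(SUP \<epsilon>\<in>{0<..}. hausdorff_pre d s \<epsilon> E) < a"
  have "hausdorff_pre d s \<delta> E < a" if "0 < \<delta>" for \<delta>
    using that by (intro le_less_trans[OF SUP_upper a]) auto
  then show "\<forall>\<^sub>F \<delta> in at_right 0. hausdorff_pre d s \<delta> E < a"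
    unfolding eventually_at_right_field by (intro exI[of _ 1]) auto
qed

lemma hausdorff_measure_eq_SUP:
  "hausdorff_measure d s E = (SUP \<epsilon>\<in>{0<..}. hausdorff_pre d s \<epsilon> E)"
  unfolding hausdorff_measure_def
  by (rule tendsto_Lim[OF _ hausdorff_pre_tendsto_SUP]) simp


section \<open>Positive solutions of the heat equation\<close>

text \<open>Solutions live on positive times only; the values \<open>u x t\<close> with \<open>t \<le> 0\<close> are irrelevant.\<close>

definition positive_heat_solution ::
    "('a::topological_space, 'e::euclidean_space) atlas \<Rightarrow> nat \<Rightarrow> (nat \<Rightarrow> 'a vfield) \<Rightarrow>
     ('a \<Rightarrow> real \<Rightarrow> real) \<Rightarrow> bool"
  where "positive_heat_solution A N X u \<longleftrightarrow>
    (\<forall>x. \<forall>t>0. 0 < u x t) \<and>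
    smooth_map_on (prod_atlas A euclidean_atlas) euclidean_atlas (UNIV \<times> {0<..}) (\<lambda>(x, t). u x t) \<and>
    (\<forall>x. \<forall>t>0.
       ((\<lambda>r. u x r) has_real_derivative sub_laplacian N X (\<lambda>y. u y t) x) (at t))"

definition S_set :: "real \<Rightarrow> ('a \<Rightarrow> real \<Rightarrow> real) \<Rightarrow> 'a set"
  where "S_set \<alpha> u = {x. Limsup (at_right 0) (\<lambda>t. ereal (t powr (\<alpha> / 2) * u x t)) = \<infinity>}"

definition T_set :: "real \<Rightarrow> ('a \<Rightarrow> real \<Rightarrow> real) \<Rightarrow> 'a set"
  where "T_set \<alpha> u = {x. Limsup (at_right 0) (\<lambda>t. ereal (t powr (\<alpha> / 2) * u x t)) > 0}"

end

theory Submission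
  imports Defs
begin

text \<open>In exponential coordinates of the second kind, adapted to the stratification, the left-invariant
  fields become homogeneous polynomial fields on the coordinate space. Their flows and the group law
  lift from the group to the coordinates, where dilations are available; the coordinate map
  \<open>Phi\<close> is a surjective homomorphism. All the analysis takes place upstairs.

  Left and right translations preserve Lebesgue measure, because homogeneous fields are divergence
  free. With accessibility by horizontal curves this gives a Nash inequality, and Moser iteration
  bounds a positive solution by its local mass:
  \<open>u(x, t) \<le> C t^(-Q/2) sup_{s \<le> t} M(x, sqrt t, s)\<close>, where \<open>M(x, r, s)\<close> integrates
  \<open>u(\<cdot>, s)\<close> against a cutoff at \<open>x\<close> of scale \<open>r\<close>. As
  \<open>\<bar>\<partial>M/\<partial>s\<bar> \<le> C r^(-2) M(x, 2r, s)\<close>, the mass at scale \<open>sqrt t\<close> is controlled by the initial masses at the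
  scales \<open>2^j sqrt t\<close>, with weights decaying like \<open>4^(-j^2/2)\<close>. Hence, if
  \<open>t^(\<alpha>/2) u(x, t)\<close> is unbounded as \<open>t \<rightarrow> 0\<close>, then for every \<open>c\<close> there are arbitrarily small
  \<open>r\<close> with \<open>M(x, r, 0+) \<ge> c r^(Q - \<alpha>)\<close>. The total mass near a compact set stays bounded as
  \<open>t \<rightarrow> 0\<close>, so a Vitali covering by such quasi-balls has arbitrarily small \<open>(Q - \<alpha>)\<close>-sum. The
  statement on the dimension follows since \<open>T_set \<alpha> u \<subseteq> S_set \<beta> u\<close> for \<open>\<beta> < \<alpha>\<close>.\<close>

section \<open>Calculus of smooth maps\<close>

text \<open>\<open>Phi\<close> is shown to be locally injective, and that carries the transfer:
  identities of the group are lifted along paths, and broken horizontal lines upstairs project to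
  horizontal curves of the same duration, so a cover by quasi-balls upstairs is pushed down with the
  same control on diameters. Dilations exist upstairs, and they reduce the estimates to unit scale.
  The mass at time 0 is never a measure. A large density is read as a lower bound valid at all small
  times, so that finitely many disjoint quasi-balls can be compared with the total mass at one
  common time. Its negation, an upper bound at arbitrarily small times, is exactly what starts the
  differential inequality for the mass. Passing through \<open>j\<close> dyadic scales costs the
  factor \<open>C^j / 4^(0 + 1 + ... + (j - 1))\<close>, which beats the growth
  \<open>2^(j (Q - \<alpha>))\<close> of the admissible masses and plays the part of a Gaussian
  bound. The Moser iteration doubles the exponent, so only natural powers of \<open>u\<close>
  occur.\<close>

abbreviation fderiv :: "('a::real_normed_vector => 'b::real_normed_vector) => 'a => 'a => 'b" where
 "fderiv f x \<equiv> frechet_derivative f (at x)"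

abbreviation smooth :: "('a::real_normed_vector => 'b::real_normed_vector) => bool" where
 "smooth \<equiv> smooth_on UNIV"

lemmas lint_mono = Bochner_Integration.integral_mono
and lint_nonneg = Bochner_Integration.integral_nonneg
and lint_sum = Bochner_Integration.integral_sum
and lint_add = Bochner_Integration.integral_add

lemma Ck_on_cong:
 assumes "open S" "!!x. x \<in> S ==> f x = g x" "Ck_on k S f"
 shows "Ck_on k S g" using assms
proof (induction k arbitrary: f g)
 case 0
 thus ?case by (auto cong: continuous_on_cong)
next
 case (Suc k)
 have hd: "(g has_derivative fderiv f x) (at x)" if "x \<in> S" for x
 proof (rule has_derivative_transform_within_open[OF _ Suc.prems(1) that])
  show "(f has_derivative fderiv f x) (at x)" using Suc.prems(3) that frechet_derivative_works by auto
 qed (use Suc.prems in auto)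
 have eq: "fderiv f x v = fderiv g x v" if "x \<in> S" for x v using frechet_derivative_at[OF hd[OF that]] by simp
 show ?case using Suc.IH[OF Suc.prems(1) eq] Suc.prems(3) hd by (auto intro: differentiableI)
qed

lemma Ck_on_SucI:
 assumes "open S" "!!x. x \<in> S ==> (f has_derivative f' x) (at x)" "!!v. Ck_on k S (%x. f' x v)"
 shows "Ck_on (Suc k) S f"
proof -
 have eq: "f' x v = fderiv f x v" if "x \<in> S" for x v using frechet_derivative_at[OF assms(2)[OF that]] by simp
 show ?thesis using assms(2) Ck_on_cong[OF assms(1) eq assms(3)] by (auto intro: differentiableI)
qed

lemma Ck_on_SucD:
 assumes "Ck_on (Suc k) S f" "x \<in> S"
 shows "(f has_derivative fderiv f x) (at x)" using assms frechet_derivative_works by auto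

lemma Ck_on_subset: "Ck_on k S f ==> T \<subseteq> S ==> Ck_on k T f" by (induction k arbitrary: f) (auto intro: continuous_on_subset)

lemma Ck_on_Suc_imp: "Ck_on (Suc k) S f ==> Ck_on k S f"
proof (induction k arbitrary: f)
 case 0
 thus ?case by (auto intro!: continuous_at_imp_continuous_on differentiable_imp_continuous_within)
qed auto

lemma Ck_on_mono: "Ck_on m S f ==> k <= m ==> Ck_on k S f"
proof (induction m)
 case (Suc m)
 thus ?case using Ck_on_Suc_imp[of m S f] by (cases "k = Suc m") (simp_all del: Ck_on.simps)
qed simp

lemma Ck_on_local:
 assumes "!!x. x \<in> S ==> EX T. open T & x \<in> T & Ck_on k T f"
 shows "Ck_on k S f" using assms
proof (induction k arbitrary: f)
 case 0
 show ?case unfolding Ck_on.simps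
 proof (intro continuous_at_imp_continuous_on ballI)
  fix x assume "x \<in> S"
  then obtain T where "open T" "x \<in> T" "continuous_on T f" using 0 by auto
  thus "isCont f x" by (simp add: continuous_on_eq_continuous_at)
 qed
next
 case (Suc k)
 have "\<forall>x\<in>S. f differentiable (at x)" using Suc.prems unfolding Ck_on.simps by meson
 moreover have "Ck_on k S (%x. fderiv f x v)" for v by (rule Suc.IH) (use Suc.prems in \<open>unfold Ck_on.simps, meson\<close>)
 ultimately show ?case by simp
qed

lemma Ck_on_const: "Ck_on k S (%x. c)" by (induction k arbitrary: c) auto

lemma Ck_on_bounded_linear:
 assumes "bounded_linear h" shows "Ck_on k S h"
proof (cases k)
 case 0
 thus ?thesis using linear_continuous_on[OF assms] by simp
next
 case (Suc m)
 have "(h has_derivative h) (at x)" for x by (rule bounded_linear_imp_has_derivative[OF assms])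
 hence "fderiv h x = h" for x using frechet_derivative_at by metis
 thus ?thesis unfolding Suc using bounded_linear_imp_differentiable[OF assms] by (auto simp: Ck_on_const)
qed

lemma Ck_on_linear_comp:
 assumes "bounded_linear h" "open S" "Ck_on k S f"
 shows "Ck_on k S (%x. h (f x))" using assms(3)
proof (induction k arbitrary: f)
 case 0
 thus ?case using continuous_on_compose2[OF linear_continuous_on[OF assms(1), of UNIV]] by auto
next
 case (Suc k)
 show ?case
 proof (rule Ck_on_SucI[OF assms(2)])
  show "((%x. h (f x)) has_derivative (%v. h (fderiv f x v))) (at x)"
   if "x \<in> S" for x by (rule bounded_linear.has_derivative[OF assms(1) Ck_on_SucD[OF Suc.prems that]])
  show "Ck_on k S (%x. h (fderiv f x v))" for v using Suc by auto
 qed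
qed

lemma Ck_on_add:
 assumes "open S" "Ck_on k S f" "Ck_on k S g"
 shows "Ck_on k S (%x. f x + g x)" using assms(2,3)
proof (induction k arbitrary: f g)
 case 0
 thus ?case by (auto intro: continuous_intros)
next
 case (Suc k)
 show ?case by (rule Ck_on_SucI[OF assms(1) has_derivative_add[OF Ck_on_SucD[OF Suc.prems(1)] Ck_on_SucD[OF Suc.prems(2)]]])
   (use Suc in auto)
qed

lemma Ck_on_bilinear:
 assumes bl: "bounded_bilinear p" and "open S" "Ck_on k S f" "Ck_on k S g"
 shows "Ck_on k S (%x. p (f x) (g x))" using assms(3,4)
proof (induction k arbitrary: f g)
 case 0
 thus ?case by (auto intro: bounded_bilinear.continuous_on[OF bl])
next
 case (Suc k)
 show ?case by (rule Ck_on_SucI[OF assms(2) bounded_bilinear.FDERIV[OF bl Ck_on_SucD[OF Suc.prems(1)] Ck_on_SucD[OF Suc.prems(2)]]])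
  (use Suc Ck_on_Suc_imp[OF Suc.prems(1)] Ck_on_Suc_imp[OF Suc.prems(2)] in
   \<open>auto intro!: Ck_on_add[OF assms(2)]\<close>)
qed

lemma Ck_on_sum:
 assumes "open S" "!!i. i \<in> I ==> Ck_on k S (f i)"
 shows "Ck_on k S (%x. \<Sum>i\<in>I. f i x)" using assms(2)
 by (induction I rule: infinite_finite_induct) (auto intro!: Ck_on_add Ck_on_const assms(1))

text \<open>The chain rule is expanded over a basis of the intermediate space. The derivative is
  then a finite sum of products, to which the induction hypothesis and the product rule apply; this
  is why that space is Euclidean.\<close>

lemma Ck_on_compose:
 fixes f :: "'a::real_normed_vector => 'b::euclidean_space" and g :: "'b => 'c::real_normed_vector"
 assumes "open S" "Ck_on k S f" "Ck_on k T g" "f ` S \<subseteq> T"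
 shows "Ck_on k S (%x. g (f x))" using assms(2,3)
proof (induction k arbitrary: g)
 case 0
 thus ?case using assms(4) by (auto intro: continuous_on_compose2)
next
 case (Suc k)
 show ?case
 proof (rule Ck_on_SucI[OF assms(1)])
  fix x assume x: "x \<in> S"
  let ?D = "%v. \<Sum>b\<in>Basis. (fderiv f x v \<bullet> b) *\<^sub>R fderiv g (f x) b"
  have f: "(f has_derivative fderiv f x) (at x)" by (rule Ck_on_SucD[OF Suc.prems(1) x])
  have g: "(g has_derivative fderiv g (f x)) (at (f x))" by (rule Ck_on_SucD[OF Suc.prems(2)]) (use x assms(4) in auto)
  have lin: "linear (fderiv g (f x))" using g has_derivative_linear by blast
  have rep: "fderiv g (f x) w = (\<Sum>b\<in>Basis. (w \<bullet> b) *\<^sub>R fderiv g (f x) b)" for w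
   by (subst (1) euclidean_representation[of w, symmetric]) (simp add: linear_sum[OF lin] linear_scale[OF lin])
  have "?D = (%v. fderiv g (f x) (fderiv f x v))" by (rule ext) (rule rep[symmetric])
  thus "((%x. g (f x)) has_derivative ?D) (at x)" using diff_chain_at[OF f g] by (simp add: o_def)
 next
  fix v
  show "Ck_on k S (%x. \<Sum>b\<in>Basis. (fderiv f x v \<bullet> b) *\<^sub>R fderiv g (f x) b)"
  proof (intro Ck_on_sum[OF assms(1)] Ck_on_bilinear[OF bounded_bilinear_scaleR assms(1)])
   fix b :: 'b
   show "Ck_on k S (%x. fderiv f x v \<bullet> b)"
    by (rule Ck_on_linear_comp[OF bounded_linear_inner_left assms(1)]) (use Suc.prems in auto)
   show "Ck_on k S (%x. fderiv g (f x) b)" by (rule Suc.IH) (use Suc.prems Ck_on_Suc_imp[OF Suc.prems(1)] in auto)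
  qed
 qed
qed

lemma Ck_on_Pair:
 assumes "open S" "Ck_on k S f" "Ck_on k S g"
 shows "Ck_on k S (%x. (f x, g x))" using assms(2,3)
proof (induction k arbitrary: f g)
 case 0
 thus ?case by (auto intro: continuous_intros)
next
 case (Suc k)
 show ?case by (rule Ck_on_SucI[OF assms(1) has_derivative_Pair[OF Ck_on_SucD[OF Suc.prems(1)] Ck_on_SucD[OF Suc.prems(2)]]])
   (use Suc in auto)
qed

lemma smooth_cong: "open S ==> (!!x. x \<in> S ==> f x = g x) ==> smooth_on S f ==> smooth_on S g"
 unfolding smooth_on_def using Ck_on_cong by blast

lemma smooth_subset: "smooth_on S f ==> T \<subseteq> S ==> smooth_on T f" unfolding smooth_on_def using Ck_on_subset by blast

lemma smooth_local:
 "(!!x. x \<in> S ==> EX T. open T & x \<in> T & smooth_on T f) ==> smooth_on S f"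
 unfolding smooth_on_def using Ck_on_local[of S _ f] by meson

lemma smooth_const [simp]: "smooth_on S (%x. c)" by (simp add: smooth_on_def Ck_on_const)

lemma smooth_bounded_linear: "bounded_linear h ==> smooth_on S h" by (simp add: smooth_on_def Ck_on_bounded_linear)

lemma smooth_id [simp]: "smooth_on S (%x. x)" by (rule smooth_bounded_linear) (rule bounded_linear_ident)

lemma smooth_fst [simp]: "smooth_on S fst" and smooth_snd [simp]: "smooth_on S snd"
 by (auto intro: smooth_bounded_linear bounded_linear_fst bounded_linear_snd)

lemma smooth_linear_comp:
 "bounded_linear h ==> open S ==> smooth_on S f ==> smooth_on S (%x. h (f x))" by (simp add: smooth_on_def Ck_on_linear_comp)

lemma smooth_compose:
 fixes f :: "'a::real_normed_vector => 'b::euclidean_space" and g :: "'b => 'c::real_normed_vector"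
 shows "open S ==> smooth_on S f ==> smooth_on T g ==> f ` S \<subseteq> T ==> smooth_on S (%x. g (f x))"
 unfolding smooth_on_def using Ck_on_compose by blast

lemma smooth_on_add:
 "open S ==> smooth_on S f ==> smooth_on S g ==> smooth_on S (%x. f x + g x)" by (simp add: smooth_on_def Ck_on_add)

lemma smooth_scaleR:
 "open S ==> smooth_on S f ==> smooth_on S g ==> smooth_on S (%x. f x *\<^sub>R g x)"
 by (simp add: smooth_on_def Ck_on_bilinear[OF bounded_bilinear_scaleR])

lemma smooth_mult:
 fixes f :: "'a::real_normed_vector => real"
 shows "open S ==> smooth_on S f ==> smooth_on S g ==> smooth_on S (%x. f x * g x)" using smooth_scaleR by force

lemma smooth_inner:
 fixes f :: "'a::real_normed_vector => 'b::euclidean_space"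
 shows "open S ==> smooth_on S f ==> smooth_on S g ==> smooth_on S (%x. f x \<bullet> g x)"
 by (simp add: smooth_on_def Ck_on_bilinear[OF bounded_bilinear_inner])

lemma smooth_on_minus: "open S ==> smooth_on S f ==> smooth_on S (%x. - f x)"
 by (rule smooth_linear_comp[OF bounded_linear_minus[OF bounded_linear_ident]])

lemma smooth_diff:
 "open S ==> smooth_on S f ==> smooth_on S g ==> smooth_on S (%x. f x - g x)" using smooth_on_add[OF _ _ smooth_on_minus] by force

lemma smooth_sum:
 "open S ==> (!!i. i \<in> I ==> smooth_on S (f i)) ==> smooth_on S (%x. \<Sum>i\<in>I. f i x)" by (simp add: smooth_on_def Ck_on_sum)

lemma smooth_power:
 fixes f :: "'a::real_normed_vector => real"
 shows "open S ==> smooth_on S f ==> smooth_on S (%x. f x ^ n)" by (induction n) (auto intro: smooth_mult)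

lemma smooth_Pair:
 "open S ==> smooth_on S f ==> smooth_on S g ==> smooth_on S (%x. (f x, g x))" by (simp add: smooth_on_def Ck_on_Pair)

lemma smooth_continuous: "smooth_on S f ==> continuous_on S f" unfolding smooth_on_def using Ck_on.simps(1)[of S f] by blast

lemma smooth_D:
 "smooth_on S f ==> x \<in> S ==> (f has_derivative fderiv f x) (at x)" unfolding smooth_on_def using Ck_on_SucD by blast

lemma smooth_frechet:
 "smooth_on S f ==> smooth_on S (%x. fderiv f x v)" unfolding smooth_on_def using Ck_on.simps(2)[of _ S f] by blast

lemma smooth_frechet_compose:
 fixes g :: "'a::real_normed_vector => 'b::euclidean_space" and f :: "'b => 'c::real_normed_vector"
 assumes "open S" "open T" "smooth_on T f" "smooth_on S g" "smooth_on S h" "g ` S \<subseteq> T"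
 shows "smooth_on S (%x. fderiv f (g x) (h x))"
proof (rule smooth_cong[OF assms(1)])
 show "smooth_on S (%x. \<Sum>b\<in>Basis. (h x \<bullet> b) *\<^sub>R fderiv f (g x) b)"
  by (intro smooth_sum smooth_scaleR smooth_inner assms smooth_const
    smooth_compose[OF _ _ smooth_frechet, of _ _ T])
 fix x assume "x \<in> S"
 hence lin: "linear (fderiv f (g x))" using smooth_D[OF assms(3)] assms(6) has_derivative_linear by blast
 have "fderiv f (g x) (h x) = fderiv f (g x) (\<Sum>b\<in>Basis. (h x \<bullet> b) *\<^sub>R b)" by (simp add: euclidean_representation)
 thus "(\<Sum>b\<in>Basis. (h x \<bullet> b) *\<^sub>R fderiv f (g x) b) = fderiv f (g x) (h x)"
  by (simp add: linear_sum[OF lin] linear_scale[OF lin])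
qed

lemma frechet_line:
 assumes "(f has_derivative f') (at (x + a *\<^sub>R v))"
 shows "((%t. f (x + t *\<^sub>R v)) has_vector_derivative f' v) (at a)"
proof -
 have "((%t. x + t *\<^sub>R v) has_derivative (%t. t *\<^sub>R v)) (at a)" by (auto intro!: derivative_eq_intros)
 from diff_chain_at[OF this assms] have "((%t. f (x + t *\<^sub>R v)) has_derivative (%t. f' (t *\<^sub>R v))) (at a)" by (simp add: o_def)
 thus ?thesis unfolding has_vector_derivative_def using linear_scale[OF has_derivative_linear[OF assms]] by simp
qed

text \<open>The mean value theorem is applied along \<open>v\<close> to the increment of
  \<open>f\<close> in direction \<open>w\<close>, and then along \<open>w\<close> to the derivative
  in direction \<open>v\<close>. The extra \<open>s\<close> in the bound for the distance makes it
  strict.\<close>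

lemma second_difference:
 fixes f :: "'a::real_normed_vector => real"
 assumes f: "smooth_on (ball x r) f" and s: "0 < s" "s * (norm v + norm w) < r"
 shows "EX y. dist x y < s * (norm v + norm w) + s &
  f (x + s *\<^sub>R v + s *\<^sub>R w) - f (x + s *\<^sub>R v) - f (x + s *\<^sub>R w) + f x
   = s * s * fderiv (%y. fderiv f y v) y w"
proof -
 let ?D = "%y. fderiv f y v"
 have le: "norm (a *\<^sub>R v + b *\<^sub>R w) <= s * (norm v + norm w)" if "0 <= a" "a <= s" "0 <= b" "b <= s" for a b
 proof -
  have "norm (a *\<^sub>R v + b *\<^sub>R w) <= a * norm v + b * norm w"
   using norm_triangle_ineq[of "a *\<^sub>R v" "b *\<^sub>R w"] that by simp
  also have "... <= s * norm v + s * norm w" by (intro add_mono mult_right_mono) (use that in auto)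
  finally show ?thesis by (simp add: distrib_left)
 qed
 have inb: "x + a *\<^sub>R v + b *\<^sub>R w \<in> ball x r" if "0 <= a" "a <= s" "0 <= b" "b <= s" for a b
  using le[OF that] s(2) by (simp add: dist_norm norm_minus_commute algebra_simps)
 define g where "g a = f (x + s *\<^sub>R w + a *\<^sub>R v) - f (x + a *\<^sub>R v)" for a
 have "DERIV g a :> ?D (x + s *\<^sub>R w + a *\<^sub>R v) - ?D (x + a *\<^sub>R v)" if "0 <= a" "a <= s" for a
  unfolding g_def has_real_derivative_iff_has_vector_derivative by (intro has_vector_derivative_diff frechet_line smooth_D[OF f])
   (use inb[of a s] inb[of a 0] that s in \<open>auto simp: algebra_simps\<close>)
 from MVT2[OF s(1) this] obtain a where a: "0 < a" "a < s"
  and ga: "g s - g 0 = s * (?D (x + s *\<^sub>R w + a *\<^sub>R v) - ?D (x + a *\<^sub>R v))" by auto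
 define h where "h b = ?D (x + a *\<^sub>R v + b *\<^sub>R w)" for b
 have "DERIV h b :> fderiv ?D (x + a *\<^sub>R v + b *\<^sub>R w) w" if "0 <= b" "b <= s" for b
  unfolding h_def has_real_derivative_iff_has_vector_derivative
  by (intro frechet_line smooth_D[OF smooth_frechet[OF f]]) (use inb[of a b] that a in auto)
 from MVT2[OF s(1) this] obtain b where b: "0 < b" "b < s"
  and hb: "h s - h 0 = s * fderiv ?D (x + a *\<^sub>R v + b *\<^sub>R w) w" by auto
 have "dist x (x + a *\<^sub>R v + b *\<^sub>R w) <= s * (norm v + norm w)"
  using le[of a b] a b by (simp add: dist_norm norm_minus_commute algebra_simps)
 thus ?thesis using ga hb s(1) by (intro exI[of _ "x + a *\<^sub>R v + b *\<^sub>R w"]) (auto simp: g_def h_def algebra_simps)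
qed

text \<open>The second difference does not change when \<open>v\<close> and \<open>w\<close> are
  exchanged. So near \<open>x\<close> there are points at which the two mixed derivatives take a
  common value, and continuity brings this to \<open>x\<close>.\<close>

lemma frechet_symmetric:
 fixes f :: "'a::real_normed_vector => real"
 assumes f: "smooth_on S f" and "open S" "x \<in> S"
 shows "fderiv (%y. fderiv f y v) x w =
  fderiv (%y. fderiv f y w) x v"
proof (rule ccontr)
 let ?A = "%x. fderiv (%y. fderiv f y v) x w"
 let ?B = "%x. fderiv (%y. fderiv f y w) x v"
 assume "?A x ~= ?B x"
 define e where "e = \<bar>?A x - ?B x\<bar> / 2"
 have e: "e > 0" using \<open>?A x ~= ?B x\<close> by (simp add: e_def)
 have "isCont ?A x" "isCont ?B x" using smooth_continuous[OF smooth_frechet[OF smooth_frechet[OF f]]] assms(2,3)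
  by (auto simp: continuous_on_eq_continuous_at)
 obtain d1 where d1: "d1 > 0" "ALL y. dist y x < d1 --> dist (?A y) (?A x) < e"
  using \<open>isCont ?A x\<close> e unfolding continuous_at_eps_delta by blast
 obtain d2 where d2: "d2 > 0" "ALL y. dist y x < d2 --> dist (?B y) (?B x) < e"
  using \<open>isCont ?B x\<close> e unfolding continuous_at_eps_delta by blast
 note d = d1(1) d1(2)[rule_format] d2(1) d2(2)[rule_format]
 obtain r where r: "r > 0" "ball x r \<subseteq> S" using assms(2,3) open_contains_ball by blast
 define m where "m = min r (min d1 d2)"
 have m: "m > 0" "m <= r" "m <= d1" "m <= d2" using r d by (auto simp: m_def)
 define s where "s = m / (2 * (norm v + norm w + 1))"
 have nn: "norm v + norm w + 1 > 0" by (simp add: add_nonneg_pos)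
 have s: "s > 0" using m nn by (simp add: s_def)
 have "s * (norm v + norm w + 1) = m / 2" using nn by (simp add: s_def field_simps)
 hence sm: "s * (norm v + norm w) + s < m" using m by (simp add: algebra_simps)
 have fb: "smooth_on (ball x r) f" using smooth_subset[OF f r(2)] .
 have sr: "s * (norm v + norm w) < r" "s * (norm w + norm v) < r" using sm m s by (auto simp: add.commute)
 obtain y where y: "dist x y < m"
  "f (x + s *\<^sub>R v + s *\<^sub>R w) - f (x + s *\<^sub>R v) - f (x + s *\<^sub>R w) + f x = s * s * ?A y"
  using second_difference[OF fb s sr(1)] sm by (meson less_trans)
 obtain z where z: "dist x z < m"
  "f (x + s *\<^sub>R w + s *\<^sub>R v) - f (x + s *\<^sub>R w) - f (x + s *\<^sub>R v) + f x = s * s * ?B z"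
  using second_difference[OF fb s sr(2)] sm by (metis add.commute less_trans)
 have "s * s * ?A y = s * s * ?B z" using y(2) z(2) by (simp add: algebra_simps)
 hence "?A y = ?B z" using s by simp
 moreover have "dist (?A y) (?A x) < e" "dist (?B z) (?B x) < e" using d(2)[of y] d(4)[of z] y(1) z(1) m by (auto simp: dist_commute)
 ultimately show False by (auto simp: e_def dist_real_def abs_if split: if_splits)
qed

lemma continuous_on_fixed_snd:
 "continuous_on D g ==> S \<times> T \<subseteq> D ==> p \<in> S ==> continuous_on T (%s. g (p, s))"
 by (rule continuous_on_compose2[of D g]) (auto intro: continuous_intros)

text \<open>The Leibniz rule asks for a convex parameter set and for a derivative that is continuous
  as an operator; hence the ball around \<open>x0\<close> and the passage to bounded linear
  functions.\<close>

lemma integral_param_has_derivative: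
 fixes g :: "'p::euclidean_space \<times> 't::euclidean_space => 'c::banach"
 assumes "open S" "open D" "S \<times> cbox a b \<subseteq> D" "Ck_on 1 D g" "x0 \<in> S"
 shows "((%p. integral (cbox a b) (%s. g (p, s))) has_derivative (%v. integral (cbox a b) (%s. fderiv g (x0, s) (v, 0)))) (at x0)"
proof -
 obtain r where r: "r > 0" "ball x0 r \<subseteq> S" using assms open_contains_ball by blast
 define fx where "fx p s = Blinfun (%v. fderiv g (p, s) (v, 0))" for p s
 have der: "(g has_derivative fderiv g y) (at y)" if "y \<in> D" for y using Ck_on_SucD[of 0 D g] assms(4) that by simp
 have bl: "bounded_linear (%v. fderiv g y (v, 0))" if "y \<in> D" for y
  by (intro bounded_linear_compose[OF has_derivative_bounded_linear[OF der[OF that]]] bounded_linear_intros)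
 have fx: "blinfun_apply (fx p s) = (%v. fderiv g (p, s) (v, 0))" if "(p, s) \<in> D" for p s
  unfolding fx_def by (rule bounded_linear_Blinfun_apply[OF bl[OF that]])
 have sub: "(p, s) \<in> D" if "p \<in> ball x0 r" "s \<in> cbox a b" for p s using that r assms(3) by auto
 have "continuous_on D (%y. fderiv g y v)" for v using assms(4) by (cases v) simp
 hence cont: "continuous_on (ball x0 r \<times> cbox a b) (%y. fderiv g y v)" for v by (rule continuous_on_subset) (use sub in auto)
 have "continuous_on (ball x0 r \<times> cbox a b) (%(p, s). fx p s)"
 proof (rule continuous_on_blinfun_componentwise)
  fix i :: 'p
  show "continuous_on (ball x0 r \<times> cbox a b) (%x. blinfun_apply (case x of (p, s) => fx p s) i)"
   by (rule continuous_on_eq[OF cont[of "(i, 0)"]]) (use sub fx in auto)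
 qed
 moreover have "((%p. g (p, s)) has_derivative blinfun_apply (fx p s)) (at p within ball x0 r)"
  if "p \<in> ball x0 r" "s \<in> cbox a b" for p s
 proof -
  have "((%p. (p, s)) has_derivative (%v. (v, 0))) (at p within ball x0 r)" by (auto intro!: derivative_eq_intros)
  from has_derivative_compose[OF this der[OF sub[OF that]]]
  show ?thesis using fx[OF sub[OF that]] by simp
 qed
 moreover have int: "(%s. g (p, s)) integrable_on cbox a b" if "p \<in> ball x0 r" for p
 proof -
  have "continuous_on D g" using Ck_on_mono[OF assms(4), of 0] by simp
  thus ?thesis by (intro integrable_continuous continuous_on_fixed_snd[of D g "ball x0 r"]) (use sub that in auto)
 qed
 ultimately have "((%p. integral (cbox a b) (%s. g (p, s))) has_derivative
   blinfun_apply (integral (cbox a b) (fx x0))) (at x0 within ball x0 r)" by (intro leibniz_rule) (use r in auto)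
 moreover have "blinfun_apply (integral (cbox a b) (fx x0)) v
   = integral (cbox a b) (%s. fderiv g (x0, s) (v, 0))" for v
 proof (subst blinfun_apply_integral)
  show "fx x0 integrable_on cbox a b"
  proof (rule integrable_continuous, rule continuous_on_blinfun_componentwise)
   fix i :: 'p
   show "continuous_on (cbox a b) (%s. blinfun_apply (fx x0 s) i)"
    by (rule continuous_on_eq[OF continuous_on_fixed_snd[OF cont[of "(i, 0)"] order_refl, of x0]]) (use sub fx r in auto)
  qed
  show "integral (cbox a b) (%s. blinfun_apply (fx x0 s) v) = integral (cbox a b) (%s. fderiv g (x0, s) (v, 0))"
   by (rule integral_cong) (use fx sub r in auto)
 qed
 ultimately show ?thesis using at_within_open[of x0 "ball x0 r"] r(1) by (auto elim!: has_derivative_eq_rhs)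
qed

lemma Ck_on_integral:
 fixes g :: "'p::euclidean_space \<times> 't::euclidean_space => 'c::banach"
 assumes "open S" "open D" "S \<times> cbox a b \<subseteq> D" "Ck_on k D g"
 shows "Ck_on k S (%p. integral (cbox a b) (%s. g (p, s)))" using assms(4)
proof (induction k arbitrary: g)
 case 0
 have "continuous_on (S \<times> cbox a b) (%(x, y). g (x, y))" using 0 assms(3) by (auto intro: continuous_on_subset)
 from integral_continuous_on_param[OF this] show ?case by simp
next
 case (Suc k)
 show ?case
 proof (rule Ck_on_SucI[OF assms(1)])
  show "((%p. integral (cbox a b) (%s. g (p, s))) has_derivative
  (%v. integral (cbox a b) (%s. fderiv g (x, s) (v, 0)))) (at x)" if "x \<in> S" for x
   by (rule integral_param_has_derivative[OF assms(1-3) _ that]) (use Ck_on_mono[OF Suc.prems, of 1] in auto)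
  show "Ck_on k S (%x. integral (cbox a b) (%s. fderiv g (x, s) (v, 0)))" for v by (rule Suc.IH) (use Suc.prems in auto)
 qed
qed

lemma smooth_integral:
 fixes g :: "'p::euclidean_space \<times> 't::euclidean_space => 'c::banach"
 assumes "open S" "open D" "S \<times> cbox a b \<subseteq> D" "smooth_on D g"
 shows "smooth_on S (%p. integral (cbox a b) (%s. g (p, s)))" using assms unfolding smooth_on_def by (blast intro: Ck_on_integral)

text \<open>The function is the integral of \<open>g\<close> from 0 to \<open>s\<close> after a
  substitution. The fixed interval \<open>{0..1}\<close> admits \<open>s\<close> of either sign and
  makes smooth dependence on parameters immediate; the lifted flows are written in this
  form.\<close>

lemma integral_rescaled_deriv:
 fixes g :: "real => 'c::banach"
 assumes "continuous_on UNIV g"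
 shows "((%s. s *\<^sub>R integral {0..1} (%th. g (th * s))) has_vector_derivative g s) (at s)"
proof -
 define R where "R = \<bar>s\<bar> + 1"
 obtain G where G: "!!x. x \<in> {-R..R} ==> (G has_vector_derivative g x) (at x within {-R..R})"
  using antiderivative_continuous[of "-R" R g] assms continuous_on_subset by blast
 have G': "(G has_vector_derivative g x) (at x)" if "\<bar>x\<bar> < R" for x
 proof -
  have "at x within {-R..R} = at x" by (rule at_within_interior) (use that in \<open>auto simp: interior_atLeastAtMost_real\<close>)
  moreover have "x \<in> {-R..R}" using that by auto
  ultimately show ?thesis using G[of x] by simp
 qed
 have eq: "G s' - G 0 = s' *\<^sub>R integral {0..1} (%th. g (th * s'))" if "\<bar>s'\<bar> < R" for s'
 proof -
  have "((%th. G (th * s')) has_vector_derivative s' *\<^sub>R g (th * s')) (at th within {0..1})" if th: "th \<in> {0..1}" for th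
  proof -
   have "\<bar>th * s'\<bar> <= 1 * \<bar>s'\<bar>" unfolding abs_mult by (rule mult_right_mono) (use th in auto)
   hence "\<bar>th * s'\<bar> < R" using \<open>\<bar>s'\<bar> < R\<close> by simp
   note h = G'[OF this]
   have "((%th. th * s') has_vector_derivative s') (at th within {0..1})"
    by (auto intro!: derivative_eq_intros simp: has_real_derivative_iff_has_vector_derivative[symmetric])
   from vector_diff_chain_within[OF this, of G "g (th * s')"] h
   show ?thesis by (simp add: o_def has_vector_derivative_at_within)
  qed
  hence "((%th. s' *\<^sub>R g (th * s')) has_integral G (1 * s') - G (0 * s')) {0..1}" by (intro fundamental_theorem_of_calculus) auto
  from integral_unique[OF this] show ?thesis by simp
 qed
 have "((%s'. G s' - G 0) has_vector_derivative g s) (at s)" using G'[of s] by (auto intro!: derivative_eq_intros simp: R_def)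
 thus ?thesis by (rule has_vector_derivative_transform_within_open[of _ _ _ "{-R<..<R}"]) (auto simp: R_def eq[symmetric])
qed

section \<open>Smooth cutoff functions\<close>

lemma exp_inverse_flat:
 "((%x::real. inverse x ^ m * exp (- inverse x)) \<longlongrightarrow> 0) (at_right 0)"
proof -
 have "((%x::real. inverse x ^ m / exp (inverse x)) \<longlongrightarrow> 0) (at_right 0)"
  by (rule filterlim_compose[OF tendsto_power_div_exp_0 filterlim_inverse_at_top_right])
 thus ?thesis by (simp add: exp_minus divide_inverse)
qed

text \<open>The derivative of a member of this family is a combination of two members, so one
  induction over all \<open>m\<close> at once gives smoothness. \<open>flat 0\<close> is the usual
  function \<open>exp (- 1 / x)\<close>.\<close>

definition flat :: "nat => real => real" where
 "flat m x = (if x <= 0 then 0 else inverse x ^ m * exp (- inverse x))"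

lemma DERIV_inverse_power:
 "x ~= 0 ==> ((%x::real. inverse x ^ m) has_real_derivative - (real m * inverse x ^ Suc m)) (at x)"
proof (induction m)
 case (Suc m)
 show ?case using DERIV_mult[OF DERIV_inverse[OF Suc.prems] Suc.IH[OF Suc.prems]] by (simp add: algebra_simps)
qed simp

lemma flat_deriv: "(flat m has_real_derivative flat (m + 2) x - real m * flat (m + 1) x) (at x)"
proof -
 consider "x < 0" | "x > 0" | "x = 0" by linarith
 thus ?thesis
 proof cases
  case 1
  have "((%x. 0) has_real_derivative 0) (at x)" by simp
  hence "(flat m has_real_derivative 0) (at x)"
   by (rule has_field_derivative_transform_within_open[of _ _ _ "{..<0}"]) (use 1 in \<open>auto simp: flat_def\<close>)
  thus ?thesis using 1 by (simp add: flat_def)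
 next
  case 2
  have "((%x. exp (- inverse x)) has_real_derivative inverse x ^ 2 * exp (- inverse x)) (at x)"
   using 2 by (auto intro!: derivative_eq_intros simp: power2_eq_square)
  from DERIV_mult[OF DERIV_inverse_power[of x m] this]
  have "((%x. inverse x ^ m * exp (- inverse x)) has_real_derivative
   flat (m + 2) x - real m * flat (m + 1) x) (at x)" using 2 by (simp add: flat_def algebra_simps power2_eq_square)
  thus ?thesis by (rule has_field_derivative_transform_within_open[of _ _ _ "{0<..}"]) (use 2 in \<open>auto simp: flat_def\<close>)
 next
  case 3
  have "((%h. flat m h / h) \<longlongrightarrow> 0) (at_right 0)" by (rule Lim_transform_eventually[OF exp_inverse_flat[of "Suc m"]])
    (auto simp: flat_def eventually_at_right_field field_simps intro!: exI[of _ 1])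
  moreover have "((%h. flat m h / h) \<longlongrightarrow> 0) (at_left 0)" by (rule Lim_transform_eventually[OF tendsto_const])
    (auto simp: flat_def eventually_at_left_field intro!: exI[of _ "-1"])
  ultimately have "((%h. flat m h / h) \<longlongrightarrow> 0) (at 0)" by (simp add: filterlim_split_at)
  thus ?thesis using 3 by (simp add: DERIV_def flat_def)
 qed
qed

lemma smooth_flat: "smooth (flat m)"
proof -
 have "Ck_on k UNIV (flat m)" for k
 proof (induction k arbitrary: m)
  case 0
  thus ?case using flat_deriv[of m] by (auto intro!: continuous_at_imp_continuous_on DERIV_isCont)
 next
  case (Suc k)
  show ?case
  proof (rule Ck_on_SucI)
   show "(flat m has_derivative (%v. (flat (m + 2) x - real m * flat (m + 1) x) * v)) (at x)" for x
    using flat_deriv[of m x] by (simp add: has_field_derivative_def)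
   have "Ck_on k UNIV (%x. v * flat (m + 2) x + (- (real m * v)) * flat (m + 1) x)" for v
    by (intro Ck_on_add Ck_on_linear_comp[OF bounded_linear_mult_right] Suc.IH) auto
   thus "Ck_on k UNIV (%x. (flat (m + 2) x - real m * flat (m + 1) x) * v)" for v by (simp add: algebra_simps)
  qed simp
 qed
 thus ?thesis by (simp add: smooth_on_def)
qed

lemma smooth_inverse_pos:
 fixes f :: "'a::real_normed_vector => real"
 assumes "open S" "smooth_on S f" "!!x. x \<in> S ==> f x > 0"
 shows "smooth_on S (%x. inverse (f x))"
proof -
 have "Ck_on k {0::real<..} (%x. inverse x ^ m)" for k m
 proof (induction k arbitrary: m)
  case 0
  thus ?case by (auto intro!: continuous_intros)
 next
  case (Suc k)
  show ?case
  proof (rule Ck_on_SucI)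
   show "((%x. inverse x ^ m) has_derivative (%v. (- (real m * v)) * inverse x ^ Suc m)) (at x)" if "x \<in> {0<..}" for x :: real
    using DERIV_inverse_power[of x m] that by (auto simp: has_field_derivative_def fun_eq_iff algebra_simps elim!: has_derivative_eq_rhs)
   show "Ck_on k {0<..} (%x. (- (real m * v)) * inverse x ^ Suc m)" for v
    by (intro Ck_on_linear_comp[OF bounded_linear_mult_right] Suc.IH) auto
  qed simp
 qed
 from this[of _ 1] have "smooth_on {0::real<..} inverse" by (simp add: smooth_on_def)
 thus ?thesis by (rule smooth_compose[OF assms(1,2)]) (use assms in auto)
qed

definition smooth_step :: "real => real" where
 "smooth_step x = flat 0 x * inverse (flat 0 x + flat 0 (1 - x))"

lemma smooth_step:
 "smooth smooth_step" "x <= 0 ==> smooth_step x = 0" "x >= 1 ==> smooth_step x = 1"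
 "0 <= smooth_step x" "smooth_step x <= 1" "0 < x ==> 0 < smooth_step x"
proof -
 have nn: "flat 0 x >= 0" for x by (simp add: flat_def)
 have pos: "flat 0 x + flat 0 (1 - x) > 0" for x by (cases "x <= 0") (auto simp: flat_def add_pos_nonneg)
 have "smooth (%x. flat 0 (1 - x))" by (rule smooth_compose[OF _ _ smooth_flat]) (auto intro: smooth_diff)
 thus "smooth smooth_step" unfolding smooth_step_def by (intro smooth_mult smooth_flat smooth_inverse_pos smooth_on_add) (use pos in auto)
 show "x <= 0 ==> smooth_step x = 0" by (simp add: smooth_step_def flat_def)
 show "x >= 1 ==> smooth_step x = 1" by (simp add: smooth_step_def flat_def)
 show "0 <= smooth_step x" "smooth_step x <= 1" using nn[of x] nn[of "1 - x"] pos[of x] by (auto simp: smooth_step_def field_simps)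
 show "0 < x ==> 0 < smooth_step x" using pos[of x] by (auto simp: smooth_step_def flat_def)
qed

section \<open>Local solutions of ordinary differential equations\<close>

lemma C1_lipschitz_cball:
 fixes W :: "'e::euclidean_space => 'f::real_normed_vector"
 assumes "Ck_on 1 S W" "cball p r \<subseteq> S"
 obtains L where "L >= 0" "!!x y. x \<in> cball p r ==> y \<in> cball p r ==> norm (W x - W y) <= L * norm (x - y)"
proof -
 have "EX B. \<forall>x\<in>cball p r. norm (fderiv W x b) <= B" for b
 proof -
  have "continuous_on (cball p r) (%x. fderiv W x b)" using assms by (auto intro: continuous_on_subset)
  from compact_imp_bounded[OF compact_continuous_image[OF this compact_cball]]
  show ?thesis unfolding bounded_iff by auto
 qed
 then obtain B where B: "!!b x. x \<in> cball p r ==> norm (fderiv W x b) <= B b" by metis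
 define L where "L = (\<Sum>b\<in>Basis. \<bar>B b\<bar>)"
 have der: "(W has_derivative fderiv W x) (at x)" if "x \<in> cball p r" for x using Ck_on_SucD[of 0 S W] assms that by auto
 have "norm (W x - W y) <= L * norm (x - y)" if "x \<in> cball p r" "y \<in> cball p r" for x y
 proof (rule differentiable_bound[OF convex_cball _ _ that])
  show "(W has_derivative fderiv W x) (at x within cball p r)" if "x \<in> cball p r" for x
   using der[OF that] has_derivative_at_withinI by blast
  show "onorm (fderiv W x) <= L" if "x \<in> cball p r" for x
  proof (rule onorm_le)
   fix v
   have lin: "linear (fderiv W x)" using der[OF that] has_derivative_linear by blast
   have "fderiv W x v = fderiv W x (\<Sum>b\<in>Basis. (v \<bullet> b) *\<^sub>R b)" by (simp add: euclidean_representation)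
   also have "norm ... <= (\<Sum>b\<in>Basis. norm ((v \<bullet> b) *\<^sub>R fderiv W x b))"
    unfolding linear_sum[OF lin] linear_scale[OF lin] by (rule norm_sum)
   also have "... <= (\<Sum>b\<in>Basis. \<bar>B b\<bar> * norm v)"
   proof (rule sum_mono)
    fix b :: 'e assume "b \<in> Basis"
    thus "norm ((v \<bullet> b) *\<^sub>R fderiv W x b) <= \<bar>B b\<bar> * norm v"
     using mult_mono[OF Basis_le_norm[of b v] order_trans[OF B[OF that, of b] abs_ge_self]] by (simp add: mult.commute)
   qed
   finally show "norm (fderiv W x v) <= L * norm v" by (simp add: L_def sum_distrib_right)
  qed
 qed
 thus ?thesis by (intro that[of L]) (auto simp: L_def sum_nonneg)
qed

text \<open>Composed with the nearest-point projection onto a ball, \<open>W\<close> becomes bounded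
  and globally Lipschitz, and the contraction acts on the bounded continuous functions on the whole
  line. The fixed point stays in the ball, where the modified field agrees with
  \<open>W\<close>.\<close>

lemma picard_local:
 fixes W :: "'e::euclidean_space => 'e"
 assumes "open S" "p0 \<in> S" "Ck_on 1 S W"
 obtains p eps where "eps > 0" "p 0 = p0"
  "!!t. \<bar>t\<bar> < eps ==> p t \<in> S" "!!t. \<bar>t\<bar> < eps ==> (p has_vector_derivative W (p t)) (at t)"
proof -
 obtain r where r: "r > 0" "cball p0 r \<subseteq> S" using assms open_contains_cball by blast
 obtain L where L: "L >= 0" "!!x y. x \<in> cball p0 r ==> y \<in> cball p0 r ==> norm (W x - W y) <= L * norm (x - y)"
  using C1_lipschitz_cball[OF assms(3) r(2)] by blast
 define W' where "W' x = W (closest_point (cball p0 r) x)" for x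
 have ne: "cball p0 r ~= {}" using r(1) by auto
 have cp: "closest_point (cball p0 r) x \<in> cball p0 r" for x by (rule closest_point_in_set[OF closed_cball ne])
 have W'L: "norm (W' x - W' y) <= L * norm (x - y)" for x y
 proof -
  have "norm (W' x - W' y) <= L * dist (closest_point (cball p0 r) x) (closest_point (cball p0 r) y)"
   unfolding W'_def dist_norm by (rule L(2)[OF cp cp])
  also have "... <= L * dist x y" by (intro mult_left_mono closest_point_lipschitz) (use L r in auto)
  finally show ?thesis by (simp add: dist_norm)
 qed
 have W'c: "continuous_on UNIV W'"
 proof -
  have "continuous_on (cball p0 r) W" using Ck_on_mono[OF assms(3), of 0] r(2) by (auto intro: continuous_on_subset)
  moreover have "continuous_on UNIV (closest_point (cball p0 r))" by (rule continuous_on_closest_point) (use r(1) in auto)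
  ultimately show ?thesis unfolding W'_def by (rule continuous_on_compose2) (use cp in auto)
 qed
 obtain M where M: "M > 0" "!!x. norm (W' x) <= M"
 proof -
  have "continuous_on (cball p0 r) W" using Ck_on_mono[OF assms(3), of 0] r(2) by (auto intro: continuous_on_subset)
  from compact_imp_bounded[OF compact_continuous_image[OF this compact_cball]]
  obtain M where "M > 0" "\<forall>x\<in>cball p0 r. norm (W x) <= M" unfolding bounded_pos by auto
  thus ?thesis using that[of M] cp by (auto simp: W'_def)
 qed
 \<comment> \<open>The first bound makes the iteration a contraction with factor 1/2, the second
   keeps its values within \<open>r\<close> of \<open>p0\<close>.\<close>
 define eps where "eps = min (1 / (8 * (L + 1))) (r / (4 * M))"
 have e: "eps > 0" "8 * (L + 1) * eps <= 1" "4 * M * eps <= r"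
 proof -
  show "eps > 0" using L(1) r(1) M(1) by (simp add: eps_def)
  have "eps <= 1 / (8 * (L + 1))" "eps <= r / (4 * M)" by (auto simp: eps_def)
  thus "8 * (L + 1) * eps <= 1" "4 * M * eps <= r" using L(1) M(1) by (simp_all add: field_simps)
 qed
 define c where "c t = max (-eps) (min eps t)" for t
 have c: "c t \<in> {-eps..eps}" for t using e by (auto simp: c_def)
 \<comment> \<open>This is the integral from 0 to \<open>c t\<close>, written as a difference
   because \<open>c t\<close> may be negative. The clamped time \<open>c t\<close> keeps
   \<open>T x\<close> bounded on the line.\<close>
 define T where "T x t = p0 + (integral {-eps..c t} (%s. W' (x s)) - integral {-eps..0} (%s. W' (x s)))"
  for x :: "real => 'e" and t
 have W'x: "continuous_on K (%s. W' (x s))" if "continuous_on UNIV x" for x :: "real => 'e" and K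
  by (rule continuous_on_compose2[OF W'c continuous_on_subset[OF that]]) auto
 have near: "norm (T x t - p0) <= r" if "continuous_on UNIV x" for x t
 proof -
  have "norm (integral {-eps..c t} (%s. W' (x s))) <= M * (c t - - eps)" by (rule integral_bound) (use c[of t] M W'x[OF that] in auto)
  moreover have "norm (integral {-eps..0} (%s. W' (x s))) <= M * (0 - - eps)" by (rule integral_bound) (use e M W'x[OF that] in auto)
  moreover have "M * (c t - - eps) <= M * (2 * eps)" using c[of t] M(1) by (intro mult_left_mono) auto
  ultimately have "norm (T x t - p0) <= M * (2 * eps) + M * eps"
   unfolding T_def using norm_triangle_ineq4[of "integral {-eps..c t} (%s. W' (x s))" "integral {-eps..0} (%s. W' (x s))"] by simp
  also have "... <= 4 * M * eps" using mult_pos_pos[OF M(1) e(1)] by simp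
  finally show ?thesis using e(3) by simp
 qed
 have Tb: "T x \<in> bcontfun" if "continuous_on UNIV x" for x
 proof -
  have "continuous_on {-eps..eps} (%t. integral {-eps..t} (%s. W' (x s)))"
   by (intro indefinite_integral_continuous_1 integrable_continuous_real W'x that)
  moreover have "continuous_on UNIV c" unfolding c_def by (intro continuous_intros)
  ultimately have "continuous_on UNIV (%t. integral {-eps..c t} (%s. W' (x s)))" by (rule continuous_on_compose2) (use c in auto)
  hence "continuous_on UNIV (T x)" unfolding T_def by (intro continuous_intros)
  moreover have "bounded (range (T x))"
  proof (rule boundedI[of _ "norm p0 + r"])
   fix y assume "y \<in> range (T x)"
   then obtain t where t: "y = T x t" by auto
   show "norm y <= norm p0 + r" using norm_triangle_sub[of y p0] near[OF that, of t] unfolding t by simp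
  qed
  ultimately show ?thesis by (simp add: bcontfun_def)
 qed
 define F where "F x = Bcontfun (T (apply_bcontfun x))" for x :: "real \<Rightarrow>\<^sub>C 'e"
 have F: "apply_bcontfun (F x) = T (apply_bcontfun x)" for x unfolding F_def by (rule Bcontfun_inverse[OF Tb]) auto
 have "dist (F x) (F y) <= 1/2 * dist x y" for x y
 proof (rule dist_bound)
  fix t
  have cx: "continuous_on K (%s. W' (x s))" "continuous_on K (%s. W' (y s))" for K by (intro W'x; simp)+
  have *: "norm (integral {-eps..a} (%s. W' (x s)) - integral {-eps..a} (%s. W' (y s))) <= L * dist x y * (2 * eps)"
   if "a \<in> {-eps..eps}" for a
  proof -
   have "norm (integral {-eps..a} (%s. W' (x s) - W' (y s))) <= L * dist x y * (a - - eps)"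
   proof (rule integral_bound)
    show "norm (W' (x s) - W' (y s)) <= L * dist x y" for s
     by (rule order_trans[OF W'L mult_left_mono[OF _ L(1)]]) (use dist_bounded[of x s y] in \<open>simp add: dist_norm\<close>)
   qed (use that cx in \<open>auto intro: continuous_intros\<close>)
   also have "... <= L * dist x y * (2 * eps)" using that L(1) by (intro mult_left_mono) auto
   finally show ?thesis by (simp add: integral_diff integrable_continuous_real cx)
  qed
  have "dist (F x t) (F y t) <= L * dist x y * (2 * eps) + L * dist x y * (2 * eps)"
  proof -
   have tri: "norm ((A - B) - (A' - B')) <= norm (A - A') + norm (B - B')" for A B A' B' :: 'e
    using norm_triangle_ineq4[of "A - A'" "B - B'"] by (simp add: algebra_simps)
   have "0 \<in> {-eps..eps}" using e(1) by simp
   have "norm (T x t - T y t) <= L * dist x y * (2 * eps) + L * dist x y * (2 * eps)" unfolding T_def add_diff_cancel_left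
    by (rule order_trans[OF tri]) (intro add_mono *[OF c[of t]] *[OF \<open>0 \<in> {-eps..eps}\<close>])
   thus ?thesis unfolding F dist_norm[of "T x t"] .
  qed
  also have "... = (4 * L * eps) * dist x y" by simp
  also have "... <= 1/2 * dist x y" using e L by (intro mult_right_mono) (auto simp: algebra_simps)
  finally show "dist (F x t) (F y t) <= 1/2 * dist x y" .
 qed
 hence "\<exists>!x. F x = x" by (intro banach_fix_type[of "1/2"]) auto
 then obtain x where x: "F x = x" by auto
 hence xT: "apply_bcontfun x t = T (apply_bcontfun x) t" for t using F by metis
 define p where "p = apply_bcontfun x"
 have pc: "continuous_on UNIV p" by (simp add: p_def)
 have W'p: "W' (p t) = W (p t)" for t using near[OF pc, of t] xT[of t] unfolding W'_def
  by (subst closest_point_self) (auto simp: p_def dist_norm norm_minus_commute)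
 show ?thesis
 proof (rule that[OF e(1)])
  show "p 0 = p0" using xT[of 0] e by (simp add: p_def T_def c_def)
  show "p t \<in> S" if "\<bar>t\<bar> < eps" for t using near[OF pc, of t] xT[of t] r(2) by (auto simp: p_def dist_norm norm_minus_commute)
  show "(p has_vector_derivative W (p t)) (at t)" if t: "\<bar>t\<bar> < eps" for t
  proof -
   have "((%t. integral {-eps..t} (%s. W' (p s))) has_vector_derivative W' (p t)) (at t within {-eps..eps})"
    by (rule integral_has_vector_derivative[OF W'x[OF pc]]) (use t in auto)
   moreover have "at t within {-eps..eps} = at t"
    by (rule at_within_interior) (use t in \<open>auto simp: interior_atLeastAtMost_real\<close>)
   moreover have pT: "p0 + (integral {-eps..t} (%s. W' (p s)) - integral {-eps..0} (%s. W' (p s))) = p t"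
    if "\<bar>t\<bar> < eps" for t
   proof -
    have "c t = t" using that by (auto simp: c_def)
    thus ?thesis using xT[of t] by (metis p_def T_def)
   qed
   ultimately have "((%t. p0 + (integral {-eps..t} (%s. W' (p s)) - integral {-eps..0} (%s. W' (p s)))) has_vector_derivative W' (p t)) (at t)"
    by (auto intro!: derivative_eq_intros)
   hence "(p has_vector_derivative W' (p t)) (at t)" by (rule has_vector_derivative_transform_within_open[of _ _ _ "{-eps<..<eps}"])
     (use t pT in auto)
   thus ?thesis by (simp add: W'p)
  qed
 qed
qed

section \<open>Smooth maps between manifolds\<close>

text \<open>The topological half of \<open>smooth_atlas\<close>. Composition and pairing of smooth
  maps need no more, and it passes to products without any discussion of transition maps.\<close>

definition pre_atlas :: "('a::topological_space, 'e::euclidean_space) atlas => bool" where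
 "pre_atlas A \<longleftrightarrow> (\<Union>(U, phi)\<in>A. U) = UNIV &
  (\<forall>(U, phi)\<in>A. open U & open (phi ` U) & homeomorphism U (phi ` U) phi (inv_into U phi))"

lemma smooth_atlas_pre: "smooth_atlas A ==> pre_atlas A" by (simp add: smooth_atlas_def pre_atlas_def)

lemma chartD:
 assumes "pre_atlas A" "(U, phi) \<in> A"
 shows "open U" "open (phi ` U)" "inj_on phi U" "continuous_on U phi" "continuous_on (phi ` U) (inv_into U phi)"
  "x \<in> U ==> inv_into U phi (phi x) = x"
proof -
 have *: "open U" "open (phi ` U)" "homeomorphism U (phi ` U) phi (inv_into U phi)" using assms unfolding pre_atlas_def by auto
 thus "open U" "open (phi ` U)" "continuous_on U phi" "continuous_on (phi ` U) (inv_into U phi)" by (auto simp: homeomorphism_def)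
 show i: "inj_on phi U" using *(3) unfolding homeomorphism_def inj_on_def by metis
 show "x \<in> U ==> inv_into U phi (phi x) = x" using i by simp
qed

lemma chart_exists: "pre_atlas A ==> EX U phi. (U, phi) \<in> A & x \<in> U" unfolding pre_atlas_def by blast

lemma chart_image_open:
 assumes "pre_atlas A" "(U, phi) \<in> A" "open T" "T \<subseteq> U"
 shows "open (phi ` T)"
proof -
 note c = chartD[OF assms(1,2)]
 have "phi ` T = phi ` U \<inter> inv_into U phi -` T" using assms(4) c(6) by force
 thus ?thesis using continuous_open_preimage[OF c(5,2) assms(3)] by simp
qed

lemma pa_euclid: "pre_atlas euclidean_atlas"
proof -
 have "homeomorphism UNIV (id ` UNIV) id (inv_into UNIV id)" unfolding inv_id by (simp add: homeomorphism_def)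
 thus ?thesis unfolding pre_atlas_def euclidean_atlas_def by (auto simp: image_id)
qed

lemma prod_euclidean: "prod_atlas euclidean_atlas euclidean_atlas = euclidean_atlas" by (auto simp: prod_atlas_def euclidean_atlas_def)

lemma inv_into_map_prod:
 assumes "inj_on phi U" "inj_on psi V" "p \<in> phi ` U" "q \<in> psi ` V"
 shows "inv_into (U \<times> V) (map_prod phi psi) (p, q) = (inv_into U phi p, inv_into V psi q)"
 by (rule inv_into_f_eq) (use assms in \<open>auto intro!: map_prod_inj_on inv_into_into f_inv_into_f\<close>)

lemma pre_atlas_prod:
 assumes "pre_atlas A" "pre_atlas B" shows "pre_atlas (prod_atlas A B)"
proof -
 have "(\<Union>(U, phi)\<in>prod_atlas A B. U) = UNIV"
 proof (intro equalityI subsetI)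
  fix z :: "'a \<times> 'c"
  obtain U phi V psi where "(U, phi) \<in> A" "fst z \<in> U" "(V, psi) \<in> B" "snd z \<in> V" using chart_exists assms by metis
  thus "z \<in> (\<Union>(U, phi)\<in>prod_atlas A B. U)"
   by (intro UN_I[of "(U \<times> V, map_prod phi psi)"]) (auto simp: prod_atlas_def mem_Times_iff)
 qed simp
 moreover have "open W & open (xi ` W) & homeomorphism W (xi ` W) xi (inv_into W xi)"
  if "(W, xi) \<in> prod_atlas A B" for W xi
 proof -
 from that obtain U phi V psi where c: "W = U \<times> V" "xi = map_prod phi psi" and A: "(U, phi) \<in> A" and B: "(V, psi) \<in> B"
  unfolding prod_atlas_def by blast
 note a = chartD[OF assms(1) A] and b = chartD[OF assms(2) B]
 let ?g = "inv_into (U \<times> V) (map_prod phi psi)"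
 have inv: "?g (p, q) = (inv_into U phi p, inv_into V psi q)" if "p \<in> phi ` U" "q \<in> psi ` V" for p q
  by (rule inv_into_map_prod[OF a(3) b(3) that])
 have im: "map_prod phi psi ` (U \<times> V) = (phi ` U) \<times> (psi ` V)" by force
 have c1: "continuous_on (U \<times> V) (map_prod phi psi)" unfolding map_prod_def split_beta
  by (intro continuous_intros continuous_on_compose2[OF a(4)] continuous_on_compose2[OF b(4)]) auto
 have "continuous_on (phi ` U \<times> psi ` V) (%z. (inv_into U phi (fst z), inv_into V psi (snd z)))"
  by (intro continuous_intros continuous_on_compose2[OF a(5)] continuous_on_compose2[OF b(5)]) auto
 hence c2: "continuous_on (phi ` U \<times> psi ` V) ?g" by (rule continuous_on_eq) (auto simp: inv)
 have "homeomorphism (U \<times> V) (map_prod phi psi ` (U \<times> V)) (map_prod phi psi) ?g" unfolding homeomorphism_def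
  using c1 c2 im a(6) b(6) inv by (auto simp: image_iff intro!: bexI) (force simp: inv)+
 thus ?thesis unfolding c using a(1,2) b(1,2) im by (auto intro: open_Times)
 qed
 ultimately show ?thesis unfolding pre_atlas_def by blast
qed

lemma smooth_map_on_continuous: "smooth_map_on A B S f ==> continuous_on S f" by (simp add: smooth_map_on_def)

lemma smooth_map_onD:
 "smooth_map_on A B S f ==> (U, phi) \<in> A ==> (V, psi) \<in> B ==>
  smooth_on (phi ` (S \<inter> U \<inter> f -` V)) (%q. psi (f (inv_into U phi q)))" unfolding smooth_map_on_def o_def by blast

lemma smooth_map_onI:
 assumes "continuous_on S f"
  "!!U phi V psi. (U, phi) \<in> A ==> (V, psi) \<in> B ==>
   smooth_on (phi ` (S \<inter> U \<inter> f -` V)) (%q. psi (f (inv_into U phi q)))"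
 shows "smooth_map_on A B S f" using assms unfolding smooth_map_on_def o_def by blast

lemma smooth_map_on_subset:
 assumes "smooth_map_on A B S f" "T \<subseteq> S" shows "smooth_map_on A B T f"
proof (rule smooth_map_onI)
 show "continuous_on T f" using assms smooth_map_on_continuous continuous_on_subset by blast
 fix U phi V psi assume "(U, phi) \<in> A" "(V, psi) \<in> B"
 from smooth_map_onD[OF assms(1) this]
 show "smooth_on (phi ` (T \<inter> U \<inter> f -` V)) (%q. psi (f (inv_into U phi q)))" by (rule smooth_subset) (use assms(2) in auto)
qed

lemma open_chart_dom:
 assumes "pre_atlas A" "pre_atlas B" "open S" "continuous_on S f" "(U, phi) \<in> A" "(V, psi) \<in> B"
 shows "open (S \<inter> U \<inter> f -` V)" "open (phi ` (S \<inter> U \<inter> f -` V))"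
proof -
 have "open (S \<inter> f -` V)" by (rule continuous_open_preimage[OF assms(4,3) chartD(1)[OF assms(2,6)]])
 hence "open (S \<inter> f -` V \<inter> U)" using chartD(1)[OF assms(1,5)] by blast
 thus *: "open (S \<inter> U \<inter> f -` V)" by (simp add: Int_ac)
 show "open (phi ` (S \<inter> U \<inter> f -` V))" by (rule chart_image_open[OF assms(1,5) *]) auto
qed

lemma smooth_map_on_cong:
 assumes "pre_atlas A" "pre_atlas B" "open S" "!!x. x \<in> S ==> f x = g x" "smooth_map_on A B S f"
 shows "smooth_map_on A B S g"
proof (rule smooth_map_onI)
 show "continuous_on S g" using assms by (metis continuous_on_cong smooth_map_on_continuous)
 fix U phi V psi assume U: "(U, phi) \<in> A" and V: "(V, psi) \<in> B"
 have eq: "S \<inter> U \<inter> f -` V = S \<inter> U \<inter> g -` V" using assms(4) by auto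
 show "smooth_on (phi ` (S \<inter> U \<inter> g -` V)) (%q. psi (g (inv_into U phi q)))" unfolding eq[symmetric]
  by (rule smooth_cong[OF open_chart_dom(2)[OF assms(1-3) smooth_map_on_continuous[OF assms(5)] U V] _ smooth_map_onD[OF assms(5) U V]])
   (use assms(4) chartD(6)[OF assms(1) U] in auto)
qed

lemma smooth_map_on_local:
 assumes "pre_atlas A" "pre_atlas B" "!!x. x \<in> S ==> EX T. open T & x \<in> T & smooth_map_on A B T f"
 shows "smooth_map_on A B S f"
proof (rule smooth_map_onI)
 show c: "continuous_on S f"
 proof (rule continuous_on_subset)
  show "continuous_on (\<Union>{T. open T & smooth_map_on A B T f}) f"
   by (rule continuous_on_open_Union) (auto intro: smooth_map_on_continuous)
  show "S \<subseteq> \<Union>{T. open T & smooth_map_on A B T f}" using assms(3) by blast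
 qed
 fix U phi V psi assume U: "(U, phi) \<in> A" and V: "(V, psi) \<in> B"
 show "smooth_on (phi ` (S \<inter> U \<inter> f -` V)) (%q. psi (f (inv_into U phi q)))"
 proof (rule smooth_local)
  fix q assume "q \<in> phi ` (S \<inter> U \<inter> f -` V)"
  then obtain x where x: "q = phi x" "x \<in> S" "x \<in> U" "f x \<in> V" by auto
  obtain T where T: "open T" "x \<in> T" "smooth_map_on A B T f" using assms(3) x by blast
  show "EX T. open T & q \<in> T & smooth_on T (%q. psi (f (inv_into U phi q)))"
   using open_chart_dom(2)[OF assms(1,2) T(1) smooth_map_on_continuous[OF T(3)] U V]
    smooth_map_onD[OF T(3) U V] x T(2) by blast
 qed
qed

lemma smooth_map_on_compose:
 assumes A: "pre_atlas A" and B: "pre_atlas B" and C: "pre_atlas C" and "open S" "open T"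
  and f: "smooth_map_on A B S f" and g: "smooth_map_on B C T g" and sub: "f ` S \<subseteq> T"
 shows "smooth_map_on A C S (%x. g (f x))"
proof (rule smooth_map_onI)
 note cf = smooth_map_on_continuous[OF f] and cg = smooth_map_on_continuous[OF g]
 show "continuous_on S (%x. g (f x))" by (rule continuous_on_compose2[OF cg cf sub])
 fix U phi W xi assume U: "(U, phi) \<in> A" and W: "(W, xi) \<in> C"
 show "smooth_on (phi ` (S \<inter> U \<inter> (%x. g (f x)) -` W)) (%q. xi (g (f (inv_into U phi q))))"
 proof (rule smooth_local)
  fix q assume "q \<in> phi ` (S \<inter> U \<inter> (%x. g (f x)) -` W)"
  then obtain x where x: "q = phi x" "x \<in> S" "x \<in> U" "g (f x) \<in> W" by auto
  obtain V psi where V: "(V, psi) \<in> B" "f x \<in> V" using chart_exists[OF B] by blast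
  define R where "R = T \<inter> V \<inter> g -` W"
  have oR: "open R" unfolding R_def by (rule open_chart_dom[OF B C assms(5) cg V(1) W])
  define D where "D = S \<inter> U \<inter> f -` R"
  have "open (S \<inter> f -` R)" by (rule continuous_open_preimage[OF cf assms(4) oR])
  hence "open (S \<inter> f -` R \<inter> U)" using chartD(1)[OF A U] by blast
  hence oD: "open D" by (simp add: D_def Int_ac)
  have oD': "open (phi ` D)" by (rule chart_image_open[OF A U oD]) (auto simp: D_def)
  have 1: "smooth_on (phi ` D) (%q. psi (f (inv_into U phi q)))"
   by (rule smooth_subset[OF smooth_map_onD[OF f U V(1)]]) (auto simp: D_def R_def)
  have 2: "smooth_on (psi ` R) (%q. xi (g (inv_into V psi q)))" unfolding R_def by (rule smooth_map_onD[OF g V(1) W])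
  have "smooth_on (phi ` D) (%q. xi (g (inv_into V psi (psi (f (inv_into U phi q))))))"
   by (rule smooth_compose[OF oD' 1 2]) (use chartD(6)[OF A U] in \<open>auto simp: D_def\<close>)
  hence "smooth_on (phi ` D) (%q. xi (g (f (inv_into U phi q))))" by (rule smooth_cong[OF oD', rotated])
    (use chartD(6)[OF A U] chartD(6)[OF B V(1)] in \<open>auto simp: D_def R_def\<close>)
  moreover have "q \<in> phi ` D" using x V sub by (auto simp: D_def R_def)
  ultimately show "EX T. open T & q \<in> T & smooth_on T (%q. xi (g (f (inv_into U phi q))))" using oD' by blast
 qed
qed

lemma smooth_map_on_Pair:
 assumes A: "pre_atlas A" and B: "pre_atlas B" and C: "pre_atlas C" and "open S"
  and f: "smooth_map_on A B S f" and g: "smooth_map_on A C S g"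
 shows "smooth_map_on A (prod_atlas B C) S (%x. (f x, g x))"
proof (rule smooth_map_onI)
 note cf = smooth_map_on_continuous[OF f] and cg = smooth_map_on_continuous[OF g]
 show c: "continuous_on S (%x. (f x, g x))" using cf cg by (intro continuous_intros)
 fix U phi W xi assume U: "(U, phi) \<in> A" and W: "(W, xi) \<in> prod_atlas B C"
 then obtain V psi V' psi' where V: "W = V \<times> V'" "xi = map_prod psi psi'" "(V, psi) \<in> B" "(V', psi') \<in> C"
  unfolding prod_atlas_def by blast
 have o: "open (phi ` (S \<inter> U \<inter> (%x. (f x, g x)) -` W))" by (rule open_chart_dom[OF A pre_atlas_prod[OF B C] assms(4) c U W])
 show "smooth_on (phi ` (S \<inter> U \<inter> (%x. (f x, g x)) -` W)) (%q. xi (f (inv_into U phi q), g (inv_into U phi q)))"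
  unfolding V(2) map_prod_simp by (intro smooth_Pair o smooth_subset[OF smooth_map_onD[OF f U V(3)]]
    smooth_subset[OF smooth_map_onD[OF g U V(4)]]) (auto simp: V(1))
qed

lemma smooth_map_euclidean:
 "open S ==> smooth_map_on euclidean_atlas euclidean_atlas S f \<longleftrightarrow> smooth_on S f"
 unfolding smooth_map_on_def euclidean_atlas_def by (auto simp: smooth_continuous o_def id_def inv_id[unfolded id_def])

lemma smooth_map_on_const:
 assumes "pre_atlas A" shows "smooth_map_on A B S (%x. c)" by (rule smooth_map_onI) auto

lemma smooth_map_on_chart:
 assumes "smooth_atlas A" "(U, phi) \<in> A"
 shows "smooth_map_on A euclidean_atlas U phi" "smooth_map_on euclidean_atlas A (phi ` U) (inv_into U phi)"
proof -
 note c = chartD[OF smooth_atlas_pre[OF assms(1)] assms(2)]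
 have tr: "smooth_on (psi ` (V \<inter> W)) (%q. xi (inv_into V psi q))" if "(V, psi) \<in> A" "(W, xi) \<in> A" for V psi W xi
  using assms(1) that unfolding smooth_atlas_def o_def by blast
 show "smooth_map_on A euclidean_atlas U phi" by (rule smooth_map_onI[OF c(4)])
   (use tr[OF _ assms(2)] in \<open>auto simp: euclidean_atlas_def Int_commute id_def\<close>)
 have "phi ` U \<inter> inv_into U phi -` V = phi ` (U \<inter> V)" for V using c(6) by auto
 thus "smooth_map_on euclidean_atlas A (phi ` U) (inv_into U phi)" by (intro smooth_map_onI[OF c(5)])
   (use tr[OF assms(2)] in \<open>auto simp: euclidean_atlas_def inv_id[unfolded id_def] id_def\<close>)
qed

lemma smooth_map_on_id:
 assumes "smooth_atlas A" shows "smooth_map_on A A S (%x. x)"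
proof (rule smooth_map_onI)
 fix U phi V psi assume "(U, phi) \<in> A" "(V, psi) \<in> A"
 hence "smooth_on (phi ` (U \<inter> V)) (%q. psi (inv_into U phi q))" using assms unfolding smooth_atlas_def o_def by blast
 thus "smooth_on (phi ` (S \<inter> U \<inter> (%x. x) -` V)) (%q. psi (inv_into U phi q))" by (rule smooth_subset) auto
qed simp

lemma smooth_fun_chart:
 assumes "(U, phi) \<in> A" "smooth_map_on A euclidean_atlas S f"
 shows "smooth_on (phi ` (S \<inter> U)) (%q. f (inv_into U phi q))"
 using smooth_map_onD[OF assms(2,1), of UNIV id] by (simp add: euclidean_atlas_def)

lemma has_derivative_partial:
 assumes "(g has_derivative g') (at (p, q))"
 shows "((%x. g (x, q)) has_derivative (%v. g' (v, 0))) (at p)"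
  "((%x. g (p, x)) has_derivative (%v. g' (0, v))) (at q)"
proof -
 have "((%x. (x, q)) has_derivative (%v. (v, 0))) (at p)"
  "((%x. (p, x)) has_derivative (%v. (0, v))) (at q)" by (auto intro!: derivative_eq_intros)
 from this[THEN has_derivative_compose, of g g'] assms
 show "((%x. g (x, q)) has_derivative (%v. g' (v, 0))) (at p)"
  "((%x. g (p, x)) has_derivative (%v. g' (0, v))) (at q)" by simp_all
qed

text \<open>Used where two factors of a group product move at the same time: each is differentiated
  with the other one frozen.\<close>

lemma diagonal_derivative:
 fixes F :: "real \<times> real => real"
 assumes F: "smooth_on (S \<times> S) F" "t \<in> S"
  and "((%s. F (s, t)) has_real_derivative a) (at t)" "((%s. F (t, s)) has_real_derivative b) (at t)"
 shows "((%s. F (s, s)) has_real_derivative a + b) (at t)"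
proof -
 let ?D = "fderiv F (t, t)"
 have D: "(F has_derivative ?D) (at (t, t))" by (rule smooth_D[OF F(1)]) (use F in auto)
 have lin: "linear ?D" using D has_derivative_linear by blast
 have a: "?D (v, 0) = a * v" for v using has_derivative_unique[OF has_derivative_partial(1)[OF D]] assms(3)
  unfolding has_field_derivative_def by metis
 have b: "?D (0, v) = b * v" for v using has_derivative_unique[OF has_derivative_partial(2)[OF D]] assms(4)
  unfolding has_field_derivative_def by metis
 have "((%s. (s, s)) has_derivative (%v. (v, v))) (at t)" by (auto intro!: derivative_eq_intros)
 from has_derivative_compose[OF this D]
 have "((%s. F (s, s)) has_derivative (%v. ?D (v, v))) (at t)" .
 moreover have "?D (v, v) = (a + b) * v" for v using linear_add[OF lin, of "(v, 0)" "(0, v)"] a b by (simp add: algebra_simps)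
 ultimately show ?thesis by (simp add: has_field_derivative_def)
qed

definition bump :: "'e::euclidean_space => real => 'e => real" where
 "bump p r q = smooth_step (2 - (2 / r^2) * ((q - p) \<bullet> (q - p)))"

lemma bump:
 fixes p :: "'e::euclidean_space"
 assumes "r > 0"
 shows "smooth_on S (bump p r)" "q \<notin> ball p r ==> bump p r q = 0" "q \<in> ball p (r / 2) ==> bump p r q = 1"
  "0 <= bump p r q" "bump p r q <= 1" "bump p r p = 1" "q \<in> ball p r ==> bump p r q > 0"
proof -
 have "smooth (%q. 2 - (2 / r^2) * ((q - p) \<bullet> (q - p)))"
  by (intro smooth_diff smooth_mult smooth_inner smooth_const smooth_id open_UNIV)
 hence "smooth (bump p r)" unfolding bump_def by (intro smooth_compose[OF _ _ smooth_step(1)]) auto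
 thus "smooth_on S (bump p r)" by (rule smooth_subset) simp
 have n: "(q - p) \<bullet> (q - p) = (dist p q)^2" for q
 proof -
  have "dist p q = norm (q - p)" by (simp add: dist_norm norm_minus_commute)
  thus ?thesis by (simp only: power2_norm_eq_inner)
 qed
 show "bump p r q = 0" if "q \<notin> ball p r"
 proof -
  have "r^2 <= (dist p q)^2" by (rule power_mono) (use assms that in auto)
  thus ?thesis unfolding bump_def n using assms by (intro smooth_step(2)) (auto simp: field_simps)
 qed
 show "bump p r q = 1" if "q \<in> ball p (r / 2)"
 proof -
  have "(dist p q)^2 <= (r / 2)^2" by (rule power_mono) (use assms that in auto)
  hence "(dist p q)^2 * 4 <= r^2" by (simp add: field_simps power2_eq_square)
  moreover have "0 <= (dist p q)^2" by simp
  ultimately have "(dist p q)^2 * 2 <= r^2" by linarith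
  thus ?thesis unfolding bump_def n using assms by (intro smooth_step(3)) (simp add: field_simps)
 qed
 thus "bump p r p = 1" by (simp add: bump_def smooth_step(3))
 show "0 <= bump p r q" "bump p r q <= 1" by (simp_all add: bump_def smooth_step)
 show "bump p r q > 0" if "q \<in> ball p r"
 proof -
  have "(dist p q)^2 < r^2" by (rule power_strict_mono) (use assms that in auto)
  thus ?thesis unfolding bump_def n using assms by (intro smooth_step(6)) (simp add: field_simps)
 qed
qed

lemma bump_outside: "r > 0 ==> q \<notin> cball p r ==> bump p r q = 0" by (rule bump(2)) auto

section \<open>Left-invariant vector fields and one-parameter subgroups\<close>

locale lie_grp =
 fixes A :: "('a::{topological_group_add, t2_space, second_countable_topology}, 'e::euclidean_space) atlas"
 assumes lie: "lie_group A"
begin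

lemma sa: "smooth_atlas A" and pa: "pre_atlas A" using lie smooth_atlas_pre by (auto simp: lie_group_def)

abbreviation sf :: "('a => real) set" where "sf \<equiv> smooth_funs A"

lemma sf_iff: "f \<in> sf \<longleftrightarrow> smooth_map_on A euclidean_atlas UNIV f" by (simp add: smooth_funs_def)

lemma smooth_add:
 assumes "pre_atlas B" "open S" "smooth_map_on B A S f" "smooth_map_on B A S g"
 shows "smooth_map_on B A S (%x. f x + g x)" using smooth_map_on_compose[OF assms(1) pre_atlas_prod[OF pa pa] pa assms(2) open_UNIV
   smooth_map_on_Pair[OF assms(1) pa pa assms(2-4)], of "%(x, y). x + y"] lie by (simp add: lie_group_def)

lemma smooth_uminus:
 assumes "pre_atlas B" "open S" "smooth_map_on B A S f"
 shows "smooth_map_on B A S (%x. - f x)" using smooth_map_on_compose[OF assms(1) pa pa assms(2) open_UNIV assms(3), of uminus] lie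
 by (simp add: lie_group_def)

lemma smooth_minus:
 assumes "pre_atlas B" "open S" "smooth_map_on B A S f" "smooth_map_on B A S g"
 shows "smooth_map_on B A S (%x. f x - g x)" using smooth_add[OF assms(1-3) smooth_uminus[OF assms(1,2,4)]] by simp

lemma sf_comp:
 assumes "pre_atlas B" "open S" "smooth_map_on B A S g" "f \<in> sf"
 shows "smooth_map_on B euclidean_atlas S (%x. f (g x))"
 by (rule smooth_map_on_compose[OF assms(1) pa pa_euclid assms(2) open_UNIV assms(3)]) (use assms(4) sf_iff in auto)

lemma sf_comp_euclid:
 "open S ==> smooth_map_on euclidean_atlas A S g ==> f \<in> sf ==> smooth_on S (%x. f (g x))"
 using sf_comp[OF pa_euclid] smooth_map_euclidean by blast

lemma smooth_comp_euclid:
 fixes g :: "'m::euclidean_space => 'k::euclidean_space"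
 assumes "open S" "open T" "smooth_on S g" "smooth_map_on euclidean_atlas A T h" "g ` S \<subseteq> T"
 shows "smooth_map_on euclidean_atlas A S (%x. h (g x))" by (rule smooth_map_on_compose[OF pa_euclid pa_euclid pa assms(1,2) _ assms(4,5)])
  (use assms smooth_map_euclidean in blast)

lemma sf_translate: "f \<in> sf ==> (%x. f (a + x + b)) \<in> sf" unfolding sf_iff by (rule sf_comp[OF pa open_UNIV, unfolded sf_iff])
  (intro smooth_add pa open_UNIV smooth_map_on_const smooth_map_on_id sa)

lemma sf_left: "f \<in> sf ==> (%x. f (a + x)) \<in> sf" and sf_right: "f \<in> sf ==> (%x. f (x + b)) \<in> sf"
 using sf_translate[of f a 0] sf_translate[of f 0 b] by simp_all

lemma sf_binop:
 fixes h :: "real \<times> real => real"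
 assumes "smooth h" "f \<in> sf" "g \<in> sf"
 shows "(%x. h (f x, g x)) \<in> sf" unfolding sf_iff
proof (rule smooth_map_on_compose[OF pa pre_atlas_prod[OF pa_euclid pa_euclid] pa_euclid open_UNIV open_UNIV])
 show "smooth_map_on A (prod_atlas euclidean_atlas euclidean_atlas) UNIV (%x. (f x, g x))"
  by (intro smooth_map_on_Pair pa pa_euclid open_UNIV) (use assms sf_iff in auto)
 show "smooth_map_on (prod_atlas euclidean_atlas euclidean_atlas) euclidean_atlas UNIV h"
  unfolding prod_euclidean smooth_map_euclidean[OF open_UNIV] by (rule assms)
qed simp

lemma sf_const [simp]: "(%x. c) \<in> sf" unfolding sf_iff by (rule smooth_map_on_const[OF pa])

lemma sf_add: "f \<in> sf ==> g \<in> sf ==> (%x. f x + g x) \<in> sf" using sf_binop[of "%z. fst z + snd z"] by (simp add: smooth_on_add)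

lemma sf_mult: "f \<in> sf ==> g \<in> sf ==> (%x. f x * g x) \<in> sf" using sf_binop[of "%z. fst z * snd z"] by (simp add: smooth_mult)

lemma sf_diff: "f \<in> sf ==> g \<in> sf ==> (%x. f x - g x) \<in> sf" using sf_binop[of "%z. fst z - snd z"] by (simp add: smooth_diff)

lemma sf_scale: "f \<in> sf ==> (%x. c * f x) \<in> sf" using sf_mult[OF sf_const] .

lemma sf_sum: "(!!i. i \<in> I ==> f i \<in> sf) ==> (%x. \<Sum>i\<in>I. f i x) \<in> sf"
 by (induction I rule: infinite_finite_induct) (auto intro: sf_add)

text \<open>The part of the chart that lies over \<open>D\<close> and the complement of the image of
  \<open>K\<close> cover the group, and the latter is open because compact sets are closed in a
  Hausdorff space. The function is given by \<open>g\<close> on the first set and is 0 on the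
  second.\<close>

lemma extend_by_zero:
 assumes U: "(U, phi) \<in> A" and D: "open D" "D \<subseteq> phi ` U" and g: "smooth_on D g"
  and K: "compact K" "K \<subseteq> D" "!!q. q \<in> D - K ==> g q = 0"
 shows "(%x. if x \<in> U & phi x \<in> D then g (phi x) else 0) \<in> sf" (is "?h \<in> sf") unfolding sf_iff
proof (rule smooth_map_on_local[OF pa pa_euclid])
 fix x
 note c = chartD[OF pa U]
 let ?V = "U \<inter> phi -` D"
 have oV: "open ?V" by (rule continuous_open_preimage[OF c(4,1) D(1)])
 have s1: "smooth_map_on A euclidean_atlas ?V ?h"
 proof (rule smooth_map_on_cong[OF pa pa_euclid oV])
  show "smooth_map_on A euclidean_atlas ?V (%x. g (phi x))" by (rule smooth_map_on_compose[OF pa pa_euclid pa_euclid oV D(1)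
      smooth_map_on_subset[OF smooth_map_on_chart(1)[OF sa U]]]) (use g D smooth_map_euclidean in auto)
 qed auto
 let ?W = "- (inv_into U phi ` K)"
 have "compact (inv_into U phi ` K)" by (rule compact_continuous_image[OF continuous_on_subset[OF c(5)] K(1)]) (use K D in auto)
 hence oW: "open ?W" by (simp add: compact_imp_closed open_Compl)
 have s2: "smooth_map_on A euclidean_atlas ?W ?h" by (rule smooth_map_on_cong[OF pa pa_euclid oW _ smooth_map_on_const[OF pa, of _ _ 0]])
   (use K(3) c(6) in \<open>auto simp: image_iff, metis DiffI\<close>)
 have "x \<in> ?V \<or> x \<in> ?W" using K(2) D(2) by (auto simp: inv_into_into f_inv_into_f subset_iff)
 thus "EX T. open T & x \<in> T & smooth_map_on A euclidean_atlas T ?h" using s1 s2 oV oW by blast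
qed

text \<open>The compact support will bound the derivatives of \<open>f\<close> along all
  left-invariant fields, which yields the lower bound for the metric in
  \<open>cc_dist_pos\<close>.\<close>

lemma separating_function:
 assumes "x ~= y"
 obtains f C where "f \<in> sf" "f x = 1" "f y = 0" "compact C" "!!z. z \<notin> C ==> f z = 0"
proof -
 obtain U phi where U: "(U, phi) \<in> A" "x \<in> U" using chart_exists[OF pa] by blast
 note c = chartD[OF pa U(1)]
 have "open (phi ` (U - {y}))" by (rule chart_image_open[OF pa U(1)]) (use c(1) in auto)
 moreover have "phi x \<in> phi ` (U - {y})" using U assms by auto
 ultimately obtain r where r: "r > 0" "cball (phi x) r \<subseteq> phi ` (U - {y})" using open_contains_cball by blast
 define r2 where "r2 = r / 2"
 have r2: "r2 > 0" "cball (phi x) r2 \<subseteq> ball (phi x) r" using r by (auto simp: r2_def)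
 define h where "h = (%z. if z \<in> U & phi z \<in> ball (phi x) r then bump (phi x) r2 (phi z) else 0)"
 have sub: "ball (phi x) r \<subseteq> phi ` (U - {y})" using r(2) ball_subset_cball by blast
 have "h \<in> sf" unfolding h_def by (rule extend_by_zero[OF U(1) open_ball _ bump(1)[OF r2(1)] compact_cball r2(2)])
   (use sub bump_outside[OF r2(1)] in auto)
 moreover have "h x = 1" using U r bump(6)[OF r2(1)] by (simp add: h_def)
 moreover have "h y = 0"
 proof -
  have "phi y \<notin> ball (phi x) r" if "y \<in> U"
  proof
   assume "phi y \<in> ball (phi x) r"
   then obtain z where "z \<in> U - {y}" "phi y = phi z" using sub by blast
   thus False using c(3) that by (auto simp: inj_on_def)
  qed
  thus ?thesis by (auto simp: h_def)
 qed
 moreover have "compact (inv_into U phi ` cball (phi x) r2)"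
  by (rule compact_continuous_image[OF continuous_on_subset[OF c(5)] compact_cball]) (use sub r2 in blast)
 moreover have "h z = 0" if "z \<notin> inv_into U phi ` cball (phi x) r2" for z
 proof (rule ccontr)
  assume "h z ~= 0"
  hence "z \<in> U" "bump (phi x) r2 (phi z) ~= 0" by (auto simp: h_def split: if_splits)
  hence "phi z \<in> cball (phi x) r2" using bump(2)[OF r2(1)] by force
  thus False using that c(6)[OF \<open>z \<in> U\<close>] by (metis image_eqI)
 qed
 ultimately show ?thesis using that by blast
qed

lemma sf_separate: "(!!f. f \<in> sf ==> f x = f y) ==> x = y" by (metis separating_function zero_neq_one)

text \<open>A fixed chart at the neutral element, with inverse \<open>ex\<close>.\<close>

definition cs where "cs = (SOME c. c \<in> A & 0 \<in> fst c)"
definition "U0 = fst cs"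
definition "ph = snd cs"
definition "D0 = ph ` U0"
definition "ex = inv_into U0 ph"
definition "p0 = ph 0"

lemma ch0: "(U0, ph) \<in> A" "0 \<in> U0"
proof -
 have "EX c. c \<in> A & 0 \<in> fst c" using chart_exists[OF pa, of 0] by force
 from someI_ex[OF this] show "(U0, ph) \<in> A" "0 \<in> U0" unfolding U0_def ph_def cs_def by auto
qed

lemma D0: "open D0" "p0 \<in> D0" "ex p0 = 0" "q \<in> D0 ==> ex q \<in> U0" "q \<in> D0 ==> ph (ex q) = q"
 "x \<in> U0 ==> ex (ph x) = x" "x \<in> U0 ==> ph x \<in> D0" "open U0" using chartD[OF pa ch0(1)] ch0(2)
 by (auto simp: D0_def p0_def ex_def f_inv_into_f intro: inv_into_into)

lemma smooth_ex: "smooth_map_on euclidean_atlas A D0 ex" unfolding D0_def ex_def by (rule smooth_map_on_chart[OF sa ch0(1)])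

lemma smooth_ph: "smooth_map_on A euclidean_atlas U0 ph" by (rule smooth_map_on_chart[OF sa ch0(1)])

text \<open>The derivative of \<open>f\<close> at \<open>x\<close> along the left-invariant field
  whose value at the neutral element has chart coordinates \<open>v\<close>. Thus the coordinate
  space \<open>'e\<close> serves as a model of the Lie algebra.\<close>

definition tv :: "'e => ('a => real) => 'a => real" where
 "tv v f x = fderiv (%q. f (x + ex q)) p0 v"

lemma tv_has_derivative:
 assumes "f \<in> sf" shows "((%q. f (x + ex q)) has_derivative (%v. tv v f x)) (at p0)"
proof -
 have "smooth_on D0 (%q. f (x + ex q))" by (intro sf_comp_euclid[OF D0(1) _ assms] smooth_add pa_euclid D0(1) smooth_map_on_const smooth_ex)
 from smooth_D[OF this D0(2)] show ?thesis by (simp add: tv_def[abs_def])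
qed

lemma tv_unique:
 assumes "f \<in> sf" "((%q. f (x + ex q)) has_derivative f') (at p0)"
 shows "tv v f x = f' v" using has_derivative_unique[OF tv_has_derivative[OF assms(1)] assms(2)] by meson

lemma tv_linear: "f \<in> sf ==> linear (%v. tv v f x)" using tv_has_derivative has_derivative_linear by blast

lemma tv_left: "tv v (%y. f (g + y)) x = tv v f (g + x)" by (simp add: tv_def add.assoc)

lemma smooth_pair_map:
 assumes "open S" "smooth_map_on euclidean_atlas A S g"
 shows "smooth_map_on euclidean_atlas A (S \<times> D0) (%z. g (fst z) + ex (snd z))" by (intro smooth_add pa_euclid open_Times assms D0(1)
   smooth_comp_euclid[OF _ assms(1) _ assms(2)] smooth_comp_euclid[OF _ D0(1) _ smooth_ex]) auto

lemma tv_smooth: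
 assumes "f \<in> sf" shows "tv v f \<in> sf" unfolding sf_iff
proof (rule smooth_map_on_local[OF pa pa_euclid])
 fix x
 obtain V psi where V: "(V, psi) \<in> A" "x \<in> V" using chart_exists[OF pa] by blast
 note c = chartD[OF pa V(1)]
 let ?g = "%z. f (inv_into V psi (fst z) + ex (snd z))"
 have g: "smooth_on (psi ` V \<times> D0) ?g"
  by (intro sf_comp_euclid[OF _ _ assms] smooth_pair_map smooth_map_on_chart[OF sa V(1)] open_Times c D0(1))
 have gd: "tv v f y = fderiv ?g (psi y, p0) (0, v)" if "y \<in> V" for y
 proof -
  have "(?g has_derivative fderiv ?g (psi y, p0)) (at (psi y, p0))" by (rule smooth_D[OF g]) (use that D0 in auto)
  from has_derivative_partial(2)[OF this]
  show ?thesis using tv_unique[OF assms] c(6)[OF that] by simp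
 qed
 have "smooth_on (psi ` V) (%q. fderiv ?g (q, p0) (0, v))"
  by (rule smooth_frechet_compose[OF c(2) _ g]) (auto intro!: smooth_Pair c(2) open_Times D0)
 hence "smooth_map_on A euclidean_atlas V (%y. fderiv ?g (psi y, p0) (0, v))"
  by (intro smooth_map_on_compose[OF pa pa_euclid pa_euclid c(1,2) smooth_map_on_chart(1)[OF sa V(1)]])
   (use smooth_map_euclidean c(2) in auto)
 hence "smooth_map_on A euclidean_atlas V (tv v f)" by (rule smooth_map_on_cong[OF pa pa_euclid c(1), rotated]) (simp add: gd)
 thus "EX T. open T & x \<in> T & smooth_map_on A euclidean_atlas T (tv v f)" using c(1) V(2) by blast
qed

lemma tv_const [simp]: "tv v (%x. c) x = 0" by (simp add: tv_def)

lemma tv_add: "f \<in> sf ==> g \<in> sf ==> tv v (%x. f x + g x) x = tv v f x + tv v g x"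
 by (rule tv_unique[OF sf_add]) (auto intro!: has_derivative_add tv_has_derivative)

lemma tv_mult: "f \<in> sf ==> g \<in> sf ==> tv v (%x. f x * g x) x = f x * tv v g x + tv v f x * g x" by (rule tv_unique[OF sf_mult])
  (use has_derivative_mult[OF tv_has_derivative[of f x] tv_has_derivative[of g x]] D0(3) in auto)

lemma tv_scale: "f \<in> sf ==> tv v (%x. c * f x) x = c * tv v f x"
 by (rule tv_unique[OF sf_scale]) (auto intro!: has_derivative_mult_right tv_has_derivative)

definition vf :: "'e => 'a vfield" where
 "vf v f = (if f \<in> sf then tv v f else (%x. 0))"

lemma vf_in: "vf v \<in> lie_algebra A" unfolding lie_algebra_def vector_field_def
 by (auto simp: vf_def tv_smooth tv_add tv_mult tv_scale sf_add sf_mult sf_scale sf_left fun_eq_iff tv_left)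

text \<open>Hadamard's lemma: a derivation at \<open>0\<close> only sees first order Taylor coefficients.\<close>

lemma lie_algebra_vf:
 assumes X: "X \<in> lie_algebra A"
 obtains v where "X = vf v"
proof -
 have XF: "vector_field A X" and left: "!!f g x. f \<in> sf ==> X (%x. f (g + x)) x = X f (g + x)"
  and nX: "!!f. f \<notin> sf ==> X f = (%x. 0)" using X unfolding lie_algebra_def vector_field_def by (auto simp: fun_eq_iff)
 define D where "D f = X f 0" for f
 have Dadd: "D (%x. f x + g x) = D f + D g" and Dmult: "D (%x. f x * g x) = f 0 * D g + D f * g 0"
  and Dscale: "D (%x. c * f x) = c * D f" if "f \<in> sf" "g \<in> sf" for f g c using XF that unfolding vector_field_def D_def by simp_all
 have D1: "D (%x. c) = 0" for c
 proof -
  have "D (%x. 1) = 0" using Dmult[of "%x. 1" "%x. 1"] by simp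
  thus ?thesis using Dscale[of "%x. 1" "%x. 1" c] by simp
 qed
 have Dsum: "D (%x. \<Sum>b\<in>I. f b x) = (\<Sum>b\<in>I. D (f b))" if "!!b. b \<in> I ==> f b \<in> sf" for f :: "'e => _" and I
  using that by (induction I rule: infinite_finite_induct) (auto simp: D1 Dadd sf_sum)
 obtain R where R: "R > 0" "cball p0 R \<subseteq> D0" using D0(1,2) open_contains_cball by blast
 define r where "r = R / 2"
 have r: "r > 0" "cball p0 r \<subseteq> ball p0 R" using R by (auto simp: r_def)
 have bR: "ball p0 R \<subseteq> ph ` U0" using R(2) ball_subset_cball unfolding D0_def by blast
 define E where "E g x = (if x \<in> U0 & ph x \<in> ball p0 R then bump p0 r (ph x) * g (ph x) else 0)" for g x
 have Esf: "E g \<in> sf" if "smooth_on (ball p0 R) g" for g unfolding E_def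
  by (rule extend_by_zero[OF ch0(1) open_ball bR _ compact_cball r(2), of "%q. bump p0 r q * g q"])
   (use that bump(1)[OF r(1)] bump_outside[OF r(1)] in \<open>auto intro!: smooth_mult\<close>)
 have E0: "E g 0 = g p0" for g using ch0(2) R(1) bump(6)[OF r(1), of p0] by (simp add: E_def p0_def)
 define ch where "ch = E (%q. 1)"
 have ch: "ch \<in> sf" "ch 0 = 1" unfolding ch_def using Esf E0 by auto
 define co where "co b = E (%q. (q - p0) \<bullet> b)" for b
 have co: "co b \<in> sf" "co b 0 = 0" for b unfolding co_def using E0 by (auto intro!: Esf smooth_inner smooth_diff)
 define v where "v = (\<Sum>b\<in>Basis. D (co b) *\<^sub>R b)"
 have main: "D f = tv v f 0" if f: "f \<in> sf" for f
 proof -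
  define F where "F q = f (ex q)" for q
  have F: "smooth_on D0 F" unfolding F_def by (rule sf_comp_euclid[OF D0(1) smooth_ex f])
  have FD: "(F has_derivative fderiv F q) (at q)" if "q \<in> D0" for q by (rule smooth_D[OF F that])
  have seg: "p0 + s *\<^sub>R (q - p0) \<in> D0" if "q \<in> ball p0 R" "s \<in> {0..1}" for q s
  proof -
   have "dist p0 (p0 + s *\<^sub>R (q - p0)) <= 1 * norm (q - p0)"
    using mult_right_mono[of s 1 "norm (q - p0)"] that by (simp add: dist_norm)
   also have "... < R" using that by (simp add: dist_norm norm_minus_commute)
   finally show ?thesis using R(2) by (auto simp: subset_iff)
  qed
  define H where "H b q = integral {0..1} (%s. fderiv F (p0 + s *\<^sub>R (q - p0)) b)" for b q
  have H: "smooth_on (ball p0 R) (H b)" for b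
  proof -
   let ?O = "(%z. p0 + snd z *\<^sub>R (fst z - p0)) -` D0"
   have "open ?O" by (intro open_vimage D0(1) continuous_intros)
   moreover have "smooth_on ?O (%z. fderiv F (p0 + snd z *\<^sub>R (fst z - p0)) b)"
    by (rule smooth_compose[OF \<open>open ?O\<close> _ smooth_frechet[OF F]])
     (auto intro!: smooth_on_add smooth_scaleR smooth_diff \<open>open ?O\<close> smooth_fst smooth_snd)
   moreover have "ball p0 R \<times> cbox 0 1 \<subseteq> ?O" using seg by (auto simp: cbox_interval)
   ultimately have "smooth_on (ball p0 R) (%q. integral (cbox 0 1) (%s. fderiv F (p0 + snd (q, s) *\<^sub>R (fst (q, s) - p0)) b))"
    by (intro smooth_integral[OF open_ball])
   thus ?thesis by (simp add: H_def[abs_def] cbox_interval)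
  qed
  have tay: "F q - F p0 = (\<Sum>b\<in>Basis. ((q - p0) \<bullet> b) * H b q)" if q: "q \<in> ball p0 R" for q
  proof -
   have "((%s. F (p0 + s *\<^sub>R (q - p0))) has_vector_derivative
     fderiv F (p0 + s *\<^sub>R (q - p0)) (q - p0)) (at s within {0..1})" if "s \<in> {0..1}" for s
    by (rule has_vector_derivative_at_within[OF frechet_line[OF FD[OF seg[OF q that]]]])
   from fundamental_theorem_of_calculus[OF zero_le_one this]
   have i1: "((%s. fderiv F (p0 + s *\<^sub>R (q - p0)) (q - p0)) has_integral F q - F p0) {0..1}" by simp
   have i2: "fderiv F (p0 + s *\<^sub>R (q - p0)) (q - p0) =
    (\<Sum>b\<in>Basis. ((q - p0) \<bullet> b) * fderiv F (p0 + s *\<^sub>R (q - p0)) b)" if "s \<in> {0..1}" for s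
   proof -
    have lin: "linear (fderiv F (p0 + s *\<^sub>R (q - p0)))" using FD[OF seg[OF q that]] has_derivative_linear by blast
    have "fderiv F (p0 + s *\<^sub>R (q - p0)) (q - p0)
     = fderiv F (p0 + s *\<^sub>R (q - p0)) (\<Sum>b\<in>Basis. ((q - p0) \<bullet> b) *\<^sub>R b)" by (simp add: euclidean_representation)
    thus ?thesis by (simp add: linear_sum[OF lin] linear_scale[OF lin])
   qed
   have "((%s. \<Sum>b\<in>Basis. ((q - p0) \<bullet> b) * fderiv F (p0 + s *\<^sub>R (q - p0)) b) has_integral F q - F p0) {0..1}"
    by (rule has_integral_eq[OF i2 i1])
   moreover have "((%s. \<Sum>b\<in>Basis. ((q - p0) \<bullet> b) * fderiv F (p0 + s *\<^sub>R (q - p0)) b) has_integral (\<Sum>b\<in>Basis. ((q - p0) \<bullet> b) * H b q)) {0..1}"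
   proof (intro has_integral_sum has_integral_mult_right finite_Basis)
    fix b :: 'e
    have "continuous_on {0..1} (%s. fderiv F (p0 + s *\<^sub>R (q - p0)) b)"
     by (rule continuous_on_compose2[OF smooth_continuous[OF smooth_frechet[OF F]]])
      (use seg[OF q] in \<open>auto intro!: continuous_intros\<close>)
    thus "((%s. fderiv F (p0 + s *\<^sub>R (q - p0)) b) has_integral H b q) {0..1}"
     unfolding H_def by (intro integrable_integral integrable_continuous_real)
   qed
   ultimately show ?thesis using has_integral_unique by blast
  qed
  define g where "g x = f x - f 0" for x
  have g: "g \<in> sf" "g 0 = 0" unfolding g_def using sf_diff[OF f sf_const] by auto
  \<comment> \<open>The cutoff is squared because \<open>co b\<close> and \<open>E (H b)\<close>
    carry one factor each. In the remaining term both \<open>1 - ch x * ch x\<close> and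
    \<open>g\<close> vanish at the neutral element, so the Leibniz rule makes \<open>D\<close> kill
    it.\<close>
  have split: "(%x. (\<Sum>b\<in>Basis. co b x * E (H b) x) + (1 - ch x * ch x) * g x) = g"
  proof
   fix x
   show "(\<Sum>b\<in>Basis. co b x * E (H b) x) + (1 - ch x * ch x) * g x = g x"
   proof (cases "x \<in> U0 & ph x \<in> ball p0 R")
    case True
    hence "g x = (\<Sum>b\<in>Basis. ((ph x - p0) \<bullet> b) * H b (ph x))" using tay[of "ph x"] by (simp add: g_def F_def D0)
    hence "ch x * ch x * g x = (\<Sum>b\<in>Basis. co b x * E (H b) x)"
     using True by (simp add: ch_def co_def E_def sum_distrib_left algebra_simps)
    thus ?thesis by (simp add: algebra_simps)
   next
    case False
    thus ?thesis by (auto simp: ch_def co_def E_def)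
   qed
  qed
  have s1: "(%x. co b x * E (H b) x) \<in> sf" for b by (intro sf_mult co Esf H)
  have s2: "(%x. 1 - ch x * ch x) \<in> sf" by (intro sf_diff sf_mult ch sf_const)
  have "D g = D (%x. \<Sum>b\<in>Basis. co b x * E (H b) x) + D (%x. (1 - ch x * ch x) * g x)"
   by (subst split[symmetric], rule Dadd) (intro sf_sum s1 sf_mult s2 g)+
  also have "D (%x. (1 - ch x * ch x) * g x) = 0" using Dmult[OF s2 g(1)] g(2) ch(2) by simp
  also have "D (%x. \<Sum>b\<in>Basis. co b x * E (H b) x) = (\<Sum>b\<in>Basis. D (co b) * H b p0)"
   by (subst Dsum[OF s1], rule sum.cong) (auto simp: Dmult[OF co(1) Esf[OF H]] co(2) E0)
  also have "(\<Sum>b\<in>Basis. D (co b) * H b p0) = fderiv F p0 v"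
  proof -
   have lin: "linear (fderiv F p0)" using FD[OF D0(2)] has_derivative_linear by blast
   have "H b p0 = fderiv F p0 b" for b by (simp add: H_def)
   thus ?thesis by (simp add: v_def linear_sum[OF lin] linear_scale[OF lin])
  qed
  finally have "D g = tv v f 0" by (simp add: tv_def F_def[abs_def])
  moreover have "D g = D f"
  proof -
   have "D (%x. g x + f 0) = D g + D (%x. f 0)" by (rule Dadd) (use g in auto)
   thus ?thesis by (simp add: g_def D1)
  qed
  ultimately show ?thesis by simp
 qed
 have "X f = vf v f" for f
 proof (cases "f \<in> sf")
  case True
  have "X f x = tv v f x" for x using left[OF True, of x 0] main[OF sf_left[OF True, of x]] tv_left[of v f x 0] by (simp add: D_def)
  thus ?thesis using True by (auto simp: vf_def)
 qed (simp add: nX vf_def)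
 thus ?thesis using that by blast
qed

end

lemma real_derivI:
 fixes f :: "real => real"
 assumes "(f has_derivative f') (at t)" shows "(f has_real_derivative f' 1) (at t)"
proof -
 have "f' v = f' 1 * v" for v using linear_scale[OF has_derivative_linear[OF assms], of v 1] by simp
 hence "f' = (*) (f' 1)" by (rule ext)
 thus ?thesis using assms by (simp add: has_field_derivative_def)
qed

lemma smooth_partial2:
 fixes F :: "real \<times> real => real"
 assumes "smooth_on (S \<times> S) F" "t \<in> S"
 obtains b where "((%s. F (t, s)) has_real_derivative b) (at t)"
proof -
 let ?D = "fderiv F (t, t)"
 have D: "(F has_derivative ?D) (at (t, t))" by (rule smooth_D[OF assms(1)]) (use assms in auto)
 show ?thesis by (rule that[OF real_derivI[OF has_derivative_partial(2)[OF D]]])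
qed

text \<open>Bootstrapping: the derivative \<open>W (p t)\<close> is as regular as \<open>p\<close>
  itself.\<close>

lemma smooth_autonomous:
 fixes W :: "'e::euclidean_space => 'e"
 assumes "open I" "open S" "smooth_on S W"
  "!!t. t \<in> I ==> p t \<in> S" "!!t. t \<in> I ==> (p has_vector_derivative W (p t)) (at t)"
 shows "smooth_on I p"
proof -
 have hd: "(p has_derivative (%h. h *\<^sub>R W (p t))) (at t)" if "t \<in> I" for t
  using assms(5)[OF that] by (simp add: has_vector_derivative_def)
 have "Ck_on k I p" for k
 proof (induction k)
  case 0
  show ?case unfolding Ck_on.simps by (intro continuous_at_imp_continuous_on ballI has_derivative_continuous[OF hd])
 next
  case (Suc k)
  have W: "Ck_on k S W" using assms(3) by (simp add: smooth_on_def)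
  show ?case by (rule Ck_on_SucI[OF assms(1) hd])
    (use assms(4) in \<open>auto intro!: Ck_on_bilinear[OF bounded_bilinear_scaleR assms(1)] Ck_on_const
     Ck_on_compose[OF assms(1) Suc W]\<close>)
 qed
 thus ?thesis by (simp add: smooth_on_def)
qed

context lie_grp
begin

lemma tv_inject:
 assumes "!!f. f \<in> sf ==> tv v f x = tv w f x" shows "v = w"
proof (rule euclidean_eqI)
 fix b :: 'e
 obtain R where R: "R > 0" "cball p0 R \<subseteq> D0" using D0(1,2) open_contains_cball by blast
 define r where "r = R / 2"
 have r: "r > 0" "cball p0 r \<subseteq> ball p0 R" using R by (auto simp: r_def)
 have bR: "ball p0 R \<subseteq> ph ` U0" "ball p0 R \<subseteq> D0" using R(2) ball_subset_cball unfolding D0_def by blast+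
 define h where "h x = (if x \<in> U0 & ph x \<in> ball p0 R then bump p0 r (ph x) * ((ph x - p0) \<bullet> b) else 0)" for x
 have h: "h \<in> sf" unfolding h_def
  by (rule extend_by_zero[OF ch0(1) open_ball bR(1) _ compact_cball r(2), of "%q. bump p0 r q * ((q - p0) \<bullet> b)"])
   (use bump(1)[OF r(1)] bump_outside[OF r(1)] in \<open>auto intro!: smooth_mult smooth_inner smooth_diff\<close>)
 have d0: "tv u h 0 = u \<bullet> b" for u
 proof (rule tv_unique[OF h])
  have "((%q. (q - p0) \<bullet> b) has_derivative (%u. u \<bullet> b)) (at p0)" by (auto intro!: derivative_eq_intros)
  thus "((%q. h (0 + ex q)) has_derivative (%u. u \<bullet> b)) (at p0)"
  proof (rule has_derivative_transform_within_open[OF _ open_ball, of _ _ _ _ p0 "r / 2"])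
   fix q assume q: "q \<in> ball p0 (r / 2)"
   hence "q \<in> ball p0 R" using r R by (auto simp: r_def)
   hence "q \<in> D0" using bR by blast
   thus "(q - p0) \<bullet> b = h (0 + ex q)"
    using q D0(4,5)[OF \<open>q \<in> D0\<close>] \<open>q \<in> ball p0 R\<close> bump(3)[OF r(1) q] by (simp add: h_def)
  qed (use r in auto)
 qed
 have "tv u (%y. h (- x + y)) x = tv u h 0" for u using tv_left[of u h "- x" x] by simp
 thus "v \<bullet> b = w \<bullet> b" using assms[OF sf_left[OF h, of "- x"]] d0 by simp
qed

lemma vf_inject: "vf v = vf w \<longleftrightarrow> v = w" using tv_inject[of v 0 w] by (metis vf_def)

lemma lie_bracket_in: "lie_bracket (vf y) (vf z) \<in> lie_algebra A"
proof -
 have z: "vf y (%x. 0) = (%x. 0)" for y by (simp add: vf_def fun_eq_iff)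
 have a: "tv y (%x. f x + g x) = (%x. tv y f x + tv y g x)"
  and m: "tv y (%x. f x * g x) = (%x. f x * tv y g x + tv y f x * g x)"
  and s: "tv y (%x. c * f x) = (%x. c * tv y f x)" if "f \<in> sf" "g \<in> sf" for y f g c
  using that by (auto simp: fun_eq_iff tv_add tv_mult tv_scale)
 have l: "tv y (%x. f (g + x)) = (%x. tv y f (g + x))" for y f g by (auto simp: tv_left)
 show ?thesis unfolding lie_algebra_def vector_field_def lie_bracket_def
  by (auto simp: vf_def z[unfolded vf_def] tv_smooth a m s l sf_add sf_mult sf_scale sf_left sf_diff algebra_simps fun_eq_iff)
qed

definition br :: "'e => 'e => 'e" where
 "br y z = (SOME w. vf w = lie_bracket (vf y) (vf z))"

lemma vf_br: "vf (br y z) = lie_bracket (vf y) (vf z)" unfolding br_def by (rule someI_ex) (metis lie_algebra_vf lie_bracket_in)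

lemma tv_br: "f \<in> sf ==> tv (br y z) f x = tv y (tv z f) x - tv z (tv y f) x"
 using fun_cong[OF fun_cong[OF vf_br[of y z], of f], of x] by (simp add: vf_def lie_bracket_def tv_smooth)

section \<open>Integral curves and the exponential map\<close>

definition icurve :: "'e => real set => (real => 'a) => bool" where
 "icurve v S c \<longleftrightarrow> smooth_map_on euclidean_atlas A S c &
  (\<forall>t\<in>S. \<forall>f\<in>sf. ((%s. f (c s)) has_real_derivative tv v f (c t)) (at t))"

lemma icurve_smooth: "icurve v S c ==> smooth_map_on euclidean_atlas A S c"
 and icurve_deriv: "icurve v S c ==> t \<in> S ==> f \<in> sf ==> ((%s. f (c s)) has_real_derivative tv v f (c t)) (at t)"
 by (auto simp: icurve_def)

lemma icurve_left:
 assumes "open S" "icurve v S c" shows "icurve v S (%s. a + c s)" unfolding icurve_def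
 using icurve_deriv[OF assms(2) _ sf_left, of _ _ a] icurve_smooth[OF assms(2)] assms(1)
 by (auto simp: tv_left intro!: smooth_add smooth_map_on_const pa_euclid)

lemma icurve_shift:
 assumes "open S" "icurve v S c" shows "icurve v ((%s. s + a) -` S) (%s. c (s + a))"
proof -
 have "open ((%s. s + a) -` S)" by (intro open_vimage assms continuous_intros)
 hence "smooth_map_on euclidean_atlas A ((%s. s + a) -` S) (%s. c (s + a))"
  by (intro smooth_comp_euclid[OF _ assms(1) _ icurve_smooth[OF assms(2)]]) (auto intro!: smooth_on_add)
 moreover have "((%s. f (c (s + a))) has_real_derivative tv v f (c (t + a))) (at t)"
  if "t + a \<in> S" "f \<in> sf" for t f using DERIV_shift[THEN iffD1, OF icurve_deriv[OF assms(2) that]] .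
 ultimately show ?thesis by (auto simp: icurve_def)
qed

lemma icurve_subset: "icurve v S c ==> T \<subseteq> S ==> icurve v T c" unfolding icurve_def using smooth_map_on_subset by blast

lemma icurve_local:
 assumes "!!t. t \<in> S ==> EX T c'. open T & t \<in> T & icurve v T c' & (\<forall>s\<in>T. c' s = c s)"
 shows "icurve v S c" unfolding icurve_def
proof (intro conjI ballI)
 show "smooth_map_on euclidean_atlas A S c"
 proof (rule smooth_map_on_local[OF pa_euclid pa])
  fix t assume "t \<in> S"
  from assms[OF this] obtain T c' where T: "open T" "t \<in> T" "icurve v T c'" "\<forall>s\<in>T. c' s = c s" by blast
  have "smooth_map_on euclidean_atlas A T c" by (rule smooth_map_on_cong[OF pa_euclid pa T(1) _ icurve_smooth[OF T(3)]]) (use T in auto)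
  thus "EX T. open T & t \<in> T & smooth_map_on euclidean_atlas A T c" using T by blast
 qed
 fix t f assume "t \<in> S" "f \<in> sf"
 from assms[OF this(1)] obtain T c' where T: "open T" "t \<in> T" "icurve v T c'" "\<forall>s\<in>T. c' s = c s" by blast
 have "((%s. f (c' s)) has_real_derivative tv v f (c t)) (at t)" using icurve_deriv[OF T(3,2) \<open>f \<in> sf\<close>] T(2,4) by simp
 thus "((%s. f (c s)) has_real_derivative tv v f (c t)) (at t)"
  by (rule has_field_derivative_transform_within_open[OF _ T(1,2)]) (use T in auto)
qed

text \<open>Two integral curves \<open>c\<close>, \<open>c'\<close> of a left-invariant field differ by a constant left factor:
 the two contributions to the derivative of \<open>c' - c\<close> cancel.\<close>

lemma icurve_unique:
 assumes S: "open S" "convex S" and c: "icurve v S c" "icurve v S c'" and t0: "t0 \<in> S" "c t0 = c' t0" and t: "t \<in> S"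
 shows "c t = c' t"
proof -
 have "c' t - c t = 0"
 proof (rule sf_separate)
  fix f assume f: "f \<in> sf"
  have sm: "smooth_on (S \<times> S) (%z. f (a + d (fst z) - c (snd z)))" if "icurve v S d" for a d
   by (intro sf_comp_euclid[OF _ _ f] smooth_add smooth_minus pa_euclid open_Times S smooth_map_on_const
     smooth_comp_euclid[OF _ S(1) _ icurve_smooth[OF that]] smooth_comp_euclid[OF _ S(1) _ icurve_smooth[OF c(1)]]) auto
  have "((%s. f (c' s - c s)) has_real_derivative 0) (at t)" if t: "t \<in> S" for t
  proof -
   define g where "g y = f (y - c t)" for y
   have g: "g \<in> sf" using sf_right[OF f, of "- c t"] by (simp add: g_def[abs_def])
   have 1: "((%s. f (c' s - c t)) has_real_derivative tv v g (c' t)) (at t)" using icurve_deriv[OF c(2) t g] by (simp add: g_def)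
   let ?x = "c' t - c t"
   have 2: "((%s. f (?x + c s - c t)) has_real_derivative tv v g (c' t)) (at t)"
    using icurve_deriv[OF icurve_left[OF S(1) c(1), of ?x] t g] by (simp add: g_def)
   obtain b where b: "((%s. f (?x + c t - c s)) has_real_derivative b) (at t)" using smooth_partial2[OF sm[OF c(1), of ?x] t] by auto
   have "((%s. f (?x + c s - c s)) has_real_derivative tv v g (c' t) + b) (at t)"
    using diagonal_derivative[OF sm[OF c(1), of ?x] t] 2 b by simp
   moreover have "(%s. f (?x + c s - c s)) = (%s. f ?x)" by (simp add: fun_eq_iff add_diff_eq[symmetric])
   ultimately have "tv v g (c' t) + b = 0" using DERIV_unique DERIV_const by metis
   moreover have "((%s. f (c' s - c s)) has_real_derivative tv v g (c' t) + b) (at t)"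
    using diagonal_derivative[OF sm[OF c(2), of 0] t] 1 b by simp
   ultimately show ?thesis by simp
  qed
  hence "f (c' t - c t) = f (c' t0 - c t0)" using has_derivative_zero_unique[OF S(2), of "%t. f (c' t - c t)" t t0] t t0
   by (simp add: has_field_derivative_def has_derivative_at_withinI lambda_zero)
  thus "f (c' t - c t) = f 0" using t0 by simp
 qed
 thus ?thesis by simp
qed

text \<open>In the chart at the neutral element, the field \<open>v\<close> is the derivative at
  \<open>p0\<close> of the group law in its second argument; this is the field \<open>W\<close> to
  which \<open>picard_local\<close> applies.\<close>

lemma local_icurve: "\<exists>eps>0. EX c. icurve v {-eps<..<eps} c & c 0 = 0"
proof -
 let ?m = "%z. ex (fst z) + ex (snd z)"
 define E where "E = (D0 \<times> D0) \<inter> ?m -` U0"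
 have m: "smooth_map_on euclidean_atlas A (D0 \<times> D0) ?m" by (rule smooth_pair_map[OF D0(1) smooth_ex])
 have oE: "open E" unfolding E_def by (rule continuous_open_preimage[OF smooth_map_on_continuous[OF m] open_Times[OF D0(1,1)] D0(8)])
 define \<Theta> where "\<Theta> z = ph (?m z)" for z
 have "smooth_map_on euclidean_atlas euclidean_atlas E \<Theta>" unfolding \<Theta>_def
  by (rule smooth_map_on_compose[OF pa_euclid pa pa_euclid oE D0(8) smooth_map_on_subset[OF m] smooth_ph]) (auto simp: E_def)
 hence \<Theta>: "smooth_on E \<Theta>" using smooth_map_euclidean oE by blast
 have qE: "(q, p0) \<in> E" if "q \<in> D0" for q using that D0 by (simp add: E_def)
 define W where "W q = fderiv \<Theta> (q, p0) (0, v)" for q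
 have W: "smooth_on D0 W" unfolding W_def
  by (rule smooth_frechet_compose[OF D0(1) oE \<Theta>]) (use qE D0(1) in \<open>auto intro!: smooth_Pair\<close>)
 have W1: "Ck_on 1 D0 W" using W unfolding smooth_on_def by blast
 obtain eps p where p: "eps > 0" "p 0 = p0" "!!t. \<bar>t\<bar> < eps ==> p t \<in> D0"
  "!!t. \<bar>t\<bar> < eps ==> (p has_vector_derivative W (p t)) (at t)" by (rule picard_local[OF D0(1,2) W1]) (rule that)
 let ?I = "{-eps<..<eps}"
 have sp: "smooth_on ?I p" by (rule smooth_autonomous[OF _ D0(1) W]) (use p in auto)
 have "smooth_map_on euclidean_atlas A ?I (%t. ex (p t))" by (rule smooth_comp_euclid[OF _ D0(1) sp smooth_ex]) (use p in auto)
 moreover have "((%s. f (ex (p s))) has_real_derivative tv v f (ex (p t))) (at t)" if t: "t \<in> ?I" and f: "f \<in> sf" for t f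
 proof -
  have pt: "p t \<in> D0" using p t by auto
  define F where "F q = f (ex q)" for q
  have "smooth_on D0 F" unfolding F_def by (rule sf_comp_euclid[OF D0(1) smooth_ex f])
  hence FD: "(F has_derivative fderiv F (p t)) (at (p t))" using pt smooth_D by blast
  have "((%q'. \<Theta> (p t, q')) has_derivative (%v. fderiv \<Theta> (p t, p0) (0, v))) (at p0)"
   by (rule has_derivative_partial(2)[OF smooth_D[OF \<Theta> qE[OF pt]]])
  moreover have "\<Theta> (p t, p0) = p t" using pt D0 by (simp add: \<Theta>_def)
  ultimately have "((%q'. F (\<Theta> (p t, q'))) has_derivative (%v. fderiv F (p t) (fderiv \<Theta> (p t, p0) (0, v)))) (at p0)"
   using has_derivative_compose[of "%q'. \<Theta> (p t, q')" _ p0 UNIV F] FD by simp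
  moreover have "open (Pair (p t) -` E)" by (intro open_vimage oE continuous_intros)
  ultimately have "((%q'. f (ex (p t) + ex q')) has_derivative (%v. fderiv F (p t) (fderiv \<Theta> (p t, p0) (0, v)))) (at p0)"
   by (rule has_derivative_transform_within_open) (use qE[OF pt] D0 in \<open>auto simp: E_def F_def \<Theta>_def\<close>)
  from tv_unique[OF f this] have "tv v f (ex (p t)) = fderiv F (p t) (W (p t))" by (simp add: W_def)
  moreover have "((%s. F (p s)) has_vector_derivative fderiv F (p t) (W (p t))) (at t)"
   using vector_derivative_diff_chain_within[of p "W (p t)" t UNIV F] p(4)[of t] t
    has_derivative_at_withinI[OF FD] by (auto simp: o_def)
  ultimately show ?thesis by (simp add: F_def has_real_derivative_iff_has_vector_derivative)
 qed
 ultimately have "icurve v ?I (%t. ex (p t))" by (simp add: icurve_def)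
 thus ?thesis using p(1,2) D0(3) by (intro exI[of _ eps] conjI exI[of _ "%t. ex (p t)"]) auto
qed

text \<open>Left translates of integral curves are integral curves. Translating by
  \<open>c (R/2)\<close> and by \<open>c (- (R/2))\<close> prolongs the curve by \<open>R/2\<close>
  on either side, and uniqueness makes the pieces agree where they overlap.\<close>

lemma icurve_extend:
 assumes R: "R > 0" and c: "icurve v {-R<..<R} c" "c 0 = 0"
 shows "EX c'. icurve v {-(R * (3/2))<..<R * (3/2)} c' & c' 0 = 0"
proof -
 define c1 where "c1 s = c (R/2) + c (s + - (R/2))" for s
 define c2 where "c2 s = c (- (R/2)) + c (s + R/2)" for s
 let ?I1 = "{-(R/2)<..<R * (3/2)}" and ?I2 = "{-(R * (3/2))<..<R/2}"
 have 1: "icurve v ?I1 c1" unfolding c1_def by (rule icurve_subset[OF icurve_left[OF _ icurve_shift[OF _ c(1)]]])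
   (auto intro!: open_vimage continuous_intros)
 have 2: "icurve v ?I2 c2" unfolding c2_def by (rule icurve_subset[OF icurve_left[OF _ icurve_shift[OF _ c(1)]]])
   (auto intro!: open_vimage continuous_intros)
 have e1: "c1 s = c s" if "s \<in> {-(R/2)<..<R}" for s by (rule icurve_unique[of "{-(R/2)<..<R}" v c1 c "R/2"])
   (use that c(2) R in \<open>auto intro!: icurve_subset[OF 1] icurve_subset[OF c(1)], simp add: c1_def\<close>)
 have e2: "c2 s = c s" if "s \<in> {-R<..<R/2}" for s by (rule icurve_unique[of "{-R<..<R/2}" v c2 c "-(R/2)"])
   (use that c(2) R in \<open>auto intro!: icurve_subset[OF 2] icurve_subset[OF c(1)], simp add: c2_def\<close>)
 define c' where "c' s = (if s >= R then c1 s else if s <= -R then c2 s else c s)" for s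
 have "icurve v {-(R * (3/2))<..<R * (3/2)} c'"
 proof (rule icurve_local)
  fix t assume t: "t \<in> {-(R * (3/2))<..<R * (3/2)}"
  consider "t \<in> {-R<..<R}" | "t >= R" | "t <= -R" by force
  thus "EX T d. open T & t \<in> T & icurve v T d & (\<forall>s\<in>T. d s = c' s)"
  proof cases
   case 1
   thus ?thesis by (intro exI[of _ "{-R<..<R}"] exI[of _ c]) (use c in \<open>auto simp: c'_def\<close>)
  next
   case 2
   thus ?thesis by (intro exI[of _ ?I1] exI[of _ c1]) (use 1 e1 t R in \<open>auto simp: c'_def\<close>)
  next
   case 3
   thus ?thesis by (intro exI[of _ ?I2] exI[of _ c2]) (use 2 e2 t R in \<open>auto simp: c'_def\<close>)
  qed
 qed
 thus ?thesis using R c(2) by (intro exI[of _ c']) (auto simp: c'_def)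
qed

lemma global_icurve: "EX c. icurve v UNIV c & c 0 = 0"
proof -
 obtain eps c0 where e: "eps > 0" "icurve v {-eps<..<eps} c0" "c0 0 = 0" using local_icurve by blast
 define R where "R m = eps * (3/2) ^ m" for m :: nat
 have Rpos: "R m > 0" for m using e by (simp add: R_def)
 have Rmono: "R m <= R n" if "m <= n" for m n using e that by (simp add: R_def power_increasing)
 have "EX c. icurve v {-R m<..<R m} c & c 0 = 0" for m
 proof (induction m)
  case 0
  thus ?case using e by (auto simp: R_def)
 next
  case (Suc m)
  thus ?case using icurve_extend[OF Rpos] by (auto simp: R_def mult_ac)
 qed
 then obtain C where C: "!!m. icurve v {-R m<..<R m} (C m)" "!!m. C m 0 = 0" by metis
 have eq: "C m t = C n t" if "m <= n" "\<bar>t\<bar> < R m" for m n t by (rule icurve_unique[of "{-R m<..<R m}" v _ _ 0])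
   (use C Rpos that Rmono[OF that(1)] in \<open>auto intro!: icurve_subset[OF C(1)[of n]]\<close>)
 have ex: "EX m. \<bar>t\<bar> < R m" for t
 proof -
  obtain m where "\<bar>t\<bar> / eps < (3/2) ^ m" using real_arch_pow[of "3/2"] by auto
  thus ?thesis using e by (auto simp: R_def field_simps)
 qed
 define c where "c t = C (LEAST m. \<bar>t\<bar> < R m) t" for t
 have cC: "c t = C m t" if "\<bar>t\<bar> < R m" for t m
  unfolding c_def by (rule eq) (use that Least_le LeastI in \<open>auto intro: LeastI Least_le\<close>)
 have "icurve v UNIV c"
 proof (rule icurve_local)
  fix t :: real
  obtain m where "\<bar>t\<bar> < R m" using ex by blast
  thus "EX T c'. open T & t \<in> T & icurve v T c' & (\<forall>s\<in>T. c' s = c s)"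
   by (intro exI[of _ "{-R m<..<R m}"] exI[of _ "C m"]) (use C(1) cC[symmetric] in auto)
 qed
 moreover have "c 0 = 0" using cC[of 0 0] C(2) Rpos by simp
 ultimately show ?thesis by blast
qed

definition ep :: "'e => real => 'a" where
 "ep v = (SOME c. icurve v UNIV c & c 0 = 0)"

lemma ep: "icurve v UNIV (ep v)" "ep v 0 = 0" using someI_ex[OF global_icurve[of v]] by (auto simp: ep_def)

lemma icurve_UNIV_unique:
 assumes "icurve v UNIV c" shows "c t = c 0 + ep v t"
 by (rule icurve_unique[OF _ _ assms icurve_left[OF _ ep(1)], of 0]) (use ep(2) in auto)

lemma ep_add: "ep v (s + t) = ep v s + ep v t" using icurve_UNIV_unique[of v "%t. ep v (t + s)" t] icurve_shift[OF open_UNIV ep(1), of v s]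
 by (simp add: add.commute)

lemma ep_minus: "ep v (- t) = - ep v t" using ep_add[of v "- t" t] ep(2)[of v] by (simp add: eq_neg_iff_add_eq_0)

lemma ep_smooth: "smooth_map_on euclidean_atlas A S (ep v)" using smooth_map_on_subset[OF icurve_smooth[OF ep(1)]] by simp

lemma ep_deriv: "f \<in> sf ==> ((%s. f (a + ep v s)) has_real_derivative tv v f (a + ep v t)) (at t)"
 using icurve_deriv[OF icurve_left[OF open_UNIV ep(1)]] by auto

text \<open>Elements of the same one-parameter subgroup commute, so a left-invariant field is also
  invariant under right translation by its own subgroup.\<close>

lemma tv_right_ep:
 assumes "f \<in> sf" shows "tv v (%x. f (x + ep v b)) x = tv v f (x + ep v b)"
proof -
 have 1: "((%s. f (x + ep v s + ep v b)) has_real_derivative tv v (%x. f (x + ep v b)) x) (at 0)"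
  using ep_deriv[OF sf_right[OF assms, of "ep v b"], of x v 0] ep(2) by simp
 have 2: "((%s. f (x + ep v b + ep v s)) has_real_derivative tv v f (x + ep v b)) (at 0)"
  using ep_deriv[OF assms, of "x + ep v b" v 0] ep(2) by simp
 have "ep v s + ep v b = ep v b + ep v s" for s by (metis ep_add add.commute)
 hence "(%s. f (x + ep v s + ep v b)) = (%s. f (x + ep v b + ep v s))" by (simp add: add.assoc)
 thus ?thesis using DERIV_unique[OF 1] 2 by simp
qed

section \<open>The adjoint action\<close>

text \<open>The derivative of \<open>f\<close> at \<open>x\<close> along the image of
  \<open>y\<close> under the adjoint action of \<open>ep z (- t)\<close>, expressed by translations
  of \<open>f\<close> and of the point.\<close>

definition conj_deriv :: "'e => ('a => real) => 'a => 'e => real => real" where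
 "conj_deriv z f x y t = tv y (%w. f (w + ep z t)) (x - ep z t)"

text \<open>Time enters twice, through the point and through the translated function. The first
  contributes minus \<open>z\<close> applied after \<open>y\<close>, the second \<open>y\<close>
  applied after \<open>z\<close> once two mixed derivatives are exchanged; their sum is the
  bracket.\<close>

lemma conj_deriv_DERIV:
 assumes f: "f \<in> sf"
 shows "(conj_deriv z f x y has_real_derivative conj_deriv z f x (br y z) t) (at t)"
proof -
 define K where "K = (%w. f (x - ep z (fst (fst w)) + ex (snd w) + ep z (snd (fst w))))"
 have K: "smooth_on ((UNIV \<times> UNIV) \<times> D0) K" unfolding K_def
  by (intro sf_comp_euclid[OF _ _ f] smooth_add smooth_minus pa_euclid open_Times open_UNIV D0(1)
    smooth_map_on_const smooth_comp_euclid[OF _ open_UNIV _ ep_smooth] smooth_comp_euclid[OF _ D0(1) _ smooth_ex]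
    smooth_compose[OF _ _ smooth_fst, of _ _ UNIV] smooth_compose[OF _ _ smooth_snd, of _ _ UNIV]) auto
 have oK: "open (((UNIV::real set) \<times> (UNIV::real set)) \<times> D0)" by (intro open_Times open_UNIV D0(1))
 define F where "F s = fderiv K (s, p0) (0, y)" for s
 have F: "smooth_on (UNIV \<times> UNIV) F"
  unfolding F_def by (rule smooth_frechet_compose[OF _ oK K]) (use D0(2) in \<open>auto intro!: smooth_Pair open_Times\<close>)
 have Feq: "F (a, b) = tv y (%w. f (w + ep z b)) (x - ep z a)" for a b
 proof -
  have "(K has_derivative fderiv K ((a, b), p0)) (at ((a, b), p0))" by (rule smooth_D[OF K]) (use D0(2) in auto)
  from has_derivative_partial(2)[OF this] show ?thesis unfolding F_def by (subst tv_unique[OF sf_right[OF f]]) (auto simp: K_def)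
 qed
 have R: "(%w. f (w + ep z t)) \<in> sf" by (rule sf_right[OF f])
 have "((%a. F (a, t)) has_real_derivative - tv z (tv y (%w. f (w + ep z t))) (x - ep z t)) (at t)"
 proof -
  have "((%s. tv y (%w. f (w + ep z t)) (x + ep z s)) has_real_derivative
    tv z (tv y (%w. f (w + ep z t))) (x + ep z (- t))) (at (- t))" by (rule ep_deriv[OF tv_smooth[OF R]])
  from DERIV_mirror[THEN iffD1, OF this] show ?thesis by (simp add: Feq ep_minus)
 qed
 moreover have "((%b. F (t, b)) has_real_derivative tv y (tv z (%w. f (w + ep z t))) (x - ep z t)) (at t)"
 proof -
  have F': "(F has_derivative fderiv F (t, t)) (at (t, t))" by (rule smooth_D[OF F]) auto
  let ?d = "fderiv F (t, t) (0, 1)"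
  have "((%b. F (t, b)) has_real_derivative ?d) (at t)" by (rule real_derivI[OF has_derivative_partial(2)[OF F']])
  moreover have "?d = tv y (tv z (%w. f (w + ep z t))) (x - ep z t)"
  proof -
   let ?K1 = "%w. fderiv K w (0, y)" and ?K2 = "%w. fderiv K w ((0, 1), 0)"
   have "(?K1 has_derivative fderiv ?K1 ((t, t), p0)) (at ((t, t), p0))" by (rule smooth_D[OF smooth_frechet[OF K]]) (use D0(2) in auto)
   from has_derivative_partial(1)[OF this]
   have "?d = fderiv ?K1 ((t, t), p0) ((0, 1), 0)" using frechet_derivative_at[of F _ "(t, t)"] by (simp add: F_def[abs_def])
   also have "... = fderiv ?K2 ((t, t), p0) (0, y)" by (rule frechet_symmetric[OF K oK]) (use D0(2) in auto)
   also have "... = tv y (tv z (%w. f (w + ep z t))) (x - ep z t)"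
   proof -
    have K2: "?K2 ((t, b), q) = tv z f (x - ep z t + ex q + ep z b)" if "q \<in> D0" for q b
    proof -
     have D: "(K has_derivative fderiv K ((t, b), q)) (at ((t, b), q))" by (rule smooth_D[OF K]) (use that in auto)
     have "((%b. K ((t, b), q)) has_real_derivative ?K2 ((t, b), q)) (at b)"
      by (rule real_derivI[OF has_derivative_partial(2)[OF has_derivative_partial(1)[OF D]]])
     moreover have "((%b. K ((t, b), q)) has_real_derivative tv z f (x - ep z t + ex q + ep z b)) (at b)"
      using ep_deriv[OF f, of "x - ep z t + ex q" z b] by (simp add: K_def)
     ultimately show ?thesis using DERIV_unique by blast
    qed
    have "(?K2 has_derivative fderiv ?K2 ((t, t), p0)) (at ((t, t), p0))" by (rule smooth_D[OF smooth_frechet[OF K]]) (use D0(2) in auto)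
    from has_derivative_partial(2)[OF this]
    have "((%q. tv z f (x - ep z t + ex q + ep z t)) has_derivative (%v. fderiv ?K2 ((t, t), p0) (0, v))) (at p0)"
     by (rule has_derivative_transform_within_open[OF _ D0(1,2)]) (simp add: K2)
    hence "tv y (%w. tv z f (w + ep z t)) (x - ep z t) = fderiv ?K2 ((t, t), p0) (0, y)"
     by (rule tv_unique[OF sf_right[OF tv_smooth[OF f]]])
    moreover have "(%w. tv z f (w + ep z t)) = tv z (%w. f (w + ep z t))" by (auto simp: tv_right_ep[OF f])
    ultimately show ?thesis by simp
   qed
   finally show ?thesis .
  qed
  ultimately show ?thesis by simp
 qed
 ultimately have "((%s. F (s, s)) has_real_derivative
   - tv z (tv y (%w. f (w + ep z t))) (x - ep z t) + tv y (tv z (%w. f (w + ep z t))) (x - ep z t)) (at t)"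
  by (intro diagonal_derivative[OF F]) auto
 thus ?thesis using tv_br[OF R, of y z "x - ep z t"] by (simp add: Feq conj_deriv_def[abs_def])
qed

text \<open>Each derivative in \<open>t\<close> replaces \<open>y\<close> by its bracket with
  \<open>z\<close>. The Taylor formula with Lagrange remainder is therefore the exponential series
  of the adjoint action, and its remainder vanishes by nilpotency.\<close>

lemma Ad_formula:
 assumes f: "f \<in> sf" and nil: "((%y. br y z) ^^ n) y = 0"
 shows "conj_deriv z f x y t = (\<Sum>m<n. tv (((%y. br y z) ^^ m) y) f x / fact m * t ^ m)"
proof -
 define H where "H m = conj_deriv z f x (((%y. br y z) ^^ m) y)" for m
 have "H 0 = conj_deriv z f x y" by (simp add: H_def)
 moreover have "ALL m t. DERIV (H m) t :> H (Suc m) t" using conj_deriv_DERIV[OF f] by (simp add: H_def)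
 ultimately obtain th where
  t: "conj_deriv z f x y t = (\<Sum>m<n. H m 0 / fact m * t ^ m) + H n th / fact n * t ^ n"
  using Maclaurin_all_le_objl[of H "conj_deriv z f x y" t n] by blast
 have "tv 0 f w = 0" if "f \<in> sf" for f w using linear_0[OF tv_linear[OF that]] .
 hence "H n th = 0" using nil sf_right[OF f] by (simp add: H_def conj_deriv_def)
 moreover have "H m 0 = tv (((%y. br y z) ^^ m) y) f x" for m by (simp add: H_def conj_deriv_def ep)
 ultimately show ?thesis using t by simp
qed

end

context lie_grp
begin

lemma tv_lin:
 assumes "f \<in> sf"
 shows "tv (v + w) f x = tv v f x + tv w f x" "tv (c *\<^sub>R v) f x = c * tv v f x" "tv 0 f x = 0"
  "tv (v - w) f x = tv v f x - tv w f x" "tv (\<Sum>i\<in>I. h i) f x = (\<Sum>i\<in>I. tv (h i) f x)"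
 using linear_add[OF tv_linear[OF assms]] linear_scale[OF tv_linear[OF assms]]
  linear_0[OF tv_linear[OF assms]] linear_diff[OF tv_linear[OF assms]] linear_sum[OF tv_linear[OF assms]] by auto

lemma br_linear1: "linear (%y. br y z)"
proof (rule linearI; rule tv_inject)
 fix f a b c assume f: "f \<in> sf"
 note n = sf_add[OF tv_smooth[OF f, of a] tv_smooth[OF f, of b]] tv_smooth[OF f]
 have "tv (a + b) f = (%x. tv a f x + tv b f x)" "tv (c *\<^sub>R b) f = (%x. c * tv b f x)" using f by (auto simp: tv_lin)
 thus "tv (br (a + b) z) f 0 = tv (br a z + br b z) f 0" "tv (br (c *\<^sub>R b) z) f 0 = tv (c *\<^sub>R br b z) f 0"
  using f n by (simp_all add: tv_br tv_lin tv_add tv_scale algebra_simps)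
qed

lemma br_antisym: "br y z = - br z y"
proof (rule tv_inject)
 fix f assume "f \<in> sf"
 thus "tv (br y z) f 0 = tv (- br z y) f 0" using linear_neg[OF tv_linear, of f "br z y" 0] by (simp add: tv_br)
qed

lemma br_linear2: "linear (%z. br y z)"
proof -
 have "(%z. br y z) = (%z. - br z y)" by (rule ext) (rule br_antisym)
 thus ?thesis using linear_compose_neg[OF br_linear1] by simp
qed

lemma br_jacobi: "br (br a b) c = br a (br b c) - br b (br a c)"
proof (rule tv_inject)
 fix f assume f: "f \<in> sf"
 have d: "tv a (%x. g x - h x) x = tv a g x - tv a h x" if "g \<in> sf" "h \<in> sf" for a g h x
  using tv_add[OF that(1) sf_scale[OF that(2), of "-1"], of a x] tv_scale[OF that(2), of a "-1" x] by simp
 have e: "tv (br a b) f = (%x. tv a (tv b f) x - tv b (tv a f) x)" for a b using f by (auto simp: tv_br)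
 show "tv (br (br a b) c) f 0 = tv (br a (br b c) - br b (br a c)) f 0" using f by (simp add: tv_lin tv_br tv_smooth e d)
qed

end

section \<open>Dilations and homogeneous matrices\<close>

text \<open>The entry \<open>(i, j)\<close> is homogeneous of degree \<open>w j - w i\<close>; the
  powers stand on both sides since this degree may be negative. The argument \<open>u\<close>
  prescribes the value at the origin: the identity matrix for \<open>%i. i\<close>, the zero matrix
  for \<open>%i. i - i\<close>.\<close>

definition hommat :: "('e::euclidean_space => nat) => ('e => 'e) => (real => 'e => 'e) => ('e => 'e => 'e => real) => bool" where
 "hommat w u dil M \<longleftrightarrow> (\<forall>i\<in>Basis. \<forall>j\<in>Basis. smooth (%z. M z i j) & M 0 i j = u i \<bullet> j &
  (\<forall>r>0. ALL z. r ^ w i * M (dil r z) i j = r ^ w j * M z i j))"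

locale weights =
 fixes w :: "'e::euclidean_space => nat" and l :: nat
 assumes w1: "b \<in> Basis ==> 1 <= w b" and wl: "b \<in> Basis ==> w b <= l"
begin

definition dil :: "real => 'e => 'e" where
 "dil r z = (\<Sum>b\<in>Basis. (r ^ w b * (z \<bullet> b)) *\<^sub>R b)"

lemma dil_inner [simp]: "b \<in> Basis ==> dil r z \<bullet> b = r ^ w b * (z \<bullet> b)" by (simp add: dil_def inner_sum_left_Basis)

lemma dil_dil: "dil r (dil s z) = dil (r * s) z" by (rule euclidean_eqI) (simp add: power_mult_distrib)

lemma dil_1 [simp]: "dil 1 z = z" by (rule euclidean_eqI) simp

lemma dil_0 [simp]: "dil r 0 = 0" by (rule euclidean_eqI) simp

lemma dil_inverse: "r > 0 ==> dil r (dil (1 / r) z) = z" "r > 0 ==> dil (1 / r) (dil r z) = z" by (auto simp: dil_dil)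

lemma dil_linear: "linear (dil r)" by (rule linearI; rule euclidean_eqI) (simp_all add: inner_add_left algebra_simps)

lemma dil_tendsto: "((%r. dil r z) \<longlongrightarrow> 0) (at_right 0)"
proof -
 have "((%r. \<Sum>b\<in>Basis. (r ^ w b * (z \<bullet> b)) *\<^sub>R b) \<longlongrightarrow> (\<Sum>b\<in>Basis. (0 ^ w b * (z \<bullet> b)) *\<^sub>R b)) (at_right 0)"
  by (intro tendsto_intros)
 moreover have "(\<Sum>b\<in>Basis. (0 ^ w b * (z \<bullet> b)) *\<^sub>R b) = 0"
  using w1 by (intro sum.neutral ballI) (auto simp: power_0_left dest!: w1)
 ultimately show ?thesis by (simp add: dil_def)
qed

abbreviation hm where "hm \<equiv> hommat w (%i. i) dil"

lemma hmD:
 assumes "hommat w u dil M" "i \<in> Basis" "j \<in> Basis"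
 shows "smooth_on S (%z. M z i j)" "M 0 i j = u i \<bullet> j" "r > 0 ==> r ^ w i * M (dil r z) i j = r ^ w j * M z i j"
 using assms smooth_subset[of UNIV "%z. M z i j" S] unfolding hommat_def by auto

text \<open>An entry of degree at most 0 is found by letting \<open>r\<close> tend to 0: it is
  continuous at the origin, and \<open>r ^ (w i - w j) * M (dil r z) i j\<close> does not depend on
  \<open>r\<close>. So a matrix with value 1 at the origin is unipotent and triangular with respect
  to the weights.\<close>

lemma hm_limit:
 assumes M: "hommat w u dil M" "i \<in> Basis" "j \<in> Basis" and "w j <= w i"
 shows "M z i j = (if w j = w i then u i \<bullet> j else 0)"
proof -
 have "isCont (%z. M z i j) 0" using smooth_continuous[OF hmD(1)[OF M, of UNIV]] by (simp add: continuous_on_eq_continuous_at)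
 from isCont_tendsto_compose[OF this dil_tendsto]
 have "((%r. r ^ (w i - w j) * M (dil r z) i j) \<longlongrightarrow> 0 ^ (w i - w j) * M 0 i j) (at_right 0)"
  by (intro tendsto_intros) simp
 moreover have "r ^ (w i - w j) * M (dil r z) i j = M z i j" if "r > 0" for r
 proof -
  have "r ^ w j * (r ^ (w i - w j) * M (dil r z) i j) = r ^ w j * M z i j"
   using hmD(3)[OF M that, of z] assms(4) by (simp add: mult.assoc[symmetric] power_add[symmetric])
  thus ?thesis using that by simp
 qed
 hence "((%r. r ^ (w i - w j) * M (dil r z) i j) \<longlongrightarrow> M z i j) (at_right 0)"
  by (intro Lim_transform_eventually[OF tendsto_const]) (auto simp: eventually_at_right_field intro!: exI[of _ 1])
 ultimately have "M z i j = 0 ^ (w i - w j) * M 0 i j" by (rule tendsto_unique[OF trivial_limit_at_right_real, rotated])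
 thus ?thesis using assms(4) hmD(2)[OF M] by (auto simp: power_0_left)
qed

lemma hm_mult:
 assumes M: "hm M" and M': "hommat w u dil M'"
 shows "hommat w u dil (%z i j. \<Sum>k\<in>Basis. M z i k * M' z k j)" unfolding hommat_def
proof (intro ballI conjI allI impI)
 fix i j :: 'e assume ij: "i \<in> Basis" "j \<in> Basis"
 show "smooth (%z. \<Sum>k\<in>Basis. M z i k * M' z k j)" by (intro smooth_sum smooth_mult hmD(1)[OF M] hmD(1)[OF M'] ij) auto
 show "(\<Sum>k\<in>Basis. M 0 i k * M' 0 k j) = u i \<bullet> j"
  using ij by (simp add: hmD(2)[OF M] hmD(2)[OF M'] inner_Basis if_distrib[of "%x. x * _"] cong: if_cong)
 fix r :: real and z assume r: "r > 0"
 have "r ^ w i * (M (dil r z) i k * M' (dil r z) k j) = r ^ w j * (M z i k * M' z k j)" if "k \<in> Basis" for k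
 proof -
  have "r ^ w i * (M (dil r z) i k * M' (dil r z) k j) = (r ^ w i * M (dil r z) i k) * M' (dil r z) k j" by simp
  also have "... = M z i k * (r ^ w k * M' (dil r z) k j)" unfolding hmD(3)[OF M ij(1) that r] by simp
  finally show ?thesis unfolding hmD(3)[OF M' that ij(2) r] by simp
 qed
 thus "r ^ w i * (\<Sum>k\<in>Basis. M (dil r z) i k * M' (dil r z) k j) = r ^ w j * (\<Sum>k\<in>Basis. M z i k * M' z k j)"
  by (simp add: sum_distrib_left)
qed

lemma hm_unit: "hm (%z i j. i \<bullet> j)" by (auto simp: hommat_def inner_Basis)

lemma hm_diff:
 assumes "hommat w u dil M" "hommat w u' dil M'"
 shows "hommat w (%i. u i - u' i) dil (%z i j. M z i j - M' z i j)"
 using assms unfolding hommat_def by (auto simp: inner_diff_left right_diff_distrib intro!: smooth_diff)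

text \<open>\<open>A\<close> is the identity plus a matrix \<open>N\<close> that is strictly
  triangular in the weights, so the Neumann series stops. The recursion for its partial sums
  \<open>S m\<close> keeps them homogeneous, and the entry \<open>(i, j)\<close> is final once
  \<open>w j <= w i + m\<close>; hence \<open>m = l\<close> suffices.\<close>

lemma hm_inverse:
 assumes A: "hm A"
 obtains P where "hm P" "!!z i j. i \<in> Basis ==> j \<in> Basis ==> (\<Sum>k\<in>Basis. P z i k * A z k j) = i \<bullet> j"
proof -
 define N where "N = (%z i j. A z i j - i \<bullet> j)"
 have N: "hommat w (%i. i - i) dil N" unfolding N_def by (rule hm_diff[OF A hm_unit])
 have N0: "N z i j = 0" if "i \<in> Basis" "j \<in> Basis" "w j <= w i" for z i j using hm_limit[OF N that] by simp
 define S where "S = rec_nat (%z i j. i \<bullet> j) (%m S z i j. i \<bullet> j - (\<Sum>k\<in>Basis. S z i k * N z k j))"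
 have S0: "S 0 = (%z i j. i \<bullet> j)" and SS: "S (Suc m) = (%z i j. i \<bullet> j - (\<Sum>k\<in>Basis. S m z i k * N z k j))" for m
  by (simp_all add: S_def)
 have S: "hm (S m)" for m
 proof (induction m)
  case 0
  thus ?case using hm_unit by (simp add: S0)
 next
  case (Suc m)
  have "hommat w (%i. i - (i - i)) dil (S (Suc m))" unfolding SS by (rule hm_diff[OF hm_unit hm_mult[OF Suc N]])
  thus ?case by simp
 qed
 have stab: "S (Suc m) z i j = S m z i j" if "i \<in> Basis" "j \<in> Basis" "w j <= w i + m" for m z i j using that
 proof (induction m arbitrary: j)
  case 0
  have "(\<Sum>k\<in>Basis. (i \<bullet> k) * N z k j) = N z i j"
   using 0 by (simp add: inner_Basis if_distrib[of "%x. x * _"] cong: if_cong)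
  thus ?case using 0 N0[of i j z] by (simp add: SS S0)
 next
  case (Suc m)
  have "S (Suc m) z i k * N z k j = S m z i k * N z k j" if "k \<in> Basis" for k
  proof (cases "w j <= w k")
   case False
   thus ?thesis using Suc.IH[of k] that Suc.prems by simp
  qed (simp add: N0 that Suc.prems)
  hence eq: "(\<Sum>k\<in>Basis. S (Suc m) z i k * N z k j) = (\<Sum>k\<in>Basis. S m z i k * N z k j)" by (rule sum.cong[OF refl])
  have "S (Suc (Suc m)) z i j = i \<bullet> j - (\<Sum>k\<in>Basis. S (Suc m) z i k * N z k j)" by (simp only: SS[of "Suc m"])
  also have "... = S (Suc m) z i j" unfolding eq by (simp only: SS[of m])
  finally show ?case .
 qed
 show ?thesis
 proof (rule that[of "S l", OF S])
  fix z i j :: 'e assume ij: "i \<in> Basis" "j \<in> Basis"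
  have "S l z i j = i \<bullet> j - (\<Sum>k\<in>Basis. S l z i k * N z k j)" using stab[OF ij, of l z] wl[OF ij(2)] by (simp add: SS)
  also have "... = i \<bullet> j - (\<Sum>k\<in>Basis. S l z i k * A z k j) + (\<Sum>k\<in>Basis. S l z i k * (k \<bullet> j))"
   by (simp add: N_def right_diff_distrib sum_subtractf)
  also have "(\<Sum>k\<in>Basis. S l z i k * (k \<bullet> j)) = S l z i j"
   using ij by (simp add: inner_Basis if_distrib[of "%x. _ * x"] cong: if_cong)
  finally show "(\<Sum>k\<in>Basis. S l z i k * A z k j) = i \<bullet> j" by simp
 qed
qed

end

section \<open>Exponential coordinates of the second kind\<close>

text \<open>What the analysis retains of the stratification: a basis \<open>y\<close> of the Lie
  algebra, indexed by the standard basis, in which \<open>y b\<close> lies in the layer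
  \<open>w b\<close>. Here \<open>grad\<close> is the grading and \<open>gen\<close> the generation
  by the first layer; \<open>adapted_basis\<close> provides the data.\<close>

locale strat = lie_grp A + weights w l
 for A :: "('a::{topological_group_add, t2_space, second_countable_topology}, 'e::euclidean_space) atlas"
  and w :: "'e => nat" and l :: nat +
 fixes y :: "'e => 'e"
 assumes y_bij: "bij (%v. \<Sum>b\<in>Basis. (v \<bullet> b) *\<^sub>R y b)"
  and grad: "i \<in> Basis ==> j \<in> Basis ==> br (y i) (y j) \<in> span {y k |k. k \<in> Basis & w k = w i + w j}"
  and gen: "k \<in> Basis ==> w k = Suc m ==> 1 <= m ==>
   y k \<in> span {br (y j) (y i) |i j. i \<in> Basis & j \<in> Basis & w j = m & w i = 1}"
begin

text \<open>Coordinates with respect to the basis \<open>y\<close>.\<close>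

definition kap :: "'e => 'e" where
 "kap = inv (%v. \<Sum>b\<in>Basis. (v \<bullet> b) *\<^sub>R y b)"

lemma kap_expand: "(\<Sum>b\<in>Basis. (kap v \<bullet> b) *\<^sub>R y b) = v"
 unfolding kap_def by (rule surj_f_inv_f[OF bij_is_surj[OF y_bij]])

lemma kap_eqI: "(\<Sum>b\<in>Basis. (v \<bullet> b) *\<^sub>R y b) = u ==> kap u = v"
 unfolding kap_def by (rule inv_f_eq[OF bij_is_inj[OF y_bij]])

lemma kap_linear: "linear kap"
proof -
 have F: "linear (%v. \<Sum>b\<in>Basis. (v \<bullet> b) *\<^sub>R y b)"
  by (rule linearI) (simp_all add: inner_add_left scaleR_add_left sum.distrib scaleR_sum_right)
 show ?thesis by (rule linearI; rule kap_eqI; simp only: linear_add[OF F] linear_scale[OF F] kap_expand)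
qed

lemma kap_y: "b \<in> Basis ==> kap (y b) = b" by (rule kap_eqI) (simp add: inner_Basis if_distrib[of "%x. x *\<^sub>R _"] cong: if_cong)

lemma tv_kap: "f \<in> sf ==> tv v f x = (\<Sum>b\<in>Basis. (kap v \<bullet> b) * tv (y b) f x)"
 by (subst kap_expand[symmetric, of v]) (simp add: tv_lin)

lemma kap_graded: "v \<in> span {y k |k. k \<in> Basis & w k = a} ==> b \<in> Basis ==> w b ~= a ==> kap v \<bullet> b = 0"
proof (induction rule: span_induct_alt)
 case base
 thus ?case by (simp add: linear_0[OF kap_linear])
next
 case (step c x v)
 thus ?case by (auto simp: linear_add[OF kap_linear] linear_scale[OF kap_linear] inner_add_left kap_y inner_Basis split: if_splits)
qed

definition adm :: "'e => nat => 'e => 'e" where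
 "adm k m i = ((%v. br v (y k)) ^^ m) (y i)"

lemma adm_graded:
 assumes "k \<in> Basis" "i \<in> Basis"
 shows "adm k m i \<in> span {y j |j. j \<in> Basis & w j = w i + m * w k}"
proof (induction m)
 case 0
 thus ?case using assms by (auto simp: adm_def intro: span_base)
next
 case (Suc m)
 have "br v (y k) \<in> span {y j |j. j \<in> Basis & w j = w i + Suc m * w k}"
  if "v \<in> span {y j |j. j \<in> Basis & w j = w i + m * w k}" for v using that
 proof (induction rule: span_induct_alt)
  case base
  thus ?case by (simp add: linear_0[OF br_linear1] span_zero)
 next
  case (step c x v)
  then obtain j where j: "x = y j" "j \<in> Basis" "w j = w i + m * w k" by blast
  have "br x (y k) \<in> span {y j |j. j \<in> Basis & w j = w i + Suc m * w k}" using grad[OF j(2) assms(1)] j by (simp add: algebra_simps)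
  thus ?case using step by (simp add: linear_add[OF br_linear1] linear_scale[OF br_linear1] span_add span_scale)
 qed
 from this[OF Suc] show ?case by (simp add: adm_def)
qed

lemma adm_nil:
 assumes "k \<in> Basis" "i \<in> Basis" shows "adm k l i = 0"
proof -
 have "w i + l * w k > w j" if "j \<in> Basis" for j
 proof -
  have "l * 1 <= l * w k" using w1[OF assms(1)] by (intro mult_left_mono) auto
  thus ?thesis using wl[OF that] w1[OF assms(2)] by linarith
 qed
 hence "{y j |j. j \<in> Basis & w j = w i + l * w k} = {}" by fastforce
 thus ?thesis using adm_graded[OF assms, of l] by (metis singletonD span_empty)
qed

text \<open>The matrix, in the basis \<open>y\<close>, of the adjoint action of
  \<open>ep (y k) (- t)\<close>: an exponential series, cut off at \<open>l\<close> by
  \<open>adm_nil\<close>.\<close>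

definition Bm :: "'e => real => 'e => 'e => real" where
 "Bm k t i j = (\<Sum>m<l. (kap (adm k m i) \<bullet> j) / fact m * t ^ m)"

lemma Ad_matrix:
 assumes "f \<in> sf" "k \<in> Basis" "i \<in> Basis"
 shows "tv (y i) (%x. f (x + ep (y k) t)) x = (\<Sum>j\<in>Basis. Bm k t i j * tv (y j) f (x + ep (y k) t))"
proof -
 have "tv (y i) (%x. f (x + ep (y k) t)) x = conj_deriv (y k) f (x + ep (y k) t) (y i) t" by (simp add: conj_deriv_def)
 also have "... = (\<Sum>m<l. tv (adm k m i) f (x + ep (y k) t) / fact m * t ^ m)"
  using Ad_formula[OF assms(1), where n=l] adm_nil[OF assms(2,3)] by (simp add: adm_def)
 also have "... = (\<Sum>m<l. \<Sum>j\<in>Basis. (kap (adm k m i) \<bullet> j) / fact m * t ^ m * tv (y j) f (x + ep (y k) t))"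
  by (intro sum.cong refl, subst tv_kap[OF assms(1)], unfold sum_divide_distrib sum_distrib_right, intro sum.cong refl, simp)
 also have "... = (\<Sum>j\<in>Basis. Bm k t i j * tv (y j) f (x + ep (y k) t))" by (subst sum.swap) (simp add: Bm_def sum_distrib_right)
 finally show ?thesis .
qed

lemma Bm_hm:
 assumes "k \<in> Basis" shows "hm (%z i j. Bm k (z \<bullet> k) i j)" unfolding hommat_def
proof (intro ballI conjI allI impI)
 fix i j :: 'e assume ij: "i \<in> Basis" "j \<in> Basis"
 have "smooth (%z. \<Sum>m<l. (kap (adm k m i) \<bullet> j) / fact m * (z \<bullet> k) ^ m)"
  by (intro smooth_sum smooth_mult smooth_power smooth_inner) auto
 thus "smooth (%z. Bm k (z \<bullet> k) i j)" by (simp add: Bm_def)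
 have "l >= 1" using w1[OF assms] wl[OF assms] by simp
 have "Bm k (0 \<bullet> k) i j = (\<Sum>m<l. if m = 0 then kap (adm k 0 i) \<bullet> j else 0)"
  unfolding Bm_def by (intro sum.cong) (auto simp: power_0_left)
 thus "Bm k (0 \<bullet> k) i j = i \<bullet> j" using \<open>l >= 1\<close> ij by (simp add: adm_def kap_y)
 fix r :: real and z :: 'e assume "r > 0"
 have "r ^ w i * ((kap (adm k m i) \<bullet> j) / fact m * (r ^ w k * (z \<bullet> k)) ^ m)
  = r ^ w j * ((kap (adm k m i) \<bullet> j) / fact m * (z \<bullet> k) ^ m)" for m
 proof (cases "w j = w i + m * w k")
  case True
  thus ?thesis by (simp add: power_mult_distrib power_add power_mult[symmetric] mult.commute)
 next
  case False
  thus ?thesis using kap_graded[OF adm_graded[OF assms ij(1)] ij(2)] by simp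
 qed
 note eq = this
 show "r ^ w i * Bm k (dil r z \<bullet> k) i j = r ^ w j * Bm k (z \<bullet> k) i j"
  unfolding Bm_def sum_distrib_left dil_inner[OF assms] by (rule sum.cong[OF refl eq])
qed

definition Ph :: "'e list => 'e => 'a" where
 "Ph L z = sum_list (map (%b. ep (y b) (z \<bullet> b)) L)"

lemma Ph_simps [simp]: "Ph [] z = 0" "Ph (b # L) z = ep (y b) (z \<bullet> b) + Ph L z" by (simp_all add: Ph_def)

lemma Ph_smooth: "smooth_map_on euclidean_atlas A UNIV (Ph L)"
proof (induction L)
 case Nil
 thus ?case by (simp add: Ph_def[abs_def] smooth_map_on_const pa_euclid)
next
 case (Cons b L)
 have "smooth_map_on euclidean_atlas A UNIV (%z. ep (y b) (z \<bullet> b) + Ph L z)"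
  by (intro smooth_add pa_euclid open_UNIV Cons smooth_comp_euclid[OF _ open_UNIV _ ep_smooth] smooth_inner) auto
 thus ?case by (simp add: Ph_def[abs_def])
qed

lemma Ph_conj:
 assumes "set L \<subseteq> Basis"
 shows "EX C. hm C & (\<forall>f\<in>sf. ALL x z. \<forall>i\<in>Basis. tv (y i) (%x. f (x + Ph L z)) x = (\<Sum>j\<in>Basis. C z i j * tv (y j) f (x + Ph L z)))"
 using assms
proof (induction L)
 case Nil
 have "tv (y i) f x = (\<Sum>j\<in>Basis. (i \<bullet> j) * tv (y j) f x)" if "i \<in> Basis" for i f x
  using that by (simp add: inner_Basis if_distrib[of "%x. x * _"] cong: if_cong)
 thus ?case using hm_unit by (intro exI[of _ "%z i j. i \<bullet> j"]) auto
next
 case (Cons b L)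
 then obtain C where C: "hm C" "!!f x z i. f \<in> sf ==> i \<in> Basis ==>
  tv (y i) (%x. f (x + Ph L z)) x = (\<Sum>j\<in>Basis. C z i j * tv (y j) f (x + Ph L z))" by auto
 have b: "b \<in> Basis" using Cons by simp
 have "tv (y i) (%x. f (x + Ph (b # L) z)) x = (\<Sum>j\<in>Basis. (\<Sum>k\<in>Basis. Bm b (z \<bullet> b) i k * C z k j) * tv (y j) f (x + Ph (b # L) z))"
  if f: "f \<in> sf" and i: "i \<in> Basis" for f i x z
 proof -
  have "tv (y i) (%x. f (x + Ph (b # L) z)) x = (\<Sum>k\<in>Basis. Bm b (z \<bullet> b) i k * tv (y k) (%x. f (x + Ph L z)) (x + ep (y b) (z \<bullet> b)))"
   using Ad_matrix[OF sf_right[OF f, of "Ph L z"] b i, of "z \<bullet> b" x] by (simp add: add.assoc)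
  also have "... = (\<Sum>k\<in>Basis. \<Sum>j\<in>Basis. Bm b (z \<bullet> b) i k * (C z k j * tv (y j) f (x + Ph (b # L) z)))"
   by (intro sum.cong refl) (simp add: C(2)[OF f] sum_distrib_left add.assoc)
  also have "... = (\<Sum>j\<in>Basis. (\<Sum>k\<in>Basis. Bm b (z \<bullet> b) i k * C z k j) * tv (y j) f (x + Ph (b # L) z))"
   by (subst sum.swap) (simp add: sum_distrib_right mult.assoc)
  finally show ?thesis .
 qed
 thus ?case using hm_mult[OF Bm_hm[OF b] C(1)] by (intro exI[of _ "%z i j. \<Sum>k\<in>Basis. Bm b (z \<bullet> b) i k * C z k j"]) auto
qed

text \<open>Varying one coordinate inserts the corresponding field in the middle of the product;
  \<open>Ph_conj\<close> moves it past the remaining factors to the right end, where it becomes a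
  combination of the fields \<open>y k\<close>. Rows of basis vectors outside \<open>L\<close> are
  those of the identity matrix, which keeps \<open>hm M\<close> true.\<close>

lemma Ph_deriv:
 assumes "set L \<subseteq> Basis" "distinct L"
 shows "EX M. hm M & (\<forall>f\<in>sf. ALL x z. ((%z. f (x + Ph L z)) has_derivative
  (%v. \<Sum>b\<in>set L. (v \<bullet> b) * (\<Sum>k\<in>Basis. M z b k * tv (y k) f (x + Ph L z)))) (at z))" using assms
proof (induction L)
 case Nil
 thus ?case using hm_unit by (intro exI[of _ "%z i j. i \<bullet> j"]) auto
next
 case (Cons b L)
 hence b: "b \<in> Basis" "b \<notin> set L" by auto
 from Cons obtain M where M: "hm M" "!!f x z. f \<in> sf ==> ((%z. f (x + Ph L z)) has_derivative
  (%v. \<Sum>b\<in>set L. (v \<bullet> b) * (\<Sum>k\<in>Basis. M z b k * tv (y k) f (x + Ph L z)))) (at z)" by auto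
 obtain C where C: "hm C" "!!f x z i. f \<in> sf ==> i \<in> Basis ==>
  tv (y i) (%x. f (x + Ph L z)) x = (\<Sum>j\<in>Basis. C z i j * tv (y j) f (x + Ph L z))" using Ph_conj[of L] Cons by auto
 define M' where "M' = (%z i j. if i = b then C z i j else M z i j)"
 have hM': "hm M'" using C(1) M(1) unfolding hommat_def M'_def by auto
 have "((%z. f (x + Ph (b # L) z)) has_derivative
  (%v. \<Sum>c\<in>set (b # L). (v \<bullet> c) * (\<Sum>k\<in>Basis. M' z c k * tv (y k) f (x + Ph (b # L) z)))) (at z)"
  if f: "f \<in> sf" for f x z
 proof -
  define F where "F = (%q. f (x + ep (y b) (fst q) + Ph L (snd q)))"
  have F: "smooth_on (UNIV \<times> UNIV) F" unfolding F_def
   by (intro sf_comp_euclid[OF _ _ f] smooth_add pa_euclid open_Times open_UNIV smooth_map_on_const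
     smooth_comp_euclid[OF _ open_UNIV _ ep_smooth] smooth_comp_euclid[OF _ open_UNIV _ Ph_smooth]) auto
  let ?D = "fderiv F (z \<bullet> b, z)"
  have D: "(F has_derivative ?D) (at (z \<bullet> b, z))" by (rule smooth_D[OF F]) auto
  have lin: "linear ?D" using D has_derivative_linear by blast
  have "((%z. (z \<bullet> b, z)) has_derivative (%v. (v \<bullet> b, v))) (at z)" by (auto intro!: derivative_eq_intros)
  from has_derivative_compose[OF this D]
  have "((%z. F (z \<bullet> b, z)) has_derivative (%v. ?D (v \<bullet> b, v))) (at z)" .
  moreover have "?D (v \<bullet> b, v) = (\<Sum>c\<in>set (b # L). (v \<bullet> c) * (\<Sum>k\<in>Basis. M' z c k * tv (y k) f (x + Ph (b # L) z)))" for v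
  proof -
   have "?D (v \<bullet> b, v) = (v \<bullet> b) * ?D (1, 0) + ?D (0, v)"
    using linear_add[OF lin, of "((v \<bullet> b), 0)" "(0, v)"] linear_scale[OF lin, of "v \<bullet> b" "(1, 0)"] by simp
   also have "?D (1, 0) = tv (y b) (%w. f (w + Ph L z)) (x + ep (y b) (z \<bullet> b))"
   proof (rule DERIV_unique)
    show "((%s. F (s, z)) has_real_derivative ?D (1, 0)) (at (z \<bullet> b))" by (rule real_derivI[OF has_derivative_partial(1)[OF D]])
    show "((%s. F (s, z)) has_real_derivative tv (y b) (%w. f (w + Ph L z)) (x + ep (y b) (z \<bullet> b))) (at (z \<bullet> b))"
     using ep_deriv[OF sf_right[OF f, of "Ph L z"]] by (simp add: F_def)
   qed
   also have "... = (\<Sum>k\<in>Basis. M' z b k * tv (y k) f (x + Ph (b # L) z))" using C(2)[OF f b(1)] by (simp add: M'_def add.assoc)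
   also have "?D (0, v) = (\<Sum>c\<in>set L. (v \<bullet> c) * (\<Sum>k\<in>Basis. M' z c k * tv (y k) f (x + Ph (b # L) z)))"
   proof -
    have "((%z'. F (z \<bullet> b, z')) has_derivative
     (%v. \<Sum>c\<in>set L. (v \<bullet> c) * (\<Sum>k\<in>Basis. M z c k * tv (y k) f (x + ep (y b) (z \<bullet> b) + Ph L z)))) (at z)"
     using M(2)[OF f, of "x + ep (y b) (z \<bullet> b)" z] by (simp add: F_def)
    from has_derivative_unique[OF has_derivative_partial(2)[OF D] this]
    have "?D (0, v) = (\<Sum>c\<in>set L. (v \<bullet> c) * (\<Sum>k\<in>Basis. M z c k * tv (y k) f (x + ep (y b) (z \<bullet> b) + Ph L z)))"
     by meson
    also have "... = (\<Sum>c\<in>set L. (v \<bullet> c) * (\<Sum>k\<in>Basis. M' z c k * tv (y k) f (x + Ph (b # L) z)))"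
    proof (rule sum.cong[OF refl])
     fix c assume "c \<in> set L"
     hence "c ~= b" using b(2) by auto
     thus "(v \<bullet> c) * (\<Sum>k\<in>Basis. M z c k * tv (y k) f (x + ep (y b) (z \<bullet> b) + Ph L z))
      = (v \<bullet> c) * (\<Sum>k\<in>Basis. M' z c k * tv (y k) f (x + Ph (b # L) z))" by (simp add: M'_def add.assoc)
    qed
    finally show ?thesis .
   qed
   finally show ?thesis using b(2) by simp
  qed
  ultimately show ?thesis by (simp add: F_def add.assoc)
 qed
 thus ?case using hM' by blast
qed

definition bs :: "'e list" where "bs = (SOME L. set L = Basis & distinct L)"

lemma bs: "set bs = Basis" "distinct bs" using someI_ex[OF finite_distinct_list[OF finite_Basis]] by (auto simp: bs_def)

definition Phi :: "'e => 'a" where "Phi = Ph bs"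

definition frame_matrix :: "('e => 'e => 'e => real) => bool" where
 "frame_matrix M \<longleftrightarrow> hm M & (\<forall>f\<in>sf. ALL x z. ((%z. f (x + Phi z)) has_derivative
  (%v. \<Sum>b\<in>Basis. (v \<bullet> b) * (\<Sum>k\<in>Basis. M z b k * tv (y k) f (x + Phi z)))) (at z))"

definition "Am = (SOME M. frame_matrix M)"

lemma Am: "hm Am" "f \<in> sf ==> ((%z. f (Phi z)) has_derivative
  (%v. \<Sum>b\<in>Basis. (v \<bullet> b) * (\<Sum>k\<in>Basis. Am z b k * tv (y k) f (Phi z)))) (at z)"
proof -
 have "EX M. frame_matrix M" using Ph_deriv[of bs] unfolding frame_matrix_def Phi_def bs(1) using bs(2) by blast
 hence *: "frame_matrix Am" unfolding Am_def by (rule someI_ex)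
 thus "hm Am" by (simp add: frame_matrix_def)
 show "((%z. f (Phi z)) has_derivative
  (%v. \<Sum>b\<in>Basis. (v \<bullet> b) * (\<Sum>k\<in>Basis. Am z b k * tv (y k) f (Phi z)))) (at z)" if "f \<in> sf"
  using *[unfolded frame_matrix_def, THEN conjunct2, rule_format, OF that, of 0 z] by simp
qed

definition P where "P = (SOME P. hm P & (ALL z. \<forall>i\<in>Basis. \<forall>j\<in>Basis. (\<Sum>k\<in>Basis. P z i k * Am z k j) = i \<bullet> j))"

lemma P: "hm P" "i \<in> Basis ==> j \<in> Basis ==> (\<Sum>k\<in>Basis. P z i k * Am z k j) = i \<bullet> j"
proof -
 have "EX P. hm P & (ALL z. \<forall>i\<in>Basis. \<forall>j\<in>Basis. (\<Sum>k\<in>Basis. P z i k * Am z k j) = i \<bullet> j)"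
  using hm_inverse[OF Am(1)] by metis
 from someI_ex[OF this] show "hm P" "i \<in> Basis ==> j \<in> Basis ==> (\<Sum>k\<in>Basis. P z i k * Am z k j) = i \<bullet> j"
  unfolding P_def by blast+
qed

text \<open>The lift of the left-invariant field \<open>y b\<close> to the coordinate space:
  \<open>P\<close> is the inverse of the matrix that expresses the derivatives of \<open>Phi\<close>
  through the fields.\<close>

definition Vf :: "'e => 'e => 'e" where "Vf b z = (\<Sum>c\<in>Basis. P z b c *\<^sub>R c)"

lemma Phi_smooth: "smooth_map_on euclidean_atlas A UNIV Phi" unfolding Phi_def by (rule Ph_smooth)

lemma Phi_0 [simp]: "Phi 0 = 0"
proof -
 have "Ph L 0 = 0" for L by (induction L) (auto simp: ep)
 thus ?thesis by (simp add: Phi_def)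
qed

lemma Phi_Vf:
 assumes "f \<in> sf" "b \<in> Basis" "((%z. f (Phi z)) has_derivative D) (at z)"
 shows "D (Vf b z) = tv (y b) f (Phi z)"
proof -
 have "D (Vf b z) = (\<Sum>c\<in>Basis. (Vf b z \<bullet> c) * (\<Sum>k\<in>Basis. Am z c k * tv (y k) f (Phi z)))"
  using has_derivative_unique[OF assms(3) Am(2)[OF assms(1)]] by meson
 also have "... = (\<Sum>c\<in>Basis. \<Sum>k\<in>Basis. P z b c * (Am z c k * tv (y k) f (Phi z)))"
  by (intro sum.cong refl) (simp add: Vf_def inner_sum_left_Basis sum_distrib_left)
 also have "... = (\<Sum>k\<in>Basis. (\<Sum>c\<in>Basis. P z b c * Am z c k) * tv (y k) f (Phi z))"
  by (subst sum.swap) (simp add: sum_distrib_right mult.assoc)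
 also have "... = tv (y b) f (Phi z)" using assms(2) by (simp add: P(2) inner_Basis if_distrib[of "%x. x * _"] cong: if_cong)
 finally show ?thesis .
qed

lemma tv_y_independent:
 assumes "!!f. f \<in> sf ==> (\<Sum>k\<in>Basis. c k * tv (y k) f x) = 0" "k \<in> Basis" shows "c k = 0"
proof -
 have "tv (\<Sum>k\<in>Basis. c k *\<^sub>R y k) f x = tv 0 f x" if "f \<in> sf" for f using assms(1)[OF that] that by (simp add: tv_lin)
 hence "(\<Sum>k\<in>Basis. c k *\<^sub>R y k) = 0" by (rule tv_inject)
 hence "kap 0 = (\<Sum>k\<in>Basis. c k *\<^sub>R k)" by (intro kap_eqI) (simp add: inner_sum_left_Basis)
 hence "(\<Sum>k\<in>Basis. c k *\<^sub>R k) \<bullet> k = 0" by (simp add: linear_0[OF kap_linear])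
 thus ?thesis using assms(2) by (simp add: inner_sum_left_Basis)
qed

lemma Am_injective:
 assumes "!!k. k \<in> Basis ==> (\<Sum>b\<in>Basis. (v \<bullet> b) * Am z b k) = 0" shows "v = 0"
proof -
 have *: "v \<bullet> k = 0" if "k \<in> Basis" for k using that
 proof (induction "w k" arbitrary: k rule: less_induct)
  case less
  have "(v \<bullet> b) * Am z b k = (if b = k then v \<bullet> k else 0)" if b: "b \<in> Basis" for b
  proof (cases "w b < w k")
   case True
   thus ?thesis using less(1)[OF True b] by auto
  next
   case False
   thus ?thesis using hm_limit[OF Am(1) b less(2)] b less(2) by (auto simp: inner_Basis)
  qed
  thus ?case using assms[OF less(2)] less(2) by simp
 qed
 show ?thesis by (rule euclidean_eqI) (simp add: *)
qed

text \<open>If the derivative of \<open>Phi\<close> kills \<open>v\<close>, then independence of the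
  fields \<open>y k\<close> gives that \<open>v\<close> times \<open>Am z\<close> is zero, and
  \<open>v\<close> vanishes because \<open>Am z\<close> is unipotent. The inverse function theorem
  does the rest.\<close>

lemma Phi_locally_injective: "\<exists>r>0. inj_on Phi (ball z r)"
proof -
 obtain U phi where U: "(U, phi) \<in> A" "Phi z \<in> U" using chart_exists[OF pa] by blast
 note c = chartD[OF pa U(1)]
 define S where "S = Phi -` U"
 have oS: "open S" unfolding S_def
  by (rule continuous_open_vimage[OF c(1)]) (use smooth_map_on_continuous[OF Phi_smooth] continuous_on_eq_continuous_at in blast)
 have zS: "z \<in> S" using U by (simp add: S_def)
 define g where "g x = phi (Phi x)" for x
 have "smooth_map_on euclidean_atlas euclidean_atlas S g" unfolding g_def
  by (rule smooth_map_on_compose[OF pa_euclid pa pa_euclid oS c(1) _ smooth_map_on_chart(1)[OF sa U(1)]])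
   (use smooth_map_on_subset[OF Phi_smooth] in \<open>auto simp: S_def\<close>)
 hence g: "smooth_on S g" using smooth_map_euclidean oS by blast
 let ?D = "%x. fderiv g x"
 have D: "(g has_derivative ?D x) (at x)" if "x \<in> S" for x by (rule smooth_D[OF g that])
 have lin: "linear (?D z)" using D[OF zS] has_derivative_linear by blast
 have "inj (?D z)" unfolding linear_injective_0[OF lin]
 proof (intro allI impI)
  fix v assume v: "?D z v = 0"
  have "(\<Sum>k\<in>Basis. (\<Sum>b\<in>Basis. (v \<bullet> b) * Am z b k) * tv (y k) f (Phi z)) = 0" if f: "f \<in> sf" for f
  proof -
   have fs: "smooth_on (phi ` U) (%q. f (inv_into U phi q))" using smooth_fun_chart[OF U(1), of UNIV f] f sf_iff by simp
   hence "((%q. f (inv_into U phi q)) has_derivative fderiv (%q. f (inv_into U phi q)) (g z)) (at (g z))"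
    by (rule smooth_D) (use U in \<open>auto simp: g_def\<close>)
   from has_derivative_compose[OF D[OF zS] this]
   have "((%x. f (inv_into U phi (g x))) has_derivative (%v. fderiv (%q. f (inv_into U phi q)) (g z) (?D z v))) (at z)" .
   hence d: "((%x. f (Phi x)) has_derivative (%v. fderiv (%q. f (inv_into U phi q)) (g z) (?D z v))) (at z)"
    by (rule has_derivative_transform_within_open[OF _ oS zS]) (use c(6) in \<open>auto simp: g_def S_def\<close>)
   have "linear (fderiv (%q. f (inv_into U phi q)) (g z))" using smooth_D[OF fs, of "g z"] U has_derivative_linear by (auto simp: g_def)
   from linear_0[OF this] has_derivative_unique[OF d Am(2)[OF f]] v
   have "(\<Sum>b\<in>Basis. (v \<bullet> b) * (\<Sum>k\<in>Basis. Am z b k * tv (y k) f (Phi z))) = 0" by metis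
   thus ?thesis unfolding sum_distrib_left sum_distrib_right by (subst sum.swap) (simp add: mult.assoc)
  qed
  from tv_y_independent[OF this] show "v = 0" by (intro Am_injective[of v z]) auto
 qed
 from linear_injective_left_inverse[OF lin this] obtain g' where g': "linear g'" "g' \<circ> ?D z = id" by blast
 \<comment> \<open>The theorem on local injectivity asks for continuity of the derivative in the
   operator norm, whereas smoothness provides it one direction at a time.\<close>
 have "\<exists>d>0. ALL x. dist z x < d --> onorm (%v. ?D x v - ?D z v) < e" if e: "e > 0" for e
 proof -
  define e' where "e' = e / (2 * (DIM('e) + 1))"
  have e': "e' > 0" using e by (simp add: e'_def)
  have "\<exists>d>0. ALL x. dist x z < d --> dist (?D x b) (?D z b) < e'" for b
  proof -
   have "isCont (%x. ?D x b) z" using smooth_continuous[OF smooth_frechet[OF g]] oS zS continuous_on_eq_continuous_at by blast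
   thus ?thesis using e' unfolding continuous_at_eps_delta by blast
  qed
  then obtain d where d: "!!b. d b > 0" "!!b x. dist x z < d b ==> dist (?D x b) (?D z b) < e'" by metis
  obtain d0 where d0: "d0 > 0" "ball z d0 \<subseteq> S" using oS zS open_contains_ball by blast
  define dd where "dd = Min (insert d0 (d ` Basis))"
  have dd: "dd > 0" "dd <= d0" using d(1) d0 by (auto simp: dd_def)
  have ddb: "dd <= d b" if "b \<in> Basis" for b unfolding dd_def by (rule Min_le) (use that in auto)
  have "onorm (%v. ?D x v - ?D z v) < e" if x: "dist z x < dd" for x
  proof -
   have "x \<in> S" using x dd d0 by (auto simp: subset_iff)
   hence linx: "linear (%v. ?D x v - ?D z v)"
    using D[OF \<open>x \<in> S\<close>] D[OF zS] has_derivative_linear linear_compose_sub by blast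
   have "onorm (%v. ?D x v - ?D z v) <= e' * DIM('e)"
   proof (rule onorm_le)
    fix v :: 'e
    define T where "T v = ?D x v - ?D z v" for v
    have T: "linear T" using linx by (simp add: T_def[abs_def])
    have "T v = T (\<Sum>b\<in>Basis. (v \<bullet> b) *\<^sub>R b)" by (simp add: euclidean_representation)
    also have "... = (\<Sum>b\<in>Basis. (v \<bullet> b) *\<^sub>R T b)" by (simp add: linear_sum[OF T] linear_scale[OF T])
    finally have "?D x v - ?D z v = (\<Sum>b\<in>Basis. (v \<bullet> b) *\<^sub>R (?D x b - ?D z b))" by (simp add: T_def)
    also have "norm ... <= (\<Sum>b\<in>(Basis::'e set). norm v * e')"
    proof (rule order_trans[OF norm_sum sum_mono])
     fix b :: 'e assume b: "b \<in> Basis"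
     have "norm (?D x b - ?D z b) <= e'" using d(2)[of x b] x ddb[OF b] by (simp add: dist_norm norm_minus_commute)
     thus "norm ((v \<bullet> b) *\<^sub>R (?D x b - ?D z b)) <= norm v * e'" using mult_mono[OF Basis_le_norm[OF b, of v]] by simp
    qed
    finally show "norm (?D x v - ?D z v) <= e' * DIM('e) * norm v" by (simp add: mult_ac)
   qed
   also have "... < e" using e add_nonneg_pos[of "e * real DIM('e)" "e * 2"] by (simp add: e'_def field_simps)
   finally show ?thesis .
  qed
  thus ?thesis using dd(1) by blast
 qed
 then obtain r where "r > 0" "ball z r \<subseteq> S" "inj_on g (ball z r)"
  using has_derivative_locally_injective[OF zS oS linear_conv_bounded_linear[THEN iffD1, OF g'(1)] g'(2) D] by blast
 thus ?thesis unfolding g_def inj_on_def by metis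
qed

end

section \<open>The group structure in homogeneous coordinates\<close>

context weights
begin

text \<open>The partial derivative in direction \<open>i\<close> is homogeneous of the negative
  degree \<open>q - p - w i\<close> and continuous at the origin, which forces it to vanish.\<close>

lemma hom_deriv_zero:
 fixes g :: "'e => real"
 assumes g: "smooth g" and hom: "!!r z. r > 0 ==> r ^ p * g (dil r z) = r ^ q * g z"
  and i: "i \<in> Basis" "q < p + w i"
 shows "fderiv g z i = 0"
proof -
 let ?D = "%z. fderiv g z i"
 have gd: "(g has_derivative fderiv g z) (at z)" for z by (rule smooth_D[OF g]) simp
 have dl: "(dil r has_derivative dil r) (at z)" for r z
  by (rule bounded_linear_imp_has_derivative[OF linear_conv_bounded_linear[THEN iffD1, OF dil_linear]])
 have di: "dil r i = r ^ w i *\<^sub>R i" for r by (rule euclidean_eqI) (use i(1) in \<open>auto simp: inner_Basis\<close>)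
 have eq: "?D z = r ^ (p + w i - q) * ?D (dil r z)" if r: "r > 0" for r
 proof -
  have "((%z. r ^ p * g (dil r z)) has_derivative (%v. r ^ p * fderiv g (dil r z) (dil r v))) (at z)"
   by (intro has_derivative_mult_right has_derivative_compose[OF dl gd])
  moreover have "((%z. r ^ p * g (dil r z)) has_derivative (%v. r ^ q * fderiv g z v)) (at z)"
   unfolding hom[OF r] by (intro has_derivative_mult_right gd)
  ultimately have "(%v. r ^ p * fderiv g (dil r z) (dil r v)) = (%v. r ^ q * fderiv g z v)" by (rule has_derivative_unique)
  from fun_cong[OF this, of i] have "r ^ p * (r ^ w i * ?D (dil r z)) = r ^ q * ?D z"
   using linear_scale[OF has_derivative_linear[OF gd]] by (simp add: di)
  moreover have "r ^ p * r ^ w i = r ^ q * r ^ (p + w i - q)" using i(2) by (simp add: power_add[symmetric])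
  ultimately have "r ^ q * (r ^ (p + w i - q) * ?D (dil r z)) = r ^ q * ?D z" by (simp add: mult.assoc[symmetric])
  thus ?thesis using r by simp
 qed
 have "isCont ?D 0" using smooth_continuous[OF smooth_frechet[OF g]] by (simp add: continuous_on_eq_continuous_at)
 from isCont_tendsto_compose[OF this dil_tendsto]
 have "((%r. r ^ (p + w i - q) * ?D (dil r z)) \<longlongrightarrow> 0 ^ (p + w i - q) * ?D 0) (at_right 0)" by (intro tendsto_intros) simp
 moreover have "((%r. r ^ (p + w i - q) * ?D (dil r z)) \<longlongrightarrow> ?D z) (at_right 0)"
  by (rule Lim_transform_eventually[OF tendsto_const]) (use eq in \<open>auto simp: eventually_at_right_field intro!: exI[of _ 1]\<close>)
 ultimately have "?D z = 0 ^ (p + w i - q) * ?D 0" by (rule tendsto_unique[OF trivial_limit_at_right_real, rotated])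
 thus ?thesis using i(2) by (simp add: power_0_left)
qed

end

lemma line_constant:
 fixes g :: "'a::real_normed_vector => real"
 assumes "!!t. (g has_derivative g' t) (at (x + t *\<^sub>R v))" "!!t. g' t v = 0"
 shows "g (x + v) = g x"
proof -
 have "((%t. g (x + t *\<^sub>R v)) has_vector_derivative 0) (at t)" for t using frechet_line[OF assms(1)[of t]] assms(2) by simp
 hence "!!t. ((%t. g (x + t *\<^sub>R v)) has_derivative (%h. 0)) (at t within UNIV)" by (simp add: has_vector_derivative_def)
 from has_derivative_zero_unique[OF convex_UNIV this, of 1 0] show ?thesis by simp
qed

context strat
begin

lemma Vf_inner [simp]: "c \<in> Basis ==> Vf b z \<bullet> c = P z b c" by (simp add: Vf_def inner_sum_left_Basis)

lemma Vf_smooth: "b \<in> Basis ==> smooth_on S (Vf b)" unfolding Vf_def[abs_def] by (rule smooth_subset[of UNIV])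
  (intro smooth_sum smooth_scaleR hmD(1)[OF P(1)] smooth_const open_UNIV, auto)

lemma Vf_dil: "b \<in> Basis ==> r > 0 ==> dil r (Vf b z) = r ^ w b *\<^sub>R Vf b (dil r z)"
 by (rule euclidean_eqI) (simp add: hmD(3)[OF P(1)])

lemma Vf_0: "b \<in> Basis ==> Vf b 0 = b" by (rule euclidean_eqI) (simp add: hmD(2)[OF P(1)])

lemma Vf_div_free: "b \<in> Basis ==> c \<in> Basis ==> w c <= w i ==> i \<in> Basis ==> fderiv (%z. P z b c) z i = 0"
 by (rule hom_deriv_zero[OF hmD(1)[OF P(1)] hmD(3)[OF P(1)]]) (use w1[of b] in auto)

text \<open>By \<open>Vf_div_free\<close> the coefficient is constant in all coordinates of weight
  at least \<open>w c\<close>, so it does not change along the segment from \<open>z\<close> to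
  \<open>z'\<close>.\<close>

lemma P_triangular:
 assumes "b \<in> Basis" "c \<in> Basis" "!!i. i \<in> Basis ==> w i < w c ==> z \<bullet> i = z' \<bullet> i"
 shows "P z' b c = P z b c"
proof -
 let ?g = "%z. P z b c" and ?v = "z' - z"
 have gd: "(?g has_derivative fderiv ?g x) (at x)" for x by (rule smooth_D[OF hmD(1)[OF P(1) assms(1,2), of UNIV]]) simp
 have "fderiv ?g x ?v = 0" for x
 proof -
  have lin: "linear (fderiv ?g x)" using gd has_derivative_linear by blast
  have "fderiv ?g x ?v = fderiv ?g x (\<Sum>i\<in>Basis. (?v \<bullet> i) *\<^sub>R i)" by (simp add: euclidean_representation)
  also have "... = (\<Sum>i\<in>Basis. (?v \<bullet> i) *\<^sub>R fderiv ?g x i)" by (simp add: linear_sum[OF lin] linear_scale[OF lin])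
  also have "... = 0"
  proof (rule sum.neutral, rule ballI)
   fix i :: 'e assume "i \<in> Basis"
   thus "(?v \<bullet> i) *\<^sub>R fderiv ?g x i = 0"
    using assms Vf_div_free[of b c i x] by (cases "w i < w c") (auto simp: inner_diff_left)
  qed
  finally show ?thesis .
 qed
 thus ?thesis using line_constant[of ?g _ z ?v, OF gd] by simp
qed

text \<open>Picard iterates of the flow of \<open>Vf b\<close>; by triangularity the iteration becomes stationary.\<close>

primrec Em :: "nat => 'e => real => 'e => 'e" where
 "Em 0 b s z = z"
| "Em (Suc m) b s z = z + s *\<^sub>R integral {0..1} (%th. Vf b (Em m b (th * s) z))"

definition "Ef = Em l"

lemma Em_smooth:
 assumes b: "b \<in> Basis" shows "smooth (%p. Em m b (fst p) (snd p))"
proof (induction m)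
 case 0
 thus ?case by simp
next
 case (Suc m)
 have "smooth (%q::(real \<times> 'e) \<times> real. Em m b (fst (snd q * fst (fst q), snd (fst q))) (snd (snd q * fst (fst q), snd (fst q))))"
  by (rule smooth_compose[OF open_UNIV _ Suc]) (auto intro!: smooth_Pair smooth_mult smooth_compose[OF open_UNIV _ smooth_fst, of _ UNIV]
    smooth_compose[OF open_UNIV _ smooth_snd, of _ UNIV])
 hence "smooth (%q::(real \<times> 'e) \<times> real. Vf b (Em m b (snd q * fst (fst q)) (snd (fst q))))"
  by (intro smooth_compose[OF open_UNIV _ Vf_smooth[OF b, of UNIV]]) auto
 hence "smooth (%p. integral (cbox 0 1) (%th. Vf b (Em m b (snd (p, th) * fst (fst (p, th))) (snd (fst (p, th))))))"
  by (rule smooth_integral[OF open_UNIV open_UNIV, rotated]) auto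
 thus ?case by (auto simp: cbox_interval intro!: smooth_on_add smooth_scaleR)
qed

lemma Em_cont:
 assumes "b \<in> Basis" shows "continuous_on UNIV (%th. Vf b (Em m b (th * s) z))"
proof -
 have "continuous_on UNIV (%th. Em m b (fst (th * s, z)) (snd (th * s, z)))"
  by (rule continuous_on_compose2[OF smooth_continuous[OF Em_smooth[OF assms]]]) (auto intro!: continuous_intros)
 thus ?thesis by (intro continuous_on_compose2[OF smooth_continuous[OF Vf_smooth[OF assms, of UNIV]]]) auto
qed

lemma Em_int: "b \<in> Basis ==> (%th. Vf b (Em m b (th * s) z)) integrable_on {0..1}"
 using Em_cont continuous_on_subset integrable_continuous_real by blast

lemma Em_stable:
 assumes b: "b \<in> Basis"
 shows "c \<in> Basis ==> w c <= m ==> Em (Suc m) b s z \<bullet> c = Em m b s z \<bullet> c"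
proof (induction m arbitrary: c s)
 case 0
 thus ?case using w1 by fastforce
next
 case (Suc m)
 have "integral {0..1} (%th. Vf b (Em (Suc m) b (th * s) z)) \<bullet> c = integral {0..1} (%th. P (Em (Suc m) b (th * s) z) b c)"
  using integral_component_eq[OF Em_int[OF b, of "Suc m" s z], of c] Suc.prems by simp
 also have "... = integral {0..1} (%th. P (Em m b (th * s) z) b c)"
  by (intro integral_cong P_triangular[OF b Suc.prems(1)]) (use Suc in \<open>auto simp del: Em.simps\<close>)
 also have "... = integral {0..1} (%th. Vf b (Em m b (th * s) z)) \<bullet> c"
  using integral_component_eq[OF Em_int[OF b, of m s z], of c] Suc.prems by simp
 finally show ?case by (simp only: Em.simps(2)[of "Suc m"] Em.simps(2)[of m] inner_add_left inner_scaleR_left)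
qed

lemma Ef_eq:
 assumes b: "b \<in> Basis" shows "Ef b s z = z + s *\<^sub>R integral {0..1} (%th. Vf b (Ef b (th * s) z))"
proof -
 have "Em (Suc l) b s z = Em l b s z" by (rule euclidean_eqI) (rule Em_stable[OF b _ wl])
 thus ?thesis by (simp add: Ef_def)
qed

lemma Ef_smooth: "b \<in> Basis ==> smooth (%p. Ef b (fst p) (snd p))" unfolding Ef_def by (rule Em_smooth)

lemma Ef_0 [simp]: "b \<in> Basis ==> Ef b 0 z = z" by (subst Ef_eq) auto

lemma Ef_deriv:
 assumes b: "b \<in> Basis" shows "((%s. Ef b s z) has_vector_derivative Vf b (Ef b s z)) (at s)"
proof -
 have "((%s. z + s *\<^sub>R integral {0..1} (%th. Vf b (Ef b (th * s) z))) has_vector_derivative 0 + Vf b (Ef b s z)) (at s)"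
 proof (intro has_vector_derivative_add has_vector_derivative_const)
  have "continuous_on UNIV (%s. Vf b (Ef b s z))" using Em_cont[OF b, of l 1 z] by (simp add: Ef_def)
  from integral_rescaled_deriv[OF this]
  show "((%s. s *\<^sub>R integral {0..1} (%th. Vf b (Ef b (th * s) z))) has_vector_derivative Vf b (Ef b s z)) (at s)" .
 qed
 thus ?thesis using Ef_eq[OF b, symmetric] by simp
qed

lemma Ef_dil:
 assumes b: "b \<in> Basis" and r: "r > 0" shows "dil r (Ef b s z) = Ef b (r ^ w b * s) (dil r z)"
proof -
 have bl: "bounded_linear (dil r)" using dil_linear linear_conv_bounded_linear by blast
 have "dil r (Em m b s z) = Em m b (r ^ w b * s) (dil r z)" for m s
 proof (induction m arbitrary: s)
  case 0
  thus ?case by simp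
 next
  case (Suc m)
  have "dil r (Em (Suc m) b s z) = dil r z + s *\<^sub>R dil r (integral {0..1} (%th. Vf b (Em m b (th * s) z)))"
   by (simp add: linear_add[OF dil_linear] linear_scale[OF dil_linear])
  also have "dil r (integral {0..1} (%th. Vf b (Em m b (th * s) z))) = integral {0..1} (%th. dil r (Vf b (Em m b (th * s) z)))"
   using integral_linear[OF Em_int[OF b, of m s z] bl] by (simp add: o_def)
  also have "... = integral {0..1} (%th. r ^ w b *\<^sub>R Vf b (Em m b (th * (r ^ w b * s)) (dil r z)))"
   by (simp add: Vf_dil[OF b r] Suc mult_ac)
  finally show ?case by (simp add: mult.commute)
 qed
 thus ?thesis by (simp add: Ef_def)
qed

lemma Ef_path_smooth: "b \<in> Basis ==> smooth (%s. Ef b s z)"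
proof -
 assume b: "b \<in> Basis"
 have "smooth (%s. Ef b (fst (s, z)) (snd (s, z)))" by (rule smooth_compose[OF open_UNIV _ Ef_smooth[OF b]]) (auto intro!: smooth_Pair)
 thus ?thesis by simp
qed

lemma Phi_Ef:
 assumes b: "b \<in> Basis" shows "Phi (Ef b s z) = Phi z + ep (y b) s"
proof -
 have "icurve (y b) UNIV (%s. Phi (Ef b s z))" unfolding icurve_def
 proof (intro conjI ballI)
  show "smooth_map_on euclidean_atlas A UNIV (%s. Phi (Ef b s z))" by (rule smooth_comp_euclid[OF _ _ Ef_path_smooth[OF b] Phi_smooth]) auto
  fix t f assume f: "f \<in> sf"
  let ?D = "(%v. \<Sum>c\<in>Basis. (v \<bullet> c) * (\<Sum>k\<in>Basis. Am (Ef b t z) c k * tv (y k) f (Phi (Ef b t z))))"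
  have D: "((%z. f (Phi z)) has_derivative ?D) (at (Ef b t z))" by (rule Am(2)[OF f])
  have "((%s. f (Phi (Ef b s z))) has_vector_derivative ?D (Vf b (Ef b t z))) (at t)"
   using vector_derivative_diff_chain_within[OF Ef_deriv[OF b] has_derivative_at_withinI[OF D]] by (simp add: o_def)
  thus "((%s. f (Phi (Ef b s z))) has_real_derivative tv (y b) f (Phi (Ef b t z))) (at t)"
   using Phi_Vf[OF f b D] by (simp add: has_real_derivative_iff_has_vector_derivative)
 qed
 from icurve_UNIV_unique[OF this, of s] show ?thesis using b by simp
qed

section \<open>Lifting the group law\<close>

text \<open>The set where two lifts agree is closed, and open by local injectivity of
  \<open>Phi\<close>. Identities of the group are lifted with it: both sides are joined by a path to
  a case in which they agree, usually the one where an argument is 0.\<close>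

lemma lift_unique:
 fixes g h :: "real => 'e"
 assumes c: "continuous_on UNIV g" "continuous_on UNIV h" and eq: "!!t. Phi (g t) = Phi (h t)" and "g 0 = h 0"
 shows "g t = h t"
proof -
 let ?S = "{t. g t = h t}"
 have "closed ?S" by (rule closed_Collect_eq[OF c])
 moreover have "open ?S" unfolding open_contains_ball
 proof
  fix t assume "t \<in> ?S"
  hence t: "g t = h t" by simp
  obtain r where r: "r > 0" "inj_on Phi (ball (g t) r)" using Phi_locally_injective by blast
  have "open (g -` ball (g t) r \<inter> h -` ball (g t) r)" by (intro open_Int open_vimage open_ball c)
  moreover have "t \<in> g -` ball (g t) r \<inter> h -` ball (g t) r" using r t by simp
  ultimately obtain d where d: "d > 0" "ball t d \<subseteq> g -` ball (g t) r \<inter> h -` ball (g t) r" using open_contains_ball by blast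
  have "ball t d \<subseteq> ?S"
  proof
   fix s assume "s \<in> ball t d"
   hence "g s \<in> ball (g t) r" "h s \<in> ball (g t) r" using d(2) by auto
   thus "s \<in> ?S" using inj_onD[OF r(2) eq[of s]] by simp
  qed
  thus "\<exists>e>0. ball t e \<subseteq> ?S" using d(1) by blast
 qed
 moreover have "0 \<in> ?S" using assms by simp
 ultimately have "?S = UNIV" using clopen[of ?S] by blast
 thus ?thesis by blast
qed

text \<open>Right multiplication by \<open>ep (y b) s\<close> lifts to the flow
  \<open>Ef b s\<close>. Multiplication by \<open>z\<close> on the right thus runs the flows with
  times \<open>z \<bullet> b\<close>, in the order in which the factors of \<open>Phi z\<close>
  occur.\<close>

definition mulL :: "'e list => 'e => 'e => 'e" where
 "mulL L a z = fold (%b x. Ef b (z \<bullet> b) x) L a"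

definition mul :: "'e => 'e => 'e" where "mul = mulL bs"

lemma mulL_simps [simp]: "mulL [] a z = a" "mulL (b # L) a z = mulL L (Ef b (z \<bullet> b) a) z" by (simp_all add: mulL_def)

lemma Phi_mul: "Phi (mul a z) = Phi a + Phi z"
proof -
 have "set L \<subseteq> Basis ==> Phi (mulL L a z) = Phi a + Ph L z" for L by (induction L arbitrary: a) (auto simp: Phi_Ef add.assoc)
 thus ?thesis using bs by (simp add: mul_def Phi_def)
qed

lemma mulL_smooth: "set L \<subseteq> Basis ==> open S ==> smooth_on S f ==> smooth_on S g ==> smooth_on S (%x. mulL L (f x) (g x))"
proof (induction L arbitrary: f)
 case Nil
 thus ?case by simp
next
 case (Cons b L)
 have "smooth_on S (%x. Ef b (fst (g x \<bullet> b, f x)) (snd (g x \<bullet> b, f x)))"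
  by (rule smooth_compose[OF Cons.prems(2) _ Ef_smooth]) (use Cons.prems in \<open>auto intro!: smooth_Pair smooth_inner\<close>)
 thus ?case using Cons by simp
qed

lemma mul_smooth:
 fixes f :: "'m::real_normed_vector => 'e"
 shows "open S ==> smooth_on S f ==> smooth_on S g ==> smooth_on S (%x. mul (f x) (g x))" unfolding mul_def using mulL_smooth bs by blast

lemma mul_cont:
 fixes f :: "real => 'e"
 assumes "continuous_on UNIV f" "continuous_on UNIV g"
 shows "continuous_on UNIV (%x. mul (f x) (g x))"
proof -
 have "continuous_on UNIV (%p. mul (fst p) (snd p))" by (rule smooth_continuous[OF mul_smooth]) auto
 from continuous_on_compose2[OF this continuous_on_Pair[OF assms]] show ?thesis by simp
qed

lemma mul_0_right [simp]: "mul a 0 = a"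
proof -
 have "set L \<subseteq> Basis ==> mulL L a 0 = a" for L by (induction L) auto
 thus ?thesis using bs by (simp add: mul_def)
qed

lemma mul_0_left [simp]: "mul 0 z = z"
proof -
 have "mul 0 (1 *\<^sub>R z) = 1 *\<^sub>R z" by (rule lift_unique[of "%t. mul 0 (t *\<^sub>R z)" "%t. t *\<^sub>R z"])
   (auto simp: Phi_mul intro!: mul_cont continuous_intros)
 thus ?thesis by simp
qed

lemma mul_assoc: "mul (mul a b) c = mul a (mul b c)"
proof -
 have "mul (mul a b) (1 *\<^sub>R c) = mul a (mul b (1 *\<^sub>R c))"
  by (rule lift_unique[of "%t. mul (mul a b) (t *\<^sub>R c)" "%t. mul a (mul b (t *\<^sub>R c))"])
   (auto simp: Phi_mul add.assoc intro!: mul_cont continuous_intros)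
 thus ?thesis by simp
qed

lemma Ef_cont: "b \<in> Basis ==> continuous_on UNIV (%s. Ef b (s + t) z)"
 by (rule continuous_on_compose2[OF smooth_continuous[OF Ef_path_smooth]]) (auto intro!: continuous_intros)

lemma Ef_add:
 assumes b: "b \<in> Basis" shows "Ef b (s + t) z = Ef b s (Ef b t z)"
 by (rule lift_unique[of "%s. Ef b (s + t) z" "%s. Ef b s (Ef b t z)"]) (use Ef_cont[OF b, of t] Ef_cont[OF b, of 0] b in
   \<open>auto simp: Phi_Ef ep_add[symmetric] add.assoc add.commute\<close>)

lemma Ef_mul:
 assumes b: "b \<in> Basis" shows "Ef b s (mul a z) = mul a (Ef b s z)"
 by (rule lift_unique[of "%s. Ef b s (mul a z)" "%s. mul a (Ef b s z)"])
  (use Ef_cont[OF b, of 0] b in \<open>auto simp: Phi_Ef Phi_mul add.assoc intro!: mul_cont\<close>)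

lemma Ef_right: "b \<in> Basis ==> Ef b s z = mul z (Ef b s 0)" using Ef_mul[of b s z 0] by simp

lemma mul_dil:
 assumes r: "r > 0" shows "dil r (mul a z) = mul (dil r a) (dil r z)"
proof -
 have "set L \<subseteq> Basis ==> dil r (mulL L a z) = mulL L (dil r a) (dil r z)" for L
  by (induction L arbitrary: a) (auto simp: Ef_dil r)
 thus ?thesis using bs by (simp add: mul_def)
qed

definition ginv :: "'e => 'e" where
 "ginv z = fold (%b x. Ef b (- (z \<bullet> b)) x) (rev bs) 0"

lemma mul_ginv_left [simp]: "mul (ginv z) z = 0"
proof -
 have "set L \<subseteq> Basis ==> mulL L (fold (%b x. Ef b (- (z \<bullet> b)) x) (rev L) x) z = x" for L x
 proof (induction L)
  case (Cons b L)
  thus ?case using Ef_add[of b "z \<bullet> b" "- (z \<bullet> b)"] by simp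
 qed simp
 thus ?thesis using bs by (simp add: mul_def ginv_def)
qed

lemma mul_ginv_right [simp]: "mul z (ginv z) = 0"
proof -
 have "mul z (ginv z) = mul (mul (ginv (ginv z)) (ginv z)) (mul z (ginv z))" by simp
 also have "... = mul (ginv (ginv z)) (mul (mul (ginv z) z) (ginv z))" by (simp only: mul_assoc)
 finally show ?thesis by simp
qed

lemma mul_ginv_cancel [simp]: "mul (ginv a) (mul a z) = z" "mul a (mul (ginv a) z) = z" by (simp_all add: mul_assoc[symmetric])

lemma ginv_smooth: "smooth ginv"
proof -
 have "set L \<subseteq> Basis ==> smooth f ==> smooth (%z. fold (%b x. Ef b (- (z \<bullet> b)) x) L (f z))" for L f
 proof (induction L arbitrary: f)
  case (Cons b L)
  have "smooth (%z. Ef b (fst (- (z \<bullet> b), f z)) (snd (- (z \<bullet> b), f z)))" by (rule smooth_compose[OF open_UNIV _ Ef_smooth])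
    (use Cons.prems in \<open>auto intro!: smooth_Pair smooth_inner smooth_on_minus\<close>)
  thus ?case using Cons by simp
 qed simp
 thus ?thesis using bs unfolding ginv_def[abs_def] by simp
qed

lemma Phi_ginv: "Phi (ginv z) = - Phi z" using Phi_mul[of "ginv z" z] by (simp add: eq_neg_iff_add_eq_0)

subsection \<open>Horizontal accessibility\<close>

text \<open>Broken lines along one horizontal field at a time, with total duration \<open>T\<close>.
  Such paths serve both for the difference quotients in the Nash inequality and for upper bounds of
  the metric.\<close>

inductive hreach :: "'e => real => 'e => bool" where
 hrefl: "hreach a 0 a"
| hstep: "hreach a T b ==> c \<in> Basis ==> w c = 1 ==> hreach a (T + \<bar>s\<bar>) (Ef c s b)"

lemma hreach_nonneg: "hreach a T b ==> T >= 0" by (induction rule: hreach.induct) auto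

lemma hreach_trans: "hreach b T' c ==> hreach a T b ==> hreach a (T + T') c"
proof (induction rule: hreach.induct)
 case (hstep b T' b' c s)
 thus ?case using hreach.hstep[of a "T + T'" b' c s] by (simp add: add.assoc)
qed simp

lemma hreach_left: "hreach a T b ==> hreach (mul g a) T (mul g b)"
 by (induction rule: hreach.induct) (auto simp: Ef_mul[symmetric] intro: hreach.intros)

lemma hreach_dil: "hreach a T b ==> r > 0 ==> hreach (dil r a) (r * T) (dil r b)"
proof (induction rule: hreach.induct)
 case (hstep a T b c s)
 hence "hreach (dil r a) (r * T + \<bar>r * s\<bar>) (Ef c (r * s) (dil r b))" by (intro hreach.hstep) auto
 thus ?case using hstep by (simp add: Ef_dil abs_mult distrib_left)
qed (simp add: hrefl)

definition \<Gamma> :: "'e set" where "\<Gamma> = {z. EX T. hreach 0 T z}"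

lemma \<Gamma>_mul: "a \<in> \<Gamma> ==> b \<in> \<Gamma> ==> mul a b \<in> \<Gamma>"
 using hreach_trans hreach_left[of 0 _ b a] unfolding \<Gamma>_def by (auto simp: ) (metis mul_0_right)

lemma \<Gamma>_Ef: "c \<in> Basis ==> w c = 1 ==> a \<in> \<Gamma> ==> Ef c s a \<in> \<Gamma>"
 unfolding \<Gamma>_def using hreach.hstep by blast

lemma \<Gamma>_dil: "a \<in> \<Gamma> ==> r > 0 ==> dil r a \<in> \<Gamma>" unfolding \<Gamma>_def using hreach_dil[of 0] by auto

lemma \<Gamma>_0: "0 \<in> \<Gamma>" unfolding \<Gamma>_def using hrefl by blast

text \<open>Tangent vectors at the origin of curves in \<open>\<Gamma>\<close>. The curves are
  parametrised by the whole line, so that negative multiples stay in the set, and differentiability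
  is required only at 0.\<close>

definition tang :: "'e set" where
 "tang = {v. EX c. continuous_on UNIV c & (\<forall>s::real. c s \<in> \<Gamma>) & c 0 = 0 & (c has_derivative (%h. h *\<^sub>R v)) (at 0)}"

lemma mul_deriv_0: "((%p. mul (fst p) (snd p)) has_derivative (%v. fst v + snd v)) (at (0, 0))"
proof -
 let ?m = "%p. mul (fst p) (snd p)"
 have "smooth ?m" by (rule mul_smooth) auto
 hence D: "(?m has_derivative fderiv ?m (0, 0)) (at (0, 0))" by (rule smooth_D) simp
 have lin: "linear (fderiv ?m (0, 0))" using D has_derivative_linear by blast
 have "fderiv ?m (0, 0) (v, 0) = v" "fderiv ?m (0, 0) (0, v) = v" for v
  using has_derivative_unique[OF has_derivative_partial(1)[OF D], of "%v. v"]
   has_derivative_unique[OF has_derivative_partial(2)[OF D], of "%v. v"] by (auto simp: fun_eq_iff)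
 hence "fderiv ?m (0, 0) v = fst v + snd v" for v using linear_add[OF lin, of "(fst v, 0)" "(0, snd v)"] by simp
 thus ?thesis using D by (auto elim!: has_derivative_eq_rhs)
qed

lemma mul_has_derivative_0:
 assumes "(f has_derivative f') (at 0)" "(g has_derivative g') (at 0)" "f 0 = 0" "g 0 = 0"
 shows "((%x. mul (f x) (g x)) has_derivative (%v. f' v + g' v)) (at 0)"
 using has_derivative_compose[OF has_derivative_Pair[OF assms(1,2)], of "%p. mul (fst p) (snd p)" "%v. fst v + snd v"]
  mul_deriv_0 assms(3,4) by simp

lemma tang_subspace: "subspace tang"
proof (rule subspaceI)
 show "0 \<in> tang" unfolding tang_def using \<Gamma>_0 by (auto intro!: exI[of _ "%s. 0"])
 fix u v assume "u \<in> tang" "v \<in> tang"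
 then obtain c d where c: "continuous_on UNIV c" "!!s. c s \<in> \<Gamma>" "c 0 = 0" "(c has_derivative (%h. h *\<^sub>R u)) (at (0::real))"
  and d: "continuous_on UNIV d" "!!s. d s \<in> \<Gamma>" "d 0 = 0" "(d has_derivative (%h. h *\<^sub>R v)) (at (0::real))"
  unfolding tang_def by blast
 have "((%s. mul (c s) (d s)) has_derivative (%h. h *\<^sub>R (u + v))) (at 0)"
  using mul_has_derivative_0[OF c(4) d(4) c(3) d(3)] by (simp add: scaleR_add_right)
 thus "u + v \<in> tang" unfolding tang_def using c d by (auto intro!: exI[of _ "%s. mul (c s) (d s)"] mul_cont \<Gamma>_mul)
next
 fix k v assume "v \<in> tang"
 then obtain c where c: "continuous_on UNIV c" "!!s. c s \<in> \<Gamma>" "c 0 = 0" "(c has_derivative (%h. h *\<^sub>R v)) (at (0::real))"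
  unfolding tang_def by blast
 have "((%s. k * s) has_derivative (%h. k * h)) (at (0::real))" by (auto intro!: derivative_eq_intros)
 from has_derivative_compose[OF this, of c "%h. h *\<^sub>R v"] c(4)
 have "((%s. c (k * s)) has_derivative (%h. h *\<^sub>R (k *\<^sub>R v))) (at 0)" by (simp add: mult.commute)
 thus "k *\<^sub>R v \<in> tang" unfolding tang_def
  using c by (auto intro!: exI[of _ "%s. c (k * s)"] continuous_on_compose2[OF c(1)] continuous_intros)
qed

lemma tang_horizontal: "b \<in> Basis ==> w b = 1 ==> b \<in> tang" unfolding tang_def
 using Ef_cont[of b 0 0] \<Gamma>_Ef[OF _ _ \<Gamma>_0] Ef_deriv[of b 0 0]
 by (auto intro!: exI[of _ "%s. Ef b s 0"] simp: has_vector_derivative_def Vf_0)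

lemma Am_0_deriv:
 assumes "f \<in> sf" shows "((%z. f (Phi z)) has_derivative (%v. \<Sum>b\<in>Basis. (v \<bullet> b) * tv (y b) f 0)) (at 0)"
proof -
 have "(\<Sum>k\<in>Basis. Am 0 b k * tv (y k) f 0) = tv (y b) f 0" if "b \<in> Basis" for b
  using that by (simp add: hmD(2)[OF Am(1)] inner_Basis if_distrib[of "%x. x * _"] cong: if_cong)
 thus ?thesis using Am(2)[OF assms, of 0] by simp
qed

text \<open>Conjugation by \<open>Ef k t 0\<close> maps \<open>\<Gamma>\<close> into itself and
  fixes the origin, so its derivative there preserves \<open>tang\<close>; in coordinates this
  derivative is given by the matrix \<open>Bm k t\<close>.\<close>

lemma tang_Ad:
 assumes k: "k \<in> Basis" "w k = 1" and v: "v \<in> tang"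
 shows "(\<Sum>j\<in>Basis. (\<Sum>b\<in>Basis. (v \<bullet> b) * Bm k t b j) *\<^sub>R j) \<in> tang"
proof -
 obtain c where c: "continuous_on UNIV c" "!!s. c s \<in> \<Gamma>" "c 0 = 0" "(c has_derivative (%h. h *\<^sub>R v)) (at (0::real))"
  using v unfolding tang_def by blast
 define Q where "Q x = mul (Ef k (- t) 0) (Ef k t x)" for x
 have sQ: "smooth Q"
 proof -
  have "smooth (%x. Ef k (fst (t, x)) (snd (t, x)))" by (rule smooth_compose[OF open_UNIV _ Ef_smooth[OF k(1)]]) (auto intro!: smooth_Pair)
  thus ?thesis unfolding Q_def[abs_def] by (intro mul_smooth) auto
 qed
 have Q0: "Q 0 = 0"
 proof -
  have "Q 0 = Ef k t (Ef k (- t) 0)" using Ef_right[OF k(1), of t "Ef k (- t) 0"] by (simp add: Q_def)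
  thus ?thesis using Ef_add[OF k(1), of t "- t" 0] k(1) by simp
 qed
 let ?L = "fderiv Q 0"
 have L: "(Q has_derivative ?L) (at 0)" by (rule smooth_D[OF sQ]) simp
 have PhQ: "Phi (Q x) = - ep (y k) t + Phi x + ep (y k) t" for x using k by (simp add: Q_def Phi_mul Phi_Ef ep_minus add.assoc)
 have Lv: "?L v \<bullet> j = (\<Sum>b\<in>Basis. (v \<bullet> b) * Bm k t b j)" if "j \<in> Basis" for j
 proof -
  have "(\<Sum>j\<in>Basis. (?L v \<bullet> j - (\<Sum>b\<in>Basis. (v \<bullet> b) * Bm k t b j)) * tv (y j) f 0) = 0" if f: "f \<in> sf" for f
  proof -
   define g where "g x = f (- ep (y k) t + x + ep (y k) t)" for x
   have g: "g \<in> sf" unfolding g_def[abs_def] by (rule sf_translate[OF f])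
   have e1: "((%x. f (Phi (Q x))) has_derivative (%v. \<Sum>b\<in>Basis. (?L v \<bullet> b) * tv (y b) f 0)) (at 0)"
    using has_derivative_compose[OF L, of "%z. f (Phi z)"] Am_0_deriv[OF f] Q0 by simp
   have e2: "((%x. f (Phi (Q x))) has_derivative (%v. \<Sum>b\<in>Basis. (v \<bullet> b) * tv (y b) g 0)) (at 0)"
    using Am_0_deriv[OF g] by (simp add: PhQ g_def)
   have "(\<Sum>b\<in>Basis. (?L v \<bullet> b) * tv (y b) f 0) = (\<Sum>b\<in>Basis. (v \<bullet> b) * tv (y b) g 0)"
    using fun_cong[OF has_derivative_unique[OF e1 e2], of v] .
   also have "... = (\<Sum>b\<in>Basis. \<Sum>j\<in>Basis. (v \<bullet> b) * (Bm k t b j * tv (y j) f 0))"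
   proof (rule sum.cong[OF refl])
    fix b :: 'e assume b: "b \<in> Basis"
    have "tv (y b) g 0 = tv (y b) (%x. f (x + ep (y k) t)) (- ep (y k) t)"
     using tv_left[of "y b" "%x. f (x + ep (y k) t)" "- ep (y k) t" 0] by (simp add: g_def[abs_def])
    also have "... = (\<Sum>j\<in>Basis. Bm k t b j * tv (y j) f 0)" by (simp add: Ad_matrix[OF f k(1) b])
    finally show "(v \<bullet> b) * tv (y b) g 0 = (\<Sum>j\<in>Basis. (v \<bullet> b) * (Bm k t b j * tv (y j) f 0))"
     by (simp add: sum_distrib_left)
   qed
   also have "... = (\<Sum>j\<in>Basis. (\<Sum>b\<in>Basis. (v \<bullet> b) * Bm k t b j) * tv (y j) f 0)"
    by (subst sum.swap) (simp add: sum_distrib_right mult.assoc)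
   finally show ?thesis by (simp add: left_diff_distrib sum_subtractf)
  qed
  from tv_y_independent[OF this that] show ?thesis by simp
 qed
 have "?L v = (\<Sum>j\<in>Basis. (\<Sum>b\<in>Basis. (v \<bullet> b) * Bm k t b j) *\<^sub>R j)"
  by (rule euclidean_eqI) (simp add: Lv inner_sum_left_Basis)
 moreover have "?L v \<in> tang"
 proof -
  have "((%s. Q (c s)) has_derivative (%h. h *\<^sub>R ?L v)) (at 0)"
   using has_derivative_compose[OF c(4), of Q ?L] L c(3) linear_scale[OF has_derivative_linear[OF L]] by simp
  moreover have "Q (c s) \<in> \<Gamma>" for s unfolding Q_def by (intro \<Gamma>_mul \<Gamma>_Ef k \<Gamma>_0 c)
  moreover have "continuous_on UNIV (%s. Q (c s))" by (rule continuous_on_compose2[OF smooth_continuous[OF sQ] c(1)]) simp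
  ultimately show ?thesis unfolding tang_def using c(3) Q0 by (auto intro!: exI[of _ "%s. Q (c s)"])
 qed
 ultimately show ?thesis by simp
qed

text \<open>The bracket is the derivative at \<open>t = 0\<close> of the curve that
  \<open>tang_Ad\<close> provides. The difference quotients lie in \<open>tang\<close>, which as a
  subspace of a finite-dimensional space is closed.\<close>

lemma tang_bracket:
 assumes k: "k \<in> Basis" "w k = 1" and v: "kap x \<in> tang"
 shows "kap (br x (y k)) \<in> tang"
proof -
 define v where "v = kap x"
 define g where "g t = (\<Sum>j\<in>Basis. (\<Sum>b\<in>Basis. (v \<bullet> b) * Bm k t b j) *\<^sub>R j)" for t
 have gt: "g t \<in> tang" for t unfolding g_def by (rule tang_Ad[OF k]) (use v in \<open>simp add: v_def\<close>)
 have dB: "((%t. Bm k t b j) has_real_derivative kap (adm k 1 b) \<bullet> j) (at 0)" if "b \<in> Basis" for b j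
 proof -
  have "((%t. \<Sum>m<l. (kap (adm k m b) \<bullet> j) / fact m * t ^ m) has_real_derivative
    (\<Sum>m<l. (kap (adm k m b) \<bullet> j) / fact m * (real m * 0 ^ (m - 1)))) (at 0)"
   by (auto intro!: derivative_eq_intros simp: algebra_simps)
  also have "(\<Sum>m<l. (kap (adm k m b) \<bullet> j) / fact m * (real m * 0 ^ (m - 1))) = (\<Sum>m<l. if m = 1 then kap (adm k 1 b) \<bullet> j else 0)"
   by (rule sum.cong) (auto simp: power_0_left)
  also have "... = kap (adm k 1 b) \<bullet> j"
  proof (cases "1 < l")
   \<comment> \<open>For \<open>l = 1\<close> the series in \<open>Bm\<close> has no linear term,
     but then the bracket is zero as well.\<close>
   case False
   hence "l = 1" using w1[OF k(1)] wl[OF k(1)] by simp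
   thus ?thesis using adm_nil[OF k(1) that] by (simp add: linear_0[OF kap_linear])
  qed simp
  finally show ?thesis by (simp add: Bm_def[abs_def])
 qed
 have "(g has_vector_derivative (\<Sum>j\<in>Basis. (\<Sum>b\<in>Basis. (v \<bullet> b) * (kap (adm k 1 b) \<bullet> j)) *\<^sub>R j)) (at 0)"
  unfolding g_def[abs_def]
 proof (rule has_vector_derivative_sum)
  fix j :: 'e assume "j \<in> Basis"
  have "((%t. \<Sum>b\<in>Basis. (v \<bullet> b) * Bm k t b j) has_real_derivative
    (\<Sum>b\<in>Basis. (v \<bullet> b) * (kap (adm k 1 b) \<bullet> j))) (at 0)" by (intro DERIV_sum DERIV_cmult dB)
  from has_vector_derivative_scaleR[OF this has_vector_derivative_const]
  show "((%t. (\<Sum>b\<in>Basis. (v \<bullet> b) * Bm k t b j) *\<^sub>R j) has_vector_derivative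
    (\<Sum>b\<in>Basis. (v \<bullet> b) * (kap (adm k 1 b) \<bullet> j)) *\<^sub>R j) (at 0)" by simp
 qed
 moreover have "(\<Sum>j\<in>Basis. (\<Sum>b\<in>Basis. (v \<bullet> b) * (kap (adm k 1 b) \<bullet> j)) *\<^sub>R j) = kap (br x (y k))"
 proof (rule euclidean_eqI)
  fix j :: 'e assume j: "j \<in> Basis"
  have "br x (y k) = br (\<Sum>b\<in>Basis. (v \<bullet> b) *\<^sub>R y b) (y k)" by (simp add: v_def kap_expand)
  also have "... = (\<Sum>b\<in>Basis. (v \<bullet> b) *\<^sub>R adm k 1 b)"
   by (simp add: linear_sum[OF br_linear1] linear_scale[OF br_linear1] adm_def)
  finally have "kap (br x (y k)) = (\<Sum>b\<in>Basis. (v \<bullet> b) *\<^sub>R kap (adm k 1 b))"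
   by (simp add: linear_sum[OF kap_linear] linear_scale[OF kap_linear])
  thus "(\<Sum>j\<in>Basis. (\<Sum>b\<in>Basis. (v \<bullet> b) * (kap (adm k 1 b) \<bullet> j)) *\<^sub>R j) \<bullet> j = kap (br x (y k)) \<bullet> j"
   using j by (subst inner_sum_left_Basis) (auto simp: inner_sum_left)
 qed
 ultimately have "(g has_vector_derivative kap (br x (y k))) (at 0)" by simp
 hence lim: "((%h. norm (g h - g 0 - h *\<^sub>R kap (br x (y k))) / \<bar>h\<bar>) \<longlongrightarrow> 0) (at 0)"
  by (simp add: has_vector_derivative_def has_derivative_at)
 have "((%h. (g h - g 0) /\<^sub>R h - kap (br x (y k))) \<longlongrightarrow> 0) (at 0)"
 proof (rule tendsto_norm_zero_cancel, rule Lim_transform_eventually[OF lim])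
  have "norm (u - h *\<^sub>R v) / \<bar>h\<bar> = norm (u /\<^sub>R h - v)" if "h ~= 0" for u v :: 'e and h :: real
  proof -
   have "u /\<^sub>R h - v = (u - h *\<^sub>R v) /\<^sub>R h" using that by (simp add: scaleR_diff_right)
   thus ?thesis by (simp add: divide_inverse mult.commute)
  qed
  thus "\<forall>\<^sub>F h in at 0. norm (g h - g 0 - h *\<^sub>R kap (br x (y k))) / \<bar>h\<bar> = norm ((g h - g 0) /\<^sub>R h - kap (br x (y k)))"
   by (auto simp: eventually_at_filter)
 qed
 hence "((%h. (g h - g 0) /\<^sub>R h) \<longlongrightarrow> kap (br x (y k))) (at 0)" by (rule LIM_zero_cancel)
 thus ?thesis by (rule Lim_in_closed_set[OF closed_subspace[OF tang_subspace], rotated 2])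
   (use gt in \<open>auto intro!: always_eventually subspace_scale[OF tang_subspace] subspace_diff[OF tang_subspace]\<close>)
qed

lemma tang_UNIV: "b \<in> Basis ==> b \<in> tang"
proof -
 have "k \<in> Basis ==> w k = Suc m ==> kap (y k) \<in> tang" for k m
 proof (induction m arbitrary: k)
  case 0
  thus ?case by (simp add: kap_y tang_horizontal)
 next
  case (Suc m)
  have "y k \<in> span {br (y j) (y i) |i j. i \<in> Basis & j \<in> Basis & w j = Suc m & w i = 1}" by (rule gen) (use Suc in auto)
  thus ?case
  proof (induction rule: span_induct_alt)
   case base
   thus ?case using subspace_0[OF tang_subspace] by (simp add: linear_0[OF kap_linear])
  next
   case (step c x v)
   then obtain i j where "x = br (y j) (y i)" "i \<in> Basis" "j \<in> Basis" "w j = Suc m" "w i = 1" by blast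
   hence "kap x \<in> tang" using tang_bracket Suc.IH by blast
   thus ?case using step
    by (simp add: linear_add[OF kap_linear] linear_scale[OF kap_linear] subspace_add[OF tang_subspace] subspace_scale[OF tang_subspace])
  qed
 qed
 note this[of b "w b - 1"]
 moreover assume "b \<in> Basis"
 ultimately show ?thesis using w1[of b] by (simp add: kap_y)
qed

text \<open>A product of curves in \<open>\<Gamma>\<close> tangent to the basis vectors is a
  continuous map of the coordinate space into \<open>\<Gamma>\<close> with derivative the identity
  at 0. The open mapping theorem for maps differentiable at a single point makes
  \<open>\<Gamma>\<close> a neighbourhood of the origin, and dilations spread it over the whole
  space.\<close>

lemma chow: "EX T. hreach 0 T z"
proof -
 have "EX c. continuous_on UNIV c & (\<forall>s::real. c s \<in> \<Gamma>) & c 0 = 0 & (c has_derivative (%h. h *\<^sub>R b)) (at 0)"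
  if "b \<in> Basis" for b using tang_UNIV[OF that] unfolding tang_def by blast
 then obtain c where c: "!!b. b \<in> Basis ==> continuous_on UNIV (c b)" "!!b s. b \<in> Basis ==> c b (s::real) \<in> \<Gamma>"
  "!!b. b \<in> Basis ==> c b 0 = 0" "!!b. b \<in> Basis ==> (c b has_derivative (%h. h *\<^sub>R b)) (at 0)" by metis
 define \<Theta> where "\<Theta> L \<tau> = foldr (%b x. mul (c b (\<tau> \<bullet> b)) x) L 0" for L \<tau>
 have \<Theta>: "continuous_on UNIV (\<Theta> L) & (\<forall>\<tau>. \<Theta> L \<tau> \<in> \<Gamma>) & \<Theta> L 0 = 0 & (\<Theta> L has_derivative (%v. \<Sum>b\<in>set L. (v \<bullet> b) *\<^sub>R b)) (at 0)"
  if "set L \<subseteq> Basis" "distinct L" for L using that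
 proof (induction L)
  case Nil
  thus ?case using \<Gamma>_0 by (simp add: \<Theta>_def[abs_def])
 next
  case (Cons b L)
  have b: "b \<in> Basis" using Cons by simp
  have eq: "\<Theta> (b # L) = (%\<tau>. mul (c b (\<tau> \<bullet> b)) (\<Theta> L \<tau>))" by (simp add: \<Theta>_def[abs_def])
  have c1: "continuous_on UNIV (%\<tau>. c b (\<tau> \<bullet> b))"
   by (rule continuous_on_compose2[OF c(1)[OF b]]) (auto intro!: continuous_intros)
  have "continuous_on UNIV (%p. mul (fst p) (snd p))" by (rule smooth_continuous[OF mul_smooth]) auto
  from continuous_on_compose2[OF this continuous_on_Pair[OF c1, of "\<Theta> L"]] Cons
  have "continuous_on UNIV (\<Theta> (b # L))" by (simp add: eq)
  moreover have "((%\<tau>. \<tau> \<bullet> b) has_derivative (%v. v \<bullet> b)) (at 0)" by (auto intro!: derivative_eq_intros)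
  from has_derivative_compose[OF this, of "c b" "%h. h *\<^sub>R b"] c(4)[OF b]
  have "((%\<tau>. c b (\<tau> \<bullet> b)) has_derivative (%v. (v \<bullet> b) *\<^sub>R b)) (at 0)" by simp
  from mul_has_derivative_0[OF this, of "\<Theta> L"] Cons c(3)[OF b]
  have "(\<Theta> (b # L) has_derivative (%v. (v \<bullet> b) *\<^sub>R b + (\<Sum>b\<in>set L. (v \<bullet> b) *\<^sub>R b))) (at 0)"
   by (simp add: eq)
  ultimately show ?case using Cons c(2,3)[OF b] by (auto simp: eq intro!: \<Gamma>_mul)
 qed
 have 1: "continuous_on UNIV (\<Theta> bs)" "!!\<tau>. \<Theta> bs \<tau> \<in> \<Gamma>" "\<Theta> bs 0 = 0" "(\<Theta> bs has_derivative id) (at 0)"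
  using \<Theta>[of bs] bs by (auto simp: euclidean_representation id_def)
 have "\<Theta> bs 0 \<in> interior (\<Theta> bs ` UNIV)"
  by (rule sussmann_open_mapping[OF open_UNIV 1(1) _ 1(4) bounded_linear_ident]) (auto simp: fun_eq_iff)
 moreover have "range (\<Theta> bs) \<subseteq> \<Gamma>" using 1(2) by auto
 from interior_mono[OF this] have "interior (range (\<Theta> bs)) \<subseteq> interior \<Gamma>" .
 ultimately have "0 \<in> interior \<Gamma>" unfolding 1(3) by (rule rev_subsetD)
 then obtain d where d: "d > 0" "ball 0 d \<subseteq> \<Gamma>" using mem_interior by blast
 have "\<forall>\<^sub>F r in at_right 0. dist (dil r z) 0 < d" by (rule tendstoD[OF dil_tendsto d(1)])
 then obtain r where r: "r > 0" "norm (dil r z) < d" unfolding eventually_at_right_field by (auto simp: dist_norm dest: dense)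
 hence "dil r z \<in> \<Gamma>" using d(2) by auto
 from \<Gamma>_dil[OF this, of "1 / r"] have "dil (1 / r) (dil r z) \<in> \<Gamma>" using r by simp
 thus ?thesis using dil_inverse(2)[OF r(1)] by (simp add: \<Gamma>_def)
qed

lemma Phi_open: "open (range Phi)" unfolding open_subopen[of "range Phi"]
proof
 fix x assume "x \<in> range Phi"
 then obtain z where z: "x = Phi z" by blast
 obtain U phi where U: "(U, phi) \<in> A" "Phi z \<in> U" using chart_exists[OF pa] by blast
 note c = chartD[OF pa U(1)]
 have cP: "continuous_on UNIV Phi" by (rule smooth_map_on_continuous[OF Phi_smooth])
 obtain r where r: "r > 0" "inj_on Phi (ball z r)" using Phi_locally_injective by blast
 define B where "B = ball z r \<inter> Phi -` U"
 have oB: "open B" unfolding B_def by (intro open_Int open_ball open_vimage c(1) cP)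
 have "continuous_on B (%x. phi (Phi x))" by (rule continuous_on_compose2[OF c(4) continuous_on_subset[OF cP]]) (auto simp: B_def)
 moreover have "inj_on (%x. phi (Phi x)) B" using r(2) c(3) by (auto simp: B_def inj_on_def)
 ultimately have "open ((%x. phi (Phi x)) ` B)" using invariance_of_domain oB by blast
 from continuous_open_preimage[OF c(4,1) this]
 have "open (U \<inter> phi -` ((%x. phi (Phi x)) ` B))" .
 moreover have "U \<inter> phi -` ((%x. phi (Phi x)) ` B) \<subseteq> range Phi" using c(3) by (auto simp: B_def inj_on_def)
 moreover have "x \<in> U \<inter> phi -` ((%x. phi (Phi x)) ` B)" using z U r by (auto simp: B_def)
 ultimately show "EX T. open T & x \<in> T & T \<subseteq> range Phi" by blast
qed

text \<open>The range is an open subgroup, and its complement, a union of cosets, is open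
  too.\<close>

lemma Phi_surj:
 assumes "connected (UNIV :: 'a set)" shows "surj Phi"
proof -
 let ?R = "range Phi"
 have "open (- ?R)" unfolding open_subopen[of "- ?R"]
 proof
  fix x assume x: "x \<in> - ?R"
  have "open ((%z. - x + z) -` ?R)" by (rule open_vimage[OF Phi_open]) (intro continuous_intros)
  moreover have "x \<in> (%z. - x + z) -` ?R" using rangeI[of Phi 0] by simp
  moreover have "(%z. - x + z) -` ?R \<subseteq> - ?R"
  proof (intro subsetI ComplI)
   fix z assume "z \<in> (%z. - x + z) -` ?R" "z \<in> ?R"
   then obtain a b where "- x + z = Phi a" "z = Phi b" by auto
   hence "x + Phi a = Phi b" by (simp add: add.assoc[symmetric]) (metis add.assoc add.right_inverse add_0)
   hence "x = Phi b - Phi a" by (metis add_diff_cancel)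
   hence "x = Phi (mul b (ginv a))" by (simp add: Phi_mul Phi_ginv)
   thus False using x by auto
  qed
  ultimately show "EX T. open T & x \<in> T & T \<subseteq> - ?R" by blast
 qed
 from connectedD[OF assms Phi_open this] have "?R = {} \<or> - ?R = {}" by auto
 thus ?thesis by auto
qed

end

section \<open>Integration in homogeneous coordinates\<close>

definition csupp :: "('e::euclidean_space => real) => bool" where
 "csupp f \<longleftrightarrow> (EX K. compact K & (ALL x. x \<notin> K --> f x = 0))"

lemma csupp_mult1: "csupp f ==> csupp (%x. f x * g x)" and csupp_mult2: "csupp f ==> csupp (%x. g x * f x)" unfolding csupp_def by auto

lemma csupp_add: "csupp f ==> csupp g ==> csupp (%x. f x + g x)" unfolding csupp_def by (metis Un_iff add_0 compact_Un)

lemma csupp_diff: "csupp f ==> csupp g ==> csupp (%x. f x - g x)" unfolding csupp_def by (metis Un_iff diff_self compact_Un)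

lemma csupp_sum: "(!!i. i \<in> I ==> csupp (f i)) ==> csupp (%x. \<Sum>i\<in>I. f i x)"
proof (induction I rule: infinite_finite_induct)
 case (insert i I) thus ?case by (simp add: csupp_add)
qed (auto simp: csupp_def intro!: exI[of _ "{}"])

lemma csupp_power: "csupp f ==> n > 0 ==> csupp (%x. f x ^ n)" unfolding csupp_def by (metis power_eq_0_iff)

lemma csupp_mono: "csupp f ==> (!!x. f x = 0 ==> g x = 0) ==> csupp g" unfolding csupp_def by metis

lemma csupp_comp:
 fixes f :: "'e::euclidean_space => real"
 assumes "csupp f" "continuous_on UNIV S" "!!x. S (T x) = x"
 shows "csupp (%x. f (T x))"
proof -
 obtain K where K: "compact K" "!!x. x \<notin> K ==> f x = 0" using assms(1) unfolding csupp_def by blast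
 have "compact (S ` K)" by (rule compact_continuous_image[OF continuous_on_subset[OF assms(2)] K(1)]) simp
 moreover have "f (T x) = 0" if "x \<notin> S ` K" for x using K(2)[of "T x"] that assms(3)[of x] by (metis image_eqI)
 ultimately show ?thesis unfolding csupp_def by blast
qed

lemma csupp_integrable:
 fixes f :: "'e::euclidean_space => real"
 assumes "continuous_on UNIV f" "csupp f" shows "integrable lborel f"
proof -
 obtain K where K: "compact K" "!!x. x \<notin> K ==> f x = 0" using assms(2) unfolding csupp_def by blast
 have "integrable lborel (%x. indicator K x *\<^sub>R f x)"
  by (rule borel_integrable_compact[OF K(1) continuous_on_subset[OF assms(1)]]) simp
 moreover have "(%x. indicator K x *\<^sub>R f x) = f" using K(2) by (auto simp: fun_eq_iff indicator_def)
 ultimately show ?thesis by simp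
qed

lemma integral_csupp_box:
 fixes f :: "'e::euclidean_space => real"
 assumes "continuous_on UNIV f" "!!x. x \<notin> cbox a b ==> f x = 0"
 shows "integral\<^sup>L lborel f = integral (cbox a b) f"
proof -
 have "csupp f" unfolding csupp_def using assms(2) compact_cbox by blast
 from integral_lborel[OF csupp_integrable[OF assms(1) this]]
 have "integral\<^sup>L lborel f = integral UNIV f" by simp
 also have "... = integral UNIV (%x. if x \<in> cbox a b then f x else 0)" by (rule integral_cong) (use assms(2) in auto)
 also have "... = integral (cbox a b) f" by (rule integral_restrict_UNIV)
 finally show ?thesis .
qed

lemma integral_deriv_param:
 fixes g :: "real \<times> 'e::euclidean_space => real"
 assumes I: "open I" "t0 \<in> I" and g: "smooth_on (I \<times> UNIV) g"
  and K: "compact K" "!!t z. t \<in> I ==> z \<notin> K ==> g (t, z) = 0"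
  and d: "!!z. ((%t. g (t, z)) has_real_derivative g' z) (at t0)"
 shows "((%t. LBINT z. g (t, z)) has_real_derivative (LBINT z. g' z)) (at t0)"
  and "continuous_on UNIV g'" "!!z. z \<notin> K ==> g' z = 0"
proof -
 obtain a b where ab: "K \<subseteq> cbox a b" using bounded_subset_cbox_symmetric[OF compact_imp_bounded[OF K(1)]] by metis
 have g'eq: "g' z = fderiv g (t0, z) (1, 0)" for z
 proof -
  have "(g has_derivative fderiv g (t0, z)) (at (t0, z))" by (rule smooth_D[OF g]) (use I in auto)
  from real_derivI[OF has_derivative_partial(1)[OF this]] DERIV_unique[OF d] show ?thesis by auto
 qed
 have sm: "smooth_on (I \<times> UNIV) (%p. fderiv g p (1, 0))" by (rule smooth_frechet[OF g])
 show c': "continuous_on UNIV g'" unfolding g'eq[abs_def]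
  by (rule continuous_on_compose2[OF smooth_continuous[OF sm]]) (use I in \<open>auto intro!: continuous_intros\<close>)
 show z': "g' z = 0" if "z \<notin> K" for z
 proof -
  have "((%t. 0) has_real_derivative 0) (at t0)" by simp
  hence "((%t. g (t, z)) has_real_derivative 0) (at t0)"
   by (rule has_field_derivative_transform_within_open[OF _ I]) (use K(2) that in auto)
  from DERIV_unique[OF d this] show ?thesis .
 qed
 have "((%t. integral (cbox a b) (%z. g (t, z))) has_derivative (%v. integral (cbox a b) (%z. fderiv g (t0, z) (v, 0)))) (at t0)"
  by (rule integral_param_has_derivative[OF I(1) _ _ _ I(2)])
   (use g I open_Times[OF I(1) open_UNIV] in \<open>auto simp: smooth_on_def simp del: Ck_on.simps\<close>)
 from real_derivI[OF this]
 have "((%t. integral (cbox a b) (%z. g (t, z))) has_real_derivative integral (cbox a b) g') (at t0)" by (simp add: g'eq[abs_def])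
 moreover have "integral (cbox a b) g' = integral\<^sup>L lborel g'" by (rule integral_csupp_box[symmetric, OF c']) (use z' ab in blast)
 moreover have "integral (cbox a b) (%z. g (t, z)) = integral\<^sup>L lborel (%z. g (t, z))" if "t \<in> I" for t
 proof (rule integral_csupp_box[symmetric])
  show "continuous_on UNIV (%z. g (t, z))"
   by (rule continuous_on_compose2[OF smooth_continuous[OF g]]) (use that in \<open>auto intro!: continuous_intros\<close>)
  show "!!x. x \<notin> cbox a b ==> g (t, x) = 0" using K(2)[OF that] ab by blast
 qed
 ultimately show "((%t. LBINT z. g (t, z)) has_real_derivative (LBINT z. g' z)) (at t0)"
  by (auto intro: has_field_derivative_transform_within_open[OF _ I])
qed

lemma integral_translate:
 fixes q :: "'e::euclidean_space => real"
 assumes "continuous_on UNIV q" shows "(LBINT z. q (c + z)) = integral\<^sup>L lborel q"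
proof -
 have [measurable]: "q \<in> borel_measurable borel" using assms by (rule borel_measurable_continuous_onI)
 have "integral\<^sup>L (distr lborel borel ((+) c)) q = (LBINT z. q (c + z))" by (rule integral_distr) auto
 thus ?thesis by (simp add: lborel_distr_plus)
qed

text \<open>The integral of a translate does not depend on the translation; differentiate it at
  0.\<close>

lemma integral_partial_zero:
 fixes q :: "'e::euclidean_space => real"
 assumes q: "smooth q" "csupp q"
 shows "(LBINT z. fderiv q z v) = 0"
proof -
 obtain K where K: "compact K" "!!x. x \<notin> K ==> q x = 0" using q(2) unfolding csupp_def by blast
 let ?K = "{x - y |x y. x \<in> K & y \<in> (%t. t *\<^sub>R v) ` {-1..1::real}}"
 have cK: "compact ?K" by (intro compact_differences K compact_continuous_image) (auto intro!: continuous_intros)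
 let ?g = "%p. q (fst p *\<^sub>R v + snd p)"
 have "((%t. LBINT z. ?g (t, z)) has_real_derivative (LBINT z. fderiv q z v)) (at 0)"
 proof (rule integral_deriv_param(1)[of "{-1<..<1}" 0 ?g ?K])
  show "smooth_on ({-1<..<1} \<times> UNIV) ?g" by (rule smooth_compose[OF _ _ q(1)])
    (auto intro!: smooth_on_add smooth_scaleR smooth_fst smooth_snd open_Times)
  show "?g (t, z) = 0" if "t \<in> {-1<..<1}" "z \<notin> ?K" for t z
  proof (rule ccontr)
   assume "?g (t, z) ~= 0"
   hence "t *\<^sub>R v + z \<in> K" using K(2) by auto
   hence "z \<in> ?K" using that(1) by (intro CollectI exI[of _ "t *\<^sub>R v + z"] exI[of _ "t *\<^sub>R v"]) auto
   thus False using that by blast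
  qed
  show "((%t. ?g (t, z)) has_real_derivative fderiv q z v) (at 0)" for z using frechet_line[of q "fderiv q z" z 0 v] smooth_D[OF q(1), of z]
   by (simp add: has_real_derivative_iff_has_vector_derivative add.commute)
 qed (use cK in auto)
 moreover have "(%t. LBINT z. ?g (t, z)) = (%t. integral\<^sup>L lborel q)" using integral_translate[OF smooth_continuous[OF q(1)]] by auto
 ultimately show ?thesis using DERIV_unique[OF DERIV_const] by metis
qed

lemma smooth_Pair_const: "smooth (Pair s)" using smooth_Pair[OF open_UNIV smooth_const smooth_id, of s] by simp

lemma frechet_mult:
 fixes f g :: "'e::euclidean_space => real"
 assumes "smooth f" "smooth g"
 shows "fderiv (%z. f z * g z) z v = f z * fderiv g z v + fderiv f z v * g z"
 using frechet_derivative_at[OF has_derivative_mult[OF smooth_D[OF assms(1)] smooth_D[OF assms(2)]], of z, symmetric] by simp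

lemma frechet_expand:
 fixes f :: "'e::euclidean_space => real"
 assumes "smooth f"
 shows "fderiv f z v = (\<Sum>c\<in>Basis. (v \<bullet> c) * fderiv f z c)"
proof -
 have lin: "linear (fderiv f z)" using smooth_D[OF assms, of z] has_derivative_linear by blast
 have "fderiv f z v = fderiv f z (\<Sum>c\<in>Basis. (v \<bullet> c) *\<^sub>R c)" by (simp add: euclidean_representation)
 thus ?thesis by (simp add: linear_sum[OF lin] linear_scale[OF lin])
qed

lemma csupp_frechet:
 fixes f :: "'e::euclidean_space => real"
 assumes "csupp f" shows "csupp (%z. fderiv f z (V z))"
proof -
 obtain K where K: "compact K" "!!x. x \<notin> K ==> f x = 0" using assms unfolding csupp_def by blast
 have "fderiv f z v = 0" if "z \<notin> K" for z v
 proof -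
  have "((%x. 0) has_derivative (%v. 0)) (at z)" by simp
  hence "(f has_derivative (%v. 0)) (at z)" by (rule has_derivative_transform_within_open[of _ _ _ _ "- K"])
    (use K that in \<open>auto simp: compact_imp_closed open_Compl\<close>)
  from frechet_derivative_at[OF this] show ?thesis by metis
 qed
 thus ?thesis using K(1) unfolding csupp_def by blast
qed

context weights
begin

definition Q :: nat where "Q = (\<Sum>b\<in>Basis. w b)"

lemma dil_cont: "continuous_on S (dil r)" and dil_smooth: "smooth_on S (dil r)"
 using dil_linear linear_conv_bounded_linear linear_continuous_on smooth_bounded_linear by blast+

lemma integral_dil:
 assumes r: "r > 0" and f: "continuous_on UNIV f"
 shows "(LBINT z. f (dil r z)) = integral\<^sup>L lborel f / r ^ Q"
proof -
 have [measurable]: "f \<in> borel_measurable borel" using f by (rule borel_measurable_continuous_onI)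
 have [measurable]: "dil r \<in> borel_measurable borel" by (rule borel_measurable_continuous_onI[OF dil_cont])
 have eq: "lborel = density (distr lborel borel (dil r)) (%_. (\<Prod>j\<in>Basis. ennreal \<bar>r ^ w j\<bar>))"
  using lborel_affine_euclidean[of "%j. r ^ w j" 0] r by (simp add: dil_def[abs_def] prod_ennreal)
 have "(\<Prod>j\<in>Basis. ennreal \<bar>r ^ w j\<bar>) = ennreal (r ^ Q)" using r by (simp add: prod_ennreal Q_def power_sum)
 hence "integral\<^sup>L lborel f = integral\<^sup>L (density (distr lborel borel (dil r)) (%_. ennreal (r ^ Q))) f" using eq by simp
 also have "... = (\<integral>z. r ^ Q *\<^sub>R f z \<partial>(distr lborel borel (dil r)))" using r by (intro integral_density) auto
 also have "... = (LBINT z. r ^ Q *\<^sub>R f (dil r z))" by (rule integral_distr) auto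
 finally show ?thesis using r by simp
qed

text \<open>A homogeneous one-parameter group of positive degree preserves Lebesgue measure: by
 homogeneity its generator is divergence free.\<close>

lemma flow_preserves_integral:
 fixes T :: "real => 'e => 'e"
 assumes T: "smooth (%p. T (fst p) (snd p))" and T0: "!!z. T 0 z = z"
  and Tadd: "!!s t z. T (s + t) z = T s (T t z)"
  and Tdil: "!!r s z. r > 0 ==> dil r (T s z) = T (r ^ k * s) (dil r z)" and k: "k >= 1"
  and f: "smooth f" "csupp f"
 shows "(LBINT z. f (T s z)) = integral\<^sup>L lborel f"
proof -
 let ?T = "%p. T (fst p) (snd p)"
 define V where "V z = fderiv ?T (0, z) (1, 0)" for z
 have TD: "(?T has_derivative fderiv ?T p) (at p)" for p by (rule smooth_D[OF T]) simp
 have V: "((%s. T s z) has_vector_derivative V z) (at 0)" for z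
 proof -
  have lin: "linear (fderiv ?T (0, z))" using TD has_derivative_linear by blast
  have "fderiv ?T (0, z) (h, 0) = h *\<^sub>R V z" for h using linear_scale[OF lin, of h "(1, 0)"] by (simp add: V_def)
  thus ?thesis using has_derivative_partial(1)[OF TD[of "(0, z)"]] by (simp add: has_vector_derivative_def)
 qed
 have sV: "smooth V" unfolding V_def[abs_def] by (rule smooth_frechet_compose[OF _ _ T]) (auto intro!: smooth_Pair)
 have sVc: "smooth (%z. V z \<bullet> c)" for c by (intro smooth_inner sV) auto
 have hom: "r ^ k * (V (dil r z) \<bullet> c) = r ^ w c * (V z \<bullet> c)" if r: "r > 0" and c: "c \<in> Basis" for r z c
 proof -
  have "((%s. T (r ^ k * s) (dil r z)) has_vector_derivative r ^ k *\<^sub>R V (dil r z)) (at 0)"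
   using vector_diff_chain_at[of "%s. r ^ k * s" "r ^ k" 0 "%s. T s (dil r z)" "V (dil r z)"] V
   by (auto simp: o_def has_real_derivative_iff_has_vector_derivative[symmetric] intro!: derivative_eq_intros)
  moreover have "((%s. dil r (T s z)) has_vector_derivative dil r (V z)) (at 0)"
   by (rule bounded_linear.has_vector_derivative[OF linear_conv_bounded_linear[THEN iffD1, OF dil_linear] V])
  ultimately have "r ^ k *\<^sub>R V (dil r z) = dil r (V z)" using vector_derivative_unique_at Tdil[OF r] by simp
  hence "(r ^ k *\<^sub>R V (dil r z)) \<bullet> c = dil r (V z) \<bullet> c" by simp
  thus ?thesis using c by simp
 qed
 have div: "fderiv (%z. V z \<bullet> c) z c = 0" if "c \<in> Basis" for z c by (rule hom_deriv_zero[OF sVc hom]) (use that k in auto)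
 have ibp: "(LBINT z. fderiv h z (V z)) = 0" if h: "smooth h" "csupp h" for h
 proof -
  have p: "smooth (%z. (V z \<bullet> c) * h z)" "csupp (%z. (V z \<bullet> c) * h z)" for c
   using h sVc by (auto intro!: smooth_mult csupp_mult2)
  have "fderiv h z (V z) = (\<Sum>c\<in>Basis. fderiv (%z. (V z \<bullet> c) * h z) z c)" for z
   using frechet_expand[OF h(1), of z "V z"] by (simp add: frechet_mult[OF sVc h(1)] div)
  hence "(LBINT z. fderiv h z (V z)) = (\<Sum>c\<in>Basis. LBINT z. fderiv (%z. (V z \<bullet> c) * h z) z c)"
   by (simp add: lint_sum csupp_integrable smooth_continuous[OF smooth_frechet[OF p(1)]] csupp_frechet[OF p(2)])
  thus ?thesis by (simp add: integral_partial_zero[OF p])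
 qed
 obtain K where K: "compact K" "!!x. x \<notin> K ==> f x = 0" using f(2) unfolding csupp_def by blast
 have inv: "T (- t) (T t z) = z" for t z using Tadd[of "- t" t z] T0 by simp
 have cT: "continuous_on UNIV ?T" by (rule smooth_continuous[OF T])
 \<comment> \<open>The group property turns the derivative at time \<open>s\<close> into the
   derivative at time 0 for the test function \<open>?h\<close>, to which \<open>ibp\<close>
   applies.\<close>
 have "((%s. LBINT z. f (T s z)) has_real_derivative 0) (at s)" for s
 proof -
  let ?h = "%z. f (T s z)"
  have sTs: "smooth (%z. T s z)" using smooth_compose[OF open_UNIV smooth_Pair_const T, of s] by simp
  have h: "smooth ?h" by (rule smooth_compose[OF open_UNIV sTs f(1)]) simp
  have csh: "csupp ?h"
  proof (rule csupp_comp[OF f(2), of "T (- s)"])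
   show "continuous_on UNIV (T (- s))" using continuous_on_compose2[OF cT smooth_continuous[OF smooth_Pair_const], of "- s"] by simp
  qed (rule inv)
  let ?g = "%p. f (T (fst p) (snd p))"
  let ?K = "?T ` ({- s - 1..- s + 1} \<times> K)"
  have "((%t. LBINT z. ?g (t, z)) has_real_derivative (LBINT z. fderiv ?h z (V z))) (at s)"
  proof (rule integral_deriv_param(1)[of "{s - 1<..<s + 1}" s ?g ?K])
   show "smooth_on ({s - 1<..<s + 1} \<times> UNIV) ?g" by (rule smooth_subset[OF smooth_compose[OF open_UNIV T f(1)]]) auto
   show "compact ?K" by (intro compact_continuous_image[OF continuous_on_subset[OF cT]] compact_Times K(1)) auto
   show "?g (t, z) = 0" if "t \<in> {s - 1<..<s + 1}" "z \<notin> ?K" for t z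
   proof (rule ccontr)
    assume "?g (t, z) ~= 0"
    hence "T t z \<in> K" using K(2) by auto
    hence "?T (- t, T t z) \<in> ?K" by (intro imageI) (use that(1) in auto)
    thus False using that(2) inv by simp
   qed
   fix z
   have "((%sig. ?h (T sig z)) has_vector_derivative fderiv ?h z (V z)) (at 0)"
    using vector_derivative_diff_chain_within[OF V[of z], of ?h "fderiv ?h z"]
     has_derivative_at_withinI[OF smooth_D[OF h, of z]] T0 by (simp add: o_def)
   hence "((%sig. f (T (sig + s) z)) has_real_derivative fderiv ?h z (V z)) (at 0)"
    by (simp add: Tadd[symmetric] add.commute has_real_derivative_iff_has_vector_derivative)
   thus "((%t. ?g (t, z)) has_real_derivative fderiv ?h z (V z)) (at s)" using DERIV_shift[of "%t. f (T t z)" _ 0 s] by simp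
  qed auto
  thus ?thesis using ibp[OF h csh] by simp
 qed
 hence "(LBINT z. f (T s z)) = (LBINT z. f (T 0 z))" by (rule DERIV_isconst_all[rule_format, rotated])
 thus ?thesis by (simp add: T0)
qed

end

context strat
begin

lemma Ef_z_smooth: "b \<in> Basis ==> smooth (Ef b s)" using smooth_compose[OF open_UNIV smooth_Pair_const Ef_smooth, of b s] by simp

lemma mul_z_smooth: "smooth (mul a)" and mul_a_smooth: "smooth (%a. mul a z)"
 using mul_smooth[of UNIV "%z. a" "%z. z"] mul_smooth[of UNIV "%z. z" "%a. z"] by auto

lemma smooth_comp_UNIV:
 fixes g :: "'e => 'k::euclidean_space"
 shows "smooth f ==> smooth g ==> smooth (%z. f (g z))" by (rule smooth_compose[OF open_UNIV]) auto

lemma csupp_Ef: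
 assumes b: "b \<in> Basis" and "csupp f" shows "csupp (%z. f (Ef b s z))"
proof (rule csupp_comp[OF assms(2) smooth_continuous[OF Ef_z_smooth[OF b, of "- s"]]])
 show "Ef b (- s) (Ef b s x) = x" for x using Ef_add[OF b, of "- s" s x] b by simp
qed

lemma csupp_left: "csupp f ==> csupp (%z. f (mul a z))" by (rule csupp_comp[OF _ smooth_continuous[OF mul_z_smooth, of "ginv a"]]) auto

lemma csupp_right:
 assumes "csupp f" shows "csupp (%z. f (mul z a))"
 by (rule csupp_comp[OF assms smooth_continuous[OF mul_a_smooth, of "ginv a"]]) (simp add: mul_assoc)

lemma csupp_dil: "r > 0 ==> csupp f ==> csupp (%z. f (dil r z))" by (rule csupp_comp[OF _ dil_cont[of _ "1 / r"]]) (auto simp: dil_inverse)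

lemma integral_Ef:
 assumes b: "b \<in> Basis" and f: "smooth f" "csupp f"
 shows "(LBINT z. f (Ef b s z)) = integral\<^sup>L lborel f"
 by (rule flow_preserves_integral[OF Ef_smooth[OF b] Ef_0[OF b] Ef_add[OF b] Ef_dil[OF b] w1[OF b] f])

text \<open>Left translation by \<open>Ef b s 0\<close> is again a homogeneous one-parameter group,
  of degree \<open>w b\<close>, and every element is a product of such points.\<close>

lemma integral_left:
 assumes f: "smooth f" "csupp f"
 shows "(LBINT z. f (mul a z)) = integral\<^sup>L lborel f"
proof -
 have step: "(LBINT z. f (mul (Ef b s 0) z)) = integral\<^sup>L lborel f"
  if b: "b \<in> Basis" and f: "smooth f" "csupp f" for b s f
 proof (rule flow_preserves_integral[where T="%s z. mul (Ef b s 0) z" and k="w b", OF _ _ _ _ w1[OF b] f])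
  show "smooth (%p. mul (Ef b (fst p) 0) (snd p))" by (intro mul_smooth smooth_compose[OF open_UNIV smooth_fst Ef_path_smooth[OF b]]) auto
  show "mul (Ef b 0 0) z = z" for z using b by simp
  show "mul (Ef b (s + t) 0) z = mul (Ef b s 0) (mul (Ef b t 0) z)" for s t z
   using Ef_add[OF b, of t s 0] Ef_right[OF b, of t "Ef b s 0"] by (simp add: mul_assoc add.commute)
  show "dil r (mul (Ef b s 0) z) = mul (Ef b (r ^ w b * s) 0) (dil r z)" if "r > 0" for r s z using that by (simp add: mul_dil Ef_dil[OF b])
 qed
 have "set L \<subseteq> Basis ==> ALL f. smooth f --> csupp f --> (LBINT z. f (mul x z)) = integral\<^sup>L lborel f ==>
  ALL f. smooth f --> csupp f --> (LBINT z. f (mul (mulL L x a) z)) = integral\<^sup>L lborel f" for L x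
 proof (induction L arbitrary: x)
  case (Cons b L)
  have b: "b \<in> Basis" using Cons.prems by simp
  have "(LBINT z. f (mul (Ef b (a \<bullet> b) x) z)) = integral\<^sup>L lborel f" if f: "smooth f" "csupp f" for f
  proof -
   have "(LBINT z. f (mul (Ef b (a \<bullet> b) x) z)) = (LBINT z. f (mul x (mul (Ef b (a \<bullet> b) 0) z)))"
    using Ef_right[OF b, of "a \<bullet> b" x] by (simp add: mul_assoc)
   also have "... = (LBINT z. f (mul x z))" by (rule step[OF b smooth_comp_UNIV[OF f(1) mul_z_smooth] csupp_left[OF f(2)]])
   finally show ?thesis using Cons.prems(2) f by simp
  qed
  thus ?case using Cons by simp
 qed simp
 from this[of bs 0] bs f show ?thesis by (simp add: mul_def[symmetric])
qed

subsection \<open>Derivatives along the left-invariant fields\<close>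

definition XX :: "'e => ('e => real) => 'e => real" where
 "XX b f z = fderiv f z (Vf b z)"

lemma XX_smooth: "b \<in> Basis ==> smooth f ==> smooth (XX b f)"
 unfolding XX_def[abs_def] by (rule smooth_frechet_compose[of _ UNIV]) (auto intro: Vf_smooth)

lemma XX_csupp: "csupp f ==> csupp (XX b f)" unfolding XX_def[abs_def] by (rule csupp_frechet)

lemma XX_flow:
 assumes b: "b \<in> Basis" and f: "smooth f"
 shows "((%s. f (Ef b s z)) has_real_derivative XX b f (Ef b s z)) (at s)"
 using vector_derivative_diff_chain_within[OF Ef_deriv[OF b, of z s], of f "fderiv f (Ef b s z)"]
  has_derivative_at_withinI[OF smooth_D[OF f, of "Ef b s z"]] by (simp add: o_def XX_def has_real_derivative_iff_has_vector_derivative)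

lemma XX_eqI:
 assumes "b \<in> Basis" "smooth f" "((%s. f (Ef b s z)) has_real_derivative d) (at 0)"
 shows "XX b f z = d" using DERIV_unique[OF XX_flow[OF assms(1,2), of z 0] assms(3)] assms(1) by simp

lemma XX_left:
 assumes b: "b \<in> Basis" and f: "smooth f"
 shows "XX b (%z. f (mul a z)) z = XX b f (mul a z)" by (rule XX_eqI[OF b smooth_comp_UNIV[OF f mul_z_smooth]])
  (use XX_flow[OF b f, of "mul a z" 0] b in \<open>simp add: Ef_mul\<close>)

lemma XX_dil:
 assumes b: "b \<in> Basis" and f: "smooth f" and r: "r > 0"
 shows "XX b (%z. f (dil r z)) z = r ^ w b * XX b f (dil r z)"
proof (rule XX_eqI[OF b smooth_comp_UNIV[OF f dil_smooth]])
 have "((%s. f (Ef b (r ^ w b * s) (dil r z))) has_real_derivative XX b f (dil r z) * r ^ w b) (at 0)"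
  using DERIV_chain2[of "%s. f (Ef b s (dil r z))" "XX b f (dil r z)" "%s. r ^ w b * s" 0 "r ^ w b"]
   XX_flow[OF b f, of "dil r z" 0] b by (auto intro!: derivative_eq_intros)
 thus "((%s. f (dil r (Ef b s z))) has_real_derivative r ^ w b * XX b f (dil r z)) (at 0)" by (simp add: Ef_dil[OF b r] mult.commute)
qed

lemma XX_mult:
 "smooth f ==> smooth g ==> XX b (%z. f z * g z) z = f z * XX b g z + XX b f z * g z" by (simp add: XX_def frechet_mult)

lemma XX_chain:
 fixes g :: "real => real"
 assumes b: "b \<in> Basis" and f: "smooth f" and g: "smooth g" "(g has_real_derivative d) (at (f z))"
 shows "XX b (%z. g (f z)) z = d * XX b f z" by (rule XX_eqI[OF b smooth_compose[OF open_UNIV f g(1)]])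
  (use DERIV_chain2[OF _ XX_flow[OF b f, of z 0], of g d] g(2) b in auto)

lemma integral_XX:
 assumes b: "b \<in> Basis" and f: "smooth f" "csupp f"
 shows "(LBINT z. XX b f z) = 0"
proof -
 obtain K where K: "compact K" "!!x. x \<notin> K ==> f x = 0" using f(2) unfolding csupp_def by blast
 let ?T = "%p. Ef b (fst p) (snd p)"
 have cT: "continuous_on UNIV ?T" by (rule smooth_continuous[OF Ef_smooth[OF b]])
 have "((%t. LBINT z. (%p. f (?T p)) (t, z)) has_real_derivative (LBINT z. XX b f z)) (at 0)"
 proof (rule integral_deriv_param(1)[of "{-1<..<1}" 0 _ "?T ` ({-1..1} \<times> K)"])
  show "smooth_on ({-1<..<1} \<times> UNIV) (%p. f (?T p))"
   by (rule smooth_subset[OF smooth_compose[OF open_UNIV Ef_smooth[OF b] f(1)]]) auto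
  show "compact (?T ` ({-1..1} \<times> K))" by (intro compact_continuous_image[OF continuous_on_subset[OF cT]] compact_Times K(1)) auto
  show "f (?T (t, z)) = 0" if "t \<in> {-1<..<1}" "z \<notin> ?T ` ({-1..1} \<times> K)" for t z
  proof (rule ccontr)
   assume "f (?T (t, z)) ~= 0"
   hence "Ef b t z \<in> K" using K(2) by auto
   hence "?T (- t, Ef b t z) \<in> ?T ` ({-1..1} \<times> K)" by (intro imageI) (use that(1) in auto)
   thus False using that(2) Ef_add[OF b, of "- t" t z] b by simp
  qed
  show "((%t. f (?T (t, z))) has_real_derivative XX b f z) (at 0)" for z using XX_flow[OF b f(1), of z 0] b by simp
 qed auto
 moreover have "(%t. LBINT z. (%p. f (?T p)) (t, z)) = (%t. integral\<^sup>L lborel f)" using integral_Ef[OF b f] by auto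
 ultimately show ?thesis using DERIV_unique[OF DERIV_const] by metis
qed

lemma integral_by_parts:
 assumes b: "b \<in> Basis" and f: "smooth f" "csupp f" and g: "smooth g"
 shows "(LBINT z. f z * XX b g z) = - (LBINT z. XX b f z * g z)"
proof -
 have "0 = (LBINT z. f z * XX b g z + XX b f z * g z)"
  using integral_XX[OF b smooth_mult[OF open_UNIV f(1) g] csupp_mult1[OF f(2)]] by (simp add: XX_mult[OF f(1) g])
 also have "... = (LBINT z. f z * XX b g z) + (LBINT z. XX b f z * g z)"
  by (intro lint_add csupp_integrable smooth_continuous smooth_mult XX_smooth b f g
    open_UNIV csupp_mult1 XX_csupp)
 finally show ?thesis by simp
qed

end

section \<open>A local Nash inequality\<close>

context strat
begin

abbreviation Hz :: "'e set" where "Hz \<equiv> {b \<in> Basis. w b = 1}"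

definition dir :: "('e => real) => real" where
 "dir f = (\<Sum>b\<in>Hz. LBINT z. (XX b f z)^2)"

lemma dir_nonneg: "dir f >= 0" unfolding dir_def by (intro sum_nonneg lint_nonneg) auto

lemma XX_sq: "b \<in> Basis ==> smooth f ==> csupp f ==> smooth (%z. (XX b f z)^2)"
 "csupp f ==> csupp (%z. (XX b f z)^2)" by (auto intro!: smooth_power XX_smooth csupp_power XX_csupp)

lemma smooth_csupp_integrable: "smooth f ==> csupp f ==> integrable lborel f" by (intro csupp_integrable smooth_continuous)

text \<open>The squared distance \<open>h t\<close> of \<open>f\<close> from its translate has
  derivative at most \<open>h t / s + s * G\<close>, by Young's inequality with weight
  \<open>s\<close> and invariance of the integral under the flow. Gronwall's argument on
  \<open>{0..s}\<close> gives the factor \<open>exp 1\<close>, which is at most 3.\<close>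

lemma flow_difference_pos:
 assumes b: "b \<in> Basis" and f: "smooth f" "csupp f" and s: "s > 0"
 shows "(LBINT z. (f (Ef b s z) - f z)^2) <= 3 * s^2 * (LBINT z. (XX b f z)^2)"
proof -
 define G where "G = (LBINT z. (XX b f z)^2)"
 have G0: "G >= 0" unfolding G_def by (rule lint_nonneg) simp
 define h where "h t = (LBINT z. (f (Ef b t z) - f z)^2)" for t
 obtain K where K: "compact K" "!!x. x \<notin> K ==> f x = 0" using f(2) unfolding csupp_def by blast
 let ?T = "%p. Ef b (fst p) (snd p)"
 have cT: "continuous_on UNIV ?T" by (rule smooth_continuous[OF Ef_smooth[OF b]])
 have sm: "smooth (%z. f (Ef b t z))" for t by (rule smooth_comp_UNIV[OF f(1) Ef_z_smooth[OF b]])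
 have sd: "smooth (%z. (f (Ef b t z) - f z)^2)" "csupp (%z. (f (Ef b t z) - f z)^2)" for t
  by (auto intro!: smooth_power smooth_diff sm f csupp_power csupp_diff csupp_Ef[OF b])
 have sx: "smooth (%z. (XX b f (Ef b t z))^2)" "csupp (%z. (XX b f (Ef b t z))^2)" for t
  using smooth_comp_UNIV[OF XX_sq(1)[OF b f] Ef_z_smooth[OF b]] csupp_Ef[OF b XX_sq(2)[OF f(2)]] by auto
 have dh: "(h has_real_derivative (LBINT z. 2 * (f (Ef b t z) - f z) * XX b f (Ef b t z))) (at t)" for t
 proof -
  let ?g = "%p. (f (?T p) - f (snd p))^2"
  let ?K = "?T ` ({- t - 1..- t + 1} \<times> K) \<union> K"
  have "((%t. LBINT z. ?g (t, z)) has_real_derivative (LBINT z. 2 * (f (Ef b t z) - f z) * XX b f (Ef b t z))) (at t)"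
  proof (rule integral_deriv_param(1)[of "{t - 1<..<t + 1}" t ?g ?K])
   show "smooth_on ({t - 1<..<t + 1} \<times> UNIV) ?g" by (rule smooth_subset[of UNIV]) (auto intro!: smooth_power smooth_diff
     smooth_compose[OF open_UNIV Ef_smooth[OF b] f(1)] smooth_compose[OF open_UNIV smooth_snd f(1)])
   show "compact ?K" by (intro compact_Un K(1) compact_continuous_image[OF continuous_on_subset[OF cT]] compact_Times) auto
   show "?g (r, z) = 0" if "r \<in> {t - 1<..<t + 1}" "z \<notin> ?K" for r z
   proof -
    have "f z = 0" using that K(2) by blast
    moreover have "Ef b r z \<notin> K"
    proof
     assume "Ef b r z \<in> K"
     hence "?T (- r, Ef b r z) \<in> ?T ` ({- t - 1..- t + 1} \<times> K)" by (intro imageI) (use that(1) in auto)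
     thus False using that(2) Ef_add[OF b, of "- r" r z] b by simp
    qed
    ultimately show ?thesis using K(2) by simp
   qed
   show "((%r. ?g (r, z)) has_real_derivative 2 * (f (Ef b t z) - f z) * XX b f (Ef b t z)) (at t)" for z
    using XX_flow[OF b f(1), of z t] by (auto intro!: derivative_eq_intros)
  qed auto
  thus ?thesis by (simp add: h_def[abs_def])
 qed
 have dle: "(LBINT z. 2 * (f (Ef b t z) - f z) * XX b f (Ef b t z)) <= h t / s + s * G" for t
 proof -
  have GE: "(LBINT z. (XX b f (Ef b t z))^2) = G" unfolding G_def by (rule integral_Ef[OF b XX_sq(1)[OF b f] XX_sq(2)[OF f(2)]])
  have "(LBINT z. 2 * (f (Ef b t z) - f z) * XX b f (Ef b t z))
   <= (LBINT z. (f (Ef b t z) - f z)^2 / s + s * (XX b f (Ef b t z))^2)"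
  proof (rule lint_mono)
   show "integrable lborel (%z. 2 * (f (Ef b t z) - f z) * XX b f (Ef b t z))"
    by (intro smooth_csupp_integrable smooth_mult smooth_diff smooth_const sm f open_UNIV
      smooth_comp_UNIV[OF XX_smooth[OF b f(1)] Ef_z_smooth[OF b]] csupp_mult2 csupp_Ef[OF b XX_csupp[OF f(2)]])
   show "integrable lborel (%z. (f (Ef b t z) - f z)^2 / s + s * (XX b f (Ef b t z))^2)"
    by (intro Bochner_Integration.integrable_add integrable_divide integrable_mult_right smooth_csupp_integrable sd sx)
   fix z
   have "0 <= ((f (Ef b t z) - f z) - s * XX b f (Ef b t z))^2 / s" using s by simp
   also have "... = (f (Ef b t z) - f z)^2 / s + s * (XX b f (Ef b t z))^2 - 2 * (f (Ef b t z) - f z) * XX b f (Ef b t z)"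
    using s by (simp add: field_simps power2_eq_square)
   finally show "2 * (f (Ef b t z) - f z) * XX b f (Ef b t z) <= (f (Ef b t z) - f z)^2 / s + s * (XX b f (Ef b t z))^2" by simp
  qed
  also have "... = h t / s + s * G" unfolding h_def GE[symmetric] by (simp add: lint_add smooth_csupp_integrable sd sx)
  finally show ?thesis .
 qed
 define k where "k t = exp (- t / s) * h t - s * G * t" for t
 have "k s <= k 0"
 proof (rule DERIV_nonpos_imp_nonincreasing[of 0 s k])
  show "0 <= s" using s by simp
  fix t assume t: "0 <= t" "t <= s"
  let ?d = "(LBINT z. 2 * (f (Ef b t z) - f z) * XX b f (Ef b t z))"
  have "(k has_real_derivative exp (- t / s) * (?d - h t / s) - s * G) (at t)" unfolding k_def[abs_def] using s
   by (auto intro!: derivative_eq_intros dh simp: field_simps)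
  moreover have "exp (- t / s) * (?d - h t / s) <= 1 * (s * G)"
  proof (cases "?d - h t / s <= 0")
   case True
   hence "exp (- t / s) * (?d - h t / s) <= 0" by (simp add: mult_nonneg_nonpos)
   also have "0 <= 1 * (s * G)" using s G0 by simp
   finally show ?thesis .
  next
   case False
   thus ?thesis using dle[of t] t s by (intro mult_mono) auto
  qed
  ultimately show "EX y. (k has_real_derivative y) (at t) & y <= 0" by (auto intro!: exI)
 qed
 moreover have "h 0 = 0" using b by (simp add: h_def)
 ultimately have "exp (- 1) * h s <= s * G * s" using s by (simp add: k_def)
 hence "exp 1 * (exp (- 1) * h s) <= exp 1 * (s * G * s)" by (rule mult_left_mono) simp
 hence "h s <= exp 1 * (s * G * s)" by (simp add: mult.assoc[symmetric] exp_add[symmetric])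
 also have "... <= 3 * (s * G * s)" by (rule mult_right_mono[OF exp_le]) (use s G0 in simp)
 finally show ?thesis by (simp add: h_def G_def power2_eq_square mult_ac)
qed

lemma flow_difference:
 assumes b: "b \<in> Basis" and f: "smooth f" "csupp f"
 shows "(LBINT z. (f (Ef b s z) - f z)^2) <= 3 * s^2 * (LBINT z. (XX b f z)^2)"
proof -
 consider "s > 0" | "s = 0" | "s < 0" by linarith
 thus ?thesis
 proof cases
  case 1
  thus ?thesis by (rule flow_difference_pos[OF b f])
 next
  case 2
  thus ?thesis using b by simp
 next
  case 3
  let ?q = "%z. (f (Ef b (- s) z) - f z)^2"
  have q: "smooth ?q" "csupp ?q"
   by (auto intro!: smooth_power smooth_diff smooth_comp_UNIV[OF f(1) Ef_z_smooth[OF b]] f csupp_power csupp_diff csupp_Ef[OF b])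
  have "?q (Ef b s z) = (f (Ef b s z) - f z)^2" for z using Ef_add[OF b, of "- s" s z] b by (simp add: power2_commute)
  hence "(LBINT z. (f (Ef b s z) - f z)^2) = (LBINT z. ?q z)" using integral_Ef[OF b q, of s] by simp
  thus ?thesis using flow_difference_pos[OF b f, of "- s"] 3 by simp
 qed
qed

lemma integral_right_reach:
 "hreach a T g ==> a = 0 ==> smooth f ==> csupp f ==> (LBINT z. f (mul z g)) = integral\<^sup>L lborel f"
proof (induction arbitrary: f rule: hreach.induct)
 case (hstep a T b c s)
 have "(LBINT z. f (Ef c s (mul z b))) = (LBINT z. f (Ef c s z))"
  by (rule hstep.IH[OF hstep.prems(1) smooth_comp_UNIV[OF hstep.prems(2) Ef_z_smooth[OF hstep.hyps(2)]] csupp_Ef[OF hstep.hyps(2) hstep.prems(3)]])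
 also have "... = integral\<^sup>L lborel f" by (rule integral_Ef[OF hstep.hyps(2) hstep.prems(2,3)])
 finally show ?case by (simp add: Ef_mul[OF hstep.hyps(2)])
qed simp

lemma sq_add_le: "(r + s)^2 <= 2 * r^2 + 2 * (s :: real)^2" using sum_squares_bound[of r s] by (simp add: power2_sum)

lemma diff_sq_smooth:
 assumes "smooth f" "csupp f" "smooth g" "csupp g"
 shows "smooth (%z. (f z - g z)^2)" "csupp (%z. (f z - g z)^2)"
 using assms by (auto intro!: smooth_power smooth_diff csupp_power csupp_diff)

lemma diff_sq_triangle:
 assumes f: "smooth f" "csupp f" and g: "smooth g" "csupp g" and h: "smooth h" "csupp h"
 shows "(LBINT z. (f z - h z)^2) <= 2 * (LBINT z. (f z - g z)^2) + 2 * (LBINT z. (g z - h z)^2)"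
proof -
 note i = smooth_csupp_integrable[OF diff_sq_smooth[OF f g]] smooth_csupp_integrable[OF diff_sq_smooth[OF g h]]
 have "(LBINT z. (f z - h z)^2) <= (LBINT z. 2 * (f z - g z)^2 + 2 * (g z - h z)^2)"
 proof (rule lint_mono)
  show "integrable lborel (%z. 2 * (f z - g z)^2 + 2 * (g z - h z)^2)"
   using i by (intro Bochner_Integration.integrable_add integrable_mult_right)
  show "(f z - h z)^2 <= 2 * (f z - g z)^2 + 2 * (g z - h z)^2" for z using sq_add_le[of "f z - g z" "g z - h z"] by simp
 qed (rule smooth_csupp_integrable[OF diff_sq_smooth[OF f h]])
 thus ?thesis using i by (simp add: lint_add)
qed

lemma smooth_right: "smooth f ==> smooth (%z. f (mul z g))" by (rule smooth_comp_UNIV[OF _ mul_a_smooth])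

text \<open>Each segment of the broken line is handled by \<open>flow_difference\<close>, in which
  only a horizontal derivative enters. The constant depends on the path; uniformity comes later,
  from dilations.\<close>

lemma right_difference_reach:
 "hreach a T g ==> a = 0 ==> EX C>=0. ALL f. smooth f --> csupp f --> (LBINT z. (f (mul z g) - f z)^2) <= C * dir f"
proof (induction rule: hreach.induct)
 case (hrefl a)
 thus ?case by (intro exI[of _ 0]) auto
next
 case (hstep a T b c s)
 then obtain C where C: "C >= 0" "!!f. smooth f ==> csupp f ==> (LBINT z. (f (mul z b) - f z)^2) <= C * dir f" by auto
 have "(LBINT z. (f (mul z (Ef c s b)) - f z)^2) <= (6 * s^2 + 2 * C) * dir f" if f: "smooth f" "csupp f" for f
 proof -
  let ?q = "%z. (f (Ef c s z) - f z)^2"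
  note fE = smooth_comp_UNIV[OF f(1) Ef_z_smooth[OF hstep.hyps(2), of s]] csupp_Ef[OF hstep.hyps(2) f(2), of s]
  have "(LBINT z. (f (mul z (Ef c s b)) - f z)^2) <= 2 * (LBINT z. (f (mul z (Ef c s b)) - f (mul z b))^2) + 2 * (LBINT z. (f (mul z b) - f z)^2)"
   by (intro diff_sq_triangle smooth_right csupp_right f)
  also have "(LBINT z. (f (mul z (Ef c s b)) - f (mul z b))^2) = (LBINT z. ?q (mul z b))" by (simp add: Ef_mul[OF hstep.hyps(2)])
  also have "... = (LBINT z. ?q z)" by (rule integral_right_reach[OF hstep.hyps(1) hstep.prems diff_sq_smooth[OF fE f]])
  also have "... <= 3 * s^2 * (LBINT z. (XX c f z)^2)" by (rule flow_difference[OF hstep.hyps(2) f])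
  also have "(LBINT z. (XX c f z)^2) <= dir f"
   unfolding dir_def by (rule member_le_sum) (use hstep.hyps in \<open>auto intro!: lint_nonneg\<close>)
  also have "(LBINT z. (f (mul z b) - f z)^2) <= C * dir f" by (rule C(2)[OF f])
  finally show ?thesis by (simp add: algebra_simps mult_right_mono)
 qed
 thus ?case using C(1) by (intro exI[of _ "6 * s^2 + 2 * C"]) auto
qed

lemma right_difference:
 obtains C where "C >= 0" "!!f. smooth f ==> csupp f ==> (LBINT z. (f (mul z g) - f z)^2) <= C * dir f"
proof -
 obtain T where "hreach 0 T g" using chow by blast
 from right_difference_reach[OF this refl] that show ?thesis by blast
qed

lemma dir_dil:
 assumes r: "r > 0" and f: "smooth f" "csupp f"
 shows "dir (%z. f (dil r z)) = r^2 * dir f / r ^ Q"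
proof -
 have "(LBINT z. (XX b (%z. f (dil r z)) z)^2) = r^2 * (LBINT z. (XX b f z)^2) / r ^ Q" if b: "b \<in> Hz" for b
 proof -
  have b': "b \<in> Basis" "w b = 1" using b by auto
  have "(LBINT z. (XX b (%z. f (dil r z)) z)^2) = (LBINT z. r^2 * (XX b f (dil r z))^2)"
   by (simp add: XX_dil[OF b'(1) f(1) r] b'(2) power_mult_distrib)
  also have "... = r^2 * (LBINT z. (XX b f z)^2) / r ^ Q" using integral_dil[OF r smooth_continuous[OF XX_sq(1)[OF b'(1) f]]] by simp
  finally show ?thesis .
 qed
 thus ?thesis by (simp add: dir_def sum_distrib_left sum_divide_distrib)
qed

text \<open>For \<open>s = 1\<close> and \<open>s = - 1\<close> the endpoint is horizontally
  accessible, whatever the weight of \<open>b\<close>. Any other \<open>s\<close> is reduced to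
  these by the dilation with factor \<open>sig\<close>, the root of order \<open>w b\<close> of its
  modulus; this costs \<open>sig^2\<close>, which is at most 1.\<close>

lemma small_flow_difference:
 assumes b: "b \<in> Basis"
 obtains C where "C >= 0" "!!f s. smooth f ==> csupp f ==> \<bar>s\<bar> <= 1 ==> (LBINT z. (f (Ef b s z) - f z)^2) <= C * dir f"
proof -
 obtain C1 where C1: "C1 >= 0" "!!f. smooth f ==> csupp f ==> (LBINT z. (f (mul z (Ef b 1 0)) - f z)^2) <= C1 * dir f"
  using right_difference by metis
 obtain C2 where C2: "C2 >= 0" "!!f. smooth f ==> csupp f ==> (LBINT z. (f (mul z (Ef b (- 1) 0)) - f z)^2) <= C2 * dir f"
  using right_difference by metis
 define C where "C = max C1 C2"
 have "(LBINT z. (f (Ef b s z) - f z)^2) <= C * dir f" if f: "smooth f" "csupp f" and s: "\<bar>s\<bar> <= 1" for f s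
 proof (cases "s = 0")
  case True
  thus ?thesis using b C1(1) dir_nonneg by (simp add: C_def le_max_iff_disj)
 next
  case False
  define sig where "sig = root (w b) \<bar>s\<bar>"
  have wb: "w b > 0" using w1[OF b] by simp
  have sig: "sig > 0" "sig ^ w b = \<bar>s\<bar>" "sig <= 1" using False s wb by (auto simp: sig_def)
  define e where "e = sgn s"
  have e: "e = 1 \<or> e = -1" "s = sig ^ w b * e" using False sig(2) by (auto simp: e_def sgn_if abs_if split: if_splits)
  define g where "g = Ef b e 0"
  let ?F = "%z. (f (Ef b s z) - f z)^2" and ?f = "%z. f (dil sig z)"
  have F: "smooth ?F" "csupp ?F"
   using diff_sq_smooth[OF smooth_comp_UNIV[OF f(1) Ef_z_smooth[OF b, of s]] csupp_Ef[OF b f(2), of s] f] by auto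
  have "Ef b s (dil sig z) = dil sig (mul z g)" for z using Ef_dil[OF b sig(1), of e z] Ef_right[OF b, of e z] e(2) by (simp add: g_def)
  hence "(LBINT z. (?f (mul z g) - ?f z)^2) = (LBINT z. ?F (dil sig z))" by simp
  also have "... = (LBINT z. ?F z) / sig ^ Q" by (rule integral_dil[OF sig(1) smooth_continuous[OF F(1)]])
  finally have "(LBINT z. ?F z) = sig ^ Q * (LBINT z. (?f (mul z g) - ?f z)^2)" using sig by simp
  also have "(LBINT z. (?f (mul z g) - ?f z)^2) <= C * dir ?f"
  proof -
   note sf = smooth_comp_UNIV[OF f(1) dil_smooth[of UNIV sig]] csupp_dil[OF sig(1) f(2)]
   have "C1 * dir ?f <= C * dir ?f" "C2 * dir ?f <= C * dir ?f" unfolding C_def by (intro mult_right_mono dir_nonneg; simp)+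
   thus ?thesis using e(1) C1(2)[OF sf] C2(2)[OF sf] unfolding g_def by fastforce
  qed
  also have "sig ^ Q * (C * dir ?f) = sig^2 * (C * dir f)" using sig(1) by (simp add: dir_dil[OF sig(1) f])
  also have "... <= 1 * (C * dir f)"
   by (rule mult_right_mono) (use sig C1(1) dir_nonneg[of f] in \<open>auto simp: C_def power_le_one le_max_iff_disj\<close>)
  finally show ?thesis using sig(1) by (simp add: mult_left_mono)
 qed
 thus ?thesis using that[of C] C1(1) by (simp add: C_def le_max_iff_disj)
qed

lemma mulL_csupp: "set L \<subseteq> Basis ==> csupp f ==> csupp (%z. f (mulL L z h))"
proof (induction L)
 case (Cons b L)
 thus ?case using csupp_Ef[of b "%z. f (mulL L z h)" "h \<bullet> b"] by simp
qed simp

lemma mulL_smooth1: "set L \<subseteq> Basis ==> smooth f ==> smooth (%z. f (mulL L z h))" by (rule smooth_comp_UNIV[OF _ mulL_smooth]) auto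

lemma box_difference:
 obtains C where "C >= 0" "!!f h. smooth f ==> csupp f ==> (!!b. b \<in> Basis ==> \<bar>h \<bullet> b\<bar> <= 1) ==>
  (LBINT z. (f (mul z h) - f z)^2) <= C * dir f"
proof -
 have "EX C>=0. ALL f h. smooth f --> csupp f --> (\<forall>b\<in>Basis. \<bar>h \<bullet> b\<bar> <= 1) --> (LBINT z. (f (mulL L z h) - f z)^2) <= C * dir f"
  if "set L \<subseteq> Basis" for L using that
 proof (induction L)
  case Nil
  thus ?case by (intro exI[of _ 0]) auto
 next
  case (Cons b L)
  hence b: "b \<in> Basis" and L: "set L \<subseteq> Basis" by auto
  obtain C where C: "C >= 0" "!!f h. smooth f ==> csupp f ==> \<forall>b\<in>Basis. \<bar>h \<bullet> b\<bar> <= 1 ==> (LBINT z. (f (mulL L z h) - f z)^2) <= C * dir f"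
   using Cons.IH[OF L] by blast
  obtain C' where C': "C' >= 0" "!!f s. smooth f ==> csupp f ==> \<bar>s\<bar> <= 1 ==> (LBINT z. (f (Ef b s z) - f z)^2) <= C' * dir f"
   using small_flow_difference[OF b] by blast
  have "(LBINT z. (f (mulL (b # L) z h) - f z)^2) <= (2 * C + 2 * C') * dir f"
   if f: "smooth f" "csupp f" and h: "\<forall>b\<in>Basis. \<bar>h \<bullet> b\<bar> <= 1" for f h
  proof -
   let ?s = "h \<bullet> b" and ?q = "%z. (f (mulL L z h) - f z)^2"
   note fE = smooth_comp_UNIV[OF f(1) Ef_z_smooth[OF b, of ?s]] csupp_Ef[OF b f(2), of ?s]
   note fL = mulL_smooth1[OF L f(1), of h] mulL_csupp[OF L f(2), of h]
   have "(LBINT z. (f (mulL (b # L) z h) - f z)^2)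
    <= 2 * (LBINT z. (f (mulL (b # L) z h) - f (Ef b ?s z))^2) + 2 * (LBINT z. (f (Ef b ?s z) - f z)^2)"
    by (rule diff_sq_triangle[OF mulL_smooth1[OF Cons.prems f(1)] mulL_csupp[OF Cons.prems f(2)] fE f])
   also have "(LBINT z. (f (mulL (b # L) z h) - f (Ef b ?s z))^2) = (LBINT z. ?q (Ef b ?s z))" by simp
   also have "... = (LBINT z. ?q z)" by (rule integral_Ef[OF b diff_sq_smooth[OF fL f]])
   also have "... <= C * dir f" by (rule C(2)[OF f h])
   also have "(LBINT z. (f (Ef b ?s z) - f z)^2) <= C' * dir f" by (rule C'(2)[OF f]) (use h b in auto)
   finally show ?thesis by (simp add: algebra_simps)
  qed
  thus ?case using C(1) C'(1) by (intro exI[of _ "2 * C + 2 * C'"]) auto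
 qed
 from this[of bs] bs obtain C where "C >= 0" "ALL f h. smooth f --> csupp f --> (\<forall>b\<in>Basis. \<bar>h \<bullet> b\<bar> <= 1) --> (LBINT z. (f (mulL bs z h) - f z)^2) <= C * dir f"
  by auto
 thus ?thesis using that[of C] by (simp add: mul_def)
qed

text \<open>The function is compared with its translates by all \<open>h\<close> in a unit cube
  \<open>D\<close>. The mean square difference is bounded through \<open>box_difference\<close>, and
  the integral of the translates over \<open>D\<close> through the total integral of
  \<open>f\<close>.\<close>

lemma nash_unit:
 obtains C where "C > 0" "!!f. smooth f ==> csupp f ==> (!!z. f z >= 0) ==>
  (LBINT z. (f z)^2) <= C * dir f + C * (integral\<^sup>L lborel f)^2"
proof -
 obtain C where C: "C >= 0" "!!f h. smooth f ==> csupp f ==> (!!b. b \<in> Basis ==> \<bar>h \<bullet> b\<bar> <= 1) ==>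
  (LBINT z. (f (mul z h) - f z)^2) <= C * dir f" using box_difference by blast
 define D where "D = cbox (- One) (One :: 'e)"
 have Dh: "\<bar>h \<bullet> b\<bar> <= 1" if "h \<in> D" "b \<in> Basis" for h b
  using that by (auto simp: D_def mem_box abs_le_iff minus_le_iff)
 define m where "m = measure lborel D"
 have m: "m > 0" unfolding m_def D_def using content_pos_lt_eq[of "- One" "One :: 'e"] by auto
 have main: "m * (LBINT z. (f z)^2) <= m * C * dir f + 2 * (integral\<^sup>L lborel f)^2"
  if f: "smooth f" "csupp f" "!!z. f z >= 0" for f
 proof -
  obtain K where K: "compact K" "!!x. x \<notin> K ==> f x = 0" using f(2) unfolding csupp_def by blast
  define F where "F = integral\<^sup>L lborel f"
  have cf: "continuous_on UNIV f" by (rule smooth_continuous[OF f(1)])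
  have cm: "continuous_on UNIV (%p. mul (fst p) (snd p))" by (rule smooth_continuous[OF mul_smooth]) auto
  have cfm: "continuous_on UNIV (%p. (f (fst p) - f (mul (fst p) (snd p)))^2)"
   by (intro continuous_intros continuous_on_compose2[OF cf] cm) auto
  have cfm1: "continuous_on UNIV (%h. (f z - f (mul z h))^2)" "continuous_on UNIV (%h. f (mul z h))" for z
   by (intro continuous_intros continuous_on_compose2[OF cf] smooth_continuous[OF mul_z_smooth]; simp)+
  let ?K' = "(%p. mul (fst p) (ginv (snd p))) ` (K \<times> D)"
  have "continuous_on UNIV (%p. mul (fst p) (ginv (snd p)))"
   by (intro smooth_continuous mul_smooth smooth_compose[OF open_UNIV smooth_snd ginv_smooth]) auto
  hence "compact (K \<union> ?K')"
   by (intro compact_Un K(1) compact_continuous_image[OF continuous_on_subset] compact_Times) (auto simp: D_def)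
  then obtain a where B0: "K \<union> ?K' \<subseteq> cbox (- a) a" using bounded_subset_cbox_symmetric[OF compact_imp_bounded] by metis
  define N where "N z = integral D (%h. (f z - f (mul z h))^2)" for z
  have zero: "(f z - f (mul z h))^2 = 0" if "h \<in> D" "z \<notin> cbox (- a) a" for z h
  proof -
   have "mul z h \<notin> K"
   proof
    assume "mul z h \<in> K"
    hence "mul (mul z h) (ginv h) \<in> ?K'" using that(1) by force
    thus False using B0 that(2) by (simp add: mul_assoc subset_iff)
   qed
   moreover have "z \<notin> K" using B0 that(2) by auto
   ultimately show ?thesis using K(2) by simp
  qed
  have N0: "N z = 0" if "z \<notin> cbox (- a) a" for z
   unfolding N_def using zero that by (simp add: integral_cong[of D "%h. (f z - f (mul z h))^2" "%h. 0"])
  have cN: "continuous_on UNIV N"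
  proof -
   have "Ck_on 0 UNIV (%z. integral (cbox (- One) One) (%h. (%p. (f (fst p) - f (mul (fst p) (snd p)))^2) (z, h)))"
    by (rule Ck_on_integral[OF open_UNIV open_UNIV]) (use cfm in auto)
   thus ?thesis by (simp add: N_def[abs_def] D_def)
  qed
  \<comment> \<open>This integrates \<open>a^2 <= (a - b)^2 + 2 * a * b\<close> over
    \<open>h\<close> in \<open>D\<close>, with \<open>a = f z\<close> and
    \<open>b = f (mul z h)\<close>. Left invariance of the integral and \<open>f >= 0\<close> bound
    the integral of \<open>b\<close> by \<open>F\<close>.\<close>
  have pt: "m * (f z)^2 <= N z + 2 * f z * F" for z
  proof -
   have i: "(%h. (f z - f (mul z h))^2) integrable_on D" "(%h. f (mul z h)) integrable_on D"
    unfolding D_def by (intro integrable_continuous continuous_on_subset[OF cfm1(1)] continuous_on_subset[OF cfm1(2)]; simp)+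
   have "m * (f z)^2 = integral D (%h. (f z)^2)" by (simp add: m_def D_def)
   also have "... <= integral D (%h. (f z - f (mul z h))^2 + 2 * f z * f (mul z h))"
   proof (rule integral_le)
    show "(%h. (f z)^2) integrable_on D" by (simp add: D_def integrable_const)
    show "(%h. (f z - f (mul z h))^2 + 2 * f z * f (mul z h)) integrable_on D" by (intro integrable_add i integrable_on_mult_right)
    fix h
    have "(f z - f (mul z h))^2 + 2 * f z * f (mul z h) - (f z)^2 = (f (mul z h))^2" by (simp add: power2_diff)
    thus "(f z)^2 <= (f z - f (mul z h))^2 + 2 * f z * f (mul z h)" using zero_le_power2[of "f (mul z h)"] by linarith
   qed
   also have "... = N z + 2 * f z * integral D (%h. f (mul z h))"
    unfolding N_def by (subst integral_add) (auto intro!: i integrable_on_mult_right)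
   also have "integral D (%h. f (mul z h)) <= F"
   proof -
    have int: "integrable lborel (%h. f (mul z h))" by (intro csupp_integrable cfm1 csupp_left f)
    have "integral D (%h. f (mul z h)) <= integral UNIV (%h. f (mul z h))"
     by (rule integral_subset_le) (use i integrable_on_lborel[OF int] f(3) in auto)
    also have "... = F" unfolding F_def using integral_lborel[OF int] integral_left[OF f(1,2), of z] by simp
    finally show ?thesis .
   qed
   finally show ?thesis using f(3)[of z] by (simp add: mult_left_mono)
  qed
  have iN: "integrable lborel N" using cN N0 by (intro csupp_integrable) (auto simp: csupp_def intro!: exI[of _ "cbox (- a) a"])
  have "m * (LBINT z. (f z)^2) = (LBINT z. m * (f z)^2)" by simp
  also have "... <= (LBINT z. N z + 2 * F * f z)"
  proof (rule lint_mono)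
   show "integrable lborel (%z. m * (f z)^2)" by (intro integrable_mult_right smooth_csupp_integrable smooth_power f csupp_power) auto
   show "integrable lborel (%z. N z + 2 * F * f z)"
    by (intro Bochner_Integration.integrable_add iN integrable_mult_right smooth_csupp_integrable f)
   show "m * (f z)^2 <= N z + 2 * F * f z" for z using pt[of z] by (simp add: mult_ac)
  qed
  also have "... = integral\<^sup>L lborel N + 2 * F * F" using iN smooth_csupp_integrable[OF f(1,2)] by (simp add: lint_add F_def)
  also have "integral\<^sup>L lborel N = integral (cbox (- a) a) N" by (rule integral_csupp_box[OF cN N0])
  also have "... = integral (cbox (- One) One) (%h. integral (cbox (- a) a) (%z. (f z - f (mul z h))^2))" unfolding N_def[abs_def] D_def
   by (rule integral_swap_continuous) (use continuous_on_subset[OF cfm] in \<open>auto simp: split_beta\<close>)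
  also have "... <= integral (cbox (- One) One) (%h::'e. C * dir f)"
  proof (rule integral_le)
   have "Ck_on 0 UNIV (%h. integral (cbox (- a) a) (%z. (%p. (f (snd p) - f (mul (snd p) (fst p)))^2) (h, z)))"
   proof (rule Ck_on_integral[OF open_UNIV open_UNIV])
    have "continuous_on UNIV (%p. mul (snd p) (fst p))" by (rule smooth_continuous[OF mul_smooth]) auto
    thus "Ck_on 0 UNIV (%p. (f (snd p) - f (mul (snd p) (fst p)))^2)" by (auto intro!: continuous_intros continuous_on_compose2[OF cf])
   qed auto
   thus "(%h. integral (cbox (- a) a) (%z. (f z - f (mul z h))^2)) integrable_on cbox (- One) One"
    by (intro integrable_continuous) (auto intro: continuous_on_subset)
   fix h :: 'e assume h: "h \<in> cbox (- One) One"
   have ch: "continuous_on UNIV (%z. (f z - f (mul z h))^2)"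
    by (intro continuous_intros continuous_on_compose2[OF cf] smooth_continuous[OF mul_a_smooth]) auto
   have "integral (cbox (- a) a) (%z. (f z - f (mul z h))^2) = (LBINT z. (f z - f (mul z h))^2)"
    by (rule integral_csupp_box[symmetric, OF ch]) (use zero h in \<open>auto simp: D_def\<close>)
   also have "... = (LBINT z. (f (mul z h) - f z)^2)" by (simp add: power2_commute)
   also have "... <= C * dir f" by (rule C(2)[OF f(1,2)]) (use Dh h in \<open>auto simp: D_def\<close>)
   finally show "integral (cbox (- a) a) (%z. (f z - f (mul z h))^2) <= C * dir f" .
  qed (simp add: integrable_const)
  also have "... = m * C * dir f" by (simp add: m_def D_def)
  finally show ?thesis by (simp add: F_def power2_eq_square mult.assoc)
 qed
 define C' where "C' = C + 2 / m"
 have C'1: "C' > 0" using C(1) m by (simp add: C'_def add_nonneg_pos)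
 have "(LBINT z. (f z)^2) <= C' * dir f + C' * (integral\<^sup>L lborel f)^2"
  if "smooth f" "csupp f" "!!z. f z >= 0" for f
 proof -
  have "(LBINT z. (f z)^2) <= C * dir f + 2 / m * (integral\<^sup>L lborel f)^2" using main[OF that] m by (simp add: field_simps)
  also have "C * dir f <= C' * dir f" using m dir_nonneg by (intro mult_right_mono) (auto simp: C'_def)
  also have "2 / m * (integral\<^sup>L lborel f)^2 <= C' * (integral\<^sup>L lborel f)^2"
   using C(1) by (intro mult_right_mono) (auto simp: C'_def)
  finally show ?thesis by simp
 qed
 thus ?thesis using that C'1 by blast
qed

text \<open>A dilation of \<open>nash_unit\<close>. Optimising in the free scale \<open>r\<close>
  would give the multiplicative form of Nash's inequality; the iteration instead chooses
  \<open>r\<close> proportional to the gap between two cylinders.\<close>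

lemma nash:
 obtains C where "C > 0" "!!f r. smooth f ==> csupp f ==> (!!z. f z >= 0) ==> r > 0 ==>
  (LBINT z. (f z)^2) <= C * r^2 * dir f + C * (integral\<^sup>L lborel f)^2 / r ^ Q"
proof -
 obtain C where C: "C > 0" "!!f. smooth f ==> csupp f ==> (!!z. f z >= 0) ==>
  (LBINT z. (f z)^2) <= C * dir f + C * (integral\<^sup>L lborel f)^2" using nash_unit by blast
 have "(LBINT z. (f z)^2) <= C * r^2 * dir f + C * (integral\<^sup>L lborel f)^2 / r ^ Q"
  if f: "smooth f" "csupp f" "!!z. f z >= 0" and r: "r > 0" for f r
 proof -
  have "(LBINT z. (f (dil r z))^2) <= C * dir (%z. f (dil r z)) + C * (LBINT z. f (dil r z))^2"
   by (rule C(2)) (use f smooth_comp_UNIV[OF f(1) dil_smooth] csupp_dil[OF r f(2)] in auto)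
  moreover have "(LBINT z. (f (dil r z))^2) = (LBINT z. (f z)^2) / r ^ Q"
   by (rule integral_dil[OF r]) (auto intro!: smooth_continuous smooth_power f)
  moreover have "(LBINT z. f (dil r z)) = integral\<^sup>L lborel f / r ^ Q" by (rule integral_dil[OF r smooth_continuous[OF f(1)]])
  ultimately have "(LBINT z. (f z)^2) / r ^ Q <= C * (r^2 * dir f / r ^ Q) + C * (integral\<^sup>L lborel f / r ^ Q)^2"
   by (simp add: dir_dil[OF r f(1,2)])
  moreover have "x <= (c + C * F^2 / R)" if "x / R <= c / R + C * (F / R)^2" "R > 0" for x c F R :: real
  proof -
   have "x / R * R <= (c / R + C * (F / R)^2) * R" using that by (intro mult_right_mono) auto
   thus ?thesis using that(2) by (simp add: distrib_right power2_eq_square)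
  qed
  ultimately show ?thesis using r by (simp add: mult.assoc)
 qed
 thus ?thesis using that C(1) by blast
qed

end

section \<open>Moser iteration\<close>

lemma smooth_step_deriv:
 obtains S1 M where "!!x. (smooth_step has_real_derivative S1 x) (at x)" "!!x. \<bar>S1 x\<bar> <= M" "M > 0" "!!x. x < 0 ==> S1 x = 0"
proof -
 define S1 where "S1 x = fderiv smooth_step x 1" for x :: real
 have d: "(smooth_step has_real_derivative S1 x) (at x)" for x unfolding S1_def by (rule real_derivI[OF smooth_D[OF smooth_step(1)]]) simp
 have neg: "S1 x = 0" if "x < 0" for x
 proof -
  have "((%x. 0) has_real_derivative 0) (at x)" by simp
  hence "(smooth_step has_real_derivative 0) (at x)"
   by (rule has_field_derivative_transform_within_open[of _ _ _ "{..<0}"]) (use that smooth_step(2) in auto)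
  from DERIV_unique[OF d this] show ?thesis .
 qed
 have pos: "S1 x = 0" if "x > 1" for x
 proof -
  have "((%x. 1) has_real_derivative 0) (at x)" by simp
  hence "(smooth_step has_real_derivative 0) (at x)"
   by (rule has_field_derivative_transform_within_open[of _ _ _ "{1<..}"]) (use that smooth_step(3) in auto)
  from DERIV_unique[OF d this] show ?thesis .
 qed
 have "continuous_on {0..1} S1" unfolding S1_def
  by (rule continuous_on_subset[OF smooth_continuous[OF smooth_frechet[OF smooth_step(1)]]]) simp
 from compact_imp_bounded[OF compact_continuous_image[OF this compact_Icc]]
 obtain M where M: "M > 0" "\<forall>x\<in>{0..1}. norm (S1 x) <= M" unfolding bounded_pos by auto
 have "\<bar>S1 x\<bar> <= M" for x using M neg[of x] pos[of x] by (cases "x < 0"; cases "x > 1") auto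
 thus ?thesis using that d M(1) neg by blast
qed

lemma linear_decay:
 fixes f D :: "real => real"
 assumes "a <= t" "lam > 0" "bet >= 0"
  and d: "!!s. a <= s ==> s <= t ==> (f has_real_derivative D s) (at s)"
  and le: "!!s. a <= s ==> s <= t ==> D s <= - lam * f s + bet"
 shows "f t <= exp (- lam * (t - a)) * f a + bet / lam"
proof -
 define k where "k s = exp (lam * (s - a)) * (f s - bet / lam)" for s
 have "k t <= k a"
 proof (rule DERIV_nonpos_imp_nonincreasing[OF assms(1)])
  fix s assume s: "a <= s" "s <= t"
  have "(k has_real_derivative exp (lam * (s - a)) * (D s + lam * f s - bet)) (at s)"
   unfolding k_def using assms(2) by (auto intro!: derivative_eq_intros d s simp: field_simps)
  moreover have "exp (lam * (s - a)) * (D s + lam * f s - bet) <= 0" by (rule mult_nonneg_nonpos) (use le[OF s] in auto)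
  ultimately show "EX y. (k has_real_derivative y) (at s) & y <= 0" by blast
 qed
 hence "exp (- lam * (t - a)) * k t <= exp (- lam * (t - a)) * k a" by (intro mult_left_mono) auto
 hence "f t - bet / lam <= exp (- lam * (t - a)) * (f a - bet / lam)" by (simp add: k_def mult.assoc[symmetric] exp_add[symmetric])
 also have "... <= exp (- lam * (t - a)) * f a" using assms(2,3) by (intro mult_left_mono) auto
 finally show ?thesis by simp
qed

text \<open>The explicit solution of the squaring recursion
  \<open>Y_(k+1) = c * nu^k * Y_k^2\<close> that the iteration produces.\<close>

lemma doubling_recursion:
 fixes c nu Y :: real
 assumes "c > 0" "nu > 0"
 shows "c * nu ^ k * ((c * nu^2 * Y) ^ (2 ^ k) / (c * nu ^ Suc k))^2 = (c * nu^2 * Y) ^ (2 ^ Suc k) / (c * nu ^ Suc (Suc k))"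
proof -
 have "((c * nu^2 * Y) ^ (2 ^ k))^2 = (c * nu^2 * Y) ^ (2 ^ Suc k)" by (simp add: power_mult[symmetric] mult.commute)
 moreover have "c * nu ^ k * (X / (c * nu ^ Suc k))^2 = X^2 / (c * nu ^ Suc (Suc k))" for X
  using assms by (simp add: power_divide field_simps power2_eq_square)
 ultimately show ?thesis by simp
qed

context strat
begin

definition heat :: "('e => real => real) => bool" where
 "heat u \<longleftrightarrow> smooth_on (UNIV \<times> {0<..}) (%p. u (fst p) (snd p)) & (ALL z. \<forall>t>0. 0 < u z t) &
  (ALL z. \<forall>t>0. ((%r. u z r) has_real_derivative (\<Sum>b\<in>Hz. XX b (XX b (%z. u z t)) z)) (at t))"

lemma heatD:
 assumes "heat u" "t > 0"
 shows "smooth (%z. u z t)" "u z t > 0"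
  "((%r. u z r) has_real_derivative (\<Sum>b\<in>Hz. XX b (XX b (%z. u z t)) z)) (at t)"
proof -
 have s: "smooth_on (UNIV \<times> {0<..}) (%p. u (fst p) (snd p))" using assms by (simp add: heat_def)
 have "smooth (%z. u (fst (z, t)) (snd (z, t)))"
  by (rule smooth_compose[OF open_UNIV _ s]) (use assms in \<open>auto intro!: smooth_Pair\<close>)
 thus "smooth (%z. u z t)" by simp
qed (use assms in \<open>auto simp: heat_def\<close>)

lemma heat_smooth_swap:
 assumes "heat u" "open I" "I \<subseteq> {0<..}"
 shows "smooth_on (I \<times> UNIV) (%p. u (snd p) (fst p))"
proof -
 have s: "smooth_on (UNIV \<times> {0<..}) (%p. u (fst p) (snd p))" using assms by (simp add: heat_def)
 have "smooth_on (I \<times> UNIV) (%p. u (fst (snd p, fst p)) (snd (snd p, fst p)))"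
  by (rule smooth_compose[OF _ _ s]) (use assms in \<open>auto intro!: smooth_Pair open_Times\<close>)
 thus ?thesis by simp
qed

lemma XX_power:
 assumes "b \<in> Basis" "smooth f"
 shows "XX b (%z. f z ^ n) z = real n * f z ^ (n - 1) * XX b f z"
 by (rule XX_chain[OF assms(1,2)]) (auto intro!: smooth_power derivative_eq_intros)

text \<open>In the application \<open>e\<close> is the cutoff, \<open>n\<close> its derivative,
  \<open>a = v^m\<close>, \<open>c = v\<close> and \<open>x\<close> the derivative of
  \<open>v\<close>; then \<open>A + B\<close> is the derivative of the cutoff times
  \<open>v^(m+1)\<close>. The inequality rests on
  \<open>2 A^2 + 4 A B = 2 (A + B)^2 - 2 B^2\<close>.\<close>

lemma energy_pointwise:
 fixes e n x a c :: real
 assumes "m >= 0"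
 shows "1/2 * (e * (m + 1) * a * x + n * (a * c))^2 - 2 * (a * c * n)^2
  <= 2 * (m + 1) * (2 * e * n * (a^2 * c) + e^2 * ((2 * m + 1) * a^2 * x)) * x"
proof -
 define A B where "A = e * (m + 1) * a * x" and "B = n * (a * c)"
 have 1: "0 <= 3/2 * (A + B)^2" by simp
 have 2: "0 <= 2 * (m + 1) * m * (e * a * x)^2" using assms by simp
 have "2 * (m + 1) * (2 * e * n * (a^2 * c) + e^2 * ((2 * m + 1) * a^2 * x)) * x
  = 2 * A^2 + 4 * (A * B) + 2 * (m + 1) * m * (e * a * x)^2" by (simp add: A_def B_def power2_eq_square algebra_simps)
 moreover have "3/2 * (A + B)^2 = 2 * A^2 + 4 * (A * B) - 1/2 * (A + B)^2 + 2 * B^2" by (simp add: power2_eq_square algebra_simps)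
 moreover have "(a * c * n)^2 = B^2" by (simp add: B_def mult_ac)
 ultimately show ?thesis using 1 2 unfolding A_def[symmetric] B_def[symmetric] by linarith
qed

text \<open>Caccioppoli's inequality for the power \<open>Suc m\<close> of the solution. The
  function \<open>F\<close> is the derivative of the integrand with respect to \<open>u\<close>;
  integration by parts against the sub-Laplacian leaves a product of first derivatives, which
  \<open>energy_pointwise\<close> estimates.\<close>

lemma energy:
 assumes u: "heat u" and \<eta>: "smooth \<eta>" "csupp \<eta>" and t: "t > 0"
 obtains D where "((%t. LBINT z. (\<eta> z * u z t ^ Suc m)^2) has_real_derivative D) (at t)"
  "D <= - 1/2 * dir (%z. \<eta> z * u z t ^ Suc m) + 2 * (\<Sum>b\<in>Hz. LBINT z. (u z t ^ Suc m * XX b \<eta> z)^2)"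
proof -
 obtain K where K: "compact K" "!!x. x \<notin> K ==> \<eta> x = 0" using \<eta>(2) unfolding csupp_def by blast
 define v where "v z = u z t" for z
 have v: "smooth v" unfolding v_def[abs_def] by (rule heatD(1)[OF u t])
 define F where "F z = 2 * real (Suc m) * ((\<eta> z)^2 * v z ^ (2 * m + 1))" for z
 have F: "smooth F" "csupp F" unfolding F_def[abs_def] by (auto intro!: smooth_mult smooth_power \<eta> v csupp_mono[OF \<eta>(2)])
 have F': "csupp F" using F by simp
 let ?g = "%p. (\<eta> (snd p) * u (snd p) (fst p) ^ Suc m)^2"
 let ?L = "%z. \<Sum>b\<in>Hz. XX b (XX b v) z"
 have der: "((%s. LBINT z. ?g (s, z)) has_real_derivative (LBINT z. F z * ?L z)) (at t)"
 proof (rule integral_deriv_param(1)[of "{0<..}" t ?g K])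
  show "smooth_on ({0<..} \<times> UNIV) ?g"
   by (intro smooth_power smooth_mult heat_smooth_swap[OF u] smooth_subset[OF smooth_compose[OF open_UNIV smooth_snd \<eta>(1)]])
    (auto intro!: open_Times)
  show "((%s. ?g (s, z)) has_real_derivative F z * ?L z) (at t)" for z
  proof -
   have "((%s. u z s) has_real_derivative ?L z) (at t)" using heatD(3)[OF u t, of z] by (simp add: v_def[abs_def])
   from DERIV_cmult[OF DERIV_power[OF this, of "2 * m + 2"], of "(\<eta> z)^2"]
   have "((%s. (\<eta> z)^2 * u z s ^ (2 * m + 2)) has_real_derivative
    (\<eta> z)^2 * (real (2 * m + 2) * (?L z * v z ^ (2 * m + 1)))) (at t)" by (simp add: v_def)
   moreover have "(\<eta> z)^2 * u z s ^ (2 * m + 2) = ?g (s, z)" for s unfolding power_mult_distrib power_mult[symmetric] fst_conv snd_conv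
    by (rule arg_cong[of _ _ "%n. (\<eta> z)^2 * u z s ^ n"]) simp
   moreover have "(\<eta> z)^2 * (real (2 * m + 2) * (?L z * v z ^ (2 * m + 1))) = F z * ?L z" by (simp add: F_def)
   ultimately show ?thesis by (simp only:)
  qed
 qed (use t K in auto)
 have eq: "(LBINT z. F z * ?L z) = (\<Sum>b\<in>Hz. - (LBINT z. XX b F z * XX b v z))"
 proof -
  have "(LBINT z. F z * ?L z) = (LBINT z. (\<Sum>b\<in>Hz. F z * XX b (XX b v) z))" by (simp add: sum_distrib_left)
  also have "... = (\<Sum>b\<in>Hz. LBINT z. F z * XX b (XX b v) z)"
   by (intro lint_sum smooth_csupp_integrable smooth_mult F XX_smooth v csupp_mult1) auto
  also have "... = (\<Sum>b\<in>Hz. - (LBINT z. XX b F z * XX b v z))" by (intro sum.cong refl integral_by_parts F XX_smooth v) auto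
  finally show ?thesis .
 qed
 have "- (LBINT z. XX b F z * XX b v z) <=
   - 1/2 * (LBINT z. (XX b (%z. \<eta> z * v z ^ Suc m) z)^2) + 2 * (LBINT z. (v z ^ Suc m * XX b \<eta> z)^2)"
  if "b \<in> Hz" for b
 proof -
  have b: "b \<in> Basis" using that by simp
  have sv: "smooth (%z. v z ^ n)" for n by (intro smooth_power v open_UNIV)
  have f: "smooth (%z. \<eta> z * v z ^ Suc m)" "csupp (%z. \<eta> z * v z ^ Suc m)"
   using \<eta> sv by (auto intro!: smooth_mult csupp_mult1 simp del: power_Suc)
  have X1: "XX b (%z. \<eta> z * v z ^ Suc m) z = \<eta> z * (real m + 1) * v z ^ m * XX b v z + XX b \<eta> z * (v z ^ m * v z)" for z
   by (simp add: XX_mult[OF \<eta>(1) sv[of "Suc m"], simplified] XX_power[OF b v, of "Suc m", simplified] algebra_simps)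
  have X2: "XX b F z = 2 * (real m + 1) * (2 * \<eta> z * XX b \<eta> z * ((v z ^ m)^2 * v z) + (\<eta> z)^2 * ((2 * real m + 1) * (v z ^ m)^2 * XX b v z))" for z
  proof -
   have s2: "smooth (%z. (\<eta> z)^2)" by (intro smooth_power \<eta> open_UNIV)
   have "XX b (%z. 2 * real (Suc m) * ((\<eta> z)^2 * v z ^ (2 * m + 1))) z
     = 2 * real (Suc m) * XX b (%z. (\<eta> z)^2 * v z ^ (2 * m + 1)) z" by (rule XX_chain[OF b, of _ "%x. 2 * real (Suc m) * x"])
     (auto intro!: smooth_mult s2 sv derivative_eq_intros simp del: power_Suc)
   also have "XX b (%z. (\<eta> z)^2 * v z ^ (2 * m + 1)) z
    = (\<eta> z)^2 * ((2 * real m + 1) * v z ^ (2 * m) * XX b v z) + 2 * \<eta> z * XX b \<eta> z * v z ^ (2 * m + 1)"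
    using XX_power[OF b v, of "2 * m + 1" z] XX_power[OF b \<eta>(1), of 2 z] by (simp add: XX_mult[OF s2 sv] del: power_Suc)
   also have "v z ^ (2 * m + 1) = v z ^ (2 * m) * v z" by simp
   also have "v z ^ (2 * m) = (v z ^ m)^2" by (simp add: power_mult[symmetric] mult.commute)
   finally show ?thesis by (simp add: F_def[abs_def] algebra_simps)
  qed
  have i: "integrable lborel (%z. (XX b (%z. \<eta> z * v z ^ Suc m) z)^2)" "integrable lborel (%z. (v z ^ Suc m * XX b \<eta> z)^2)"
   "integrable lborel (%z. XX b F z * XX b v z)" using XX_sq(1)[OF b f] XX_sq(2)[OF f(2)] F
   by (auto intro!: smooth_csupp_integrable smooth_power smooth_mult sv XX_smooth b \<eta>(1) v
     csupp_power XX_csupp[OF f(2)] csupp_mult2[OF XX_csupp[OF \<eta>(2)]] csupp_mult1[OF XX_csupp[OF F(2)]] simp del: power_Suc)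
  have "(LBINT z. 1/2 * (XX b (%z. \<eta> z * v z ^ Suc m) z)^2 - 2 * (v z ^ Suc m * XX b \<eta> z)^2) <= (LBINT z. XX b F z * XX b v z)"
  proof (rule lint_mono)
   show "integrable lborel (%z. 1/2 * (XX b (%z. \<eta> z * v z ^ Suc m) z)^2 - 2 * (v z ^ Suc m * XX b \<eta> z)^2)"
    by (intro Bochner_Integration.integrable_diff integrable_mult_right i)
   fix z
   show "1/2 * (XX b (%z. \<eta> z * v z ^ Suc m) z)^2 - 2 * (v z ^ Suc m * XX b \<eta> z)^2 <= XX b F z * XX b v z"
    using energy_pointwise[of "real m" "\<eta> z" "v z ^ m" "XX b v z" "XX b \<eta> z" "v z"]
    unfolding X1 X2 by (simp add: mult.commute[of "v z" "v z ^ m"])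
  qed (rule i)
  moreover have "(LBINT z. 1/2 * (XX b (%z. \<eta> z * v z ^ Suc m) z)^2 - 2 * (v z ^ Suc m * XX b \<eta> z)^2)
   = 1/2 * (LBINT z. (XX b (%z. \<eta> z * v z ^ Suc m) z)^2) - 2 * (LBINT z. (v z ^ Suc m * XX b \<eta> z)^2)"
   by (subst Bochner_Integration.integral_diff) (use i in \<open>auto simp del: power_Suc\<close>)
  ultimately show ?thesis by linarith
 qed
 hence "(\<Sum>b\<in>Hz. - (LBINT z. XX b F z * XX b v z)) <= (\<Sum>b\<in>Hz.
   - 1/2 * (LBINT z. (XX b (%z. \<eta> z * v z ^ Suc m) z)^2) + 2 * (LBINT z. (v z ^ Suc m * XX b \<eta> z)^2))" by (rule sum_mono)
 also have "... = - 1/2 * dir (%z. \<eta> z * v z ^ Suc m) + 2 * (\<Sum>b\<in>Hz. LBINT z. (v z ^ Suc m * XX b \<eta> z)^2)"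
  unfolding dir_def sum.distrib sum_distrib_left by simp
 finally show ?thesis using der unfolding eq[symmetric] by (intro that[of "LBINT z. F z * ?L z"]) (simp_all only: v_def fst_conv snd_conv)
qed

text \<open>The argument is the square of the radius. The cutoffs are then smooth functions of the
  polynomial \<open>z \<bullet> z\<close>, and gaps between balls are differences of the
  arguments.\<close>

definition BB :: "real => 'e set" where "BB R = cball 0 (sqrt R)"

lemma BB_iff: "R >= 0 ==> z \<in> BB R \<longleftrightarrow> z \<bullet> z <= R" unfolding BB_def by (simp add: norm_le_square)

lemma BB_compact: "compact (BB R)" and BB_mono: "R <= R' ==> BB R \<subseteq> BB R'" by (auto simp: BB_def subset_iff intro: order_trans)

definition ms :: "('e => real => real) => nat => real => real => real" where
 "ms u n R t = (LBINT z. indicator (BB R) z * u z t ^ n)"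

lemma ms_integrable:
 assumes "heat u" "t > 0" shows "integrable lborel (%z. indicator (BB R) z * u z t ^ n)"
 using borel_integrable_compact[OF BB_compact, of R "%z. u z t ^ n"]
  smooth_continuous[OF smooth_power[OF open_UNIV heatD(1)[OF assms]], of n] continuous_on_subset by fastforce

lemma ms_mono:
 assumes "heat u" "t > 0" "R <= R'" shows "ms u n R t <= ms u n R' t" unfolding ms_def
 by (rule lint_mono[OF ms_integrable[OF assms(1,2)] ms_integrable[OF assms(1,2)]])
  (use BB_mono[OF assms(3)] heatD(2)[OF assms(1,2)] in \<open>auto simp: indicator_def less_imp_le subset_iff\<close>)

text \<open>A bound on a parabolic cylinder with top at time 1. For \<open>R <= 2\<close> its times
  stay in \<open>{1/2..1}\<close>, and passing from \<open>R\<close> to \<open>rho\<close> gains the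
  time \<open>(R - rho) / 4\<close> at the bottom, in which the energy can decay.\<close>

definition Mb :: "('e => real => real) => nat => real => real => bool" where
 "Mb u n R S \<longleftrightarrow> (\<forall>t\<in>{1 - R / 4..1}. ms u n R t <= S)"

lemma Mb_mono: "heat u ==> Mb u n R S ==> R' <= R ==> R <= 2 ==> S <= S' ==> Mb u n R' S'" unfolding Mb_def
proof
 fix t assume a: "heat u" "\<forall>t\<in>{1 - R / 4..1}. ms u n R t <= S" "R' <= R" "R <= 2" "S <= S'" and t: "t \<in> {1 - R' / 4..1}"
 have "ms u n R' t <= ms u n R t" using a t by (intro ms_mono) auto
 also have "... <= S" using a t by auto
 finally show "ms u n R' t <= S'" using a by simp
qed

lemma Mb_exists:
 assumes u: "heat u" and R: "R <= 2" shows "EX S>=0. Mb u n R S"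
proof -
 have "smooth_on (UNIV \<times> {0<..}) (%p. u (fst p) (snd p) ^ n)" using u by (auto simp: heat_def intro!: smooth_power open_Times)
 hence "continuous_on (BB R \<times> {1/2..1}) (%p. u (fst p) (snd p) ^ n)" by (rule continuous_on_subset[OF smooth_continuous]) auto
 from compact_imp_bounded[OF compact_continuous_image[OF this compact_Times[OF BB_compact compact_Icc]]]
 obtain B where B: "B > 0" "\<forall>x\<in>BB R. \<forall>t\<in>{1/2..1}. norm (u x t ^ n) <= B" unfolding bounded_pos by auto
 have "ms u n R t <= B * measure lborel (BB R)" if t: "t \<in> {1 - R / 4..1}" for t
 proof -
  have t': "t \<in> {1/2..1}" using t R by auto
  have fin: "emeasure lborel (BB R) < \<infinity>" using emeasure_compact_finite[OF BB_compact] .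
  have "ms u n R t <= (LBINT z. indicator (BB R) z * B)" unfolding ms_def
  proof (rule lint_mono[OF ms_integrable[OF u]])
   show "integrable lborel (%z. indicator (BB R) z * B)"
    using fin BB_compact by (intro integrable_mult_left integrable_real_indicator) (auto simp: BB_def)
   show "indicator (BB R) z * u z t ^ n <= indicator (BB R) z * B" for z
    using B(2) t' by (auto simp: indicator_def intro: order_trans[OF abs_ge_self])
  qed (use t' in auto)
  thus ?thesis by (simp add: mult.commute BB_def)
 qed
 thus ?thesis using B(1) unfolding Mb_def by (intro exI[of _ "B * measure lborel (BB R)"]) auto
qed

definition eta :: "real => real => 'e => real" where
 "eta rho R z = smooth_step ((R - z \<bullet> z) / (R - rho))"

lemma eta:
 assumes "0 <= rho" "rho < R"
 shows "smooth (eta rho R)" "csupp (eta rho R)" "0 <= eta rho R z" "eta rho R z <= 1"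
  "z \<in> BB rho ==> eta rho R z = 1" "z \<notin> BB R ==> eta rho R z = 0"
proof -
 have "smooth (%z::'e. (1 / (R - rho)) * (R - z \<bullet> z))" by (intro smooth_mult smooth_diff smooth_inner) auto
 from smooth_compose[OF open_UNIV this smooth_step(1)]
 show "smooth (eta rho R)" by (simp add: eta_def[abs_def])
 show z: "eta rho R z = 0" if "z \<notin> BB R" for z
  using that assms unfolding eta_def by (intro smooth_step(2)) (auto simp: BB_iff divide_le_0_iff)
 thus "csupp (eta rho R)" unfolding csupp_def using BB_compact by blast
 show "z \<in> BB rho ==> eta rho R z = 1" using assms unfolding eta_def by (intro smooth_step(3)) (auto simp: BB_iff)
qed (auto simp: eta_def smooth_step)

lemma eta_gradient:
 obtains Ce where "Ce > 0" "!!rho R z. 0 <= rho ==> rho < R ==> R <= 2 ==>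
  (\<Sum>b\<in>Hz. (XX b (eta rho R) z)^2) <= Ce / (R - rho)^2 * indicator (BB R) z"
proof -
 obtain S1 M where S: "!!x. (smooth_step has_real_derivative S1 x) (at x)" "!!x. \<bar>S1 x\<bar> <= M" "M > 0" "!!x. x < 0 ==> S1 x = 0"
  using smooth_step_deriv by blast
 have n2: "smooth (%z::'e. z \<bullet> z)" by (intro smooth_inner) auto
 define G where "G z = (\<Sum>b\<in>Hz. (XX b (%z. z \<bullet> z) z)^2)" for z
 have "smooth G" unfolding G_def[abs_def] by (intro smooth_sum smooth_power XX_smooth n2) auto
 from compact_imp_bounded[OF compact_continuous_image[OF continuous_on_subset[OF smooth_continuous[OF this]] BB_compact]]
 obtain B where B: "B > 0" "\<forall>x\<in>BB 2. norm (G x) <= B" unfolding bounded_pos by auto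
 have "(\<Sum>b\<in>Hz. (XX b (eta rho R) z)^2) <= M^2 * B / (R - rho)^2 * indicator (BB R) z"
  if R: "0 <= rho" "rho < R" "R <= 2" for rho R z
 proof -
  have "XX b (eta rho R) z = (S1 ((R - z \<bullet> z) / (R - rho)) * (- 1 / (R - rho))) * XX b (%z. z \<bullet> z) z" if "b \<in> Hz" for b
   unfolding eta_def[abs_def]
  proof (rule XX_chain[OF _ n2])
   have "smooth (%x. smooth_step ((1 / (R - rho)) * (R - x)))" by (intro smooth_compose[OF _ _ smooth_step(1)] smooth_mult smooth_diff) auto
   thus "smooth (%x. smooth_step ((R - x) / (R - rho)))" by simp
   have "((%x. (R - x) / (R - rho)) has_real_derivative - 1 / (R - rho)) (at (z \<bullet> z))"
    by (auto intro!: derivative_eq_intros simp: divide_inverse)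
   from DERIV_chain2[OF S(1) this]
   show "((%x. smooth_step ((R - x) / (R - rho))) has_real_derivative S1 ((R - z \<bullet> z) / (R - rho)) * (- 1 / (R - rho))) (at (z \<bullet> z))" .
  qed (use that in auto)
  hence "(\<Sum>b\<in>Hz. (XX b (eta rho R) z)^2) = (S1 ((R - z \<bullet> z) / (R - rho)))^2 / (R - rho)^2 * G z"
   by (simp add: G_def power_mult_distrib power_divide sum_distrib_left)
  also have "... <= M^2 * B / (R - rho)^2 * indicator (BB R) z"
  proof (cases "z \<in> BB R")
   case True
   hence "z \<in> BB 2" using BB_mono R(3) by blast
   hence "G z <= B" using B(2) by auto
   moreover have "G z >= 0" unfolding G_def by (intro sum_nonneg) auto
   moreover have "(S1 ((R - z \<bullet> z) / (R - rho)))^2 <= M^2" using S(2) S(3) by (intro abs_le_square_iff[THEN iffD1]) auto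
   ultimately have "(S1 ((R - z \<bullet> z) / (R - rho)))^2 * G z <= M^2 * B" by (intro mult_mono) auto
   thus ?thesis using True R by (simp add: divide_right_mono)
  next
   case False
   hence "(R - z \<bullet> z) / (R - rho) < 0" using R by (simp add: BB_iff divide_less_0_iff)
   thus ?thesis using S(4) False by simp
  qed
  finally show ?thesis .
 qed
 thus ?thesis using that[of "M^2 * B"] S(3) B(1) by auto
qed

text \<open>Nash's inequality at the scale \<open>kap' * (R - rho)\<close> turns the Dirichlet
  energy into damping of the squared norm, strong enough to forget most of the initial value within
  the time gained. A fraction \<open>th\<close> of the bound \<open>S\<close> on the larger cylinder
  survives, from the initial value and from the gradient of the cutoff; the rest is the square of
  the bound for half the exponent.\<close>

lemma moser_step:
 fixes th :: real
 assumes "th > 0"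
 obtains B where "B > 0" "!!u m rho R S Y. heat u ==> 1 <= rho ==> rho < R ==> R <= 2 ==> S >= 0 ==> Y >= 0 ==>
  Mb u (2 * Suc m) R S ==> Mb u (Suc m) R Y ==> Mb u (2 * Suc m) rho (th * S + B * Y^2 / (R - rho) ^ Q)"
proof -
 obtain C where C: "C > 0" "!!f r. smooth f ==> csupp f ==> (!!z. f z >= 0) ==> r > 0 ==>
  (LBINT z. (f z)^2) <= C * r^2 * dir f + C * (integral\<^sup>L lborel f)^2 / r ^ Q" using nash by blast
 obtain Ce where Ce: "Ce > 0" "!!rho R z. 0 <= rho ==> rho < R ==> R <= 2 ==>
  (\<Sum>b\<in>Hz. (XX b (eta rho R) z)^2) <= Ce / (R - rho)^2 * indicator (BB R) z" using eta_gradient by blast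
 \<comment> \<open>The initial value contributes \<open>8 * C * kap'^2 * S\<close> and the gradient
   of the cutoff \<open>4 * C * Ce * kap'^2 * S\<close>; together they are to give
   \<open>th * S\<close>.\<close>
 define kap' where "kap' = sqrt (th / (8 * C + 4 * C * Ce))"
 have dn: "8 * C + 4 * C * Ce > 0" using C(1) Ce(1) by (simp add: add_pos_pos)
 have kap: "kap' > 0" "(8 * C + 4 * C * Ce) * kap'^2 = th" using assms dn by (simp_all add: kap'_def)
 define B where "B = C / kap' ^ Q"
 have main: "Mb u (2 * Suc m) rho (th * S + B * Y^2 / (R - rho) ^ Q)"
  if u: "heat u" and R: "1 <= rho" "rho < R" "R <= 2" and S: "S >= 0" and Y: "Y >= 0"
   and mS: "Mb u (2 * Suc m) R S" and mY: "Mb u (Suc m) R Y" for u m rho R S Y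
 proof -
  define dlt where "dlt = R - rho"
  have dlt: "0 < dlt" "dlt <= 1" using R by (auto simp: dlt_def)
  define r where "r = kap' * dlt"
  have r: "r > 0" using kap dlt by (simp add: r_def)
  define a where "a = 1 - R / 4"
  have a: "a >= 1/2" using R by (simp add: a_def)
  define \<eta> where "\<eta> = eta rho R"
  have \<eta>: "smooth \<eta>" "csupp \<eta>" "!!z. 0 <= \<eta> z" "!!z. \<eta> z <= 1" "!!z. z \<in> BB rho ==> \<eta> z = 1" "!!z. z \<notin> BB R ==> \<eta> z = 0"
   unfolding \<eta>_def using eta[of rho R] R by auto
  define f where "f t z = \<eta> z * u z t ^ Suc m" for t z
  define yy where "yy t = (LBINT z. (f t z)^2)" for t
  have f: "smooth (f t)" "csupp (f t)" "!!z. f t z >= 0" if "t > 0" for t using \<eta> heatD(1,2)[OF u that] unfolding f_def[abs_def]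
   by (auto intro!: smooth_mult smooth_power csupp_mult1 mult_nonneg_nonneg zero_le_power simp: less_imp_le simp del: power_Suc)
  have f2i: "integrable lborel (%z. (f t z)^2)" if "t > 0" for t by (intro smooth_csupp_integrable smooth_power csupp_power f[OF that]) auto
  have ind: "\<eta> z <= indicator (BB R) z" "(\<eta> z)^2 <= indicator (BB R) z" "indicator (BB rho) z <= (\<eta> z)^2" for z
   using \<eta>(3)[of z] \<eta>(4)[of z] \<eta>(5)[of z] \<eta>(6)[of z] by (auto simp: indicator_def power_le_one)
  have up: "u z t ^ n >= 0" if "t > 0" for z t n using heatD(2)[OF u that, of z] by simp
  have fsq: "(f t z)^2 = (\<eta> z)^2 * u z t ^ (2 * Suc m)" for t z
   unfolding f_def power_mult_distrib power_mult[symmetric] by (simp add: mult.commute)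
  have y_le: "yy t <= ms u (2 * Suc m) R t" if t: "t > 0" for t unfolding yy_def ms_def
   by (rule lint_mono[OF f2i[OF t] ms_integrable[OF u t]]) (unfold fsq, rule mult_right_mono[OF ind(2) up[OF t]])
  have y_ge: "ms u (2 * Suc m) rho t <= yy t" if t: "t > 0" for t unfolding yy_def ms_def
   by (rule lint_mono[OF ms_integrable[OF u t] f2i[OF t]]) (unfold fsq, rule mult_right_mono[OF ind(3) up[OF t]])
  have F_le: "integral\<^sup>L lborel (f t) <= ms u (Suc m) R t" if t: "t > 0" for t unfolding ms_def
   by (rule lint_mono[OF smooth_csupp_integrable[OF f(1,2)[OF t]] ms_integrable[OF u t]])
    (unfold f_def, rule mult_right_mono[OF ind(1) up[OF t]])
  have F_ge: "0 <= integral\<^sup>L lborel (f t)" if "t > 0" for t by (rule lint_nonneg) (use f(3)[OF that] in auto)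
  define lam where "lam = 1 / (2 * C * r^2)"
  define bet where "bet = Y^2 / (2 * r^2 * r ^ Q) + 2 * (Ce * S / dlt^2)"
  have lam: "lam > 0" using C r by (simp add: lam_def)
  have bet: "bet >= 0" using Ce S r by (simp add: bet_def)
  have "EX D. (yy has_real_derivative D) (at s) & D <= - lam * yy s + bet" if s: "a <= s" "s <= 1" for s
  proof -
   have s0: "s > 0" using s a by simp
   have s1: "s \<in> {1 - R / 4..1}" using s by (simp add: a_def)
   obtain D where D: "((%t. LBINT z. (\<eta> z * u z t ^ Suc m)^2) has_real_derivative D) (at s)"
    "D <= - 1/2 * dir (%z. \<eta> z * u z s ^ Suc m) + 2 * (\<Sum>b\<in>Hz. LBINT z. (u z s ^ Suc m * XX b \<eta> z)^2)"
    using energy[OF u \<eta>(1,2) s0] by blast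
   have "(\<Sum>b\<in>Hz. LBINT z. (u z s ^ Suc m * XX b \<eta> z)^2) = (LBINT z. (\<Sum>b\<in>Hz. (u z s ^ Suc m * XX b \<eta> z)^2))"
    by (rule lint_sum[symmetric])
     (auto intro!: smooth_csupp_integrable smooth_power smooth_mult XX_smooth \<eta> heatD(1)[OF u s0] csupp_power csupp_mult2 XX_csupp simp del: power_Suc)
   also have "... <= (LBINT z. Ce / dlt^2 * (indicator (BB R) z * u z s ^ (2 * Suc m)))"
   proof (rule lint_mono)
    show "integrable lborel (%z. \<Sum>b\<in>Hz. (u z s ^ Suc m * XX b \<eta> z)^2)" by (intro Bochner_Integration.integrable_sum)
      (auto intro!: smooth_csupp_integrable smooth_power smooth_mult XX_smooth \<eta> heatD(1)[OF u s0] csupp_power csupp_mult2 XX_csupp simp del: power_Suc)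
    show "integrable lborel (%z. Ce / dlt^2 * (indicator (BB R) z * u z s ^ (2 * Suc m)))"
     by (intro integrable_mult_right ms_integrable[OF u s0])
    fix z
    have "(\<Sum>b\<in>Hz. (u z s ^ Suc m * XX b \<eta> z)^2) = u z s ^ (2 * Suc m) * (\<Sum>b\<in>Hz. (XX b \<eta> z)^2)"
     unfolding power_mult_distrib power_mult[symmetric] sum_distrib_left by (simp add: mult.commute)
    also have "... <= u z s ^ (2 * Suc m) * (Ce / (R - rho)^2 * indicator (BB R) z)"
     unfolding \<eta>_def by (rule mult_left_mono[OF Ce(2) up[OF s0]]) (use R in auto)
    finally show "(\<Sum>b\<in>Hz. (u z s ^ Suc m * XX b \<eta> z)^2) <= Ce / dlt^2 * (indicator (BB R) z * u z s ^ (2 * Suc m))"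
     by (simp add: dlt_def mult_ac)
   qed
   also have "... = Ce / dlt^2 * ms u (2 * Suc m) R s" by (simp add: ms_def)
   also have "... <= Ce / dlt^2 * S" using mS s1 Ce(1) by (intro mult_left_mono) (auto simp: Mb_def)
   finally have grad: "(\<Sum>b\<in>Hz. LBINT z. (u z s ^ Suc m * XX b \<eta> z)^2) <= Ce * S / dlt^2" by simp
   have "yy s <= C * r^2 * dir (f s) + C * (integral\<^sup>L lborel (f s))^2 / r ^ Q" unfolding yy_def by (rule C(2)[OF f[OF s0] r])
   also have "... <= C * r^2 * dir (f s) + C * Y^2 / r ^ Q" using F_le[OF s0] F_ge[OF s0] mY s1 C(1) r
    by (intro add_left_mono divide_right_mono mult_left_mono power_mono) (force simp: Mb_def)+
   finally have "yy s / (2 * C * r^2) <= (C * r^2 * dir (f s) + C * Y^2 / r ^ Q) / (2 * C * r^2)"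
    using C(1) r by (intro divide_right_mono) auto
   also have "... = 1/2 * dir (f s) + Y^2 / (2 * r^2 * r ^ Q)"
   proof -
    have "(k * p * d + k * q / o') / (2 * k * p) = 1/2 * d + q / (2 * p * o')" if "k > 0" "p > 0" "o' > 0" for k p d q o' :: real
     using that by (simp add: field_simps)
    thus ?thesis using C(1) r by simp
   qed
   finally have "lam * yy s <= 1/2 * dir (f s) + Y^2 / (2 * r^2 * r ^ Q)" by (simp add: lam_def)
   hence "D <= - lam * yy s + bet" using D(2) grad unfolding bet_def f_def[abs_def] by linarith
   moreover have "(yy has_real_derivative D) (at s)" using D(1) by (simp add: yy_def[abs_def] f_def)
   ultimately show ?thesis by blast
  qed
  then obtain DD where DD: "!!s. a <= s ==> s <= 1 ==> (yy has_real_derivative DD s) (at s)"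
   "!!s. a <= s ==> s <= 1 ==> DD s <= - lam * yy s + bet" by metis
  have "ms u (2 * Suc m) rho t <= th * S + B * Y^2 / dlt ^ Q" if t: "t \<in> {1 - rho / 4..1}" for t
  proof -
   have ta: "a <= t" "t <= 1" "t - a >= dlt / 4" using t R by (auto simp: a_def dlt_def field_simps)
   have t0: "t > 0" using ta a by simp
   have "yy t <= exp (- lam * (t - a)) * yy a + bet / lam" by (rule linear_decay[OF ta(1) lam bet DD]) (use ta in auto)
   also have "exp (- lam * (t - a)) * yy a <= 4 / (lam * dlt) * S"
   proof (rule mult_mono)
    have x: "lam * dlt / 4 > 0" using lam dlt by simp
    have "exp (- lam * (t - a)) <= exp (- (lam * dlt / 4))" using mult_left_mono[OF ta(3), of lam] lam by simp
    also have "... <= 1 / (lam * dlt / 4)" using order_trans[OF _ exp_ge_add_one_self[of "lam * dlt / 4"], of "lam * dlt / 4"] x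
     unfolding exp_minus inverse_eq_divide by (intro divide_left_mono) auto
    finally show "exp (- lam * (t - a)) <= 4 / (lam * dlt)" by simp
    show "yy a <= S" using y_le[of a] a mS R unfolding Mb_def by (force simp: a_def)
    show "0 <= yy a" unfolding yy_def by (rule lint_nonneg) simp
   qed (use lam dlt in auto)
   also have "4 / (lam * dlt) * S = 8 * C * kap'^2 * dlt * S" using dlt(1) by (simp add: lam_def r_def power2_eq_square)
   also have "... <= 8 * C * kap'^2 * 1 * S" using dlt C(1) S by (intro mult_right_mono mult_left_mono) auto
   also have "bet / lam = C * Y^2 / r ^ Q + 4 * C * Ce * S * (r^2 / dlt^2)" using r by (simp add: bet_def lam_def field_simps)
   also have "r^2 / dlt^2 = kap'^2" using dlt(1) by (simp add: r_def power_mult_distrib)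
   also have "C * Y^2 / r ^ Q = B * Y^2 / dlt ^ Q" by (simp add: B_def r_def power_mult_distrib)
   also have "8 * C * kap'^2 * 1 * S + (B * Y^2 / dlt ^ Q + 4 * C * Ce * S * kap'^2)
     = ((8 * C + 4 * C * Ce) * kap'^2) * S + B * Y^2 / dlt ^ Q" by (simp add: algebra_simps)
   finally show ?thesis using y_ge[OF t0] by (simp add: kap(2))
  qed
  thus ?thesis by (simp add: Mb_def dlt_def)
 qed
 show ?thesis by (rule that[of B, OF _ main]) (use C(1) kap in \<open>auto simp: B_def\<close>)
qed

text \<open>The remainder \<open>th * S\<close> is absorbed by interpolating radii, with the gap to
  \<open>R\<close> halved at each stage. Halving multiplies the other term by \<open>2 ^ Q\<close>;
  with \<open>th * 2 ^ Q = 1/2\<close> the constant \<open>B1 = 2 * 2 ^ Q * B0\<close> reproduces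
  itself. Some finite \<open>S\<close> exists beforehand by compactness, so
  \<open>th ^ K * S\<close> tends to 0.\<close>

lemma moser_absorb:
 obtains B where "B >= 1" "!!u m rho R Y. heat u ==> 1 <= rho ==> rho < R ==> R <= 2 ==> Y >= 0 ==>
  Mb u (Suc m) R Y ==> Mb u (2 * Suc m) rho (B * Y^2 / (R - rho) ^ Q)"
proof -
 define th :: real where "th = 1 / (2 * 2 ^ Q)"
 have th: "th > 0" "th * 2 ^ Q = 1/2" "th < 1"
  using less_le_trans[OF _ mult_left_mono[OF one_le_power[of "2::real" Q], of 2], of 1] by (auto simp: th_def field_simps)
 obtain B0 where B0: "B0 > 0" "!!u m rho R S Y. heat u ==> 1 <= rho ==> rho < R ==> R <= 2 ==> S >= 0 ==> Y >= 0 ==>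
  Mb u (2 * Suc m) R S ==> Mb u (Suc m) R Y ==> Mb u (2 * Suc m) rho (th * S + B0 * Y^2 / (R - rho) ^ Q)"
  using moser_step[OF th(1)] by blast
 define B1 where "B1 = 2 * 2 ^ Q * B0"
 have main: "Mb u (2 * Suc m) rho (B1 * Y^2 / (R - rho) ^ Q)"
  if u: "heat u" and R: "1 <= rho" "rho < R" "R <= 2" and Y: "Y >= 0" and mY: "Mb u (Suc m) R Y" for u m rho R Y
 proof -
  obtain S where S: "S >= 0" "Mb u (2 * Suc m) R S" using Mb_exists[OF u R(3)] by blast
  have it: "1 <= rho ==> rho < R ==> Mb u (2 * Suc m) rho (th ^ K * S + B1 * Y^2 / (R - rho) ^ Q)" for K rho
  proof (induction K arbitrary: rho)
   case 0
   thus ?case using B0(1) by (intro Mb_mono[OF u S(2) _ R(3)]) (auto simp: B1_def)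
  next
   case (Suc K)
   define rho' where "rho' = (rho + R) / 2"
   have r': "1 <= rho'" "rho < rho'" "rho' < R" "rho' - rho = (R - rho) / 2" "R - rho' = (R - rho) / 2"
    using Suc.prems by (auto simp: rho'_def field_simps)
   define X where "X = Y^2 / (R - rho) ^ Q"
   have 1: "Mb u (2 * Suc m) rho' (th ^ K * S + B1 * Y^2 / (R - rho') ^ Q)" by (rule Suc.IH[OF r'(1,3)])
   have 2: "Mb u (Suc m) rho' Y" by (rule Mb_mono[OF u mY _ R(3)]) (use r' in auto)
   have "Mb u (2 * Suc m) rho (th * (th ^ K * S + B1 * Y^2 / (R - rho') ^ Q) + B0 * Y^2 / (rho' - rho) ^ Q)"
    by (rule B0(2)[OF u Suc.prems(1) r'(2) _ _ Y 1 2]) (use r' R S th B0 in \<open>auto simp: B1_def\<close>)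
   moreover have "th * (th ^ K * S + B1 * Y^2 / (R - rho') ^ Q) + B0 * Y^2 / (rho' - rho) ^ Q = th ^ Suc K * S + B1 * Y^2 / (R - rho) ^ Q"
   proof -
    have "B1 * Y^2 / (R - rho') ^ Q = B1 * 2 ^ Q * X" "B0 * Y^2 / (rho' - rho) ^ Q = B0 * 2 ^ Q * X"
     unfolding r'(4,5) X_def by (simp_all add: power_divide)
    moreover have "th * (B1 * 2 ^ Q * X) = B1 / 2 * X" using th(2) by (simp add: mult.commute mult.left_commute)
    moreover have "B1 * Y^2 / (R - rho) ^ Q = B1 * X" by (simp add: X_def)
    moreover have "B0 * 2 ^ Q * X = B1 / 2 * X" by (simp add: B1_def)
    moreover have "B1 * X = B1 / 2 * X + B1 / 2 * X" by simp
    ultimately show ?thesis by (simp only: distrib_left power_Suc mult.assoc)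
   qed
   ultimately show ?case by simp
  qed
  show ?thesis unfolding Mb_def
  proof
   fix t assume t: "t \<in> {1 - rho / 4..1}"
   have "(%K. th ^ K * S + B1 * Y^2 / (R - rho) ^ Q) \<longlonglongrightarrow> 0 * S + B1 * Y^2 / (R - rho) ^ Q"
    using th by (intro tendsto_intros LIMSEQ_realpow_zero) auto
   thus "ms u (2 * Suc m) rho t <= B1 * Y^2 / (R - rho) ^ Q"
    using it[OF R(1,2)] t by (intro LIMSEQ_le_const[where X="%K. th ^ K * S + B1 * Y^2 / (R - rho) ^ Q"]) (auto simp: Mb_def)
  qed
 qed
 have "Mb u (2 * Suc m) rho (max 1 B1 * Y^2 / (R - rho) ^ Q)"
  if "heat u" "1 <= rho" "rho < R" "R <= 2" "Y >= 0" "Mb u (Suc m) R Y" for u m rho R Y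
  by (rule Mb_mono[OF that(1) main[OF that]]) (use that in \<open>auto intro!: divide_right_mono mult_right_mono\<close>)
 thus ?thesis by (intro that[of "max 1 B1"]) auto
qed

text \<open>The exponents are \<open>2 ^ k\<close> and the sizes \<open>1 + 1 / 2 ^ k\<close>, so
  the gap \<open>1 / 2 ^ Suc k\<close> costs the factor \<open>nu ^ Suc k\<close>. In place of a
  limit of norms, near the origin \<open>u\<close> exceeds half of its value there, and on a small
  ball the powers of this half are bounded by \<open>q ^ (2 ^ k)\<close>, so the half cannot exceed
  \<open>q\<close>. Hence the factor 2 in the constant.\<close>

lemma mean_value_unit:
 obtains C where "C > 0" "!!u Y. heat u ==> (!!t. t \<in> {1/2..1} ==> ms u 1 2 t <= Y) ==> u 0 1 <= C * Y"
proof -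
 obtain B where B: "B >= 1" "!!u m rho R Y. heat u ==> 1 <= rho ==> rho < R ==> R <= 2 ==> Y >= 0 ==>
  Mb u (Suc m) R Y ==> Mb u (2 * Suc m) rho (B * Y^2 / (R - rho) ^ Q)" using moser_absorb by blast
 define nu :: real where "nu = 2 ^ Q"
 define c where "c = B * nu"
 have nu: "nu >= 1" by (simp add: nu_def)
 have c: "c >= 1" using B(1) nu mult_mono[of 1 B 1 nu] by (simp add: c_def)
 have main: "u 0 1 <= 2 * c * nu^2 * Y" if u: "heat u" and Y: "!!t. t \<in> {1/2..1} ==> ms u 1 2 t <= Y" for u Y
 proof -
  define q where "q = c * nu^2 * Y"
  have ms0: "ms u n R t >= 0" if "t > 0" for n R t
   unfolding ms_def by (rule lint_nonneg) (use heatD(2)[OF u that] in \<open>auto simp: less_imp_le\<close>)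
  have Y0: "Y >= 0" using Y[of 1] ms0[of 1 1 2] by simp
  have q0: "q >= 0" using Y0 c nu by (simp add: q_def)
  have it: "Mb u (2 ^ k) (1 + 1 / 2 ^ k) (q ^ (2 ^ k) / (c * nu ^ Suc k))" for k
  proof (induction k)
   case 0
   have "q / (c * nu) = nu * Y" using c nu by (simp add: q_def power2_eq_square)
   moreover have "Y <= nu * Y" using mult_right_mono[OF nu Y0] by simp
   ultimately have "Y <= q / (c * nu)" by simp
   thus ?case unfolding Mb_def
   proof (intro ballI)
    fix t assume t: "t \<in> {1 - (1 + 1 / 2 ^ 0) / 4..1::real}"
    have "ms u 1 2 t <= Y" using t by (intro Y) auto
    thus "ms u (2 ^ 0) (1 + 1 / 2 ^ 0) t <= q ^ 2 ^ 0 / (c * nu ^ Suc 0)" using \<open>Y <= q / (c * nu)\<close> by simp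
   qed
  next
   case (Suc k)
   define m :: nat where "m = 2 ^ k - 1"
   have m: "Suc m = 2 ^ k" by (simp add: m_def)
   have gap: "(1 + 1 / 2 ^ k) - (1 + 1 / 2 ^ Suc k) = (1 / 2 ^ Suc k :: real)" by (simp add: field_simps)
   have "Mb u (2 * Suc m) (1 + 1 / 2 ^ Suc k) (B * (q ^ (2 ^ k) / (c * nu ^ Suc k))^2 / ((1 + 1 / 2 ^ k) - (1 + 1 / 2 ^ Suc k)) ^ Q)"
    by (rule B(2)[OF u]) (use Suc q0 c nu in \<open>auto simp: m field_simps\<close>)
   moreover have "B * X / (1 / 2 ^ Suc k :: real) ^ Q = c * nu ^ k * X" for X
   proof -
    have "(2 ^ Suc k :: real) ^ Q = nu * nu ^ k" unfolding nu_def by (simp add: power_mult_distrib power_mult[symmetric] mult.commute)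
    thus ?thesis by (simp add: c_def power_one_over power_divide)
   qed
   ultimately have "Mb u (2 ^ Suc k) (1 + 1 / 2 ^ Suc k) (c * nu ^ k * (q ^ (2 ^ k) / (c * nu ^ Suc k))^2)" unfolding gap m by simp
   thus ?case using doubling_recursion[of c nu k Y] c nu by (simp add: q_def)
  qed
  have "u 0 1 / 2 <= q"
  proof (rule ccontr)
   assume "\<not> u 0 1 / 2 <= q"
   hence x: "q < u 0 1 / 2" by simp
   define x where "x = u 0 1 / 2"
   have x0: "x > 0" using heatD(2)[OF u, of 1 0] by (simp add: x_def)
   have "isCont (%z. u z 1) 0" using smooth_continuous[OF heatD(1)[OF u, of 1]] by (simp add: continuous_on_eq_continuous_at)
   then obtain d where d: "d > 0" "!!z. dist z 0 < d ==> dist (u z 1) (u 0 1) < x" using x0 unfolding continuous_at_eps_delta by blast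
   define e where "e = min (d / 2) 1"
   have e: "e > 0" "e < d" "e <= 1" using d(1) by (auto simp: e_def)
   have ux: "u z 1 >= x" if "z \<in> cball 0 e" for z
    using d(2)[of z] that e(2) by (auto simp: x_def dist_real_def dist_commute abs_if split: if_splits)
   define mu where "mu = measure lborel (cball (0::'e) e)"
   have mu: "mu > 0" using e(1) content_cball_pos[of e 0] by (simp add: mu_def)
   have le: "mu * x ^ (2 ^ k) <= q ^ (2 ^ k)" for k
   proof -
    have "mu * x ^ (2 ^ k) = (\<integral>z. indicator (cball 0 e) z * x ^ (2 ^ k) \<partial>(lborel::'e measure))" by (simp add: mu_def)
    also have "... <= ms u (2 ^ k) (1 + 1 / 2 ^ k) 1" unfolding ms_def
    proof (rule lint_mono[OF _ ms_integrable[OF u]])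
     show "integrable lborel (%z::'e. indicator (cball 0 e) z * x ^ (2 ^ k) :: real)"
      by (intro integrable_mult_left integrable_real_indicator) (use emeasure_lborel_cball_finite[of "0::'e" e] in auto)
     fix z :: 'e
     have "cball 0 e \<subseteq> BB (1 + 1 / 2 ^ k)"
      unfolding BB_def by (rule subset_cball, rule order_trans[OF e(3) real_sqrt_ge_one]) simp
     thus "indicator (cball 0 e) z * x ^ (2 ^ k) <= indicator (BB (1 + 1 / 2 ^ k)) z * u z 1 ^ (2 ^ k)"
      using ux[of z] x0 heatD(2)[OF u, of 1 z] by (auto simp: indicator_def intro!: power_mono)
    qed simp
    also have "... <= q ^ (2 ^ k) / (c * nu ^ Suc k)" using it[of k] unfolding Mb_def by auto
    also have "... <= q ^ (2 ^ k) / 1"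
    proof (rule divide_left_mono)
     show "1 <= c * nu ^ Suc k" using mult_mono[OF c one_le_power[OF nu, of "Suc k"]] c by simp
    qed (use q0 c nu in auto)
    finally show ?thesis by simp
   qed
   have q1: "q > 0"
   proof (rule ccontr)
    assume "\<not> q > 0"
    hence "q = 0" using q0 by simp
    thus False using le[of 0] mu x0 by (simp add: mult_le_0_iff)
   qed
   have "1 < x / q" using x q1 by (simp add: x_def)
   then obtain n where n: "1 / mu < (x / q) ^ n" using real_arch_pow by blast
   also have "... <= (x / q) ^ (2 ^ n)" using \<open>1 < x / q\<close> by (intro power_increasing) auto
   finally have "1 < mu * (x / q) ^ (2 ^ n)" using mu by (simp add: field_simps)
   also have "... = mu * x ^ (2 ^ n) / q ^ (2 ^ n)" by (simp add: power_divide)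
   also have "... <= 1" using le[of n] q1 by simp
   finally show False by simp
  qed
  thus ?thesis by (simp add: q_def)
 qed
 have "2 * c * nu^2 > 0" using c nu by simp
 thus ?thesis using that[of "2 * c * nu^2"] main by blast
qed

end

section \<open>Local mass and density\<close>

text \<open>The expression is the second derivative of \<open>flat 0\<close>, which is therefore
  convex up to 1/2.\<close>

lemma flat_second:
 assumes "x <= 1 / 2" shows "0 <= flat 4 x - 2 * flat 3 x"
proof (cases "x <= 0")
 case False
 hence "inverse x >= 2" using assms by (simp add: field_simps)
 moreover have "flat 4 x - 2 * flat 3 x = inverse x ^ 3 * exp (- inverse x) * (inverse x - 2)"
  using False by (simp add: flat_def algebra_simps power4_eq_xxxx power3_eq_cube)
 ultimately show ?thesis using False by simp
qed (simp add: flat_def)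

lemma flat_nonneg: "0 <= flat m x" by (simp add: flat_def)

lemma flat_0_mono: "x <= x' ==> flat 0 x <= flat 0 x'" by (auto simp: flat_def intro: le_imp_inverse_le)

lemma (in weights) norm_dil_le:
 assumes "0 <= r" "r <= 1" shows "norm (dil r z) <= r * norm z"
proof (rule norm_le_square[THEN iffD2])
 have "dil r z \<bullet> dil r z = (\<Sum>b\<in>Basis. (r ^ w b * (z \<bullet> b))^2)"
  by (subst euclidean_inner) (simp add: power2_eq_square)
 also have "... <= (\<Sum>b\<in>Basis. (r * (z \<bullet> b))^2)"
 proof (rule sum_mono)
  fix b :: 'e assume "b \<in> Basis"
  hence "r ^ w b <= r ^ 1" using w1 assms by (intro power_decreasing) auto
  hence "(r ^ w b)^2 <= r^2" using assms by (intro power_mono) auto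
  thus "(r ^ w b * (z \<bullet> b))^2 <= (r * (z \<bullet> b))^2" unfolding power_mult_distrib by (rule mult_right_mono) simp
 qed
 also have "... = (r * norm z)^2"
  unfolding power_mult_distrib sum_distrib_left[symmetric] by (subst power2_norm_eq_inner, subst euclidean_inner) (simp add: power2_eq_square)
 finally show "0 <= r * norm z & dil r z \<bullet> dil r z <= (r * norm z)^2" using assms by simp
qed

context strat
begin

section \<open>The sub-Laplacian and test functions\<close>

definition LL :: "('e => real) => 'e => real" where
 "LL f z = (\<Sum>b\<in>Hz. XX b (XX b f) z)"

lemma LL_smooth: "smooth f ==> smooth (LL f)" unfolding LL_def[abs_def] by (intro smooth_sum XX_smooth) auto

lemma LL_csupp: "csupp f ==> csupp (LL f)" unfolding LL_def[abs_def] by (intro csupp_sum XX_csupp)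

lemma LL_left:
 assumes f: "smooth f" shows "LL (%z. f (mul a z)) z = LL f (mul a z)"
proof -
 have "XX b (%z. f (mul a z)) = (%z. XX b f (mul a z))" if "b \<in> Basis" for b using XX_left[OF that f] by (rule ext)
 thus ?thesis using f by (simp add: LL_def XX_left XX_smooth)
qed

lemma LL_dil:
 assumes f: "smooth f" and r: "r > 0" shows "LL (%z. f (dil r z)) z = r^2 * LL f (dil r z)"
proof -
 have "XX b (XX b (%z. f (dil r z))) z = r^2 * XX b (XX b f) (dil r z)" if b: "b \<in> Hz" for b
 proof -
  have b': "b \<in> Basis" "w b = 1" using b by auto
  have "XX b (%z. f (dil r z)) = (%z. r * XX b f (dil r z))" using XX_dil[OF b'(1) f r] b'(2) by (simp add: fun_eq_iff)
  moreover have "XX b (%z. r * XX b f (dil r z)) z = r * XX b (%z. XX b f (dil r z)) z"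
   by (rule XX_chain[OF b'(1) smooth_comp_UNIV[OF XX_smooth[OF b'(1) f] dil_smooth]]) (auto intro!: smooth_mult derivative_eq_intros)
  ultimately show ?thesis using XX_dil[OF b'(1) XX_smooth[OF b'(1) f] r] b'(2) by (simp add: power2_eq_square)
 qed
 thus ?thesis by (simp add: LL_def sum_distrib_left)
qed

lemma LL_symmetric:
 assumes f: "smooth f" "csupp f" and g: "smooth g"
 shows "(LBINT z. f z * LL g z) = (LBINT z. LL f z * g z)"
proof -
 have "(LBINT z. f z * LL g z) = (\<Sum>b\<in>Hz. LBINT z. f z * XX b (XX b g) z)" unfolding LL_def sum_distrib_left
  by (intro lint_sum smooth_csupp_integrable smooth_mult f XX_smooth g csupp_mult1) auto
 also have "... = (\<Sum>b\<in>Hz. LBINT z. XX b (XX b f) z * g z)"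
  by (intro sum.cong refl) (simp add: integral_by_parts f g XX_smooth XX_csupp)
 also have "... = (LBINT z. LL f z * g z)" unfolding LL_def sum_distrib_right
  by (intro lint_sum[symmetric] smooth_csupp_integrable smooth_mult f XX_smooth g csupp_mult1 XX_csupp) auto
 finally show ?thesis .
qed

lemma heat_transform:
 assumes u: "heat u" and r: "r > 0"
 shows "heat (%z t. u (mul a (dil r z)) (r^2 * t))" unfolding heat_def
proof (intro conjI allI impI)
 have s: "smooth_on (UNIV \<times> {0<..}) (%p. u (fst p) (snd p))" using u by (simp add: heat_def)
 have "smooth_on (UNIV \<times> {0<..}) (%p::'e \<times> real. u (fst (mul a (dil r (fst p)), r^2 * snd p)) (snd (mul a (dil r (fst p)), r^2 * snd p)))"
 proof (rule smooth_compose[OF _ _ s])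
  have "smooth_on (UNIV \<times> {0<..}) (%p::'e \<times> real. dil r (fst p))"
   by (rule smooth_compose[OF _ smooth_fst dil_smooth[of UNIV]]) (auto intro: open_Times)
  thus "smooth_on (UNIV \<times> {0<..}) (%p::'e \<times> real. (mul a (dil r (fst p)), r^2 * snd p))"
   by (intro smooth_Pair mul_smooth smooth_mult) (auto intro: open_Times)
 qed (use r in \<open>auto intro: open_Times\<close>)
 thus "smooth_on (UNIV \<times> {0<..}) (%p. u (mul a (dil r (fst p))) (r^2 * snd p))" by simp
 fix z and t :: real assume t: "t > 0"
 have t': "r^2 * t > 0" using t r by simp
 show "0 < u (mul a (dil r z)) (r^2 * t)" by (rule heatD(2)[OF u t'])
 have v: "smooth (%z. u z (r^2 * t))" by (rule heatD(1)[OF u t'])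
 have "LL (%z. u (mul a (dil r z)) (r^2 * t)) z = r^2 * LL (%z. u (mul a z) (r^2 * t)) (dil r z)"
  by (rule LL_dil[OF smooth_comp_UNIV[OF v mul_z_smooth] r])
 also have "LL (%z. u (mul a z) (r^2 * t)) (dil r z) = LL (%z. u z (r^2 * t)) (mul a (dil r z))" by (rule LL_left[OF v])
 finally have eq: "(\<Sum>b\<in>Hz. XX b (XX b (%z. u (mul a (dil r z)) (r^2 * t))) z) = LL (%z. u z (r^2 * t)) (mul a (dil r z)) * r^2"
  by (simp add: LL_def)
 have "((%s. r^2 * s) has_real_derivative r^2) (at t)" by (auto intro!: derivative_eq_intros)
 from DERIV_chain2[OF heatD(3)[OF u t'] this]
 show "((%s. u (mul a (dil r z)) (r^2 * s)) has_real_derivative (\<Sum>b\<in>Hz. XX b (XX b (%z. u (mul a (dil r z)) (r^2 * t))) z)) (at t)"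
  unfolding eq LL_def .
qed

text \<open>The weak form of the equation, with a test function that may depend on time: the
  backward operator applied to \<open>G\<close> appears.\<close>

lemma heat_test:
 assumes u: "heat u" and I: "open I" "I \<subseteq> {0<..}" "t \<in> I" and G: "smooth_on (I \<times> UNIV) G"
  and K: "compact K" "!!s z. s \<in> I ==> z \<notin> K ==> G (s, z) = 0"
  and d: "!!z. ((%s. G (s, z)) has_real_derivative G' z) (at t)"
 shows "((%s. LBINT z. G (s, z) * u z s) has_real_derivative (LBINT z. (G' z + LL (%z. G (t, z)) z) * u z t)) (at t)"
proof -
 have t: "t > 0" using I by auto
 note v = heatD(1)[OF u t]
 have "smooth (%z. G (t, z))" by (rule smooth_compose[OF open_UNIV smooth_Pair[OF open_UNIV smooth_const smooth_id] G]) (use I in auto)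
 note Gt = this
 have Gc: "csupp (%z. G (t, z))" unfolding csupp_def using K I by blast
 have G': "continuous_on UNIV G'" "csupp G'" using integral_deriv_param(2,3)[OF I(1,3) G K d] K(1) unfolding csupp_def by blast+
 let ?g = "%p. G p * u (snd p) (fst p)"
 have "((%s. LBINT z. ?g (s, z)) has_real_derivative (LBINT z. G' z * u z t + G (t, z) * LL (%z. u z t) z)) (at t)"
 proof (rule integral_deriv_param(1)[OF I(1,3) _ K(1)])
  show "smooth_on (I \<times> UNIV) ?g"
   by (intro smooth_mult G heat_smooth_swap[OF u I(1,2)]) (use I in \<open>auto intro: open_Times\<close>)
  show "((%s. ?g (s, z)) has_real_derivative G' z * u z t + G (t, z) * LL (%z. u z t) z) (at t)" for z
   using DERIV_mult[OF d[of z] heatD(3)[OF u t, of z]] by (simp add: LL_def mult.commute add.commute)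
 qed (use K in auto)
 moreover have "(LBINT z. G' z * u z t + G (t, z) * LL (%z. u z t) z) = (LBINT z. G' z * u z t) + (LBINT z. G (t, z) * LL (%z. u z t) z)"
  by (rule lint_add; rule csupp_integrable)
   (intro csupp_mult1 G' Gc continuous_on_mult smooth_continuous[OF v] smooth_continuous[OF Gt] smooth_continuous[OF LL_smooth[OF v]])+
 moreover have "(LBINT z. G (t, z) * LL (%z. u z t) z) = (LBINT z. LL (%z. G (t, z)) z * u z t)" by (rule LL_symmetric[OF Gt Gc v])
 moreover have "(LBINT z. (G' z + LL (%z. G (t, z)) z) * u z t) = (LBINT z. G' z * u z t) + (LBINT z. LL (%z. G (t, z)) z * u z t)"
  unfolding distrib_right by (rule lint_add; rule csupp_integrable)
   (intro csupp_mult1 G' LL_csupp Gc continuous_on_mult smooth_continuous[OF v] smooth_continuous[OF LL_smooth[OF Gt]])+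
 ultimately show ?thesis by simp
qed

lemma heat_test_const:
 assumes u: "heat u" and t: "t > 0" and g: "smooth g" "csupp g"
 shows "((%s. LBINT z. g z * u z s) has_real_derivative (LBINT z. LL g z * u z t)) (at t)"
proof -
 obtain K where K: "compact K" "!!z. z \<notin> K ==> g z = 0" using g(2) unfolding csupp_def by blast
 have "smooth_on ({0<..} \<times> UNIV) (%p::real \<times> 'e. g (snd p))"
  by (rule smooth_compose[OF _ smooth_snd g(1)]) (auto intro: open_Times)
 from heat_test[OF u _ _ _ this K(1), of t "%z. 0"] t K(2) show ?thesis by auto
qed

text \<open>A cutoff of homogeneous scale \<open>r\<close>. Since half of \<open>sqrt 3\<close> is
  at most \<open>sqrt 2\<close>, the levels 2 and 3 make the cutoff of double scale equal to 1
  wherever this one is nonzero.\<close>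

definition cut :: "real => 'e => real" where "cut r z = eta 2 3 (dil (1 / r) z)"

lemma cut:
 assumes "r > 0"
 shows "smooth (cut r)" "csupp (cut r)" "0 <= cut r z" "cut r z <= 1"
  "dil (1 / r) z \<in> BB 2 ==> cut r z = 1" "dil (1 / r) z \<notin> BB 3 ==> cut r z = 0"
proof -
 note e = eta[of 2 3, simplified]
 show "smooth (cut r)" unfolding cut_def[abs_def] by (rule smooth_comp_UNIV[OF e(1) dil_smooth])
 show "csupp (cut r)" unfolding cut_def[abs_def] using assms by (intro csupp_dil e(2)) auto
qed (simp_all add: cut_def eta)

lemma sqrt_3_le: "1 / 2 * sqrt 3 <= sqrt 2" by (rule real_le_rsqrt) (simp add: power_mult_distrib power_divide)

lemma cut_1:
 assumes r: "0 < r" "r <= R" and z: "cut r z ~= 0" shows "cut (2 * R) z = 1"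
proof (rule cut(5))
 have "dil (1 / r) z \<in> BB 3" using cut(6)[OF r(1)] z by blast
 hence n: "norm (dil (1 / r) z) <= sqrt 3" by (simp add: BB_def)
 have "norm (dil (1 / (2 * R)) z) = norm (dil (r / (2 * R)) (dil (1 / r) z))" using r by (simp add: dil_dil)
 moreover have "norm (dil (r / (2 * R)) (dil (1 / r) z)) <= r / (2 * R) * norm (dil (1 / r) z)" using r by (intro norm_dil_le) auto
 moreover have "... <= 1 / 2 * sqrt 3" using r n by (intro mult_mono) auto
 moreover have "1 / 2 * sqrt 3 <= sqrt 2" by (rule sqrt_3_le)
 ultimately have "norm (dil (1 / (2 * R)) z) <= sqrt 2" by linarith
 thus "dil (1 / (2 * R)) z \<in> BB 2" by (simp add: BB_def)
qed (use assms in auto)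

lemma cut_le: "0 < r ==> r <= R ==> cut r z <= cut (2 * R) z"
 using cut_1[of r R z] cut(3,4)[of r z] cut(3)[of "2 * R" z] by (cases "cut r z = 0") auto

lemma XX_zero:
 assumes "open U" "z \<in> U" "!!x. x \<in> U ==> f x = 0" shows "XX b f z = 0"
proof -
 have "(f has_derivative (%v. 0)) (at z)"
  by (rule has_derivative_transform_within_open[OF has_derivative_const assms(1,2)]) (use assms(3) in auto)
 hence "fderiv f z = (%v. 0)" by (rule frechet_derivative_at[symmetric])
 thus ?thesis by (simp add: XX_def)
qed

text \<open>The bound is by the cutoff of double scale, so that the derivative of the mass is again
  estimated by a mass. The factor \<open>1 / r^2\<close> comes from homogeneity.\<close>

lemma LL_cut:
 obtains C where "C > 0" "!!r z. r > 0 ==> \<bar>LL (cut r) z\<bar> <= C / r^2 * cut (2 * r) z"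
proof -
 define psi :: "'e => real" where "psi = eta 2 3"
 have psi: "smooth psi" "!!z. z \<notin> BB 3 ==> psi z = 0" using eta[of 2 3] by (auto simp: psi_def)
 have op: "open (- BB 3)" using compact_imp_closed[OF BB_compact] by (simp add: open_Compl)
 have "LL psi z = 0" if "z \<notin> BB 3" for z
 proof -
  have "XX b (XX b psi) z = 0" for b by (rule XX_zero[OF op]) (use that in \<open>auto intro!: XX_zero[OF op] psi(2)\<close>)
  thus ?thesis by (simp add: LL_def)
 qed
 note z0 = this
 have "continuous_on (BB 3) (LL psi)" by (rule continuous_on_subset[OF smooth_continuous[OF LL_smooth[OF psi(1)]]]) simp
 from compact_imp_bounded[OF compact_continuous_image[OF this BB_compact]]
 obtain C where C: "C > 0" "\<forall>x\<in>BB 3. norm (LL psi x) <= C" unfolding bounded_pos by auto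
 have "\<bar>LL (cut r) z\<bar> <= C / r^2 * cut (2 * r) z" if r: "r > 0" for r z
 proof -
  have "LL (cut r) z = LL psi (dil (1 / r) z) / r^2"
   using LL_dil[OF psi(1), of "1 / r" z] r by (simp add: cut_def[abs_def] psi_def power_divide)
  moreover have "\<bar>LL psi (dil (1 / r) z)\<bar> <= C * cut (2 * r) z"
  proof (cases "dil (1 / r) z \<in> BB 3")
   case True
   have n: "norm (dil (1 / 2) (dil (1 / r) z)) <= 1 / 2 * norm (dil (1 / r) z)" by (rule norm_dil_le) auto
   have "norm (dil (1 / r) z) <= sqrt 3" using True by (simp add: BB_def)
   with n have "norm (dil (1 / (2 * r)) z) <= 1 / 2 * sqrt 3" by (simp add: dil_dil)
   also have "... <= sqrt 2" by (rule sqrt_3_le)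
   finally have "cut (2 * r) z = 1" using r by (intro cut(5)) (auto simp: BB_def)
   thus ?thesis using C(2) True by simp
  next
   case False
   thus ?thesis using z0 C cut(3)[of "2 * r" z] r by simp
  qed
  ultimately show ?thesis using r by (simp add: field_simps)
 qed
 thus ?thesis using that C(1) by blast
qed

definition mass :: "('e => real => real) => real => real => real" where
 "mass u r s = (LBINT z. cut r z * u z s)"

lemma test_integrable:
 assumes "heat u" "s > 0" "smooth g" "csupp g" shows "integrable lborel (%z. g z * u z s)"
 by (intro smooth_csupp_integrable smooth_mult assms(3) heatD(1)[OF assms(1,2)] csupp_mult1 assms(4)) auto

lemma mass_integrable: "heat u ==> r > 0 ==> s > 0 ==> integrable lborel (%z. cut r z * u z s)" by (intro test_integrable cut)

lemma mass_nonneg: "heat u ==> r > 0 ==> s > 0 ==> 0 <= mass u r s"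
 unfolding mass_def by (rule lint_nonneg, rule mult_nonneg_nonneg[OF cut(3) less_imp_le[OF heatD(2)]])

lemma mass_mono: "heat u ==> 0 < r ==> r <= R ==> s > 0 ==> mass u r s <= mass u (2 * R) s" unfolding mass_def
 by (rule lint_mono[OF mass_integrable mass_integrable], assumption+) (simp_all add: mult_right_mono cut_le less_imp_le[OF heatD(2)])

text \<open>The starting time \<open>sig\<close> is free: any small time at which the mass at scale
  \<open>r\<close> happens to be low will do.\<close>

lemma mass_step:
 obtains C where "C > 0" "!!u r sig s t M. heat u ==> r > 0 ==> 0 < sig ==> sig < s ==> s <= t ==>
  (!!\<tau>. 0 < \<tau> ==> \<tau> <= t ==> mass u (2 * r) \<tau> <= M) ==> mass u r s <= mass u r sig + C / r^2 * t * M"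
proof -
 obtain C where C: "C > 0" "!!r z. r > 0 ==> \<bar>LL (cut r) z\<bar> <= C / r^2 * cut (2 * r) z" using LL_cut by blast
 have "mass u r s <= mass u r sig + C / r^2 * t * M"
  if u: "heat u" and r: "r > 0" and sig: "0 < sig" "sig < s" "s <= t" and M: "!!\<tau>. 0 < \<tau> ==> \<tau> <= t ==> mass u (2 * r) \<tau> <= M" for u r sig s t M
 proof -
  have d: "(mass u r has_real_derivative (LBINT z. LL (cut r) z * u z \<tau>)) (at \<tau>)" if "sig <= \<tau>" for \<tau>
   unfolding mass_def[abs_def] by (rule heat_test_const[OF u]) (use that sig r in \<open>auto intro: cut\<close>)
  obtain \<tau> where \<tau>: "sig < \<tau>" "\<tau> < s" "mass u r s - mass u r sig = (s - sig) * (LBINT z. LL (cut r) z * u z \<tau>)"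
   using MVT2[OF sig(2), of "mass u r" "%\<tau>. LBINT z. LL (cut r) z * u z \<tau>"] d by blast
  have \<tau>0: "\<tau> > 0" using \<tau> sig by simp
  have "(LBINT z. LL (cut r) z * u z \<tau>) <= (LBINT z. C / r^2 * (cut (2 * r) z * u z \<tau>))"
  proof (rule lint_mono)
   show "integrable lborel (%z. LL (cut r) z * u z \<tau>)" by (intro test_integrable u \<tau>0 LL_smooth LL_csupp cut r)
   show "integrable lborel (%z. C / r^2 * (cut (2 * r) z * u z \<tau>))"
    by (intro integrable_mult_right mass_integrable u \<tau>0) (use r in auto)
   show "LL (cut r) z * u z \<tau> <= C / r^2 * (cut (2 * r) z * u z \<tau>)" for z
    using mult_right_mono[OF order_trans[OF abs_ge_self C(2)[OF r, of z]] less_imp_le[OF heatD(2)[OF u \<tau>0, of z]]] by (simp add: mult.assoc)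
  qed
  also have "... = C / r^2 * mass u (2 * r) \<tau>" by (simp add: mass_def)
  also have "... <= C / r^2 * M" using M[of \<tau>] \<tau> sig C r by (intro mult_left_mono) auto
  finally have "(s - sig) * (LBINT z. LL (cut r) z * u z \<tau>) <= (s - sig) * (C / r^2 * M)" using sig by (intro mult_left_mono) auto
  also have "... <= t * (C / r^2 * M)"
  proof (rule mult_right_mono)
   have "0 <= M" using M[of \<tau>] mass_nonneg[OF u _ \<tau>0, of "2 * r"] \<tau> sig r by auto
   thus "0 <= C / r^2 * M" using C by simp
  qed (use sig in auto)
  finally show ?thesis using \<tau>(3) by (simp add: mult_ac)
 qed
 thus ?thesis using that C(1) by blast
qed

text \<open>The mass near a compact set stays bounded as \<open>t \<rightarrow> 0\<close>: for \<open>K\<close> large and \<open>g\<close> convex,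
 \<open>g(psi/2 - K(T - s))\<close> is a subsolution of the backward equation.\<close>

lemma local_mass:
 assumes u: "heat u" and R: "R > 0"
 shows "\<exists>T>0. EX B. \<forall>sig\<in>{0<..T}. mass u R sig <= B"
proof -
 define psi where "psi = cut (2 * R)"
 have R2: "2 * R > 0" using R by simp
 have psi: "smooth psi" "csupp psi" "!!z. 0 <= psi z" "!!z. psi z <= 1" unfolding psi_def using cut[OF R2] by auto
 obtain S where S: "compact S" "!!z. z \<notin> S ==> psi z = 0" using psi(2) unfolding csupp_def by blast
 obtain C where C: "C > 0" "!!r z. r > 0 ==> \<bar>LL (cut r) z\<bar> <= C / r^2 * cut (2 * r) z" using LL_cut by blast
 define K where "K = C / (2 * R)^2"
 have K: "K > 0" using C(1) R by (simp add: K_def)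
 have LK: "\<bar>LL psi z\<bar> <= K" for z
 proof -
  have "\<bar>LL psi z\<bar> <= K * cut (2 * (2 * R)) z" using C(2)[OF R2, of z] by (simp add: psi_def K_def)
  also have "... <= K * 1" using cut(4)[of "2 * (2 * R)" z] R K by (intro mult_left_mono) auto
  finally show ?thesis by simp
 qed
 \<comment> \<open>As \<open>psi\<close> is at most 1, \<open>psi / 2\<close> keeps the argument of
   \<open>flat 0\<close> below 1/2, where this function is convex. \<open>K * T = 1/4\<close> keeps
   it above 1/4 wherever \<open>cut R\<close> is nonzero.\<close>
 define T where "T = 1 / (4 * K)"
 have T: "T > 0" "K * T = 1/4" using K by (auto simp: T_def)
 define I where "I = {0<..<T}"
 define G where "G p = flat 0 (psi (snd p) / 2 - K * (T - fst p))" for p :: "real \<times> 'e"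
 define h where "h s = (LBINT z. G (s, z) * u z s)" for s
 have I: "open I" "I \<subseteq> {0<..}" by (auto simp: I_def)
 have oI: "open (I \<times> (UNIV::'e set))" using I by (simp add: open_Times)
 have "smooth_on (I \<times> UNIV) (%p::real \<times> 'e. (1/2) * psi (snd p) - K * (T - fst p))"
  by (intro smooth_diff smooth_mult oI smooth_const smooth_compose[OF oI smooth_snd psi(1)] smooth_fst) simp
 from smooth_compose[OF oI this smooth_flat[of 0]]
 have G: "smooth_on (I \<times> UNIV) G" by (simp add: G_def[abs_def])
 have arg: "psi z / 2 - K * (T - s) <= 1/2" if "s \<in> I" for s z
 proof -
  have "0 <= K * (T - s)" using K that by (intro mult_nonneg_nonneg) (auto simp: I_def)
  thus ?thesis using psi(4)[of z] by linarith
 qed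
 have G0: "G (s, z) = 0" if "s \<in> I" "z \<notin> S" for s z using that S(2)[of z] K by (auto simp: G_def flat_def I_def mult_le_0_iff)
 have Gd: "((%s. G (s, z)) has_real_derivative flat 2 (psi z / 2 - K * (T - s)) * K) (at s)" for s z
 proof -
  have "((%s. psi z / 2 - K * (T - s)) has_real_derivative K) (at s)" by (auto intro!: derivative_eq_intros)
  from DERIV_chain2[OF flat_deriv[of 0] this] show ?thesis by (simp add: G_def numeral_2_eq_2)
 qed
 \<comment> \<open>The time derivative contributes \<open>K * flat 2\<close>, the term with
   \<open>LL psi\<close> at least minus half of that, and the term with the squared first
   derivatives is nonnegative by convexity.\<close>
 have LG: "0 <= flat 2 (psi z / 2 - K * (T - s)) * K + LL (%z. G (s, z)) z" if s: "s \<in> I" for s z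
 proof -
  define c where "c = K * (T - s)"
  let ?f1 = "%x. flat 2 (x / 2 - c) / 2" and ?f2 = "%x. (flat 4 (x / 2 - c) - 2 * flat 3 (x / 2 - c)) / 4"
  have da: "((%x. x / 2 - c) has_real_derivative 1/2) (at x)" for x by (auto intro!: derivative_eq_intros)
  have f1: "((%x. flat 0 (x / 2 - c)) has_real_derivative ?f1 x) (at x)" for x
   using DERIV_chain2[OF flat_deriv[of 0] da] by (simp add: numeral_2_eq_2)
  have f2: "(?f1 has_real_derivative ?f2 x) (at x)" for x
  proof -
   have "((%x. flat 2 (x / 2 - c)) has_real_derivative (flat 4 (x / 2 - c) - 2 * flat 3 (x / 2 - c)) * (1 / 2)) (at x)"
    using DERIV_chain2[OF flat_deriv[of 2] da] by simp
   from DERIV_cdivide[OF this, where c=2] show ?thesis by simp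
  qed
  have sm: "smooth (%x. flat k (x / 2 - c))" for k
  proof -
   have "smooth (%x. (1/2) * x - c)" by (intro smooth_diff smooth_mult) auto
   from smooth_compose[OF open_UNIV this smooth_flat[of k]] show ?thesis by simp
  qed
  have sm1: "smooth ?f1" using smooth_mult[OF open_UNIV smooth_const[of _ "1/2"] sm[of 2]] by simp
  have sm1psi: "smooth (%z. ?f1 (psi z))" by (rule smooth_compose[OF open_UNIV psi(1) sm1]) simp
  have X: "XX b (XX b (%z. G (s, z))) z = ?f1 (psi z) * XX b (XX b psi) z + ?f2 (psi z) * (XX b psi z)^2" if b: "b \<in> Basis" for b
  proof -
   have "XX b (%z. G (s, z)) = (%z. ?f1 (psi z) * XX b psi z)" using XX_chain[OF b psi(1) sm[of 0] f1] by (simp add: G_def c_def fun_eq_iff)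
   moreover have "XX b (%z. ?f1 (psi z) * XX b psi z) z = ?f1 (psi z) * XX b (XX b psi) z + XX b (%z. ?f1 (psi z)) z * XX b psi z"
    by (rule XX_mult[OF sm1psi XX_smooth[OF b psi(1)]])
   moreover have "XX b (%z. ?f1 (psi z)) z = ?f2 (psi z) * XX b psi z" by (rule XX_chain[OF b psi(1) sm1 f2])
   ultimately show ?thesis by (simp add: power2_eq_square)
  qed
  have "LL (%z. G (s, z)) z = (\<Sum>b\<in>Hz. ?f1 (psi z) * XX b (XX b psi) z + ?f2 (psi z) * (XX b psi z)^2)"
   unfolding LL_def by (intro sum.cong refl X) auto
  also have "... = ?f1 (psi z) * LL psi z + ?f2 (psi z) * (\<Sum>b\<in>Hz. (XX b psi z)^2)"
   by (simp add: LL_def sum.distrib sum_distrib_left)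
  also have "... >= ?f1 (psi z) * (- K) + 0"
  proof (intro add_mono mult_left_mono mult_nonneg_nonneg sum_nonneg)
   show "- K <= LL psi z" using LK[of z] by linarith
   show "0 <= ?f2 (psi z)" using flat_second[OF arg[OF s, of z]] by (simp add: c_def)
  qed (auto simp: flat_nonneg)
  finally have "- (flat 2 (psi z / 2 - c) / 2 * K) <= LL (%z. G (s, z)) z" by simp
  moreover have "0 <= flat 2 (psi z / 2 - c) * K" using K by (simp add: flat_nonneg)
  ultimately show ?thesis by (simp add: c_def)
 qed
 have hd: "(h has_real_derivative (LBINT z. (flat 2 (psi z / 2 - K * (T - s)) * K + LL (%z. G (s, z)) z) * u z s)) (at s)" if "s \<in> I" for s
  unfolding h_def[abs_def] by (rule heat_test[OF u I that G S(1) G0 Gd])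
 have T2: "T / 2 \<in> I" using T by (simp add: I_def)
 have hm: "h s <= h (T / 2)" if s: "0 < s" "s <= T / 2" for s
 proof (rule DERIV_nonneg_imp_nondecreasing[OF s(2)])
  fix x assume x: "s <= x" "x <= T / 2"
  hence xI: "x \<in> I" using s T by (simp add: I_def)
  have "0 <= (LBINT z. (flat 2 (psi z / 2 - K * (T - x)) * K + LL (%z. G (x, z)) z) * u z x)"
   by (rule lint_nonneg, rule mult_nonneg_nonneg[OF LG[OF xI] less_imp_le[OF heatD(2)[OF u]]]) (use x s in simp)
  with hd[OF xI] show "EX y. (h has_real_derivative y) (at x) & 0 <= y" by blast
 qed
 define kap' where "kap' = flat 0 (1/4)"
 have kap': "kap' > 0" by (simp add: kap'_def flat_def)
 have "mass u R s <= h (T / 2) / kap'" if s: "0 < s" "s <= T / 2" for s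
 proof -
  have sI: "s \<in> I" using s T by (simp add: I_def)
  have Gs: "smooth (%z. G (s, z))" "csupp (%z. G (s, z))"
  proof -
   show "smooth (%z. G (s, z))" by (rule smooth_compose[OF open_UNIV smooth_Pair[OF open_UNIV smooth_const smooth_id] G]) (use sI in auto)
   show "csupp (%z. G (s, z))" unfolding csupp_def using S(1) G0[OF sI] by blast
  qed
  have "kap' * mass u R s = (LBINT z. kap' * (cut R z * u z s))" by (simp add: mass_def)
  also have "... <= h s" unfolding h_def
  proof (rule lint_mono)
   show "integrable lborel (%z. kap' * (cut R z * u z s))" by (intro integrable_mult_right mass_integrable u R s)
   show "integrable lborel (%z. G (s, z) * u z s)" by (rule test_integrable[OF u s(1) Gs])
   fix z
   have "kap' * cut R z <= G (s, z)"
   proof (cases "cut R z = 0")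
    case False
    hence "psi z = 1" unfolding psi_def by (rule cut_1[OF R order_refl])
    moreover have "K * (T - s) <= K * T" using K s by simp
    ultimately have "kap' <= G (s, z)" unfolding kap'_def G_def using T(2) by (intro flat_0_mono) simp
    moreover have "kap' * cut R z <= kap' * 1" using cut(4)[OF R] kap' by (intro mult_left_mono) auto
    ultimately show ?thesis by simp
   qed (simp add: G_def flat_nonneg)
   thus "kap' * (cut R z * u z s) <= G (s, z) * u z s"
    using mult_right_mono[OF _ less_imp_le[OF heatD(2)[OF u s(1), of z]]] by (simp add: mult.assoc[symmetric])
  qed
  also have "... <= h (T / 2)" by (rule hm[OF s])
  finally show ?thesis using kap' by (simp add: field_simps)
 qed
 thus ?thesis using T(1) by (intro exI[of _ "T / 2"] conjI exI[of _ "h (T / 2) / kap'"]) auto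
qed

text \<open>The parabolic dilation by \<open>sqrt t\<close> moves time \<open>t\<close> to time 1;
  its Jacobian is the power \<open>sqrt t ^ Q\<close>, and \<open>BB 2\<close> becomes the set where
  the cutoff of scale \<open>sqrt t\<close> is known to be 1.\<close>

lemma mean_value:
 obtains C where "C > 0" "!!u t Y. heat u ==> t > 0 ==> (!!s. 0 < s ==> s <= t ==> mass u (sqrt t) s <= Y) ==>
  u 0 t <= C * Y / sqrt t ^ Q"
proof -
 obtain C where C: "C > 0" "!!u Y. heat u ==> (!!t. t \<in> {1/2..1} ==> ms u 1 2 t <= Y) ==> u 0 1 <= C * Y" using mean_value_unit by blast
 have "u 0 t <= C * Y / sqrt t ^ Q"
  if u: "heat u" and t: "t > 0" and Y: "!!s. 0 < s ==> s <= t ==> mass u (sqrt t) s <= Y" for u t Y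
 proof -
  define v where "v = (%z s. u (mul 0 (dil (sqrt t) z)) ((sqrt t)^2 * s))"
  have r: "sqrt t > 0" using t by simp
  have v: "heat v" unfolding v_def by (rule heat_transform[OF u r])
  have "ms v 1 2 s <= Y / sqrt t ^ Q" if s: "s \<in> {1/2..1}" for s
  proof -
   have s0: "s > 0" using s by simp
   have ts: "t * s > 0" "t * s <= t" using s t mult_left_mono[of s 1 t] by auto
   have "ms v 1 2 s <= (LBINT z. cut 1 z * v z s)" unfolding ms_def
   proof (rule lint_mono)
    show "integrable lborel (%z. indicator (BB 2) z * v z s ^ 1)" by (rule ms_integrable[OF v s0])
    show "integrable lborel (%z. cut 1 z * v z s)" by (rule mass_integrable[OF v _ s0]) simp
    show "indicator (BB 2) z * v z s ^ 1 <= cut 1 z * v z s" for z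
     using cut(5)[of 1 z] cut(3)[of 1 z] heatD(2)[OF v s0, of z] by (cases "z \<in> BB 2") auto
   qed
   also have "... = (LBINT z. cut (sqrt t) (dil (sqrt t) z) * u (dil (sqrt t) z) (t * s))" using r t by (simp add: v_def cut_def dil_dil)
   also have "... = mass u (sqrt t) (t * s) / sqrt t ^ Q" unfolding mass_def
    by (rule integral_dil[OF r, of "%z. cut (sqrt t) z * u z (t * s)"])
     (intro continuous_on_mult smooth_continuous cut r heatD(1)[OF u ts(1)])
   also have "... <= Y / sqrt t ^ Q" using Y[OF ts] r by (intro divide_right_mono) auto
   finally show ?thesis .
  qed
  hence "v 0 1 <= C * (Y / sqrt t ^ Q)" by (rule C(2)[OF v])
  thus ?thesis using t by (simp add: v_def)
 qed
 thus ?thesis using that C(1) by blast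
qed

end

section \<open>From densities of the initial mass to pointwise bounds\<close>

text \<open>The weight accumulated by \<open>mass_step\<close> in passing from the scale
  \<open>2^j sqrt t\<close> down to \<open>sqrt t\<close>, namely
  \<open>C^j / 4^(j (j - 1) / 2)\<close>. Its decay beats every geometric growth.\<close>

fun ccoef :: "real => nat => real" where
 "ccoef C 0 = 1"
| "ccoef C (Suc j) = ccoef C j * (C / 4 ^ j)"

lemma ccoef_pos: "C > 0 ==> ccoef C j > 0" by (induction j) auto

lemma ccoef_summable:
 assumes C: "C > 0" shows "summable (%i. ccoef C i * a ^ i)"
proof -
 have "(%n. \<bar>C * a\<bar> / 4 ^ n) \<longlonglongrightarrow> 0"
 proof -
  have "(%n. \<bar>C * a\<bar> * (1/4) ^ n) \<longlonglongrightarrow> \<bar>C * a\<bar> * 0" by (intro tendsto_intros LIMSEQ_realpow_zero) auto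
  thus ?thesis by (simp only: power_one_over mult_zero_right times_divide_eq_right mult_1_right)
 qed
 hence "\<forall>\<^sub>F n in sequentially. \<bar>C * a\<bar> / 4 ^ n < 1/2" by (rule order_tendstoD) simp
 then obtain N where N: "!!n. n >= N ==> \<bar>C * a\<bar> / 4 ^ n < 1/2" by (auto simp: eventually_sequentially)
 show ?thesis
 proof (rule summable_ratio_test[of "1/2" N])
  fix n assume n: "N <= n"
  have "norm (ccoef C (Suc n) * a ^ Suc n) = (\<bar>C * a\<bar> / 4 ^ n) * norm (ccoef C n * a ^ n)" by (simp add: abs_mult power_abs)
  also have "... <= 1/2 * norm (ccoef C n * a ^ n)" using N[OF n] by (intro mult_right_mono) auto
  finally show "norm (ccoef C (Suc n) * a ^ Suc n) <= 1/2 * norm (ccoef C n * a ^ n)" .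
 qed simp
qed

context strat
begin

text \<open>Used in contrapositive form. At each scale up to \<open>rho0\<close> the mass is small
  at arbitrarily small times, and at such a time \<open>mass_step\<close> is started; above
  \<open>rho0\<close> only the bound from \<open>local_mass\<close> is available.\<close>

lemma density_bound:
 fixes s :: real
 assumes u: "heat u" and s: "s >= 0" and rho0: "rho0 > 0" and M: "M >= 0"
  and freq: "!!rho. 0 < rho ==> rho <= rho0 ==> \<exists>\<^sub>F sig in at_right 0. mass u rho sig < M * rho powr s"
 shows "EX K. \<exists>T>0. \<forall>t\<in>{0<..T}. t powr ((real Q - s) / 2) * u 0 t <= K"
proof -
 obtain C1 where C1: "C1 > 0" "!!u t Y. heat u ==> t > 0 ==> (!!s. 0 < s ==> s <= t ==> mass u (sqrt t) s <= Y) ==>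
  u 0 t <= C1 * Y / sqrt t ^ Q" using mean_value by blast
 obtain C where C: "C > 0" "!!u r sig s t M. heat u ==> r > 0 ==> 0 < sig ==> sig < s ==> s <= t ==>
  (!!\<tau>. 0 < \<tau> ==> \<tau> <= t ==> mass u (2 * r) \<tau> <= M) ==> mass u r s <= mass u r sig + C / r^2 * t * M"
  using mass_step by blast
 obtain T0 B where B: "T0 > 0" "!!sig. 0 < sig ==> sig <= T0 ==> mass u (2 * rho0) sig <= B"
 proof -
  obtain T0 B where "T0 > 0" "\<forall>sig\<in>{0<..T0}. mass u (2 * rho0) sig <= B" using local_mass[OF u, of "2 * rho0"] rho0 by auto
  thus ?thesis by (intro that[of T0 B]) auto
 qed
 have B0: "B >= 0" using B(2)[of T0] B(1) mass_nonneg[OF u, of "2 * rho0" T0] rho0 by simp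
 define T where "T = min T0 (rho0^2)"
 have T: "T > 0" using B(1) rho0 by (simp add: T_def)
 \<comment> \<open>At the last scale \<open>rho k\<close>, which exceeds \<open>rho0 / 2\<close>,
   the local bound \<open>B\<close> is turned into a multiple of \<open>rho k powr s\<close>; this
   accounts for the second entry.\<close>
 define M' where "M' = max M (B * (2 / rho0) powr s)"
 have M': "M <= M'" "B * (2 / rho0) powr s <= M'" "M' >= 0" using M by (auto simp: M'_def)
 let ?c = "ccoef C"
 note c0 = ccoef_pos[OF C(1)]
 define SS where "SS = (\<Sum>i. ?c i * (2 powr s) ^ i)"
 have "t powr ((real Q - s) / 2) * u 0 t <= C1 * M' * SS" if t: "t \<in> {0<..T}" for t
 proof -
  have t0: "t > 0" "t <= T0" "t <= rho0^2" using t by (auto simp: T_def)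
  define r where "r = sqrt t"
  have r: "r > 0" "r^2 = t" "r <= rho0" using t0 rho0 by (auto simp: r_def intro: real_le_lsqrt)
  define rho where "rho j = 2 ^ j * r" for j :: nat
  have rho: "rho j > 0" "2 * rho j = rho (Suc j)" "rho 0 = r" for j using r by (auto simp: rho_def)
  have "EX k. rho k <= rho0 & rho0 < rho (Suc k)"
  proof -
   obtain n where "rho0 / r < 2 ^ n" using real_arch_pow[of 2 "rho0 / r"] by auto
   hence ex: "EX n. rho0 < rho n" using r by (auto simp: rho_def field_simps)
   define n where "n = (LEAST n. rho0 < rho n)"
   have n: "rho0 < rho n" unfolding n_def using ex by (rule LeastI_ex)
   obtain k where k: "n = Suc k" using n r rho(3) by (cases n) auto
   have "\<not> rho0 < rho k" using not_less_Least[of k "%n. rho0 < rho n"] k n_def by auto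
   thus ?thesis using n k by (intro exI[of _ k]) auto
  qed
  then obtain k where k: "rho k <= rho0" "rho0 < rho (Suc k)" by blast
  have rhok: "rho j <= rho0" if "j <= k" for j
  proof -
   have "(2::real) ^ j <= 2 ^ k" using that by (intro power_increasing) auto
   hence "rho j <= rho k" using r by (simp add: rho_def)
   thus ?thesis using k by simp
  qed
  have it: "\<forall>sig\<in>{0<..t}. ?c j * mass u (rho j) sig <= M' * (\<Sum>i=j..k. ?c i * rho i powr s)" if "j <= k" for j using that
  proof (induction rule: inc_induct)
   case base
   show ?case
   proof
    fix sig assume sig: "sig \<in> {0<..t}"
    have "mass u (rho k) sig <= mass u (2 * rho0) sig" using sig k rho by (intro mass_mono[OF u]) auto
    also have "... <= B" using sig t0 by (intro B) auto
    also have "... = B * 1" by simp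
    also have "... <= B * ((2 / rho0 * rho k) powr s)"
    proof (rule mult_left_mono[OF _ B0])
     have "2 / rho0 * rho k >= 1" using k(2) rho(2)[of k] rho0 by (simp add: field_simps)
     thus "1 <= (2 / rho0 * rho k) powr s" using s by (simp add: ge_one_powr_ge_zero)
    qed
    also have "... = (B * (2 / rho0) powr s) * rho k powr s" using rho0 rho(1)[of k] by (subst powr_mult) auto
    also have "... <= M' * rho k powr s" by (rule mult_right_mono[OF M'(2)]) simp
    finally have "?c k * mass u (rho k) sig <= ?c k * (M' * rho k powr s)" using c0 by (intro mult_left_mono) (auto intro: less_imp_le)
    thus "?c k * mass u (rho k) sig <= M' * (\<Sum>i=k..k. ?c i * rho i powr s)" by (simp add: mult_ac)
   qed
  next
   case (step j)
   define X where "X = M' * (\<Sum>i=Suc j..k. ?c i * rho i powr s)"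
   show ?case
   proof
    fix sig assume sig: "sig \<in> {0<..t}"
    have b: "mass u (2 * rho j) \<tau> <= X / ?c (Suc j)" if "0 < \<tau>" "\<tau> <= t" for \<tau>
     using step.IH that c0[of "Suc j"] unfolding rho(2) X_def by (auto simp: field_simps simp del: ccoef.simps)
    have "\<exists>\<^sub>F \<tau> in at_right 0. mass u (rho j) \<tau> < M * rho j powr s"
     by (rule freq[OF rho(1) rhok]) (use step.hyps in auto)
    moreover have "\<forall>\<^sub>F \<tau> in at_right 0. 0 < \<tau> & \<tau> < sig" using sig by (auto simp: eventually_at_right_field)
    ultimately have "\<exists>\<^sub>F \<tau> in at_right 0. mass u (rho j) \<tau> < M * rho j powr s & (0 < \<tau> & \<tau> < sig)"
     by (rule frequently_eventually_frequently)
    then obtain \<tau> where \<tau>: "mass u (rho j) \<tau> < M * rho j powr s" "0 < \<tau>" "\<tau> < sig" using frequently_ex by blast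
    have "mass u (rho j) sig <= mass u (rho j) \<tau> + C / (rho j)^2 * t * (X / ?c (Suc j))"
     by (rule C(2)[OF u rho(1) \<tau>(2,3) _ b]) (use sig in auto)
    also have "mass u (rho j) \<tau> <= M' * rho j powr s" using \<tau>(1) mult_right_mono[OF M'(1), of "rho j powr s"] by simp
    finally have 1: "?c j * mass u (rho j) sig <= ?c j * (M' * rho j powr s + C / (rho j)^2 * t * (X / ?c (Suc j)))" using c0[of j] by simp
    have "(rho j)^2 = 4 ^ j * t"
    proof -
     have "((2::real) ^ j)^2 = (2^2) ^ j" by (simp only: power_mult[symmetric] mult.commute)
     thus ?thesis using r(2) by (simp add: rho_def power_mult_distrib)
    qed
    hence "C / (rho j)^2 * t = C / 4 ^ j" using t0 by simp
    hence "?c j * (C / (rho j)^2 * t * (X / ?c (Suc j))) = X" using c0[of j] C(1) by simp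
    hence "?c j * (M' * rho j powr s + C / (rho j)^2 * t * (X / ?c (Suc j))) = M' * (?c j * rho j powr s) + X"
     unfolding distrib_left by simp
    also have "... = M' * (\<Sum>i=j..k. ?c i * rho i powr s)"
     unfolding X_def using step.hyps by (subst (2) sum.atLeast_Suc_atMost) (auto simp: distrib_left)
    finally show "?c j * mass u (rho j) sig <= M' * (\<Sum>i=j..k. ?c i * rho i powr s)" using 1 by simp
   qed
  qed
  have sum: "(\<Sum>i=0..k. ?c i * rho i powr s) <= SS * r powr s"
  proof -
   have "rho i powr s = (2 powr s) ^ i * r powr s" for i
   proof -
    have "((2::real) ^ i) powr s = (2 powr s) ^ i" by (induction i) (simp_all add: powr_mult)
    thus ?thesis using r by (simp add: rho_def powr_mult)
   qed
   hence "(\<Sum>i=0..k. ?c i * rho i powr s) = (\<Sum>i\<in>{0..k}. ?c i * (2 powr s) ^ i) * r powr s"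
    by (simp add: sum_distrib_right mult.assoc)
   also have "... <= SS * r powr s"
    unfolding SS_def by (intro mult_right_mono sum_le_suminf ccoef_summable[OF C(1)]) (auto simp: less_imp_le[OF c0])
   finally show ?thesis .
  qed
  have "mass u (sqrt t) sig <= M' * (SS * r powr s)" if "0 < sig" "sig <= t" for sig
  proof -
   have "mass u (sqrt t) sig <= M' * (\<Sum>i=0..k. ?c i * rho i powr s)" using it[of 0] that unfolding rho(3) by (auto simp: r_def)
   also have "... <= M' * (SS * r powr s)" by (rule mult_left_mono[OF sum M'(3)])
   finally show ?thesis .
  qed
  from C1(2)[OF u t0(1) this] have ub: "u 0 t <= C1 * (M' * (SS * r powr s)) / r ^ Q" by (simp add: r_def)
  have "t powr ((real Q - s) / 2) = r powr (real Q - s)" using t0 by (simp add: r_def powr_half_sqrt[symmetric] powr_powr)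
  also have "... = r ^ Q / r powr s" using r by (simp add: powr_diff powr_realpow)
  finally have "t powr ((real Q - s) / 2) * u 0 t <= r ^ Q / r powr s * (C1 * (M' * (SS * r powr s)) / r ^ Q)"
   using mult_left_mono[OF ub, of "r ^ Q / r powr s"] r(1) by simp
  also have "r ^ Q / r powr s * (C1 * (M' * (SS * r powr s)) / r ^ Q) = C1 * M' * SS" using r(1) by simp
  finally show ?thesis .
 qed
 thus ?thesis using T by blast
qed

end

section \<open>Covering by quasi-balls\<close>

lemma vitali_selection:
 fixes B :: "'i => 'p set" and r :: "'i => real"
 assumes F: "!!i. i \<in> F ==> B i ~= {}" "!!i. i \<in> F ==> 0 < r i" "!!i. i \<in> F ==> r i <= eps"
 shows "\<exists>D\<subseteq>F. (\<forall>i\<in>D. \<forall>j\<in>D. i ~= j --> B i \<inter> B j = {}) & (\<forall>i\<in>F. \<exists>j\<in>D. B i \<inter> B j ~= {} & r i <= 2 * r j)"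
proof -
 define \<Omega> where "\<Omega> = {D. D \<subseteq> F & (\<forall>i\<in>D. \<forall>j\<in>D. i ~= j --> B i \<inter> B j = {}) &
  (\<forall>i\<in>F. (\<exists>j\<in>D. B i \<inter> B j ~= {}) --> (\<exists>j\<in>D. B i \<inter> B j ~= {} & r i <= 2 * r j))}"
 have "\<exists>D\<in>\<Omega>. \<forall>X\<in>\<Omega>. D \<subseteq> X --> X = D"
 proof (rule subset_Zorn_nonempty)
  show "\<Omega> ~= {}" unfolding \<Omega>_def by (intro ex_in_conv[THEN iffD1] exI[of _ "{}"]) simp
  fix \<C> assume ch: "\<C> ~= {}" "subset.chain \<Omega> \<C>"
  have sub: "!!D. D \<in> \<C> ==> D \<in> \<Omega>" using ch(2) by (auto simp: subset.chain_def)
  have "\<Union>\<C> \<subseteq> F" using sub unfolding \<Omega>_def by (intro Union_least) blast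
  moreover have "B i \<inter> B j = {}" if ij: "i \<in> \<Union>\<C>" "j \<in> \<Union>\<C>" "i ~= j" for i j
  proof -
   obtain D D' where D: "D \<in> \<C>" "i \<in> D" "D' \<in> \<C>" "j \<in> D'" using ij by blast
   hence "D \<subseteq> D' \<or> D' \<subseteq> D" using ch(2) unfolding subset.chain_def by blast
   then obtain E where "E \<in> \<C>" "i \<in> E" "j \<in> E" using D by blast
   thus ?thesis using sub[of E] ij(3) by (auto simp: \<Omega>_def)
  qed
  moreover have "\<exists>j\<in>\<Union>\<C>. B i \<inter> B j ~= {} & r i <= 2 * r j" if h: "i \<in> F" "j \<in> \<Union>\<C>" "B i \<inter> B j ~= {}" for i j
  proof -
   obtain D where D: "D \<in> \<C>" "j \<in> D" using h(2) by blast
   hence "\<exists>j\<in>D. B i \<inter> B j ~= {} & r i <= 2 * r j" using sub[of D] h by (simp add: \<Omega>_def) blast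
   thus ?thesis using D(1) by blast
  qed
  ultimately show "\<Union>\<C> \<in> \<Omega>" unfolding \<Omega>_def by blast
 qed
 then obtain D where D: "D \<in> \<Omega>" and max: "!!X. X \<in> \<Omega> ==> D \<subseteq> X ==> X = D" by blast
 have DF: "D \<subseteq> F" and dis: "!!i j. i \<in> D ==> j \<in> D ==> i ~= j ==> B i \<inter> B j = {}"
  and eng: "!!i j. i \<in> F ==> j \<in> D ==> B i \<inter> B j ~= {} ==> \<exists>j\<in>D. B i \<inter> B j ~= {} & r i <= 2 * r j"
  using D unfolding \<Omega>_def by blast+
 have "\<exists>j\<in>D. B i \<inter> B j ~= {}" if "i \<in> F" for i
 proof (rule ccontr)
  assume no: "\<not> (\<exists>j\<in>D. B i \<inter> B j ~= {})"
  define F' where "F' = {i \<in> F. \<forall>j\<in>D. B i \<inter> B j = {}}"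
  have F': "i \<in> F'" using that no by (auto simp: F'_def)
  have bdd: "bdd_above (r ` F')" using F(3) by (auto simp: F'_def bdd_above_def)
  define s where "s = Sup (r ` F')"
  have s: "r j <= s" if "j \<in> F'" for j unfolding s_def using that bdd by (intro cSup_upper) auto
  have "s / 2 < s" using s[OF F'] F(2)[OF that] by simp
  then obtain i0 where i0: "i0 \<in> F'" "s / 2 < r i0" using less_cSup_iff[of "r ` F'" "s / 2"] F' bdd unfolding s_def by blast
  have "insert i0 D \<in> \<Omega>" unfolding \<Omega>_def
  proof (intro CollectI conjI ballI impI)
   show "insert i0 D \<subseteq> F" using DF i0 by (auto simp: F'_def)
   show "B a \<inter> B b = {}" if "a \<in> insert i0 D" "b \<in> insert i0 D" "a ~= b" for a b using that dis i0(1) by (auto simp: F'_def)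
   fix a assume a: "a \<in> F" "\<exists>j\<in>insert i0 D. B a \<inter> B j ~= {}"
   show "\<exists>j\<in>insert i0 D. B a \<inter> B j ~= {} & r a <= 2 * r j"
   proof (cases "\<exists>j\<in>D. B a \<inter> B j ~= {}")
    case True
    thus ?thesis using eng[OF a(1)] by blast
   next
    case False
    hence "a \<in> F'" using a by (auto simp: F'_def)
    hence "r a <= 2 * r i0" using s[of a] i0(2) by linarith
    moreover have "B a \<inter> B i0 ~= {}" using a(2) False by blast
    ultimately show ?thesis by blast
   qed
  qed
  hence "i0 \<in> D" using max[of "insert i0 D"] by blast
  thus False using i0(1) F(1)[of i0] by (auto simp: F'_def)
 qed
 hence "\<forall>i\<in>F. \<exists>j\<in>D. B i \<inter> B j ~= {} & r i <= 2 * r j" using eng by blast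
 thus ?thesis using DF dis by (intro exI[of _ D]) blast
qed

lemma sum_shells:
 fixes f :: "'i => real" and n :: "'i => nat"
 assumes I: "finite I" and \<eta>: "\<eta> >= 0" and le: "!!m. (\<Sum>i\<in>{i\<in>I. n i = m}. f i) <= \<eta> * (1/2) ^ Suc m"
 shows "sum f I <= \<eta>"
proof -
 have "sum f I = (\<Sum>m\<in>n ` I. \<Sum>i\<in>{i\<in>I. n i = m}. f i)" by (rule sum.image_gen[OF I])
 also have "... <= (\<Sum>m\<in>n ` I. \<eta> * (1/2) ^ Suc m)" by (rule sum_mono[OF le])
 also have "... = \<eta> * (\<Sum>m\<in>n ` I. (1/2) ^ Suc m)" by (simp add: sum_distrib_left)
 also have "... <= \<eta> * (\<Sum>m. (1/2) ^ Suc m)"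
  using power_half_series by (intro mult_left_mono[OF _ \<eta>] sum_le_suminf) (auto simp: I sums_iff)
 also have "(\<Sum>m. (1/2) ^ Suc m) = (1::real)" using power_half_series by (rule sums_unique[symmetric])
 finally show ?thesis by simp
qed

context strat
begin

lemma ginv_dil:
 assumes "r > 0" shows "dil r (ginv z) = ginv (dil r z)"
proof -
 have "mul (dil r z) (dil r (ginv z)) = 0" by (simp add: mul_dil[OF assms, symmetric])
 hence "mul (ginv (dil r z)) (mul (dil r z) (dil r (ginv z))) = ginv (dil r z)" by simp
 thus ?thesis by simp
qed

lemma mul_continuous: "continuous_on UNIV (%p. mul (fst p) (snd p))" by (intro smooth_continuous mul_smooth) auto

lemma ginv_continuous: "continuous_on S ginv" by (rule continuous_on_subset[OF smooth_continuous[OF ginv_smooth]]) simp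

lemma mass_translate:
 assumes u: "heat u" and r: "r > 0" and s: "s > 0"
 shows "mass (%z t. u (mul x z) t) r s = (LBINT z. cut r (mul (ginv x) z) * u z s)"
proof -
 have "smooth (%z. cut r (mul (ginv x) z) * u z s)"
  by (intro smooth_mult smooth_comp_UNIV[OF cut(1)[OF r] mul_z_smooth] heatD(1)[OF u s]) simp
 from integral_left[OF this csupp_mult1[OF csupp_left[OF cut(2)[OF r]]], of x]
 show ?thesis by (simp add: mass_def)
qed

lemma heat_left: "heat u ==> heat (%z t. u (mul x z) t)" using heat_transform[of u 1 x] by simp

text \<open>If a quasi-ball of scale \<open>r\<close> meets one of scale \<open>r'\<close> with
  \<open>r <= 2 * r'\<close>, then its centre lies in this set, dilated by \<open>r'\<close> and
  moved to the other centre; \<open>th\<close> is the quotient \<open>r / r'\<close>. Only centres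
  have to be covered, since they are the points of the given set. The value \<open>th = 0\<close>
  makes the set compact and puts \<open>BB 3\<close> into it.\<close>

definition engulf :: "'e set" where
 "engulf = (%(k', k, th). mul k' (ginv (dil th k))) ` (BB 3 \<times> BB 3 \<times> {0..2})"

lemma engulf_compact: "compact engulf" unfolding engulf_def
proof (rule compact_continuous_image)
 have "continuous_on X (%p. dil (snd (snd p)) (fst (snd p)))" for X :: "('e \<times> 'e \<times> real) set"
  unfolding dil_def by (intro continuous_intros)
 note c = continuous_on_compose2[OF ginv_continuous this subset_UNIV]
 show "continuous_on (BB 3 \<times> BB 3 \<times> {0..2}) (%(k', k, th). mul k' (ginv (dil th k)))" unfolding case_prod_beta
  using continuous_on_compose2[OF mul_continuous continuous_on_Pair[OF continuous_on_fst[OF continuous_on_id] c] subset_UNIV] by simp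
qed (auto intro!: compact_Times BB_compact)

lemma BB_subset_engulf: "BB 3 \<subseteq> engulf"
proof
 fix z :: 'e assume z: "z \<in> BB 3"
 have "ginv 0 = 0" using mul_ginv_left[of 0] by (simp only: mul_0_right)
 hence "z = (%(k', k, th). mul k' (ginv (dil th k))) (z, 0, 0)" by simp
 moreover have "(z, 0, 0) \<in> BB 3 \<times> BB 3 \<times> {0..2::real}" using z by (simp add: BB_def)
 ultimately show "z \<in> engulf" unfolding engulf_def by (rule image_eqI)
qed

definition qball :: "'e => real => 'e set => 'e set" where "qball x r K = (%k. mul x (dil r k)) ` K"

lemma engulfing:
 assumes "0 < r" "0 < r'" "r <= 2 * r'" "qball x r (BB 3) \<inter> qball x' r' (BB 3) ~= {}"
 shows "x \<in> qball x' r' engulf"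
proof -
 obtain k k' where k: "k \<in> BB 3" "k' \<in> BB 3" "mul x (dil r k) = mul x' (dil r' k')" using assms(4) unfolding qball_def by blast
 have "dil r' (ginv (dil (r / r') k)) = ginv (dil r k)" using assms by (simp add: ginv_dil dil_dil)
 hence "mul x' (dil r' (mul k' (ginv (dil (r / r') k)))) = mul (mul x' (dil r' k')) (ginv (dil r k))"
  using assms by (simp add: mul_dil mul_assoc)
 also have "... = x" unfolding k(3)[symmetric] by (simp add: mul_assoc)
 finally have "x = mul x' (dil r' (mul k' (ginv (dil (r / r') k))))" by simp
 moreover have "mul k' (ginv (dil (r / r') k)) \<in> engulf"
  unfolding engulf_def using k assms by (intro image_eqI[of _ _ "(k', k, r / r')"]) (auto simp: field_simps)
 ultimately show ?thesis unfolding qball_def by blast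
qed

lemma cut_translate_0:
 assumes "r > 0" "cut r (mul (ginv x) z) ~= 0" shows "z \<in> qball x r (BB 3)"
proof -
 have "dil (1 / r) (mul (ginv x) z) \<in> BB 3" using cut(6)[OF assms(1)] assms(2) by blast
 moreover have "z = mul x (dil r (dil (1 / r) (mul (ginv x) z)))" using assms(1) by (simp add: dil_inverse)
 ultimately show ?thesis unfolding qball_def by blast
qed

lemma qballs_bounded: "EX R>=1. ALL x r z. norm x <= m --> 0 < r --> r <= 1 --> z \<in> qball x r (BB 3) --> cut R z = 1"
proof -
 let ?f = "%p. mul (fst p) (dil (fst (snd p)) (snd (snd p)))"
 have "continuous_on X (%p. dil (fst (snd p)) (snd (snd p)))" for X :: "('e \<times> real \<times> 'e) set"
  unfolding dil_def by (intro continuous_intros)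
 from continuous_on_compose2[OF mul_continuous continuous_on_Pair[OF continuous_on_fst[OF continuous_on_id] this] subset_UNIV]
 have "continuous_on (cball 0 m \<times> {0..1} \<times> BB 3) ?f" by simp
 from compact_imp_bounded[OF compact_continuous_image[OF this]]
 have "bounded (?f ` (cball 0 m \<times> {0..1} \<times> BB 3))" by (simp add: compact_Times BB_compact)
 then obtain R0 where "\<forall>x\<in>?f ` (cball 0 m \<times> {0..1} \<times> BB 3). norm x <= R0" unfolding bounded_iff by blast
 hence R0: "norm (?f p) <= R0" if "p \<in> cball 0 m \<times> {0..1} \<times> BB 3" for p using that by blast
 define R where "R = max 1 R0"
 have R: "R >= 1" "R0 <= R" by (auto simp: R_def)
 have "cut R z = 1" if h: "norm x <= m" "0 < r" "r <= 1" "z \<in> qball x r (BB 3)" for x r z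
 proof (rule cut(5))
  obtain k where k: "k \<in> BB 3" "z = ?f (x, r, k)" using h(4) by (auto simp: qball_def)
  have "norm z <= R" unfolding k(2) using k(1) h R(2) by (intro order_trans[OF R0]) auto
  moreover have "norm (dil (1 / R) z) <= 1 / R * norm z" using R by (intro norm_dil_le) auto
  moreover have "1 / R * norm z <= 1 / R * R" using R \<open>norm z <= R\<close> by (intro mult_left_mono) auto
  moreover have "1 / R * R = 1" using R by simp
  ultimately have "norm (dil (1 / R) z) <= 1" by linarith
  hence "norm (dil (1 / R) z) <= sqrt 2" by (rule order_trans) simp
  thus "dil (1 / R) z \<in> BB 2" by (simp add: BB_def)
 qed (use R in auto)
 thus ?thesis using R(1) by blast
qed

lemma disjoint_mass:
 assumes u: "heat u" and I: "finite I" and R: "R > 0" and t: "t > 0"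
  and r: "!!x r. (x, r) \<in> I ==> 0 < r"
  and dis: "!!i j. i \<in> I ==> j \<in> I ==> i ~= j ==> qball (fst i) (snd i) (BB 3) \<inter> qball (fst j) (snd j) (BB 3) = {}"
  and R1: "!!x r z. (x, r) \<in> I ==> z \<in> qball x r (BB 3) ==> cut R z = 1"
 shows "(\<Sum>i\<in>I. mass (%z t. u (mul (fst i) z) t) (snd i) t) <= mass u R t"
proof -
 let ?g = "%i z. cut (snd i) (mul (ginv (fst i)) z) * u z t"
 have r': "0 < snd i" if "i \<in> I" for i using r[of "fst i" "snd i"] that by simp
 have int: "integrable lborel (?g i)" if "i \<in> I" for i
  by (intro test_integrable u t smooth_comp_UNIV[OF cut(1) mul_z_smooth] csupp_left cut(2) r' that)
 have "(\<Sum>i\<in>I. mass (%z t. u (mul (fst i) z) t) (snd i) t) = (\<Sum>i\<in>I. LBINT z. ?g i z)"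
  by (intro sum.cong refl mass_translate u r' t)
 also have "... = (LBINT z. (\<Sum>i\<in>I. ?g i z))" by (rule lint_sum[symmetric, OF int])
 also have "... <= mass u R t" unfolding mass_def
 proof (rule lint_mono)
  show "integrable lborel (%z. \<Sum>i\<in>I. ?g i z)" by (rule Bochner_Integration.integrable_sum[OF int])
  show "integrable lborel (%z. cut R z * u z t)" by (rule mass_integrable[OF u R t])
  fix z
  have u0: "0 <= u z t" using heatD(2)[OF u t, of z] by simp
  show "(\<Sum>i\<in>I. ?g i z) <= cut R z * u z t"
  proof (cases "\<exists>j\<in>I. cut (snd j) (mul (ginv (fst j)) z) ~= 0")
   case True
   then obtain j where j: "j \<in> I" "cut (snd j) (mul (ginv (fst j)) z) ~= 0" by blast
   have zj: "z \<in> qball (fst j) (snd j) (BB 3)" by (rule cut_translate_0[OF r'[OF j(1)] j(2)])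
   have "?g i z = 0" if "i \<in> I" "i ~= j" for i
    using cut_translate_0[OF r'[OF that(1)], of "fst i" z] dis[OF that(1) j(1) that(2)] zj by fastforce
   hence "(\<Sum>i\<in>I - {j}. ?g i z) = 0" by (intro sum.neutral) blast
   hence "(\<Sum>i\<in>I. ?g i z) = ?g j z" using I j(1) by (simp add: sum.remove[of I j])
   also have "... <= 1 * u z t" by (rule mult_right_mono[OF cut(4)[OF r'[OF j(1)]] u0])
   also have "... = cut R z * u z t" using R1[of "fst j" "snd j" z] j(1) zj by simp
   finally show ?thesis .
  next
   case False
   hence "(\<Sum>i\<in>I. ?g i z) = 0" by (intro sum.neutral) auto
   thus ?thesis using cut(3)[OF R, of z] u0 by simp
  qed
 qed
 finally show ?thesis .
qed

text \<open>The local bound on the mass depends on the distance from the origin, so the threshold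
  for the density is chosen separately in each shell \<open>n x = m\<close>, and the shells
  contribute a geometric series. Within a shell finitely many selected quasi-balls share a time at
  which all their lower bounds hold, and their disjointness bounds the sum by the local
  mass.\<close>

lemma density_points_cover:
 fixes s :: real
 assumes u: "heat u" and eps: "eps > 0" and \<eta>: "\<eta> > 0"
  and S: "!!x M rho0. x \<in> S ==> M >= 0 ==> rho0 > 0 ==>
   \<exists>rho>0. rho <= rho0 & (\<forall>\<^sub>F sig in at_right 0. M * rho powr s <= mass (%z t. u (mul x z) t) rho sig)"
 shows "EX D. countable D & (\<forall>(x, r)\<in>D. 0 < r & r <= eps) &
  (\<forall>I\<subseteq>D. finite I --> (\<Sum>i\<in>I. snd i powr s) <= \<eta>) & S \<subseteq> (\<Union>(x, r)\<in>D. qball x r engulf)"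
proof -
 define n where "n x = nat \<lceil>norm (x::'e)\<rceil>" for x
 have nx: "norm x <= real (n x)" for x unfolding n_def by (simp add: real_nat_ceiling_ge)
 have "EX R>=1. ALL x r z. norm x <= real m --> 0 < r --> r <= 1 --> z \<in> qball x r (BB 3) --> cut R z = 1" for m :: nat
  by (rule qballs_bounded)
 then obtain R where R: "!!m. R m >= 1" "!!m x r z. norm x <= real m ==> 0 < r ==> r <= 1 ==> z \<in> qball x r (BB 3) ==> cut (R m) z = 1"
  by metis
 have R0: "R m > 0" for m using R(1)[of m] by linarith
 have "EX B. \<exists>T>0. \<forall>sig\<in>{0<..T}. mass u (R m) sig <= B" for m using local_mass[OF u R0] by blast
 then obtain B T where T: "!!m. T m > 0" and B: "!!m sig. sig \<in> {0<..T m} ==> mass u (R m) sig <= B m" by metis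
 have B0: "B m >= 0" for m using B[of "T m" m] T[of m] mass_nonneg[OF u R0, of "T m" m] by simp
 \<comment> \<open>With this threshold the shell \<open>m\<close> contributes at most
   \<open>\<eta> * (1/2) ^ Suc m\<close>. The added 1 keeps it positive when the local bound is
   0.\<close>
 define M where "M m = (B m + 1) * 2 ^ Suc m / \<eta>" for m
 have M0: "M m > 0" for m using B0[of m] \<eta> by (auto simp: M_def)
 define F where "F = {(x, r). x \<in> S & 0 < r & r <= min eps 1 &
  (\<forall>\<^sub>F sig in at_right 0. M (n x) * r powr s <= mass (%z t. u (mul x z) t) r sig)}"
 let ?B = "%i. qball (fst i) (snd i) (BB 3)"
 have "\<exists>D\<subseteq>F. (\<forall>i\<in>D. \<forall>j\<in>D. i ~= j --> ?B i \<inter> ?B j = {}) & (\<forall>i\<in>F. \<exists>j\<in>D. ?B i \<inter> ?B j ~= {} & snd i <= 2 * snd j)"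
 proof (rule vitali_selection[of F ?B snd "min eps 1"])
  have "(0::'e) \<in> BB 3" by (simp add: BB_def)
  thus "?B i ~= {}" for i unfolding qball_def by blast
 qed (auto simp: F_def)
 then obtain D where D1: "D \<subseteq> F" and D2: "\<forall>i\<in>D. \<forall>j\<in>D. i ~= j --> ?B i \<inter> ?B j = {}"
  and D3: "\<forall>i\<in>F. \<exists>j\<in>D. ?B i \<inter> ?B j ~= {} & snd i <= 2 * snd j" by (elim exE conjE) (rule that; assumption)
 note D = D1 D2[rule_format] D3[rule_format]
 have DF: "0 < r" "r <= eps" "r <= 1" "\<forall>\<^sub>F sig in at_right 0. M (n x) * r powr s <= mass (%z t. u (mul x z) t) r sig"
  if "(x, r) \<in> D" for x r using that D(1) by (auto simp: F_def)
 have sums: "(\<Sum>i\<in>I. snd i powr s) <= \<eta>" if I: "I \<subseteq> D" "finite I" for I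
 proof (rule sum_shells[OF I(2), where n="%i. n (fst i)"])
  fix m
  define J where "J = {i\<in>I. n (fst i) = m}"
  have J: "finite J" "J \<subseteq> D" using I by (auto simp: J_def)
  have nJ: "n (fst i) = m" if "i \<in> J" for i using that by (simp add: J_def)
  have "\<forall>\<^sub>F sig in at_right 0. \<forall>i\<in>J. M m * snd i powr s <= mass (%z t. u (mul (fst i) z) t) (snd i) sig"
  proof (rule eventually_ball_finite[OF J(1)], rule ballI)
   fix i assume "i \<in> J"
   thus "\<forall>\<^sub>F sig in at_right 0. M m * snd i powr s <= mass (%z t. u (mul (fst i) z) t) (snd i) sig"
    using DF(4)[of "fst i" "snd i"] J(2) nJ by auto
  qed
  moreover have "\<forall>\<^sub>F sig in at_right 0. sig \<in> {0<..T m}"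
   using T[of m] by (auto simp: eventually_at_right_field intro!: exI[of _ "T m"])
  ultimately have "\<forall>\<^sub>F sig in at_right 0. sig \<in> {0<..T m} & (\<forall>i\<in>J. M m * snd i powr s <= mass (%z t. u (mul (fst i) z) t) (snd i) sig)"
   by eventually_elim auto
  then obtain sig where sig: "sig \<in> {0<..T m}" "!!i. i \<in> J ==> M m * snd i powr s <= mass (%z t. u (mul (fst i) z) t) (snd i) sig"
   using eventually_happens'[OF trivial_limit_at_right_real] by blast
  have "M m * (\<Sum>i\<in>J. snd i powr s) <= (\<Sum>i\<in>J. mass (%z t. u (mul (fst i) z) t) (snd i) sig)"
   unfolding sum_distrib_left by (rule sum_mono[OF sig(2)])
  also have "... <= mass u (R m) sig"
  proof (rule disjoint_mass[OF u J(1) R0])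
   show "sig > 0" using sig(1) by simp
   show "0 < r" if "(x, r) \<in> J" for x r using DF(1)[of x r] that J(2) by auto
   show "?B i \<inter> ?B j = {}" if "i \<in> J" "j \<in> J" "i ~= j" for i j using D(2)[of i j] that J(2) by auto
   show "cut (R m) z = 1" if "(x, r) \<in> J" "z \<in> qball x r (BB 3)" for x r z
    using R(2)[of x m r z] DF(1,3)[of x r] nx[of x] nJ[OF that(1)] that J(2) by auto
  qed
  also have "... <= B m + 1" using B[OF sig(1)] by simp
  also have "... = M m * (\<eta> * (1/2) ^ Suc m)" using \<eta> by (simp add: M_def power_one_over)
  finally show "(\<Sum>i\<in>{i\<in>I. n (fst i) = m}. snd i powr s) <= \<eta> * (1/2) ^ Suc m" using M0[of m] unfolding J_def by simp
 qed (use \<eta> in auto)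
 \<comment> \<open>A family of nonzero numbers whose finite sums are bounded is countable;
   disjointness alone is not exploited here.\<close>
 have "countable D"
 proof -
  have "(%i. snd i powr s) summable_on D" by (rule nonneg_bdd_above_summable_on) (use sums in \<open>auto simp: bdd_above_def\<close>)
  from summable_countable_real[OF this]
  moreover have "{i\<in>D. snd i powr s ~= 0} = D" using DF(1) by fastforce
  ultimately show ?thesis by simp
 qed
 moreover have "S \<subseteq> (\<Union>(x, r)\<in>D. qball x r engulf)"
 proof
  fix x assume x: "x \<in> S"
  then obtain r where "0 < r" "r <= min eps 1" "\<forall>\<^sub>F sig in at_right 0. M (n x) * r powr s <= mass (%z t. u (mul x z) t) r sig"
   using S[OF x less_imp_le[OF M0], of "min eps 1" "n x"] eps by auto
  hence "(x, r) \<in> F" using x by (auto simp: F_def)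
  from D(3)[OF this] obtain x' r' where j: "(x', r') \<in> D" "qball x r (BB 3) \<inter> qball x' r' (BB 3) ~= {}" "r <= 2 * r'"
   by (metis fst_conv prod.collapse snd_conv)
  have "x \<in> qball x' r' engulf" by (rule engulfing[OF \<open>0 < r\<close> DF(1)[OF j(1)] j(3,2)])
  thus "x \<in> (\<Union>(x, r)\<in>D. qball x r engulf)" using j(1) by blast
 qed
 ultimately show ?thesis using DF(1,2) sums by (intro exI[of _ D]) auto
qed

lemma singular_set_cover:
 fixes s :: real
 assumes u: "heat u" and s: "s >= 0" and eps: "eps > 0" and \<eta>: "\<eta> > 0"
 shows "EX D. countable D & (\<forall>(x, r)\<in>D. 0 < r & r <= eps) &
  (\<forall>I\<subseteq>D. finite I --> (\<Sum>i\<in>I. snd i powr s) <= \<eta>) & S_set (real Q - s) u \<subseteq> (\<Union>(x, r)\<in>D. qball x r engulf)"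
proof (rule density_points_cover[OF u eps \<eta>])
 fix x :: 'e and M rho0 :: real
 assume x: "x \<in> S_set (real Q - s) u" and M: "M >= 0" and rho0: "rho0 > 0"
 define v where "v = (%z t. u (mul x z) t)"
 have v: "heat v" unfolding v_def by (rule heat_left[OF u])
 show "\<exists>rho>0. rho <= rho0 & (\<forall>\<^sub>F sig in at_right 0. M * rho powr s <= mass (%z t. u (mul x z) t) rho sig)"
 proof (rule ccontr)
  assume no: "\<not> ?thesis"
  have "\<exists>\<^sub>F sig in at_right 0. mass v rho sig < M * rho powr s" if "0 < rho" "rho <= rho0" for rho
   using no that unfolding v_def[symmetric] by (auto simp: not_eventually not_le)
  from density_bound[OF v s rho0 M this]
  obtain K T where K: "T > 0" "!!t. t \<in> {0<..T} ==> t powr ((real Q - s) / 2) * v 0 t <= K" by blast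
  have "Limsup (at_right 0) (%t. ereal (t powr ((real Q - s) / 2) * u x t)) <= ereal K"
  proof (rule Limsup_bounded)
   show "\<forall>\<^sub>F t in at_right 0. ereal (t powr ((real Q - s) / 2) * u x t) <= ereal K"
    using K by (auto simp: eventually_at_right_field v_def intro!: exI[of _ T])
  qed
  thus False using x by (simp add: S_set_def)
 qed
qed

end

section \<open>The Carnot-Caratheodory metric and Hausdorff measure\<close>

abbreviation (input) fine_family :: "real => real => nat => (nat => real) => (nat => real) => real => bool" where
 "fine_family c d n a b dlt \<equiv> (\<forall>i<n. c <= a i & a i <= b i & b i <= d) &
  (\<forall>i<n. \<forall>j<n. i ~= j --> {a i<..<b i} \<inter> {a j<..<b j} = {}) & (\<Sum>i<n. b i - a i) < dlt"

lemma outer_open_null: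
 assumes "Z \<in> null_sets lborel" "dlt > 0"
 obtains V :: "real set" where "open V" "Z \<subseteq> V" "emeasure lborel V < ennreal dlt"
proof -
 have "Z \<in> sets borel" using assms(1) by (auto simp: null_sets_def)
 then obtain V where V: "open V" "Z \<subseteq> V" "emeasure lborel (V - Z) < ennreal dlt"
  using outer_regular_lborel[of Z dlt] assms(2) by blast
 have "emeasure lborel (V - Z) = emeasure lborel V" using assms(1) V(1) by (intro emeasure_Diff_null_set) auto
 thus ?thesis using that V by simp
qed

text \<open>A Cousin argument: on a fine division, intervals tagged in the exceptional null set lie in an
 open set of small measure, where absolute continuity applies.\<close>

lemma abs_cont_bound:
 fixes h :: "real => real"
 assumes ac: "abs_cont_on c d h" and cd: "c <= d" and K: "K >= 0"
  and der: "AE s in lborel. c < s & s < d --> (EX D. (h has_real_derivative D) (at s) & \<bar>D\<bar> <= K)"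
 shows "\<bar>h d - h c\<bar> <= K * (d - c)"
proof (rule field_le_epsilon)
 fix e0 :: real assume e0: "e0 > 0"
 define eps where "eps = e0 / (d - c + 1)"
 have "eps * (d - c + 1) = e0" using cd by (simp add: eps_def)
 hence eps: "eps > 0" "eps * (d - c) + eps = e0" using e0 cd by (auto simp: eps_def distrib_left)
 from ac eps(1) obtain dlt where dlt: "dlt > 0" "!!n (a :: nat => real) b.
   fine_family c d n a b dlt ==> (\<Sum>i<n. dist (h (a i)) (h (b i))) < eps" unfolding abs_cont_on_def by blast
 from der obtain Z0 where Z0: "Z0 \<in> null_sets lborel"
  "!!s. s \<notin> Z0 ==> c < s ==> s < d ==> EX D. (h has_real_derivative D) (at s) & \<bar>D\<bar> <= K" by (elim AE_E3) auto
 \<comment> \<open>The end points, where nothing is assumed about the derivative, are counted as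
   exceptional.\<close>
 define Z where "Z = Z0 \<union> {c, d}"
 have "Z \<in> null_sets lborel" unfolding Z_def by (intro null_sets.Un Z0 finite_imp_null_set_lborel) auto
 then obtain V where V: "open V" "Z \<subseteq> V" "emeasure lborel V < ennreal dlt" using outer_open_null[OF _ dlt(1)] by blast
 have loc: "\<exists>rho>0. ALL u v. u <= t & t <= v & {u..v} \<subseteq> ball t rho --> \<bar>h v - h u\<bar> <= (K + eps) * (v - u)"
  if t: "t \<notin> Z" "c < t" "t < d" for t
 proof -
  obtain D where D: "(h has_real_derivative D) (at t)" "\<bar>D\<bar> <= K" using Z0(2)[of t] t by (auto simp: Z_def)
  obtain rho where rho: "rho > 0" "!!y. norm (y - t) < rho ==> norm (h y - h t - D * (y - t)) <= eps * norm (y - t)"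
   using D(1) eps(1) unfolding has_field_derivative_def has_derivative_at_alt by blast
  have st: "\<bar>h y - h t\<bar> <= (K + eps) * \<bar>y - t\<bar>" if "\<bar>y - t\<bar> < rho" for y
  proof -
   have "\<bar>h y - h t\<bar> <= \<bar>D * (y - t)\<bar> + eps * \<bar>y - t\<bar>" using rho(2)[of y] that by auto
   also have "\<bar>D * (y - t)\<bar> <= K * \<bar>y - t\<bar>" unfolding abs_mult by (rule mult_right_mono[OF D(2)]) simp
   finally show ?thesis by (simp add: distrib_right)
  qed
  have "\<bar>h v - h u\<bar> <= (K + eps) * (v - u)" if uv: "u <= t" "t <= v" "{u..v} \<subseteq> ball t rho" for u v
  proof -
   have "u \<in> {u..v}" "v \<in> {u..v}" using uv by auto
   hence "u \<in> ball t rho" "v \<in> ball t rho" using uv(3) by blast+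
   hence "\<bar>h u - h t\<bar> <= (K + eps) * \<bar>u - t\<bar>" "\<bar>h v - h t\<bar> <= (K + eps) * \<bar>v - t\<bar>"
    by (intro st; simp add: dist_real_def abs_minus_commute)+
   moreover have "(K + eps) * \<bar>u - t\<bar> + (K + eps) * \<bar>v - t\<bar> = (K + eps) * (v - u)" using uv by (simp add: algebra_simps)
   ultimately show ?thesis by linarith
  qed
  thus ?thesis using rho(1) by blast
 qed
 define rho where "rho t = (SOME rho. rho > 0 & (ALL u v. u <= t & t <= v & {u..v} \<subseteq> ball t rho --> \<bar>h v - h u\<bar> <= (K + eps) * (v - u)))" for t
 have rho: "rho t > 0 & (ALL u v. u <= t & t <= v & {u..v} \<subseteq> ball t (rho t) --> \<bar>h v - h u\<bar> <= (K + eps) * (v - u))"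
  if "t \<notin> Z" "c < t" "t < d" for t unfolding rho_def by (rule someI_ex[OF loc[OF that]])
 \<comment> \<open>Intervals with exceptional tag are forced into \<open>V\<close>, all others into
   a ball where the difference quotient is controlled. Since \<open>c\<close> and \<open>d\<close>
   lie in \<open>Z\<close>, the value \<open>UNIV\<close> is taken only outside the
   interval.\<close>
 define g where "g t = (if t \<in> Z then V else if c < t & t < d then ball t (rho t) else UNIV)" for t
 have "gauge g" unfolding gauge_def g_def using V rho by auto
 then obtain p where p: "p tagged_division_of {c..d}" "g fine p" using fine_division_exists_real by blast
 have fin: "finite p" using p(1) by blast
 have el: "EX u v. k = {u..v} & u <= x & x <= v & c <= u & v <= d & {u..v} \<subseteq> g x" if xk: "(x, k) \<in> p" for x k
 proof -
  obtain u v where k: "k = {u..v}" using tagged_division_ofD(4)[OF p(1)[folded box_real(2)] xk] by (auto simp: box_real)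
  have "x \<in> k" "k \<subseteq> {c..d}" using tagged_division_ofD(2,3)[OF p(1) xk] by auto
  moreover have "k \<subseteq> g x" using p(2) xk unfolding fine_def by auto
  ultimately show ?thesis using k by auto
 qed
 let ?I = "%q::real \<times> real set. h (Sup (snd q)) - h (Inf (snd q))"
 define pb where "pb = {q \<in> p. fst q \<in> Z}"
 have finb: "finite pb" using fin by (simp add: pb_def)
 have good: "\<bar>?I q\<bar> <= (K + eps) * (Sup (snd q) - Inf (snd q))" if q: "q \<in> p - pb" for q
 proof -
  obtain x k where xk: "q = (x, k)" "(x, k) \<in> p" "x \<notin> Z" using q by (cases q) (auto simp: pb_def)
  obtain u v where uv: "k = {u..v}" "u <= x" "x <= v" "c <= u" "v <= d" "{u..v} \<subseteq> g x" using el[OF xk(2)] by blast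
  have "c < x" "x < d" using xk(3) uv by (auto simp: Z_def less_le)
  thus ?thesis using rho[of x] xk uv by (auto simp: g_def)
 qed
 have bad: "(\<Sum>q\<in>pb. \<bar>?I q\<bar>) < eps"
 proof -
  obtain e where e: "bij_betw e {..<card pb} pb" using ex_bij_betw_nat_finite[OF finb] by (auto simp: atLeast0LessThan)
  define a b where "a i = Inf (snd (e i))" and "b i = Sup (snd (e i))" for i
  have ab: "snd (e i) = {a i..b i}" "c <= a i" "a i <= b i" "b i <= d" "{a i..b i} \<subseteq> V" if "i < card pb" for i
  proof -
   have "e i \<in> pb" using e that by (auto simp: bij_betw_def)
   then obtain x k where xk: "e i = (x, k)" "(x, k) \<in> p" "x \<in> Z" by (cases "e i") (auto simp: pb_def)
   obtain u v where uv: "k = {u..v}" "u <= x" "x <= v" "c <= u" "v <= d" "{u..v} \<subseteq> g x" using el[OF xk(2)] by blast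
   hence "a i = u" "b i = v" by (auto simp: a_def b_def xk)
   thus "snd (e i) = {a i..b i}" "c <= a i" "a i <= b i" "b i <= d" "{a i..b i} \<subseteq> V" using xk uv by (auto simp: g_def)
  qed
  have dis: "{a i<..<b i} \<inter> {a j<..<b j} = {}" if ij: "i < card pb" "j < card pb" "i ~= j" for i j
  proof -
   have "e i ~= e j" using e ij by (auto simp: bij_betw_def inj_on_def)
   moreover have "e i \<in> p" "e j \<in> p" using e ij by (auto simp: bij_betw_def pb_def)
   ultimately have "interior (snd (e i)) \<inter> interior (snd (e j)) = {}"
    using tagged_division_ofD(5)[OF p(1), of "fst (e i)" "snd (e i)" "fst (e j)" "snd (e j)"] by (auto simp: prod_eq_iff)
   thus ?thesis using ab(1)[OF ij(1)] ab(1)[OF ij(2)] by (simp add: interior_atLeastAtMost_real)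
  qed
  have "ennreal (\<Sum>i<card pb. b i - a i) = (\<Sum>i<card pb. ennreal (b i - a i))" using ab(3) by (intro sum_ennreal[symmetric]) auto
  also have "... = (\<Sum>i<card pb. emeasure lborel {a i<..<b i})" using ab(3) by (intro sum.cong refl) (auto simp: emeasure_lborel_Ioo)
  also have "... = emeasure lborel (\<Union>i<card pb. {a i<..<b i})" using dis by (intro sum_emeasure) (auto simp: disjoint_family_on_def)
  also have "... <= emeasure lborel V"
  proof (rule emeasure_mono)
   show "(\<Union>i<card pb. {a i<..<b i}) \<subseteq> V" using ab(5) by fastforce
  qed (use V(1) in auto)
  also have "... < ennreal dlt" by (rule V(3))
  finally have "(\<Sum>i<card pb. b i - a i) < dlt" by (subst (asm) ennreal_less_iff) (auto intro!: sum_nonneg simp: ab(3))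
  hence "(\<Sum>i<card pb. dist (h (a i)) (h (b i))) < eps" using ab dis by (intro dlt(2)) auto
  moreover have "(\<Sum>q\<in>pb. \<bar>?I q\<bar>) = (\<Sum>i<card pb. dist (h (a i)) (h (b i)))"
   unfolding sum.reindex_bij_betw[OF e, symmetric] by (simp add: a_def b_def dist_real_def abs_minus_commute)
  ultimately show ?thesis by simp
 qed
 have "h d - h c = (\<Sum>q\<in>p. ?I q)" using additive_tagged_division_1[OF cd p(1), of h] by (simp add: case_prod_beta)
 hence "\<bar>h d - h c\<bar> <= (\<Sum>q\<in>p. \<bar>?I q\<bar>)" by simp
 also have "... = (\<Sum>q\<in>p - pb. \<bar>?I q\<bar>) + (\<Sum>q\<in>pb. \<bar>?I q\<bar>)" using fin by (intro sum.subset_diff) (auto simp: pb_def)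
 also have "(\<Sum>q\<in>p - pb. \<bar>?I q\<bar>) <= (\<Sum>q\<in>p - pb. (K + eps) * (Sup (snd q) - Inf (snd q)))" by (rule sum_mono[OF good])
 also have "... <= (\<Sum>q\<in>p. (K + eps) * (Sup (snd q) - Inf (snd q)))"
 proof (rule sum_mono2[OF fin])
  fix q assume "q \<in> p - (p - pb)"
  then obtain x k where xk: "q = (x, k)" "(x, k) \<in> p" by (cases q) auto
  show "0 <= (K + eps) * (Sup (snd q) - Inf (snd q))" using el[OF xk(2)] xk(1) K eps(1) by auto
 qed auto
 also have "... = (K + eps) * (d - c)"
  using additive_tagged_division_1[OF cd p(1), of "%x. x"] by (simp add: case_prod_beta sum_distrib_left[symmetric])
 finally have "\<bar>h d - h c\<bar> <= (K + eps) * (d - c) + eps" using bad by linarith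
 thus "\<bar>h d - h c\<bar> <= K * (d - c) + e0" using eps(2) by (simp add: distrib_right)
qed

lemma lipschitz_abs_cont:
 assumes "L-lipschitz_on {c..d} f" shows "abs_cont_on c d f" unfolding abs_cont_on_def
proof (intro allI impI)
 fix eps :: real assume eps: "eps > 0"
 have L: "L >= 0" using assms by (rule lipschitz_on_nonneg)
 show "\<exists>dlt>0. ALL n. \<forall>a b :: nat => real.
   fine_family c d n a b dlt --> (\<Sum>i<n. dist (f (a i)) (f (b i))) < eps"
 proof (intro exI[of _ "eps / (L + 1)"] conjI allI impI)
  show "eps / (L + 1) > 0" using eps L by simp
  fix n and a b :: "nat => real"
  assume h: "fine_family c d n a b (eps / (L + 1))"
  have "(\<Sum>i<n. dist (f (a i)) (f (b i))) <= (\<Sum>i<n. L * (b i - a i))"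
  proof (rule sum_mono)
   fix i assume "i \<in> {..<n}"
   hence "c <= a i" "a i <= b i" "b i <= d" using h by auto
   thus "dist (f (a i)) (f (b i)) <= L * (b i - a i)" using lipschitz_onD[OF assms, of "a i" "b i"] by (simp add: dist_real_def)
  qed
  also have "... = L * (\<Sum>i<n. b i - a i)" by (simp add: sum_distrib_left)
  also have "... <= (L + 1) * (\<Sum>i<n. b i - a i)" using h by (intro mult_right_mono sum_nonneg) auto
  also have "... < eps" using h L by (simp add: field_simps)
  finally show "(\<Sum>i<n. dist (f (a i)) (f (b i))) < eps" .
 qed
qed

lemma abs_cont_on_lipschitz_comp:
 assumes "abs_cont_on c d f" "L >= 0" "!!s t. s \<in> {c..d} ==> t \<in> {c..d} ==> dist (g s) (g t) <= L * dist (f s) (f t)"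
 shows "abs_cont_on c d g" unfolding abs_cont_on_def
proof (intro allI impI)
 fix eps :: real assume "eps > 0"
 hence e: "eps / (L + 1) > 0" using assms(2) by simp
 then obtain dlt where dlt: "dlt > 0" "!!n (a :: nat => real) b.
   fine_family c d n a b dlt ==> (\<Sum>i<n. dist (f (a i)) (f (b i))) < eps / (L + 1)" using assms(1) unfolding abs_cont_on_def by blast
 show "\<exists>dlt>0. ALL n. \<forall>a b :: nat => real.
   fine_family c d n a b dlt --> (\<Sum>i<n. dist (g (a i)) (g (b i))) < eps"
 proof (intro exI[of _ dlt] conjI allI impI dlt(1))
  fix n and a b :: "nat => real"
  assume h: "fine_family c d n a b dlt"
  have "(\<Sum>i<n. dist (g (a i)) (g (b i))) <= (\<Sum>i<n. L * dist (f (a i)) (f (b i)))"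
   using h by (intro sum_mono assms(3)) (auto intro: order_trans)
  also have "... <= (L + 1) * (\<Sum>i<n. dist (f (a i)) (f (b i)))" unfolding sum_distrib_left by (intro sum_mono mult_right_mono) auto
  also have "... < (L + 1) * (eps / (L + 1))" using dlt(2)[OF h] assms(2) by (intro mult_strict_left_mono) auto
  finally show "(\<Sum>i<n. dist (g (a i)) (g (b i))) < eps" using assms(2) by simp
 qed
qed

lemma smooth_lipschitz_interval:
 fixes h :: "real => 'f::real_normed_vector"
 assumes "smooth_on S h" "{c..d} \<subseteq> S"
 shows "EX L. L-lipschitz_on {c..d} h"
proof -
 have eq: "cball ((c + d) / 2) ((d - c) / 2) = {c..d}" by (auto simp: dist_real_def abs_le_iff field_simps)
 have "Ck_on 1 S h" using assms(1) by (simp add: smooth_on_def)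
 from C1_lipschitz_cball[OF this, of "(c + d) / 2" "(d - c) / 2"] assms(2)
 obtain L where L: "L >= 0" "!!x y. x \<in> {c..d} ==> y \<in> {c..d} ==> norm (h x - h y) <= L * norm (x - y)" unfolding eq by blast
 thus ?thesis by (intro exI[of _ L] lipschitz_onI) (auto simp: dist_norm)
qed

context lie_grp
begin

text \<open>Absolute continuity is given in charts only, so the estimate is proved on short
  intervals and assembled by bisection. Near a point of the curve \<open>f\<close> is Lipschitz in
  the chart, hence \<open>f\<close> along the curve is absolutely continuous and
  \<open>abs_cont_bound\<close> applies.\<close>

lemma abs_cont_smooth_fun:
 assumes gam: "abs_cont_curve A T gam" and T: "T >= 0" and f: "f \<in> sf" and K: "K >= 0"
  and der: "AE s in lborel. 0 < s & s < T --> (EX D. ((%s. f (gam s)) has_real_derivative D) (at s) & \<bar>D\<bar> <= K)"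
 shows "\<bar>f (gam T) - f (gam 0)\<bar> <= K * T"
proof -
 define P where "P a b \<longleftrightarrow> (0 <= a & b <= T --> \<bar>f (gam b) - f (gam a)\<bar> <= K * (b - a))" for a b
 have "P 0 T" using T
 proof (induction rule: Bolzano)
  case (trans a b c)
  show ?case unfolding P_def
  proof
   assume "0 <= a & c <= T"
   hence "\<bar>f (gam b) - f (gam a)\<bar> <= K * (b - a)" "\<bar>f (gam c) - f (gam b)\<bar> <= K * (c - b)" using trans by (auto simp: P_def)
   thus "\<bar>f (gam c) - f (gam a)\<bar> <= K * (c - a)" unfolding right_diff_distrib by linarith
  qed
 next
  case (local x)
  obtain U phi where U: "(U, phi) \<in> A" "gam x \<in> U" using chart_exists[OF pa] by blast
  note ch = chartD[OF pa U(1)]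
  have sm: "smooth_on (phi ` U) (%q. f (inv_into U phi q))" using smooth_fun_chart[OF U(1), of UNIV f] f by (simp add: sf_iff)
  obtain rho where rho: "rho > 0" "cball (phi (gam x)) rho \<subseteq> phi ` U" using ch(2) U(2) open_contains_cball by blast
  have "Ck_on 1 (phi ` U) (%q. f (inv_into U phi q))" using sm by (simp add: smooth_on_def)
  from C1_lipschitz_cball[OF this rho(2)]
  obtain L where L: "L >= 0" "!!p q. p \<in> cball (phi (gam x)) rho ==> q \<in> cball (phi (gam x)) rho ==>
   norm (f (inv_into U phi p) - f (inv_into U phi q)) <= L * norm (p - q)" by blast
  define W where "W = U \<inter> phi -` ball (phi (gam x)) rho"
  have W: "open W" unfolding W_def by (rule continuous_open_preimage[OF ch(4,1) open_ball])
  have xW: "gam x \<in> W" using U(2) rho(1) by (simp add: W_def)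
  have "continuous_on {0..T} gam" using gam by (simp add: abs_cont_curve_def)
  then obtain O' where O': "open O'" "O' \<inter> {0..T} = gam -` W \<inter> {0..T}" using W unfolding continuous_on_open_invariant by blast
  have "x \<in> O' \<inter> {0..T}" unfolding O'(2) using xW local by simp
  then obtain dlt where dlt: "dlt > 0" "ball x dlt \<subseteq> O'" using openE[OF O'(1), of x] by blast
  have "\<bar>f (gam b) - f (gam a)\<bar> <= K * (b - a)" if ab: "a <= x" "x <= b" "b - a < dlt" "0 <= a" "b <= T" for a b
  proof -
   have inW: "gam s \<in> W" if "s \<in> {a..b}" for s
   proof -
    have "s \<in> ball x dlt" using that ab by (auto simp: dist_real_def)
    hence "s \<in> O' \<inter> {0..T}" using dlt(2) that ab by auto
    thus ?thesis unfolding O'(2) by simp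
   qed
   have "abs_cont_on a b (phi \<circ> gam)"
   proof -
    have "ALL c d. 0 <= c & c <= d & d <= T & gam ` {c..d} \<subseteq> U --> abs_cont_on c d (phi \<circ> gam)"
     using gam U(1) unfolding abs_cont_curve_def by blast
    moreover have "gam ` {a..b} \<subseteq> U" using inW by (auto simp: W_def)
    ultimately show ?thesis using ab by auto
   qed
   hence "abs_cont_on a b (%s. f (gam s))"
   proof (rule abs_cont_on_lipschitz_comp[OF _ L(1)])
    fix s t assume st: "s \<in> {a..b}" "t \<in> {a..b}"
    have "gam s \<in> U" "gam t \<in> U" "phi (gam s) \<in> cball (phi (gam x)) rho" "phi (gam t) \<in> cball (phi (gam x)) rho"
     using inW[OF st(1)] inW[OF st(2)] by (auto simp: W_def)
    thus "dist (f (gam s)) (f (gam t)) <= L * dist ((phi \<circ> gam) s) ((phi \<circ> gam) t)"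
     using L(2)[of "phi (gam s)" "phi (gam t)"] by (simp add: ch(6) dist_norm)
   qed
   moreover have "AE s in lborel. a < s & s < b --> (EX D. ((%s. f (gam s)) has_real_derivative D) (at s) & \<bar>D\<bar> <= K)"
    using der by eventually_elim (use ab in auto)
   ultimately show ?thesis using ab by (intro abs_cont_bound[OF _ _ K]) auto
  qed
  thus ?case using dlt(1) unfolding P_def by blast
 qed
 thus ?thesis by (simp add: P_def)
qed

end

section \<open>Hausdorff measure from covers\<close>

lemma hausdorff_measure_zeroI:
 assumes "!!eps \<eta>. eps > 0 ==> \<eta> > 0 ==> hausdorff_pre d s eps E <= ennreal \<eta>"
 shows "hausdorff_measure d s E = 0"
proof -
 have "hausdorff_pre d s eps E <= 0" if "eps > 0" for eps by (rule ennreal_le_epsilon) (use assms[OF that] in auto)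
 hence "hausdorff_measure d s E <= 0" unfolding hausdorff_measure_eq_SUP by (intro SUP_least) auto
 thus ?thesis by simp
qed

lemma hausdorff_measure_mono:
 assumes "E \<subseteq> F" shows "hausdorff_measure d s E <= hausdorff_measure d s F" unfolding hausdorff_measure_eq_SUP hausdorff_pre_def
 using assms by (intro SUP_mono' Inf_superset_mono) blast

lemma hausdorff_pre_le_cover:
 fixes B :: "'i => 'a set" and r :: "'i => real"
 assumes D: "countable D" "E \<subseteq> (\<Union>i\<in>D. B i)"
  and B: "!!i. i \<in> D ==> 0 < ediam d (B i)" "!!i. i \<in> D ==> ediam d (B i) <= ennreal (C * r i)"
  and r: "!!i. i \<in> D ==> 0 < r i" "!!i. i \<in> D ==> C * r i <= eps" and C: "C > 0" and s: "s >= 0"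
  and sums: "!!I. I \<subseteq> D ==> finite I ==> (\<Sum>i\<in>I. r i powr s) <= \<eta>"
 shows "hausdorff_pre d s eps E <= ennreal (C powr s * \<eta>)"
proof -
 let ?g = "%U. ennreal (enn2real (ediam d U) powr s)"
 have "hausdorff_pre d s eps E <= (\<Sum>\<^sub>\<infinity>U\<in>B ` D. ?g U)" unfolding hausdorff_pre_def
 proof (rule Inf_lower, rule CollectI, rule exI[of _ "B ` D"], intro conjI)
  show "\<forall>U\<in>B ` D. 0 < ediam d U & ediam d U <= ennreal eps" using B r(2) by (auto intro: order_trans[OF _ ennreal_leI])
 qed (use D in auto)
 also have "... <= ennreal (C powr s * \<eta>)"
 proof (subst nonneg_infsum_complete, simp, rule SUP_least)
  fix F assume "F \<in> {F. finite F & F \<subseteq> B ` D}"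
  hence F: "finite F" "F \<subseteq> B ` D" by auto
  \<comment> \<open>Different indices may name the same set, and a cover counts it once. One index
    is chosen for each set, which keeps the sum over sets below a sum over indices.\<close>
  then obtain I where I: "I \<subseteq> D" "inj_on B I" "F = B ` I" unfolding subset_image_inj by blast
  have fI: "finite I" using F(1) I finite_image_iff by blast
  have "sum ?g F = (\<Sum>i\<in>I. ?g (B i))" unfolding I(3) by (rule sum.reindex[OF I(2), unfolded o_def])
  also have "... <= (\<Sum>i\<in>I. ennreal (C powr s * r i powr s))"
  proof (rule sum_mono)
   fix i assume "i \<in> I"
   hence i: "i \<in> D" using I(1) by auto
   have "0 <= C * r i" using C r(1)[OF i] by simp
   hence "enn2real (ediam d (B i)) <= C * r i" using enn2real_mono[OF B(2)[OF i]] by simp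
   hence "enn2real (ediam d (B i)) powr s <= (C * r i) powr s" by (intro powr_mono2 s) auto
   also have "... = C powr s * r i powr s" using C r(1)[OF i] by (simp add: powr_mult)
   finally show "?g (B i) <= ennreal (C powr s * r i powr s)" by (rule ennreal_leI)
  qed
  also have "... = ennreal (C powr s * (\<Sum>i\<in>I. r i powr s))" by (simp add: sum_distrib_left)
  also have "... <= ennreal (C powr s * \<eta>)" by (intro ennreal_leI mult_left_mono sums I(1) fI) simp
  finally show "sum ?g F <= ennreal (C powr s * \<eta>)" .
 qed
 finally show ?thesis .
qed

text \<open>The factor \<open>t powr ((\<alpha> - bet) / 2)\<close> tends to 0, so a finite upper
  limit with \<open>bet\<close> would push the one with \<open>\<alpha>\<close> below every positive
  number.\<close>

lemma T_set_subset_S_set: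
 assumes "bet < \<alpha>" shows "T_set \<alpha> u \<subseteq> S_set bet u"
proof
 fix x assume x: "x \<in> T_set \<alpha> u"
 let ?f = "%t. ereal (t powr (bet / 2) * u x t)"
 have "0 < Limsup (at_right 0) (%t. ereal (t powr (\<alpha> / 2) * u x t))" using x by (simp add: T_set_def)
 then obtain c where c: "0 < ereal c" "ereal c < Limsup (at_right 0) (%t. ereal (t powr (\<alpha> / 2) * u x t))"
  using ereal_dense2 by blast
 have "ereal M <= Limsup (at_right 0) ?f" for M
 proof (rule ccontr)
  assume "\<not> ereal M <= Limsup (at_right 0) ?f"
  hence "\<forall>\<^sub>F t in at_right 0. ?f t < ereal M" by (intro Limsup_lessD) simp
  hence e1: "\<forall>\<^sub>F t in at_right 0. t powr (bet / 2) * u x t < M" by simp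
  have "((%t. t powr ((\<alpha> - bet) / 2)) \<longlongrightarrow> 0) (at_right (0::real))"
   using assms by (intro tendsto_zero_powrI[where b="(\<alpha> - bet) / 2"]) (auto simp: eventually_at_right_field intro!: exI[of _ 1])
  hence "((%t. t powr ((\<alpha> - bet) / 2) * \<bar>M\<bar>) \<longlongrightarrow> 0 * \<bar>M\<bar>) (at_right (0::real))" by (intro tendsto_intros)
  hence e2: "\<forall>\<^sub>F t in at_right (0::real). t powr ((\<alpha> - bet) / 2) * \<bar>M\<bar> < c" using c(1) by (intro order_tendstoD) auto
  have e3: "\<forall>\<^sub>F t in at_right (0::real). t > 0" by (simp add: eventually_at_right_less)
  have "\<forall>\<^sub>F t in at_right 0. ereal (t powr (\<alpha> / 2) * u x t) <= ereal c" using e1 e2 e3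
  proof eventually_elim
   case (elim t)
   have "t powr (\<alpha> / 2) * u x t = t powr ((\<alpha> - bet) / 2) * (t powr (bet / 2) * u x t)"
    by (simp add: mult.assoc[symmetric] powr_add[symmetric] diff_divide_distrib)
   also have "... <= t powr ((\<alpha> - bet) / 2) * \<bar>M\<bar>" using elim(1) by (intro mult_left_mono) auto
   finally show ?case using elim(2) by simp
  qed
  hence "Limsup (at_right 0) (%t. ereal (t powr (\<alpha> / 2) * u x t)) <= ereal c" by (rule Limsup_bounded)
  thus False using c(2) by simp
 qed
 hence "Limsup (at_right 0) ?f = \<infinity>" by (intro ereal_top) auto
 thus "x \<in> S_set bet u" by (simp add: S_set_def)
qed

locale carnot = strat A w l y
 for A :: "('a::{topological_group_add, t2_space, second_countable_topology}, 'e::euclidean_space) atlas"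
  and w :: "'e => nat" and l :: nat and y :: "'e => 'e" +
 fixes N :: nat and X :: "nat => 'a vfield" and sig :: "nat => 'e"
 assumes conn: "connected (UNIV :: 'a set)"
  and sig: "bij_betw sig {1..N} {b \<in> Basis. w b = 1}"
  and X: "j \<in> {1..N} ==> X j = vf (y (sig j))"
begin

lemma X_tv: "j \<in> {1..N} ==> f \<in> sf ==> X j f = tv (y (sig j)) f" by (simp add: X vf_def)

lemma sum_sig: "(\<Sum>j\<in>{1..N}. g (sig j)) = (\<Sum>b\<in>Hz. g b)" by (rule sum.reindex_bij_betw[OF sig])

lemma XX_Phi:
 assumes "f \<in> sf" "b \<in> Basis" shows "XX b (%z. f (Phi z)) = (%z. tv (y b) f (Phi z))"
proof
 fix z
 have "smooth (%z. f (Phi z))" by (rule sf_comp_euclid[OF open_UNIV Phi_smooth assms(1)])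
 from Phi_Vf[OF assms smooth_D[OF this]]
 show "XX b (%z. f (Phi z)) z = tv (y b) f (Phi z)" by (simp add: XX_def)
qed

lemma heat_lift:
 assumes u: "positive_heat_solution A N X u" shows "heat (%z t. u (Phi z) t)" unfolding heat_def
proof (intro conjI allI impI)
 have sm: "smooth_map_on (prod_atlas A euclidean_atlas) euclidean_atlas (UNIV \<times> {0<..}) (%(x, t). u x t)"
  using u by (simp add: positive_heat_solution_def)
 note pe = pa_euclid
 note pp = pre_atlas_prod[OF pa pe]
 have o1: "open (UNIV \<times> {0::real<..} :: ('e \<times> real) set)" and o2: "open (UNIV \<times> {0::real<..} :: ('a \<times> real) set)"
  by (auto intro: open_Times)
 have "smooth_map_on euclidean_atlas (prod_atlas A euclidean_atlas) (UNIV \<times> {0<..}) (%p::'e \<times> real. (Phi (fst p), snd p))"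
  by (intro smooth_map_on_Pair[OF pe pa pe o1] smooth_comp_euclid[OF o1 open_UNIV smooth_fst Phi_smooth])
   (simp_all add: smooth_map_euclidean[OF o1])
 moreover have "(%p. (Phi (fst p), snd p)) ` (UNIV \<times> {0<..}) \<subseteq> UNIV \<times> {0<..}" by auto
 ultimately have "smooth_map_on euclidean_atlas euclidean_atlas (UNIV \<times> {0<..}) (%p. (%(x, t). u x t) (Phi (fst p), snd p))"
  by (rule smooth_map_on_compose[OF pe pp pe o1 o2 _ sm])
 thus "smooth_on (UNIV \<times> {0<..}) (%p. u (Phi (fst p)) (snd p))" by (simp add: smooth_map_euclidean[OF o1])
 fix z and t :: real assume t: "t > 0"
 show "0 < u (Phi z) t" using u t by (simp add: positive_heat_solution_def)
 have "smooth_map_on A (prod_atlas A euclidean_atlas) UNIV (%x. (x, t))"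
  by (rule smooth_map_on_Pair[OF pa pa pe open_UNIV smooth_map_on_id[OF sa] smooth_map_on_const[OF pa]])
 from smooth_map_on_compose[OF pa pp pe open_UNIV o2 this sm]
 have f: "(%x. u x t) \<in> sf" using t by (auto simp: sf_iff)
 have "(\<Sum>b\<in>Hz. XX b (XX b (%z. u (Phi z) t)) z) = (\<Sum>b\<in>Hz. tv (y b) (tv (y b) (%x. u x t)) (Phi z))"
  by (intro sum.cong refl) (simp add: XX_Phi[OF f] XX_Phi[OF tv_smooth[OF f]])
 also have "... = sub_laplacian N X (%x. u x t) (Phi z)"
  unfolding sub_laplacian_def sum_sig[symmetric] by (intro sum.cong refl) (simp add: X_tv f tv_smooth)
 finally show "((%s. u (Phi z) s) has_real_derivative (\<Sum>b\<in>Hz. XX b (XX b (%z. u (Phi z) t)) z)) (at t)"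
  using u t by (simp add: positive_heat_solution_def)
qed

subsection \<open>Horizontal curves\<close>

abbreviation tangent :: "(nat => real) => (real => 'a) => real => bool" where
 "tangent a gam s \<equiv> (\<forall>f\<in>sf. ((%r. f (gam r)) has_real_derivative (\<Sum>j\<in>{1..N}. a j * X j f (gam s))) (at s)) &
  (\<Sum>j\<in>{1..N}. (a j)^2) <= 1"

text \<open>Stronger than \<open>horizontal_curve\<close>, with Lipschitz bounds in charts and
  finitely many corners. In this form the property is easily kept when a flow segment is
  appended.\<close>

definition nice_curve :: "real => (real => 'a) => bool" where
 "nice_curve T gam \<longleftrightarrow> continuous_on {0..T} gam &
  (\<forall>(U, phi)\<in>A. ALL c d. 0 <= c & c <= d & d <= T & gam ` {c..d} \<subseteq> U --> (EX L. L-lipschitz_on {c..d} (%r. phi (gam r)))) &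
  (EX F. finite F & (ALL s. 0 < s & s < T & s \<notin> F --> (\<exists>a :: nat => real.
   tangent a gam s)))"

lemma nice_curve_horizontal:
 assumes "nice_curve T gam" shows "horizontal_curve A N X T gam" unfolding horizontal_curve_def
proof
 show "abs_cont_curve A T gam" unfolding abs_cont_curve_def
 proof (intro conjI ballI, goal_cases)
  case 1 thus ?case using assms by (simp add: nice_curve_def)
 next
  case (2 p)
  obtain U phi where p: "p = (U, phi)" by (cases p)
  have L: "EX L. L-lipschitz_on {c..d} (%r. phi (gam r))" if "0 <= c" "c <= d" "d <= T" "gam ` {c..d} \<subseteq> U" for c d
   using assms 2 that unfolding nice_curve_def p by blast
  show ?case unfolding p using L lipschitz_abs_cont by (auto simp: o_def) blast
 qed
 obtain F where F: "finite F" "!!s. 0 < s ==> s < T ==> s \<notin> F ==> \<exists>a :: nat => real.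
   tangent a gam s" using assms unfolding nice_curve_def by blast
 define a where "a s = (SOME a :: nat => real.
   tangent a gam s)" for s
 have a: "tangent (a s) gam s"
  if "0 < s" "s < T" "s \<notin> F" for s unfolding a_def by (rule someI_ex[OF F(2)[OF that]])
 have "AE s in lborel. s \<notin> F" by (rule AE_not_in[OF finite_imp_null_set_lborel[OF F(1)]])
 hence "AE s in lborel. 0 < s & s < T -->
   (\<forall>f\<in>sf. ((%r. f (gam r)) has_real_derivative (\<Sum>j\<in>{1..N}. (%j s. a s j) j s * X j f (gam s))) (at s)) &
   (\<Sum>j\<in>{1..N}. ((%j s. a s j) j s)^2) <= 1" by eventually_elim (use a in auto)
 thus "\<exists>a :: nat => real => real. AE s in lborel. 0 < s & s < T -->
   (\<forall>f\<in>sf. ((%r. f (gam r)) has_real_derivative (\<Sum>j\<in>{1..N}. a j s * X j f (gam s))) (at s)) &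
   (\<Sum>j\<in>{1..N}. (a j s)^2) <= 1" by (rule exI[of _ "%j s. a s j"])
qed

lemma hreach_nice_curve: "hreach a T b ==> EX gam. nice_curve T gam & gam 0 = Phi a & gam T = Phi b"
proof (induction rule: hreach.induct)
 case (hrefl a)
 have "nice_curve 0 (%r. Phi a)" unfolding nice_curve_def by (auto intro!: exI[of _ 0] exI[of _ "{}"] lipschitz_intros)
 thus ?case by blast
next
 case (hstep a T b c s)
 then obtain gam where gam: "nice_curve T gam" "gam 0 = Phi a" "gam T = Phi b" by blast
 have c: "c \<in> Basis" "c \<in> Hz" using hstep by auto
 have T: "T >= 0" by (rule hreach_nonneg[OF hstep(1)])
 \<comment> \<open>The sign of \<open>s\<close>: the appended segment is run in positive time and
   with unit speed, backwards along the field if \<open>s\<close> is negative.\<close>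
 define k :: real where "k = (if s >= 0 then 1 else - 1)"
 have k: "k * \<bar>s\<bar> = s" "k^2 = 1" by (auto simp: k_def)
 define dlt where "dlt r = Phi (Ef c (k * (r - T)) b)" for r
 define nu where "nu r = (if r <= T then gam r else dlt r)" for r
 let ?T = "T + \<bar>s\<bar>"
 have dltT: "dlt T = gam T" using c by (simp add: dlt_def gam)
 have "smooth (%r. Ef c (k * (r - T)) b)"
  by (rule smooth_compose[OF open_UNIV _ Ef_path_smooth[OF c(1), of b]]) (auto intro!: smooth_mult smooth_diff)
 hence dlts: "smooth_map_on euclidean_atlas A UNIV dlt"
  unfolding dlt_def[abs_def] by (intro smooth_comp_euclid[OF open_UNIV open_UNIV _ Phi_smooth]) auto
 have dltc: "continuous_on S dlt" for S by (rule continuous_on_subset[OF smooth_map_on_continuous[OF dlts]]) simp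
 obtain F where F: "finite F" "!!s. 0 < s ==> s < T ==> s \<notin> F ==> \<exists>a :: nat => real.
   tangent a gam s" using gam(1) unfolding nice_curve_def by blast
 have "nice_curve ?T nu" unfolding nice_curve_def
 proof (intro conjI)
  have "continuous_on {x \<in> {0..?T}. x <= T} gam"
   by (rule continuous_on_subset[of "{0..T}"]) (use gam(1) in \<open>auto simp: nice_curve_def\<close>)
  thus "continuous_on {0..?T} nu" unfolding nu_def by (intro continuous_on_cases_le[of _ "%x. x"] dltc) (auto simp: dltT)
  show "\<forall>(U, phi)\<in>A. ALL c d. 0 <= c & c <= d & d <= ?T & nu ` {c..d} \<subseteq> U --> (EX L. L-lipschitz_on {c..d} (%r. phi (nu r)))"
  proof (clarify)
   fix U phi c d assume U: "(U, phi) \<in> A" and cd: "0 <= c" "c <= d" "d <= ?T" "nu ` {c..d} \<subseteq> U"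
   have old: "EX L. L-lipschitz_on {c..d'} (%r. phi (gam r))" if "c <= d'" "d' <= d" "d' <= T" for d'
   proof -
    have "gam ` {c..d'} \<subseteq> U"
    proof
     fix x assume "x \<in> gam ` {c..d'}"
     then obtain r where r: "r \<in> {c..d'}" "x = gam r" by blast
     hence "nu r \<in> U" "nu r = x" using cd(4) that by (auto simp: nu_def)
     thus "x \<in> U" by simp
    qed
    thus ?thesis using gam(1) U that cd unfolding nice_curve_def by blast
   qed
   have new: "EX L. L-lipschitz_on {c'..d} (%r. phi (dlt r))" if "c <= c'" "T <= c'" for c'
   proof (rule smooth_lipschitz_interval)
    have "smooth_on (id ` (UNIV \<inter> UNIV \<inter> dlt -` U)) (%q. phi (dlt (inv_into UNIV id q)))"
     by (rule smooth_map_onD[OF dlts _ U]) (simp add: euclidean_atlas_def)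
    thus "smooth_on (dlt -` U) (%r. phi (dlt r))" by (simp add: inv_id)
    show "{c'..d} \<subseteq> dlt -` U"
    proof
     fix r assume r: "r \<in> {c'..d}"
     hence "nu r \<in> U" "nu r = dlt r" using cd(4) that dltT by (cases "r = T"; auto simp: nu_def)+
     thus "r \<in> dlt -` U" by simp
    qed
   qed
   consider "d <= T" | "T < c" | "c <= T" "T < d" by linarith
   thus "EX L. L-lipschitz_on {c..d} (%r. phi (nu r))"
   proof cases
    case 1
    then obtain L where "L-lipschitz_on {c..d} (%r. phi (gam r))" using old[of d] cd by auto
    thus ?thesis by (intro exI[of _ L], subst lipschitz_on_cong) (use 1 in \<open>auto simp: nu_def\<close>)
   next
    case 2
    then obtain L where "L-lipschitz_on {c..d} (%r. phi (dlt r))" using new[of c] by auto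
    thus ?thesis by (intro exI[of _ L], subst lipschitz_on_cong) (use 2 in \<open>auto simp: nu_def\<close>)
   next
    case 3
    obtain L where L: "L-lipschitz_on {c..T} (%r. phi (gam r))" using old[of T] 3 by auto
    obtain M where M: "M-lipschitz_on {T..d} (%r. phi (dlt r))" using new[of T] 3 by auto
    have "(max L M)-lipschitz_on {c..d} (%x. if x <= T then phi (gam x) else phi (dlt x))"
     by (rule lipschitz_on_concat_max[OF L M]) (simp add: dltT)
    moreover have "(%x. if x <= T then phi (gam x) else phi (dlt x)) = (%r. phi (nu r))" by (auto simp: nu_def)
    ultimately have "(max L M)-lipschitz_on {c..d} (%r. phi (nu r))" by (simp only:)
    thus ?thesis by (rule exI)
   qed
  qed
  show "EX F. finite F & (ALL s. 0 < s & s < ?T & s \<notin> F --> (\<exists>a :: nat => real.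
   tangent a nu s))"
  proof (intro exI[of _ "insert T F"] conjI allI impI)
   fix s assume s: "0 < s & s < ?T & s \<notin> insert T F"
   show "\<exists>a :: nat => real. tangent a nu s"
   proof (cases "s < T")
    case True
    obtain a :: "nat => real" where a: "\<forall>f\<in>sf. ((%r. f (gam r)) has_real_derivative (\<Sum>j\<in>{1..N}. a j * X j f (gam s))) (at s)" "(\<Sum>j\<in>{1..N}. (a j)^2) <= 1"
     using F(2)[of s] s True by auto
    have "((%r. f (nu r)) has_real_derivative (\<Sum>j\<in>{1..N}. a j * X j f (nu s))) (at s)" if "f \<in> sf" for f
    proof (rule has_field_derivative_transform_within_open[of "%r. f (gam r)" _ _ "{..<T}"])
     show "((%r. f (gam r)) has_real_derivative (\<Sum>j\<in>{1..N}. a j * X j f (nu s))) (at s)"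
      using bspec[OF a(1) that] True by (simp add: nu_def)
    qed (use True in \<open>auto simp: nu_def\<close>)
    thus ?thesis using a(2) by blast
   next
    case False
    hence sT: "T < s" using s by auto
    define a where "a j = (if sig j = c then k else 0)" for j
    have sum1: "(\<Sum>j\<in>{1..N}. (a j)^2) = (\<Sum>b\<in>Hz. (if b = c then k else 0)^2)" unfolding a_def by (rule sum_sig)
    also have "... = (\<Sum>b\<in>Hz. if b = c then k^2 else 0)" by (intro sum.cong) auto
    also have "... = 1" using c k by (subst sum.delta) auto
    finally have a1: "(\<Sum>j\<in>{1..N}. (a j)^2) <= 1" by simp
    have "((%r. f (nu r)) has_real_derivative (\<Sum>j\<in>{1..N}. a j * X j f (nu s))) (at s)" if f: "f \<in> sf" for f
    proof (rule has_field_derivative_transform_within_open[of "%r. f (dlt r)" _ _ "{T<..}"])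
     have "(\<Sum>j\<in>{1..N}. a j * X j f (nu s)) = (\<Sum>j\<in>{1..N}. (if sig j = c then k else 0) * tv (y (sig j)) f (nu s))"
      by (intro sum.cong refl) (simp add: a_def X_tv f)
     also have "... = (\<Sum>b\<in>Hz. (if b = c then k else 0) * tv (y b) f (nu s))" by (rule sum_sig)
     also have "... = (\<Sum>b\<in>Hz. if b = c then k * tv (y c) f (nu s) else 0)" by (intro sum.cong) auto
     also have "... = k * tv (y c) f (dlt s)" using c sT by (subst sum.delta) (auto simp: nu_def)
     finally have eq: "(\<Sum>j\<in>{1..N}. a j * X j f (nu s)) = tv (y c) f (dlt s) * k" by simp
     have "((%r. k * (r - T)) has_real_derivative k) (at s)" by (auto intro!: derivative_eq_intros)
     from DERIV_chain2[OF ep_deriv[OF f, of "Phi b" "y c" "k * (s - T)"] this]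
     show "((%r. f (dlt r)) has_real_derivative (\<Sum>j\<in>{1..N}. a j * X j f (nu s))) (at s)" unfolding eq dlt_def Phi_Ef[OF c(1)] .
    qed (use sT in \<open>auto simp: nu_def\<close>)
    thus ?thesis using a1 by blast
   qed
  qed (use F(1) in simp)
 qed
 moreover have "nu 0 = Phi a" using T gam by (simp add: nu_def)
 moreover have "nu ?T = Phi (Ef c s b)" using gam(3) c k(1) by (cases "s = 0") (auto simp: nu_def dlt_def)
 ultimately show ?case by blast
qed

lemma hreach_zero: "hreach a T b ==> T = 0 ==> a = b"
proof (induction rule: hreach.induct)
 case (hstep a T b c s)
 hence "T = 0" "s = 0" using hreach_nonneg[OF hstep(1)] by auto
 thus ?case using hstep by simp
qed simp

lemma cc_dist_le:
 assumes "hreach a T b" shows "cc_dist A N X (Phi a) (Phi b) <= T"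
proof (cases "Phi a = Phi b")
 case True
 thus ?thesis using hreach_nonneg[OF assms] by (simp add: cc_dist_def)
next
 case False
 hence "T > 0" using hreach_nonneg[OF assms] hreach_zero[OF assms] by (cases "T = 0") auto
 moreover obtain gam where "horizontal_curve A N X T gam" "gam 0 = Phi a" "gam T = Phi b"
  using hreach_nice_curve[OF assms] nice_curve_horizontal by blast
 ultimately have "T \<in> {T. 0 < T & (EX gam. horizontal_curve A N X T gam & gam 0 = Phi a & gam T = Phi b)}" by blast
 thus ?thesis using False unfolding cc_dist_def by (auto intro!: cInf_lower bdd_belowI[of _ 0])
qed

lemma tv_outside:
 assumes f: "f \<in> sf" and C: "closed C" "!!z. z \<notin> C ==> f z = 0" and z: "z \<notin> C"
 shows "tv v f z = 0"
proof -
 have c: "continuous_on UNIV (%s. z + ep v s)" by (intro continuous_on_add continuous_on_const smooth_map_on_continuous[OF ep_smooth])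
 define S where "S = (%s. z + ep v s) -` (- C)"
 have "open S" unfolding S_def using c C(1) by (intro open_vimage) auto
 moreover have "0 \<in> S" using z by (simp add: S_def ep)
 ultimately have "((%s. f (z + ep v s)) has_real_derivative 0) (at 0)"
  by (intro has_field_derivative_transform_within_open[OF DERIV_const[of 0], of S]) (auto simp: S_def C(2))
 from DERIV_unique[OF ep_deriv[OF f, of z v 0] this] show ?thesis by (simp add: ep)
qed

text \<open>A compactly supported function that separates the two points changes at a bounded rate
  along horizontal curves, so these cannot be short. Positivity is required because sets in a
  Hausdorff cover must have positive diameter.\<close>

lemma cc_dist_pos:
 assumes ne: "Phi a ~= Phi b" shows "0 < cc_dist A N X (Phi a) (Phi b)"
proof -
 obtain f C where f: "f \<in> sf" "f (Phi a) = 1" "f (Phi b) = 0" and C: "compact C" "!!z. z \<notin> C ==> f z = 0"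
  using separating_function[OF ne] by blast
 have "EX K. ALL z. \<bar>tv v f z\<bar> <= K" for v
 proof -
  have "continuous_on C (tv v f)" using smooth_map_on_continuous[of A euclidean_atlas UNIV "tv v f"] tv_smooth[OF f(1)]
   by (auto simp: sf_iff intro: continuous_on_subset)
  from compact_imp_bounded[OF compact_continuous_image[OF this C(1)]]
  obtain K where K: "K > 0" "\<forall>z\<in>C. norm (tv v f z) <= K" unfolding bounded_pos by auto
  have "\<bar>tv v f z\<bar> <= K" for z using K tv_outside[OF f(1) compact_imp_closed[OF C(1)] C(2), of z v] by (cases "z \<in> C") auto
  thus ?thesis by blast
 qed
 then obtain k where k: "!!v z. \<bar>tv v f z\<bar> <= k v" by metis
 have k0: "k v >= 0" for v using k[of v 0] by linarith
 define K where "K = (\<Sum>j\<in>{1..N}. k (y (sig j))) + 1"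
 have K: "K > 0" using k0 by (auto simp: K_def intro!: add_nonneg_pos sum_nonneg)
 have low: "1 / K <= T" if T: "0 < T" "horizontal_curve A N X T gam" "gam 0 = Phi a" "gam T = Phi b" for T gam
 proof -
  have ac: "abs_cont_curve A T gam" using T by (simp add: horizontal_curve_def)
  obtain c :: "nat => real => real" where ae: "AE s in lborel. 0 < s & s < T -->
   (\<forall>f\<in>sf. ((%r. f (gam r)) has_real_derivative (\<Sum>j\<in>{1..N}. c j s * X j f (gam s))) (at s)) &
   (\<Sum>j\<in>{1..N}. (c j s)^2) <= 1" using T unfolding horizontal_curve_def by blast
  have "AE s in lborel. 0 < s & s < T --> (EX D. ((%s. f (gam s)) has_real_derivative D) (at s) & \<bar>D\<bar> <= K)" using ae
  proof eventually_elim
   case (elim s)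
   show ?case
   proof
    assume "0 < s & s < T"
    hence d: "((%r. f (gam r)) has_real_derivative (\<Sum>j\<in>{1..N}. c j s * X j f (gam s))) (at s)"
     and c1: "(\<Sum>j\<in>{1..N}. (c j s)^2) <= 1" using elim f(1) by auto
    have "\<bar>\<Sum>j\<in>{1..N}. c j s * X j f (gam s)\<bar> <= (\<Sum>j\<in>{1..N}. \<bar>c j s * X j f (gam s)\<bar>)" by (rule sum_abs)
    also have "... <= (\<Sum>j\<in>{1..N}. k (y (sig j)))"
    proof (rule sum_mono)
     fix j assume j: "j \<in> {1..N}"
     have "(c j s)^2 <= 1" by (rule order_trans[OF member_le_sum[OF j] c1]) auto
     hence "\<bar>c j s\<bar> <= 1" by (simp add: abs_square_le_1)
     hence "\<bar>c j s\<bar> * \<bar>X j f (gam s)\<bar> <= 1 * k (y (sig j))"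
      using k[of "y (sig j)" "gam s"] j f(1) by (intro mult_mono) (auto simp: X_tv)
     thus "\<bar>c j s * X j f (gam s)\<bar> <= k (y (sig j))" by (simp add: abs_mult)
    qed
    finally show "EX D. ((%s. f (gam s)) has_real_derivative D) (at s) & \<bar>D\<bar> <= K"
     using d by (intro exI[of _ "\<Sum>j\<in>{1..N}. c j s * X j f (gam s)"]) (simp add: K_def)
   qed
  qed
  from abs_cont_smooth_fun[OF ac less_imp_le[OF T(1)] f(1) less_imp_le[OF K] this]
  have "1 <= K * T" using T f by simp
  thus ?thesis using K by (simp add: field_simps)
 qed
 \<comment> \<open>By \<open>chow\<close> there is a horizontal curve between the two points, so the
   infimum is taken over a nonempty set and is not a default value.\<close>
 obtain T where "hreach 0 T (mul (ginv a) b)" using chow by blast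
 from hreach_left[OF this, of a] have h: "hreach a T b" by simp
 have "1 / K <= Inf {T. 0 < T & (EX gam. horizontal_curve A N X T gam & gam 0 = Phi a & gam T = Phi b)}"
 proof (rule cInf_greatest)
  have "T > 0" using hreach_nonneg[OF h] hreach_zero[OF h] ne by (cases "T = 0") auto
  thus "{T. 0 < T & (EX gam. horizontal_curve A N X T gam & gam 0 = Phi a & gam T = Phi b)} ~= {}"
   using hreach_nice_curve[OF h] nice_curve_horizontal by blast
 qed (use low in blast)
 moreover have "1 / K > 0" using K by simp
 ultimately have "0 < Inf {T. 0 < T & (EX gam. horizontal_curve A N X T gam & gam 0 = Phi a & gam T = Phi b)}" by linarith
 thus ?thesis using ne by (simp add: cc_dist_def)
qed

subsection \<open>Quasi-balls and the metric\<close>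

text \<open>The two points with \<open>s = 1\<close> and \<open>s = - 1\<close> are accessible, and
  a dilation by the root of order \<open>w b\<close> of the modulus of \<open>s\<close> gives the
  others. This root is at most one plus that modulus, which makes the duration bounded on bounded
  sets.\<close>

lemma Ef_reach_uniform:
 assumes b: "b \<in> Basis" shows "EX C>=0. ALL s. EX T<=C * (1 + \<bar>s\<bar>). hreach 0 T (Ef b s 0)"
proof -
 obtain T1 where T1: "hreach 0 T1 (Ef b 1 0)" using chow by blast
 obtain T2 where T2: "hreach 0 T2 (Ef b (- 1) 0)" using chow by blast
 define C where "C = max T1 T2"
 have C: "C >= 0" "T1 <= C" "T2 <= C" using hreach_nonneg[OF T1] by (auto simp: C_def)
 have wb: "w b > 0" using w1[OF b] by simp
 have "EX T<=C * (1 + \<bar>s\<bar>). hreach 0 T (Ef b s 0)" for s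
 proof (cases "s = 0")
  case True
  thus ?thesis using C b by (intro exI[of _ 0]) (auto intro: hrefl)
 next
  case False
  define r where "r = root (w b) \<bar>s\<bar>"
  have r: "r > 0" "r ^ w b = \<bar>s\<bar>" using False wb by (auto simp: r_def)
  have "r <= 1 + \<bar>s\<bar>"
  proof (rule ccontr)
   assume n: "\<not> r <= 1 + \<bar>s\<bar>"
   hence "r ^ 1 <= r ^ w b" using wb by (intro power_increasing) auto
   thus False using n r by simp
  qed
  hence le: "r * T <= C * (1 + \<bar>s\<bar>)" if "T <= C" "T >= 0" for T
   using mult_mono[of T C r "1 + \<bar>s\<bar>"] that r C by (simp add: mult.commute)
  show ?thesis
  proof (cases "s > 0")
   case True
   have "hreach 0 (r * T1) (Ef b s 0)" using hreach_dil[OF T1 r(1)] True by (simp add: Ef_dil[OF b r(1)] r)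
   thus ?thesis using le[OF C(2) hreach_nonneg[OF T1]] by blast
  next
   case F: False
   have "hreach 0 (r * T2) (Ef b s 0)" using hreach_dil[OF T2 r(1)] F False by (simp add: Ef_dil[OF b r(1)] r)
   thus ?thesis using le[OF C(3) hreach_nonneg[OF T2]] by blast
  qed
 qed
 thus ?thesis using C(1) by blast
qed

lemma mulL_reach_uniform:
 "set L \<subseteq> Basis ==> EX C>=0. ALL z a T. hreach 0 T a --> (EX T'<=T + C * (1 + norm z). hreach 0 T' (mulL L a z))"
proof (induction L)
 case Nil
 thus ?case by (intro exI[of _ 0]) auto
next
 case (Cons b L)
 then obtain C where C: "C >= 0" "!!z a T. hreach 0 T a ==> EX T'<=T + C * (1 + norm z). hreach 0 T' (mulL L a z)" by auto
 have b: "b \<in> Basis" using Cons.prems by simp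
 obtain C' where C': "C' >= 0" "!!s. EX T<=C' * (1 + \<bar>s\<bar>). hreach 0 T (Ef b s 0)" using Ef_reach_uniform[OF b] by blast
 have "EX T'<=T + (C + C') * (1 + norm z). hreach 0 T' (mulL (b # L) a z)" if a: "hreach 0 T a" for z a T
 proof -
  obtain T1 where T1: "T1 <= C' * (1 + \<bar>z \<bullet> b\<bar>)" "hreach 0 T1 (Ef b (z \<bullet> b) 0)" using C'(2) by blast
  have "hreach a T1 (Ef b (z \<bullet> b) a)" using hreach_left[OF T1(2), of a] Ef_mul[OF b, of "z \<bullet> b" a 0] by simp
  from hreach_trans[OF this a] obtain T' where T': "T' <= (T + T1) + C * (1 + norm z)" "hreach 0 T' (mulL (b # L) a z)"
   using C(2) by fastforce
  have "C' * (1 + \<bar>z \<bullet> b\<bar>) <= C' * (1 + norm z)" using Basis_le_norm[OF b, of z] C'(1) by (intro mult_left_mono) auto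
  hence "T' <= T + (C + C') * (1 + norm z)" using T'(1) T1(1) by (simp add: distrib_right)
  thus ?thesis using T'(2) by blast
 qed
 thus ?case using C(1) C'(1) by (intro exI[of _ "C + C'"]) auto
qed

lemma reach_uniform:
 assumes "bounded W" shows "\<exists>C>0. \<forall>h\<in>W. EX T<=C. hreach 0 T h"
proof -
 obtain R where R: "R > 0" "!!h. h \<in> W ==> norm h <= R" using assms unfolding bounded_pos by blast
 have "set bs \<subseteq> Basis" by (simp add: bs)
 from mulL_reach_uniform[OF this]
 obtain C where C: "C >= 0" "!!z. EX T<=0 + C * (1 + norm z). hreach 0 T (mulL bs 0 z)" using hrefl by blast
 have "EX T<=C * (1 + R) + 1. hreach 0 T h" if "h \<in> W" for h
 proof -
  obtain T where T: "T <= C * (1 + norm h)" "hreach 0 T (mulL bs 0 h)" using C(2)[of h] by auto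
  have "C * (1 + norm h) <= C * (1 + R)" using R(2)[OF that] C(1) by (intro mult_left_mono) auto
  moreover have "mulL bs 0 h = h" using mul_0_left[of h] by (simp add: mul_def)
  ultimately show ?thesis using T by (intro exI[of _ T]) auto
 qed
 moreover have "C * (1 + R) + 1 > 0" using C(1) R(1) by (intro add_nonneg_pos) auto
 ultimately show ?thesis by blast
qed

lemma qball_ediam_le: "\<exists>C>0. ALL x r. r > 0 --> ediam (cc_dist A N X) (Phi ` qball x r engulf) <= ennreal (C * r)"
proof -
 have "continuous_on (engulf \<times> engulf) (%p. mul (ginv (fst p)) (snd p))"
  by (rule continuous_on_subset[OF smooth_continuous[OF mul_smooth[OF open_UNIV smooth_compose[OF open_UNIV smooth_fst ginv_smooth]]]]) auto
 hence "bounded ((%p. mul (ginv (fst p)) (snd p)) ` (engulf \<times> engulf))"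
  by (intro compact_imp_bounded compact_continuous_image compact_Times engulf_compact)
 from reach_uniform[OF this] obtain C where C: "C > 0" "!!k k'. k \<in> engulf ==> k' \<in> engulf ==> EX T<=C. hreach 0 T (mul (ginv k) k')"
  by fastforce
 have "ediam (cc_dist A N X) (Phi ` qball x r engulf) <= ennreal (C * r)" if r: "r > 0" for x r unfolding ediam_def
 proof (intro SUP_least ennreal_leI)
  fix p q assume "p \<in> Phi ` qball x r engulf" "q \<in> Phi ` qball x r engulf"
  then obtain k k' where k: "k \<in> engulf" "k' \<in> engulf" "p = Phi (mul x (dil r k))" "q = Phi (mul x (dil r k'))"
   unfolding qball_def by blast
  obtain T where T: "T <= C" "hreach 0 T (mul (ginv k) k')" using C(2)[OF k(1,2)] by blast
  have "hreach (mul (mul x (dil r k)) (dil r 0)) (r * T) (mul (mul x (dil r k)) (dil r (mul (ginv k) k')))"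
   by (rule hreach_left[OF hreach_dil[OF T(2) r]])
  hence "hreach (mul x (dil r k)) (r * T) (mul x (dil r k'))" by (simp add: mul_assoc mul_dil[OF r, symmetric])
  from cc_dist_le[OF this] have "cc_dist A N X p q <= r * T" by (simp add: k)
  also have "... <= C * r" using T(1) r by (simp add: mult.commute)
  finally show "cc_dist A N X p q <= C * r" .
 qed
 thus ?thesis using C(1) by blast
qed

text \<open>Two points of the quasi-ball have different images: after a left translation to the
  origin both lie in a ball on which \<open>Phi\<close> is injective.\<close>

lemma qball_ediam_pos:
 assumes r: "r > 0" shows "0 < ediam (cc_dist A N X) (Phi ` qball x r engulf)"
proof -
 obtain rho where rho: "rho > 0" "inj_on Phi (ball 0 rho)" using Phi_locally_injective by blast
 obtain b :: 'e where b: "b \<in> Basis" using nonempty_Basis by blast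
 \<comment> \<open>The bound by 1 keeps \<open>k\<close> in \<open>BB 3\<close>, which is part of
   \<open>engulf\<close>; the other bound brings \<open>dil r k\<close> into the ball of
   injectivity.\<close>
 define th where "th = min 1 (rho / (2 * r ^ w b))"
 have th: "0 < th" "th <= 1" "r ^ w b * th < rho"
 proof -
  show "0 < th" "th <= 1" using r rho(1) by (auto simp: th_def)
  have "r ^ w b * th <= r ^ w b * (rho / (2 * r ^ w b))" using r by (intro mult_left_mono) (auto simp: th_def)
  also have "... < rho" using r rho(1) by simp
  finally show "r ^ w b * th < rho" .
 qed
 define k where "k = th *\<^sub>R b"
 have dk: "dil r k = (r ^ w b * th) *\<^sub>R b" by (rule euclidean_eqI) (use b in \<open>auto simp: k_def inner_Basis\<close>)
 have nk: "norm (dil r k) < rho" "dil r k ~= 0" unfolding dk using th r b by auto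
 have "Phi (dil r k) ~= Phi 0" using inj_onD[OF rho(2), of "dil r k" 0] nk rho(1) by auto
 hence ne: "Phi (mul x (dil r 0)) ~= Phi (mul x (dil r k))" by (simp add: Phi_mul) (metis add.right_neutral add_left_cancel)
 have "norm k <= sqrt 3" using th b order_trans[OF th(2), of "sqrt 3"] by (simp add: k_def)
 hence in1: "k \<in> engulf" "0 \<in> engulf" using BB_subset_engulf by (auto simp: BB_def)
 let ?p = "Phi (mul x (dil r 0))" and ?q = "Phi (mul x (dil r k))"
 have pq: "?p \<in> Phi ` qball x r engulf" "?q \<in> Phi ` qball x r engulf" using in1 unfolding qball_def by blast+
 have "0 < ennreal (cc_dist A N X ?p ?q)" using cc_dist_pos[OF ne] by simp
 also have "... <= ediam (cc_dist A N X) (Phi ` qball x r engulf)" unfolding ediam_def by (rule SUP_upper2[OF pq(1) SUP_upper[OF pq(2)]])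
 finally show ?thesis .
qed

lemma S_set_null:
 assumes u: "positive_heat_solution A N X u" and s: "s >= 0"
 shows "hausdorff_measure (cc_dist A N X) s (S_set (real Q - s) u) = 0"
proof (rule hausdorff_measure_zeroI)
 fix eps \<eta> :: real assume eps: "eps > 0" and \<eta>: "\<eta> > 0"
 let ?d = "cc_dist A N X"
 obtain C where C: "C > 0" "!!x r. r > 0 ==> ediam ?d (Phi ` qball x r engulf) <= ennreal (C * r)" using qball_ediam_le by blast
 define \<eta>' where "\<eta>' = \<eta> / C powr s"
 have eps': "eps / C > 0" and \<eta>': "\<eta>' > 0" using eps \<eta> C by (auto simp: \<eta>'_def)
 from singular_set_cover[OF heat_lift[OF u] s eps' \<eta>']
 obtain D where D: "countable D" "\<forall>(x, r)\<in>D. 0 < r & r <= eps / C" "\<forall>I\<subseteq>D. finite I --> (\<Sum>i\<in>I. snd i powr s) <= \<eta>'"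
  and cov: "S_set (real Q - s) (%z t. u (Phi z) t) \<subseteq> (\<Union>(x, r)\<in>D. qball x r engulf)" by (elim exE conjE) (rule that; assumption)
 have D2: "0 < snd i" "snd i <= eps / C" if "i \<in> D" for i using D(2) that by auto
 have "hausdorff_pre ?d s eps (S_set (real Q - s) u) <= ennreal (C powr s * \<eta>')"
 proof (rule hausdorff_pre_le_cover[OF D(1), where B="%i. Phi ` qball (fst i) (snd i) engulf" and r=snd])
  show "S_set (real Q - s) u \<subseteq> (\<Union>i\<in>D. Phi ` qball (fst i) (snd i) engulf)"
  proof
   fix x assume x: "x \<in> S_set (real Q - s) u"
   obtain z where z: "x = Phi z" using Phi_surj[OF conn] by (meson surjD)
   have "z \<in> S_set (real Q - s) (%z t. u (Phi z) t)" using x by (simp add: S_set_def z)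
   thus "x \<in> (\<Union>i\<in>D. Phi ` qball (fst i) (snd i) engulf)" using cov z by force
  qed
  show "0 < ediam ?d (Phi ` qball (fst i) (snd i) engulf)" if "i \<in> D" for i by (rule qball_ediam_pos[OF D2(1)[OF that]])
  show "ediam ?d (Phi ` qball (fst i) (snd i) engulf) <= ennreal (C * snd i)" if "i \<in> D" for i by (rule C(2)[OF D2(1)[OF that]])
  show "C * snd i <= eps" if "i \<in> D" for i using D2(2)[OF that] C(1) by (simp add: field_simps)
  show "(\<Sum>i\<in>I. snd i powr s) <= \<eta>'" if "I \<subseteq> D" "finite I" for I using D(3) that by blast
 qed (use C(1) s D2 in auto)
 thus "hausdorff_pre ?d s eps (S_set (real Q - s) u) <= ennreal \<eta>" using C(1) by (simp add: \<eta>'_def)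
qed

lemma singular_sets:
 assumes u: "positive_heat_solution A N X u" and \<alpha>: "\<alpha> <= real Q"
 shows "hausdorff_measure (cc_dist A N X) (real Q - \<alpha>) (S_set \<alpha> u) = 0"
  "hausdorff_dim (cc_dist A N X) (T_set \<alpha> u) <= ereal (real Q - \<alpha>)"
proof -
 show "hausdorff_measure (cc_dist A N X) (real Q - \<alpha>) (S_set \<alpha> u) = 0"
  using S_set_null[OF u, of "real Q - \<alpha>"] \<alpha> by simp
 show "hausdorff_dim (cc_dist A N X) (T_set \<alpha> u) <= ereal (real Q - \<alpha>)"
 proof (rule ereal_le_epsilon2)
  fix e :: real assume e: "e > 0"
  let ?s = "real Q - \<alpha> + e"
  have "hausdorff_measure (cc_dist A N X) ?s (T_set \<alpha> u) <= hausdorff_measure (cc_dist A N X) ?s (S_set (real Q - ?s) u)"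
   by (intro hausdorff_measure_mono T_set_subset_S_set) (use e in simp)
  also have "... = 0" by (rule S_set_null[OF u]) (use e \<alpha> in simp)
  finally have "hausdorff_measure (cc_dist A N X) ?s (T_set \<alpha> u) = 0" by simp
  hence "hausdorff_dim (cc_dist A N X) (T_set \<alpha> u) <= ereal ?s"
   unfolding hausdorff_dim_def using e \<alpha> by (intro Inf_lower) auto
  thus "hausdorff_dim (cc_dist A N X) (T_set \<alpha> u) <= ereal (real Q - \<alpha>) + ereal e" by simp
 qed
qed

end

section \<open>Adapted bases\<close>

context lie_grp
begin

lemma vf_plus: "vf (v + u) = vf v + vf u" by (auto simp: vf_def fun_eq_iff tv_lin)

lemma vf_scaleR: "vf (c *\<^sub>R v) = vf_scale c (vf v)" by (auto simp: vf_def vf_scale_def fun_eq_iff tv_lin)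

lemma vf_0: "vf 0 = 0" by (auto simp: vf_def fun_eq_iff tv_lin)

lemma vf_sum: "finite I ==> vf (\<Sum>i\<in>I. h i) = (\<Sum>i\<in>I. vf (h i))"
 by (induction I rule: finite_induct) (simp_all add: vf_plus vf_0)

lemma vf_span: "vf ` span S = vf.span (vf ` S)"
proof
 have "S \<subseteq> {v. vf v \<in> vf.span (vf ` S)}" by (auto intro: vf.span_base)
 moreover have "subspace {v. vf v \<in> vf.span (vf ` S)}"
  by (auto simp: subspace_def vf_0 vf_plus vf_scaleR intro: vf.span_zero vf.span_add vf.span_scale)
 ultimately have "span S \<subseteq> {v. vf v \<in> vf.span (vf ` S)}" by (rule span_minimal)
 thus "vf ` span S \<subseteq> vf.span (vf ` S)" by auto
 have "vf.subspace (vf ` span S)" unfolding vf.subspace_def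
 proof (intro conjI ballI allI)
  show "0 \<in> vf ` span S" using span_zero vf_0 by (metis imageI)
  show "x + z \<in> vf ` span S" if "x \<in> vf ` span S" "z \<in> vf ` span S" for x z
   using that by (auto simp: vf_plus[symmetric] intro!: imageI span_add)
  show "vf_scale c x \<in> vf ` span S" if "x \<in> vf ` span S" for x c
   using that by (auto simp: vf_scaleR[symmetric] intro!: imageI span_scale)
 qed
 thus "vf.span (vf ` S) \<subseteq> vf ` span S" by (intro vf.span_minimal) (auto intro: span_base)
qed

lemma vf_inj: "inj vf" using vf_inject by (auto intro: injI)

lemma vf_independent: "vf.independent (vf ` S) \<longleftrightarrow> independent S"
proof -
 have "vf a \<in> vf.span (vf ` S - {vf a}) \<longleftrightarrow> a \<in> span (S - {a})" for a
 proof -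
  have "vf ` S - {vf a} = vf ` (S - {a})" using vf_inject by auto
  thus ?thesis by (simp add: vf_span[symmetric] inj_image_mem_iff[OF vf_inj])
 qed
 thus ?thesis unfolding vf.dependent_def dependent_def by auto
qed

lemma br_span:
 assumes "a \<in> span S" "x \<in> span T" shows "br a x \<in> span {br s t |s t. s \<in> S & t \<in> T}"
proof -
 let ?R = "span {br s t |s t. s \<in> S & t \<in> T}"
 have 1: "br s x \<in> ?R" if "s \<in> S" for s
 proof -
  have "span T \<subseteq> {x. br s x \<in> ?R}"
   using that by (intro span_minimal) (auto simp: subspace_def linear_0[OF br_linear2] linear_add[OF br_linear2] linear_scale[OF br_linear2]
    intro: span_base span_zero span_add span_scale)
  thus ?thesis using assms(2) by auto
 qed
 have "span S \<subseteq> {a. br a x \<in> ?R}"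
  using 1 by (intro span_minimal) (auto simp: subspace_def linear_0[OF br_linear1] linear_add[OF br_linear1] linear_scale[OF br_linear1]
   intro: span_zero span_add span_scale)
 thus ?thesis using assms(1) by auto
qed

lemma bracket_span_vf: "bracket_span (vf ` S) (vf ` T) = vf ` span {br s t |s t. s \<in> S & t \<in> T}"
proof -
 have "{lie_bracket Y Z |Y Z. Y \<in> vf ` S & Z \<in> vf ` T} = vf ` {br s t |s t. s \<in> S & t \<in> T}"
  by (auto simp: vf_br[symmetric] image_iff) (use vf_br in metis)+
 thus ?thesis unfolding bracket_span_def vf_span by simp
qed

end

text \<open>\<open>W j\<close> is the layer \<open>V j\<close>, seen in the model of the Lie algebra on the coordinate space.\<close>

locale layers = lie_grp A
 for A :: "('a::{topological_group_add, t2_space, second_countable_topology}, 'e::euclidean_space) atlas" +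
 fixes l :: nat and V :: "nat => 'a vfield set"
 assumes strat: "stratification A l V"
begin

definition W :: "nat => 'e set" where "W j = {v. vf v \<in> V j}"

lemma l1: "1 <= l" using strat by (simp add: stratification_def)

lemma V_sub: "j \<in> {1..l} ==> vf.subspace (V j)" using strat by (simp add: stratification_def)

lemma V_lie:
 assumes j: "j \<in> {1..l}" and Y: "Y \<in> V j" shows "Y \<in> lie_algebra A"
proof -
 define F where "F i = (if i = j then Y else if i \<in> {1..l} then 0 else undefined)" for i
 have "F \<in> Pi\<^sub>E {1..l} V" using j Y vf.subspace_0[OF V_sub] by (auto simp: F_def PiE_def extensional_def)
 moreover have "(%Y. \<Sum>j\<in>{1..l}. Y j) ` (Pi\<^sub>E {1..l} V) = lie_algebra A"
  using strat unfolding stratification_def bij_betw_def by (elim conjE)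
 ultimately have "(\<Sum>i\<in>{1..l}. F i) \<in> lie_algebra A" by (metis imageI)
 also have "(\<Sum>i\<in>{1..l}. F i) = (\<Sum>i\<in>{1..l}. if i = j then Y else 0)" by (intro sum.cong) (auto simp: F_def)
 also have "... = Y" using j by simp
 finally show ?thesis .
qed

lemma V_eq: "j \<in> {1..l} ==> V j = vf ` W j"
proof
 assume j: "j \<in> {1..l}"
 show "V j \<subseteq> vf ` W j"
 proof
  fix Y assume Y: "Y \<in> V j"
  obtain v where "Y = vf v" using lie_algebra_vf[OF V_lie[OF j Y]] by blast
  thus "Y \<in> vf ` W j" using Y by (simp add: W_def)
 qed
qed (auto simp: W_def)

lemma W_sub: "j \<in> {1..l} ==> subspace (W j)"
 using V_sub[of j] unfolding W_def subspace_def vf.subspace_def by (auto simp: vf_0 vf_plus vf_scaleR)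

lemma W_sum: "EX f. (\<forall>j\<in>{1..l}. f j \<in> W j) & v = (\<Sum>j\<in>{1..l}. f j)"
proof -
 have "vf v \<in> (%Y. \<Sum>j\<in>{1..l}. Y j) ` (Pi\<^sub>E {1..l} V)"
  using vf_in[of v] strat unfolding stratification_def bij_betw_def by simp
 then obtain Y where Y: "Y \<in> Pi\<^sub>E {1..l} V" "vf v = (\<Sum>j\<in>{1..l}. Y j)" by blast
 have "EX u. u \<in> W j & Y j = vf u" if "j \<in> {1..l}" for j using PiE_mem[OF Y(1) that] V_eq[OF that] by auto
 then obtain f where f: "!!j. j \<in> {1..l} ==> f j \<in> W j & Y j = vf (f j)" by metis
 have "vf v = vf (\<Sum>j\<in>{1..l}. f j)" using f by (simp add: Y(2) vf_sum)
 thus ?thesis using f vf_inject by (intro exI[of _ f]) auto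
qed

lemma W_unique:
 assumes f: "!!j. j \<in> {1..l} ==> f j \<in> W j" and g: "!!j. j \<in> {1..l} ==> g j \<in> W j"
  and eq: "(\<Sum>j\<in>{1..l}. f j) = (\<Sum>j\<in>{1..l}. g j)" and j: "j \<in> {1..l}"
 shows "f j = g j"
proof -
 have inj: "inj_on (%Y. \<Sum>j\<in>{1..l}. Y j) (Pi\<^sub>E {1..l} V)" using strat unfolding stratification_def bij_betw_def by blast
 let ?r = "%h. \<lambda>j\<in>{1..l}. vf (h j)"
 have m: "?r h \<in> Pi\<^sub>E {1..l} V" if "!!j. j \<in> {1..l} ==> h j \<in> W j" for h using that by (auto simp: W_def)
 have s: "(\<Sum>j\<in>{1..l}. ?r h j) = vf (\<Sum>j\<in>{1..l}. h j)" for h by (subst vf_sum) (auto intro!: sum.cong)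
 have "?r f = ?r g" by (rule inj_onD[OF inj _ m[OF f] m[OF g]]) (simp only: s eq)
 from fun_cong[OF this, of j] show ?thesis using j vf_inject by simp
qed

text \<open>The layers, continued by zero beyond \<open>l\<close>. The inclusion of brackets then
  has one form for all indices, including those whose sum exceeds \<open>l\<close>.\<close>

definition W' :: "nat => 'e set" where "W' j = (if j \<in> {1..l} then W j else {0})"

lemma W'_sub: "subspace (W' j)" using W_sub by (auto simp: W'_def subspace_def)

lemma W_br_span: "1 <= j ==> j < l ==> W (Suc j) = span {br s t |s t. s \<in> W 1 & t \<in> W j}"
 and W_br_last: "s \<in> W 1 ==> t \<in> W l ==> br s t = 0"
proof -
 assume j: "1 <= j" "j < l"
 have "bracket_span (V 1) (V j) = V (Suc j)" using strat j by (simp add: stratification_def)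
 hence "vf ` W (Suc j) = vf ` span {br s t |s t. s \<in> W 1 & t \<in> W j}"
  using V_eq[of 1] V_eq[of j] V_eq[of "Suc j"] j l1 bracket_span_vf by simp
 thus "W (Suc j) = span {br s t |s t. s \<in> W 1 & t \<in> W j}" using inj_image_eq_iff[OF vf_inj] by blast
next
 assume st: "s \<in> W 1" "t \<in> W l"
 have "bracket_span (V 1) (V l) = {0}" using strat by (simp add: stratification_def)
 hence "vf ` span {br s t |s t. s \<in> W 1 & t \<in> W l} = {0}" using V_eq[of 1] V_eq[of l] l1 bracket_span_vf by simp
 moreover have "br s t \<in> span {br s t |s t. s \<in> W 1 & t \<in> W l}" using st by (intro span_base) blast
 ultimately have "vf (br s t) = vf 0" unfolding vf_0 by blast
 thus "br s t = 0" by (simp add: vf_inject)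
qed

lemma br_W1: "s \<in> W 1 ==> 1 <= j ==> t \<in> W' j ==> br s t \<in> W' (Suc j)"
proof -
 assume s: "s \<in> W 1" and j: "1 <= j" and t: "t \<in> W' j"
 consider "j < l" | "j = l" | "j > l" by linarith
 thus ?thesis
 proof cases
  case 1
  hence "br s t \<in> W (Suc j)" unfolding W_br_span[OF j 1] using s t j by (intro span_base) (auto simp: W'_def)
  thus ?thesis using 1 by (simp add: W'_def)
 next
  case 2
  hence "br s t = 0" using W_br_last s t l1 by (auto simp: W'_def)
  thus ?thesis using subspace_0[OF W'_sub] by simp
 next
  case 3
  thus ?thesis using t subspace_0[OF W'_sub] by (simp add: W'_def linear_0[OF br_linear2])
 qed
qed

text \<open>The stratification speaks only of brackets with the first layer. As the layer
  \<open>Suc i\<close> is spanned by brackets of the first layer with the layer \<open>i\<close>,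
  the Jacobi identity reduces the claim to the layers 1 and \<open>i\<close>.\<close>

lemma br_graded:
 "1 <= i ==> i <= l ==> 1 <= j ==> a \<in> W i ==> b \<in> W' j ==> br a b \<in> W' (i + j)"
proof (induction i arbitrary: j a b rule: dec_induct)
 case base
 thus ?case using br_W1 by simp
next
 case (step i)
 have "span {br s t |s t. s \<in> W 1 & t \<in> W i} \<subseteq> {a. br a b \<in> W' (Suc i + j)}"
 proof (rule span_minimal)
  show "subspace {a. br a b \<in> W' (Suc i + j)}"
   using W'_sub[of "Suc i + j"] by (auto simp: subspace_def linear_0[OF br_linear1] linear_add[OF br_linear1] linear_scale[OF br_linear1])
  show "{br s t |s t. s \<in> W 1 & t \<in> W i} \<subseteq> {a. br a b \<in> W' (Suc i + j)}"
  proof clarify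
   fix s t assume st: "s \<in> W 1" "t \<in> W i"
   have il: "i <= l" using step.prems by simp
   have "br t b \<in> W' (i + j)" by (rule step.IH[OF il step.prems(2) st(2) step.prems(4)])
   hence 1: "br s (br t b) \<in> W' (Suc (i + j))" using br_W1[OF st(1), of "i + j"] step.hyps by simp
   have "br t (br s b) \<in> W' (i + Suc j)" by (rule step.IH[OF il _ st(2) br_W1[OF st(1) step.prems(2) step.prems(4)]]) simp
   thus "br (br s t) b \<in> W' (Suc i + j)" unfolding br_jacobi using subspace_diff[OF W'_sub 1] by simp
  qed
 qed
 thus ?case using step.prems step.hyps W_br_span[of i] by auto
qed

lemma adapted_basis:
 assumes X: "is_basis N X (V 1)"
 obtains w :: "'e => nat" and y sig where "strat A w l y" "bij_betw sig {1..N} {b\<in>Basis. w b = 1}"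
  "!!j. j \<in> {1..N} ==> X j = vf (y (sig j))" "homogeneous_dim l V = (\<Sum>b\<in>Basis. w b)"
proof -
 have l1': "1 \<in> {1..l}" using l1 by simp
 have Xb: "inj_on X {1..N}" "vf.independent (X ` {1..N})" "vf.span (X ` {1..N}) = V 1" using X by (auto simp: is_basis_def)
 have "EX v. X j = vf v" if "j \<in> {1..N}" for j
  using vf.span_base[of "X j" "X ` {1..N}"] that V_lie[OF l1'] lie_algebra_vf Xb(3) by blast
 then obtain xi where xi: "!!j. j \<in> {1..N} ==> X j = vf (xi j)" by metis
 have Xxi: "X ` {1..N} = vf ` xi ` {1..N}" using xi by (auto simp: image_iff)
 have xi1: "independent (xi ` {1..N})" using Xb(2) unfolding Xxi vf_independent .
 have "vf ` span (xi ` {1..N}) = vf ` W 1" using Xb(3) V_eq[OF l1'] unfolding Xxi vf_span by simp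
 hence xi2: "span (xi ` {1..N}) = W 1" using inj_image_eq_iff[OF vf_inj] by blast
 have xii: "inj_on xi {1..N}"
 proof (rule inj_onI)
  fix i j assume "i \<in> {1..N}" "j \<in> {1..N}" "xi i = xi j"
  thus "i = j" using xi[of i] xi[of j] inj_onD[OF Xb(1), of i j] by simp
 qed
 have "EX B. B \<subseteq> W j & independent B & W j \<subseteq> span B" for j using basis_exists[of "W j"] by metis
 then obtain B0 where B0: "!!j. B0 j \<subseteq> W j & independent (B0 j) & W j \<subseteq> span (B0 j)" by metis
 \<comment> \<open>In the first layer the basis is dictated by the fields \<open>X j\<close>; in the
   others any basis will do.\<close>
 define B where "B j = (if j = 1 then xi ` {1..N} else B0 j)" for j
 have Bi: "independent (B j)" for j using B0 xi1 by (simp add: B_def)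
 have Bs: "span (B j) = W j" if "j \<in> {1..l}" for j using B0[of j] xi2 span_minimal[OF _ W_sub[OF that], of "B0 j"] by (auto simp: B_def)
 have Bsub: "B j \<subseteq> W j" if "j \<in> {1..l}" for j using Bs[OF that] span_superset by blast
 have Bf: "finite (B j)" for j using Bi independent_bound by blast
 have zero: "f j = 0" if "!!j. j \<in> {1..l} ==> f j \<in> W j" "(\<Sum>j\<in>{1..l}. f j) = 0" "j \<in> {1..l}" for f j
  by (rule W_unique[OF that(1) _ _ that(3), of "%_. 0"]) (use that subspace_0[OF W_sub] in auto)
 have comp: "f i = a" if "!!j. j \<in> {1..l} ==> f j \<in> W j" "(\<Sum>j\<in>{1..l}. f j) = a" "i \<in> {1..l}" "a \<in> W i" for f i a
 proof -
  have "f i = (if i = i then a else 0)"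
   by (rule W_unique[OF that(1) _ _ that(3), of "%j. if j = i then a else 0"]) (use that subspace_0[OF W_sub] in auto)
  thus ?thesis by simp
 qed
 have dis: "B i \<inter> B j = {}" if ij: "i \<in> {1..l}" "j \<in> {1..l}" "i ~= j" for i j
 proof (rule ccontr)
  assume "B i \<inter> B j ~= {}"
  then obtain a where a: "a \<in> B i" "a \<in> B j" by blast
  have "(if j = i then a else 0) = a"
  proof (rule comp[of "%k. if k = i then a else 0"])
   show "(if k = i then a else 0) \<in> W k" if "k \<in> {1..l}" for k using that a Bsub subspace_0[OF W_sub[OF that]] by auto
  qed (use ij a Bsub in auto)
  hence "a = 0" using ij by auto
  thus False using a(1) Bi[of i] dependent_zero by blast
 qed
 define BB where "BB = (\<Union>j\<in>{1..l}. B j)"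
 have BBf: "finite BB" using Bf by (simp add: BB_def)
 have BBs: "span BB = UNIV"
 proof (rule equalityI[OF subset_UNIV], rule subsetI)
  fix v
  obtain f where f: "\<forall>j\<in>{1..l}. f j \<in> W j" "v = (\<Sum>j\<in>{1..l}. f j)" using W_sum by blast
  have "f j \<in> span BB" if j: "j \<in> {1..l}" for j
  proof -
   have "B j \<subseteq> BB" using j unfolding BB_def by blast
   thus ?thesis using f(1) j Bs[OF j] span_mono[of "B j" BB] by blast
  qed
  thus "v \<in> span BB" unfolding f(2) by (rule span_sum)
 qed
 have BBi: "independent BB" unfolding dependent_def
 proof
  assume "\<exists>a\<in>BB. a \<in> span (BB - {a})"
  then obtain i a where i: "i \<in> {1..l}" and a: "a \<in> B i" "a \<in> span (BB - {a})" by (auto simp: BB_def)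
  \<comment> \<open>This subspace contains \<open>BB - {a}\<close>. So if \<open>a\<close> were in
    the span of the others, its component in the layer \<open>i\<close>, which is \<open>a\<close>
    itself, would be in the span of \<open>B i - {a}\<close>.\<close>
  define D where "D = {v. EX f. (\<forall>j\<in>{1..l}. f j \<in> W j) & f i \<in> span (B i - {a}) & v = (\<Sum>j\<in>{1..l}. f j)}"
  have "subspace D" unfolding subspace_def
  proof (intro conjI ballI allI)
   show "0 \<in> D" unfolding D_def using subspace_0[OF W_sub] span_zero by (auto intro!: exI[of _ "%_. 0"])
   fix u v assume "u \<in> D" "v \<in> D"
   then obtain f g where "(\<forall>j\<in>{1..l}. f j \<in> W j) & f i \<in> span (B i - {a}) & u = (\<Sum>j\<in>{1..l}. f j)"
    "(\<forall>j\<in>{1..l}. g j \<in> W j) & g i \<in> span (B i - {a}) & v = (\<Sum>j\<in>{1..l}. g j)" unfolding D_def by blast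
   thus "u + v \<in> D" unfolding D_def
    by (intro CollectI exI[of _ "%j. f j + g j"]) (auto simp: sum.distrib intro: subspace_add[OF W_sub] span_add)
  next
   fix c v assume "v \<in> D"
   then obtain f where "(\<forall>j\<in>{1..l}. f j \<in> W j) & f i \<in> span (B i - {a}) & v = (\<Sum>j\<in>{1..l}. f j)" unfolding D_def by blast
   thus "c *\<^sub>R v \<in> D" unfolding D_def
    by (intro CollectI exI[of _ "%j. c *\<^sub>R f j"]) (auto simp: scaleR_sum_right intro: subspace_scale[OF W_sub] span_scale)
  qed
  moreover have "BB - {a} \<subseteq> D"
  proof
   fix b assume b: "b \<in> BB - {a}"
   then obtain j where j: "j \<in> {1..l}" "b \<in> B j" by (auto simp: BB_def)
   let ?f = "%k. if k = j then b else 0"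
   have "?f i \<in> span (B i - {a})" using j b by (auto intro: span_base span_zero)
   moreover have "\<forall>k\<in>{1..l}. ?f k \<in> W k" using j Bsub subspace_0[OF W_sub] by auto
   moreover have "b = (\<Sum>k\<in>{1..l}. ?f k)" using j by simp
   ultimately show "b \<in> D" unfolding D_def by (intro CollectI exI[of _ ?f] conjI)
  qed
  ultimately have "a \<in> D" using a(2) span_minimal by blast
  then obtain f where f: "\<forall>j\<in>{1..l}. f j \<in> W j" "f i \<in> span (B i - {a})" "a = (\<Sum>j\<in>{1..l}. f j)" unfolding D_def by blast
  have "f i = a" by (rule comp) (use f i a Bsub in auto)
  thus False using f(2) a(1) Bi[of i] unfolding dependent_def by blast
 qed
 have cardBB: "card BB = DIM('e)" using basis_card_eq_dim[OF subset_UNIV _ BBi] BBs by (simp add: dim_UNIV)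
 then obtain y :: "'e => 'e" where y: "bij_betw y Basis BB" using finite_same_card_bij[of "Basis :: 'e set" BB] BBf by auto
 have "EX j. j \<in> {1..l} & y b \<in> B j" if "b \<in> Basis" for b using bij_betwE[OF y] that unfolding BB_def by blast
 then obtain w where w: "!!b. b \<in> Basis ==> w b \<in> {1..l} & y b \<in> B (w b)" by metis
 have w_eq: "w b = j" if "b \<in> Basis" "j \<in> {1..l}" "y b \<in> B j" for b j using dis[of "w b" j] w[OF that(1)] that by auto
 have By: "B j = y ` {b \<in> Basis. w b = j}" if j: "j \<in> {1..l}" for j
 proof
  show "y ` {b \<in> Basis. w b = j} \<subseteq> B j" using w by auto
  show "B j \<subseteq> y ` {b \<in> Basis. w b = j}"
  proof
   fix a assume a: "a \<in> B j"
   hence "a \<in> y ` Basis" using y j unfolding bij_betw_def BB_def by blast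
   then obtain b where "b \<in> Basis" "a = y b" by blast
   thus "a \<in> y ` {b \<in> Basis. w b = j}" using w_eq[of b j] j a by blast
  qed
 qed
 have y_inj: "inj_on y Basis" using y by (simp add: bij_betw_def)
 have By': "B j = {y k |k. k \<in> Basis & w k = j}" if "j \<in> {1..l}" for j using By[OF that] by auto
 have wt: "weights w l" by unfold_locales (use w in auto)
 have str: "strat A w l y"
 proof (intro strat.intro strat_axioms.intro lie_grp_axioms wt)
  let ?T = "%v. \<Sum>b\<in>Basis. (v \<bullet> b) *\<^sub>R y b"
  have lin: "linear ?T" by (auto intro!: linearI simp: inner_add_left scaleR_add_left sum.distrib scaleR_sum_right)
  have "BB \<subseteq> range ?T"
  proof
   fix a assume "a \<in> BB"
   then obtain b where b: "b \<in> Basis" "a = y b" using y by (auto simp: bij_betw_def)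
   have "?T b = (\<Sum>c\<in>Basis. if c = b then y c else 0)" using b by (intro sum.cong) (auto simp: inner_Basis)
   hence "a = ?T b" using b by simp
   thus "a \<in> range ?T" by blast
  qed
  hence "span BB \<subseteq> range ?T" by (intro span_minimal linear_subspace_image[OF lin] subspace_UNIV)
  hence "surj ?T" using BBs by blast
  thus "bij ?T" using linear_surj_imp_inj[OF lin] by (simp add: bij_def)
  show "br (y i) (y j) \<in> span {y k |k. k \<in> Basis & w k = w i + w j}" if ij: "i \<in> Basis" "j \<in> Basis" for i j
  proof -
   have "y i \<in> W (w i)" "y j \<in> W (w j)" using w[OF ij(1)] w[OF ij(2)] Bsub by blast+
   hence "br (y i) (y j) \<in> W' (w i + w j)" using w[OF ij(1)] w[OF ij(2)] by (intro br_graded) (auto simp: W'_def)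
   thus ?thesis using Bs[of "w i + w j"] By'[of "w i + w j"] span_zero by (auto simp: W'_def split: if_splits)
  qed
  show "y k \<in> span {br (y j) (y i) |i j. i \<in> Basis & j \<in> Basis & w j = m & w i = 1}"
   if k: "k \<in> Basis" "w k = Suc m" "1 <= m" for k m
  proof -
   have m: "m \<in> {1..l}" "m < l" "Suc m \<in> {1..l}" using w[OF k(1)] k by auto
   let ?S = "{br (y j) (y i) |i j. i \<in> Basis & j \<in> Basis & w j = m & w i = 1}"
   \<comment> \<open>In \<open>gen\<close> the factor from the first layer stands second, in the
     stratification it stands first; antisymmetry of the bracket reconciles the two.\<close>
   have "br s t \<in> span ?S" if "s \<in> W 1" "t \<in> W m" for s t
   proof -
    have "br t s \<in> span {br a b |a b. a \<in> B m & b \<in> B 1}" by (rule br_span) (use that Bs[OF m(1)] Bs[OF l1'] in auto)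
    moreover have "{br a b |a b. a \<in> B m & b \<in> B 1} = ?S" unfolding By'[OF m(1)] By'[OF l1'] by blast
    ultimately have "- br t s \<in> span ?S" by (simp add: span_neg)
    thus ?thesis using br_antisym[of s t] by simp
   qed
   hence "span {br s t |s t. s \<in> W 1 & t \<in> W m} \<subseteq> span ?S" by (intro span_minimal subspace_span) auto
   hence "W (Suc m) \<subseteq> span ?S" using W_br_span[OF k(3) m(2)] by simp
   moreover have "y k \<in> W (Suc m)" using w[OF k(1)] k(2) Bsub[OF m(3)] by auto
   ultimately show ?thesis by blast
  qed
 qed
 define sig where "sig j = inv_into Basis y (xi j)" for j
 have B1: "y ` {b \<in> Basis. w b = 1} = xi ` {1..N}" using By[OF l1'] by (simp add: B_def)
 have ysig: "y (sig j) = xi j" "sig j \<in> {b \<in> Basis. w b = 1}" if "j \<in> {1..N}" for j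
 proof -
  have "xi j \<in> y ` {b \<in> Basis. w b = 1}" using that B1 by blast
  then obtain b where b: "b \<in> Basis" "w b = 1" "xi j = y b" by blast
  hence "sig j = b" using y_inj by (simp add: sig_def)
  thus "y (sig j) = xi j" "sig j \<in> {b \<in> Basis. w b = 1}" using b by auto
 qed
 have sigb: "bij_betw sig {1..N} {b\<in>Basis. w b = 1}"
 proof (rule bij_betw_imageI)
  show "inj_on sig {1..N}" using xii ysig(1) unfolding inj_on_def by metis
  show "sig ` {1..N} = {b \<in> Basis. w b = 1}"
  proof
   show "sig ` {1..N} \<subseteq> {b \<in> Basis. w b = 1}" using ysig(2) by blast
   show "{b \<in> Basis. w b = 1} \<subseteq> sig ` {1..N}"
   proof
    fix b assume b: "b \<in> {b \<in> Basis. w b = 1}"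
    then obtain j where j: "j \<in> {1..N}" "y b = xi j" using B1 by blast
    hence "sig j = b" using b y_inj unfolding sig_def j(2)[symmetric] by simp
    thus "b \<in> sig ` {1..N}" using j(1) by blast
   qed
  qed
 qed
 have "vf.dim (V j) = card {b\<in>Basis. w b = j}" if j: "j \<in> {1..l}" for j
 proof -
  have "vf.span (vf ` B j) = V j" using vf_span[of "B j"] Bs[OF j] V_eq[OF j] by simp
  hence "card (vf ` B j) = vf.dim (V j)"
   using vf.basis_card_eq_dim[of "vf ` B j" "V j"] vf.span_superset[of "vf ` B j"] vf_independent Bi by simp
  moreover have "card (vf ` B j) = card (B j)" by (rule card_image) (rule inj_on_subset[OF vf_inj], simp)
  moreover have "card (B j) = card {b\<in>Basis. w b = j}" unfolding By[OF j] by (rule card_image) (rule inj_on_subset[OF y_inj], auto)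
  ultimately show ?thesis by simp
 qed
 hence "homogeneous_dim l V = (\<Sum>j\<in>{1..l}. j * card {b\<in>Basis. w b = j})" unfolding homogeneous_dim_def by (intro sum.cong) auto
 also have "... = (\<Sum>j\<in>{1..l}. \<Sum>b\<in>{b\<in>Basis. w b = j}. w b)" by (intro sum.cong refl) (simp add: mult.commute)
 also have "... = (\<Sum>b\<in>Basis. w b)" by (rule sum.group) (use w in auto)
 finally have "homogeneous_dim l V = (\<Sum>b\<in>Basis. w b)" .
 moreover have "X j = vf (y (sig j))" if "j \<in> {1..N}" for j using xi[OF that] ysig(1)[OF that] by simp
 ultimately show ?thesis using that str sigb by blast
qed

end

theorem theorem1p3:
  fixes A :: "('a::{topological_group_add, t2_space, second_countable_topology},
               'e::euclidean_space) atlas"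
    and V :: "nat \<Rightarrow> 'a vfield set" and l :: nat
    and X :: "nat \<Rightarrow> 'a vfield" and N :: nat
    and u :: "'a \<Rightarrow> real \<Rightarrow> real" and \<alpha> :: real
  assumes "stratified_lie_group A l V"
    and "is_basis N X (V 1)"
    and "0 \<le> \<alpha>" and "\<alpha> \<le> real (homogeneous_dim l V)"
    and "positive_heat_solution A N X u"
  shows "hausdorff_measure (cc_dist A N X) (real (homogeneous_dim l V) - \<alpha>) (S_set \<alpha> u) = 0 \<and>
         hausdorff_dim (cc_dist A N X) (T_set \<alpha> u) \<le> ereal (real (homogeneous_dim l V) - \<alpha>)"
proof -
 have s: "lie_group A" "connected (UNIV :: 'a set)" "stratification A l V" using assms(1) by (auto simp: stratified_lie_group_def)
 interpret layers A l V by unfold_locales (rule s)+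
 obtain w :: "'e => nat" and y sig where b: "strat A w l y" "bij_betw sig {1..N} {b\<in>Basis. w b = 1}"
  "!!j. j \<in> {1..N} ==> X j = vf (y (sig j))" "homogeneous_dim l V = (\<Sum>b\<in>Basis. w b)" using adapted_basis[OF assms(2)] by blast
 interpret c: carnot A w l y N X sig by (intro carnot.intro carnot_axioms.intro b s)
 have "homogeneous_dim l V = c.Q" by (simp add: b(4) c.Q_def)
 thus ?thesis using c.singular_sets[OF assms(5)] assms(4) by simp
qed

end
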